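(* Fix a real $\beta$ with $0<\beta<1$. If $\mathbf{T}_\beta u=\lambda u$ for some $u\in\mathfrak{L}(I_1)$ and some scalar $\lambda\in\mathbb C$ with $|\lambda|\ge1$, then $u=0$.
   Context: Notation: $I_1=\,]-1,1[$. $L^1_0(\mathbb{R})$ is the set of $g\in L^1(\mathbb{R})$ with $\int_{\mathbb R} g=0$. Pairings are bilinear: $\langle f,g\rangle=\int fg$, extended to distributions. Hilbert transform: for a test function $\varphi\in C_c^\infty(\mathbb R)$, $\mathbf{H}\varphi(x)=\frac1\pi\,\mathrm{pv}\int_{\mathbb R}\frac{\varphi(t)}{x-t}\,dt$; for $g\in L^1(\mathbb R)$, $\mathbf{H}g$ is the distribution $\langle\varphi,\mathbf{H}g\rangle_{\mathbb R}=-\langle\mathbf{H}\varphi,g\rangle_{\mathbb R}$. $\mathfrak{L}(\mathbb R)=L^1(\mathbb R)+\mathbf{H}L^1_0(\mathbb R)$ is a space of distributions on $\mathbb R$. $\mathfrak{L}(I_1)$ is the space of restrictions to $I_1$ of distributions in $\mathfrak{L}(\mathbb R)$. Involution: for $f\in L^1(\mathbb R)$, $\mathbf{J}_\beta f(x)=\frac{\beta}{x^2}f(-\beta/x)$; on $\mathfrak{L}(\mathbb R)$ it is extended by $\mathbf{J}_\beta(f+\mathbf{H}g)=\mathbf{J}_\beta f+\mathbf{H}\mathbf{J}_\beta g$ ($f\in L^1(\mathbb{R})$, $g\in L^1_0(\mathbb{R})$), which is well defined. Periodization: $\boldsymbol\Pi_2 f(x)=\sum_{j\in\mathbb Z}f(x+2j)$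 for $f\in L^1(\mathbb R)$. The periodic Hilbert transform is $\mathbf{H}_2\varphi(x)=\frac12\mathrm{pv}\int_{-1}^1\varphi(t)\cot\frac{\pi(x-t)}2\,dt$ for $2$-periodic smooth $\varphi$, and $\langle\varphi,\mathbf{H}_2 w\rangle_{\mathbb R/2\mathbb Z}=-\langle\mathbf{H}_2\varphi,w\rangle_{\mathbb R/2\mathbb Z}$ for $2$-periodic distributions $w$. On $\mathfrak{L}(\mathbb R)$, $\boldsymbol\Pi_2(f+\mathbf{H}g)=\boldsymbol\Pi_2f+\mathbf{H}_2\boldsymbol\Pi_2g$, a $2$-periodic distribution, and $\boldsymbol\Sigma_2U:=\boldsymbol\Pi_2U-U$ (so formally $\boldsymbol\Sigma_2U(x)=\sum_{j\in\mathbb Z\setminus\{0\}}U(x+2j)$). Subtransfer operator: for $u\in\mathfrak{L}(I_1)$ choose any $U\in\mathfrak{L}(\mathbb R)$ with $U|_{I_1}=u$ and put $\mathbf{T}_\beta u:=(\boldsymbol\Sigma_2\mathbf{J}_\beta U)|_{I_1}\in\mathfrak{L}(I_1)$; this does not depend on the choice of $U$. On $L^1(I_1)$ it is given by $\mathbf{T}_\beta f(x)=\sum_{j\in\mathbb Z\setminus\{0\}}\frac{\beta}{(2j+x)^2}f\big(-\frac{\beta}{2j+x}\big)$, $x\in I_1$. *)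

theory Defs
  imports "HOL-Analysis.Analysis"
begin

text \<open>
  A distribution on an open set \<open>\<Omega>\<close> of reals is represented by the functional
  \<open>\<phi> \<mapsto> \<langle>\<phi>, u\<rangle>\<close> on complex-valued test functions, with the value \<open>0\<close> at every function
  that is not a test function on \<open>\<Omega>\<close>.  Thus equality of distributions is
  equality of functionals, and the vector space operations are the pointwise ones.
  Likewise, 2-periodic distributions are functionals on 2-periodic smooth functions.
  All pairings are bilinear (no complex conjugation).
\<close>

type_synonym functional = "(real \<Rightarrow> complex) \<Rightarrow> complex"

definition smooth :: "(real \<Rightarrow> complex) \<Rightarrow> bool" where
  "smooth \<phi> \<longleftrightarrow>
     (\<forall>n x. ((\<lambda>h t. vector_derivative h (at t)) ^^ n) \<phi> differentiable (at x))"

definition test_functions :: "real set \<Rightarrow> (real \<Rightarrow> complex) set" where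
  "test_functions \<Omega> =
     {\<phi>. smooth \<phi> \<and> compact (closure {x. \<phi> x \<noteq> 0}) \<and> closure {x. \<phi> x \<noteq> 0} \<subseteq> \<Omega>}"

definition periodic_test_functions :: "(real \<Rightarrow> complex) set" where
  "periodic_test_functions = {\<psi>. smooth \<psi> \<and> (\<forall>x. \<psi> (x + 2) = \<psi> x)}"

definition functional_on :: "(real \<Rightarrow> complex) set \<Rightarrow> functional \<Rightarrow> functional" where
  "functional_on D u = (\<lambda>\<phi>. if \<phi> \<in> D then u \<phi> else 0)"

definition dist_restrict :: "real set \<Rightarrow> functional \<Rightarrow> functional" where
  "dist_restrict \<Omega> U = functional_on (test_functions \<Omega>) U"


definition L1 :: "(real \<Rightarrow> complex) set" where
  "L1 = {f. integrable lborel f}"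

definition L1_0 :: "(real \<Rightarrow> complex) set" where
  "L1_0 = {g \<in> L1. (LINT x|lborel. g x) = 0}"

definition dist_of_fun :: "(real \<Rightarrow> complex) \<Rightarrow> functional" where
  "dist_of_fun f = functional_on (test_functions UNIV) (\<lambda>\<phi>. LINT x|lborel. \<phi> x * f x)"

definition hilbert :: "(real \<Rightarrow> complex) \<Rightarrow> real \<Rightarrow> complex" where
  "hilbert \<phi> x = complex_of_real (1 / pi) *
     Lim (at_right 0) (\<lambda>\<epsilon>. LINT t:{t. \<bar>x - t\<bar> > \<epsilon>}|lborel. \<phi> t / complex_of_real (x - t))"

definition hilbert_dist :: "(real \<Rightarrow> complex) \<Rightarrow> functional" where
  "hilbert_dist g =
     functional_on (test_functions UNIV) (\<lambda>\<phi>. - (LINT x|lborel. hilbert \<phi> x * g x))"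

definition L1_plus_HL1 :: "(real \<Rightarrow> complex) \<Rightarrow> (real \<Rightarrow> complex) \<Rightarrow> functional" where
  "L1_plus_HL1 f g = (\<lambda>\<phi>. dist_of_fun f \<phi> + hilbert_dist g \<phi>)"

definition frakL :: "functional set" where
  "frakL = {L1_plus_HL1 f g |f g. f \<in> L1 \<and> g \<in> L1_0}"

definition frakL_on :: "real set \<Rightarrow> functional set" where
  "frakL_on \<Omega> = dist_restrict \<Omega> ` frakL"

text \<open>
  The sum is not direct, so a pair \<open>(f, g)\<close> with \<open>U = f + H g\<close> has to be chosen; the
  operators defined through it below do not depend on the choice.
\<close>

definition decomp :: "functional \<Rightarrow> (real \<Rightarrow> complex) \<times> (real \<Rightarrow> complex)" where
  "decomp U = (SOME (f, g). f \<in> L1 \<and> g \<in> L1_0 \<and> U = L1_plus_HL1 f g)"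


definition J_fun :: "real \<Rightarrow> (real \<Rightarrow> complex) \<Rightarrow> real \<Rightarrow> complex" where
  "J_fun \<beta> f x = complex_of_real (\<beta> / x\<^sup>2) * f (- \<beta> / x)"

definition J_op :: "real \<Rightarrow> functional \<Rightarrow> functional" where
  "J_op \<beta> U = (let (f, g) = decomp U in L1_plus_HL1 (J_fun \<beta> f) (J_fun \<beta> g))"


definition Pi2_fun :: "(real \<Rightarrow> complex) \<Rightarrow> real \<Rightarrow> complex" where
  "Pi2_fun f x = (\<Sum>\<^sub>\<infinity>j::int\<in>UNIV. f (x + 2 * of_int j))"

definition periodic_dist_of_fun :: "(real \<Rightarrow> complex) \<Rightarrow> functional" where
  "periodic_dist_of_fun w =
     functional_on periodic_test_functions (\<lambda>\<psi>. LINT x:{-1..1}|lborel. \<psi> x * w x)"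

text \<open>
  The principal value on the circle: the kernel is singular at all \<open>t\<close> with
  \<open>t - x \<in> 2\<int>\<close>, so a neighbourhood of that whole set is removed.
  (For odd integers \<open>x\<close> both end points of \<open>[-1, 1]\<close> are singular.)
\<close>

definition hilbert2 :: "(real \<Rightarrow> complex) \<Rightarrow> real \<Rightarrow> complex" where
  "hilbert2 \<psi> x = 1 / 2 *
     Lim (at_right 0) (\<lambda>\<epsilon>. LINT t:{t \<in> {-1..1}. \<forall>k::int. \<bar>x - t - 2 * of_int k\<bar> > \<epsilon>}|lborel.
       \<psi> t * complex_of_real (cot (pi * (x - t) / 2)))"

definition hilbert2_dist :: "functional \<Rightarrow> functional" where
  "hilbert2_dist w = functional_on periodic_test_functions (\<lambda>\<psi>. - w (hilbert2 \<psi>))"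

definition Pi2_op :: "functional \<Rightarrow> functional" where
  "Pi2_op U = (let (f, g) = decomp U in
     (\<lambda>\<psi>. periodic_dist_of_fun (Pi2_fun f) \<psi> +
           hilbert2_dist (periodic_dist_of_fun (Pi2_fun g)) \<psi>))"

text \<open>
  A 2-periodic distribution \<open>w\<close> as a distribution on the line:
  the pairing of \<open>\<phi>\<close> with \<open>w\<close> over the line is the pairing of the periodization of \<open>\<phi>\<close>
  with \<open>w\<close> over one period.
\<close>

definition periodic_to_line :: "functional \<Rightarrow> functional" where
  "periodic_to_line w = functional_on (test_functions UNIV) (\<lambda>\<phi>. w (Pi2_fun \<phi>))"

definition Sigma2_op :: "functional \<Rightarrow> functional" where
  "Sigma2_op U = (\<lambda>\<phi>. periodic_to_line (Pi2_op U) \<phi> - U \<phi>)"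


abbreviation I1 :: "real set" where
  "I1 \<equiv> {-1<..<1}"

text \<open>The result does not depend on the chosen extension of \<open>u\<close> to the line.\<close>

definition T_op :: "real \<Rightarrow> functional \<Rightarrow> functional" where
  "T_op \<beta> u = dist_restrict I1 (Sigma2_op (J_op \<beta>
     (SOME U. U \<in> frakL \<and> dist_restrict I1 U = u)))"

end

(*
  Write u = f + H g and B(phi) = int phi f - int (H phi) g for a real test function phi supported in
  (-gamma, gamma), beta < gamma < 1. Two facts about phi + i H phi and its periodization P phi + i H_2 P phi
  are used: both are boundary values of bounded holomorphic functions on the upper half-plane (the second by
  the partial fraction expansion of the cotangent), and such functions are preserved by x -> -beta/x.

  First, unfolding the operators, <phi, T u> = int (Re Q) f - int (Im Q) g, where Q is the difference of the
  two functions composed with x -> -beta/x. As Re Q is supported in [-beta, beta] and Q is Hardy, mollification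
  shows that this expression vanishes as soon as B vanishes on all real test functions on (-gamma, gamma);
  hence it depends on u only through its restriction. Secondly, it equals the pairing B of phi with
  (T f - K g, T g), where T is the L^1 operator and K has a bounded kernel supported in the interval.

  Iterating, mu^n B(phi) = int phi F_n - int (H phi) G_n with G_n = T^n g and F_{n+1} = T F_n - K G_n. By duality
  T^n is controlled by the set of points surviving n steps of x -> -beta/x mod 2. The weight 1/(1 - x^2), which
  is invariant for beta = 1, is contracted by the factor beta, so the measure of the surviving set decays
  geometrically. Thus G_n tends to 0 in L^1, F_n is a convolution of this with a geometric sequence and also
  tends to 0, and |mu| >= 1 forces B(phi) = 0.
*)
theory Submission
  imports Defs "HOL-Probability.Sinc_Integral" "HOL-Real_Asymp.Real_Asymp"
begin

subsection \<open>Cauchy kernels on the line\<close>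

text \<open>An eigendistribution has no canonical representative: (f, g) is determined only up to
  pairs with f + H g = 0 on the interval, and T mixes the two components because H does not commute
  with restriction. Hence the iterates (F_n, G_n) are never compared with \<mu>^n (f, g) as
  functions, but only through pairings with test functions on ]-\<gamma>, \<gamma>[. Passing from n
  to n + 1 means testing this agreement against Q, whose real part is in general not smooth, as
  -\<beta> / x runs through infinitely many periods near 0; the duality with Hardy functions
  overcomes this. The inequality \<beta> < \<gamma> leaves room for mollification, and \<gamma> < 1
  keeps the kernel of K bounded. The Hardy property is expressed as orthogonality to products of two
  Cauchy kernels on the real line, so that translation, inversion and limits become statements about
  integrals and no theory of boundary values enters. Real test functions make \<phi> and H \<phi>
  the real and imaginary parts of one such function.\<close>

lemma integrable_inverse_1_plus_square_line: "integrable lborel (\<lambda>x::real. 1 / (1 + x\<^sup>2))"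
  using integrable_inverse_1_plus_square
  by (simp add: set_integrable_def einterval_def inverse_eq_divide)

lemma integral_inverse_1_plus_square_line: "(LINT x|lborel. 1 / (1 + x\<^sup>2)) = pi"
  using LBINT_inverse_1_plus_square
  by (simp add: interval_lebesgue_integral_def set_lebesgue_integral_def einterval_def inverse_eq_divide)

text \<open>Decay is recorded in powers of 1 + |x| because such bounds multiply factor by factor;
  the comparison 1 + x^2 \<le> (1 + |x|)^2 returns to the integrable density.\<close>

lemma integrable_bound_inverse_square:
  fixes f :: "real \<Rightarrow> complex"
  assumes "f \<in> borel_measurable borel" and "\<And>x. norm (f x) \<le> C / (1 + \<bar>x\<bar>)\<^sup>2"
  shows "integrable lborel f"
proof (rule Bochner_Integration.integrable_bound)
  show "integrable lborel (\<lambda>x::real. \<bar>C\<bar> * (1 / (1 + x\<^sup>2)))"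
    using integrable_inverse_1_plus_square_line by (rule integrable_mult_right)
  show "AE x in lborel. norm (f x) \<le> norm (\<bar>C\<bar> * (1 / (1 + x\<^sup>2)))"
  proof (rule AE_I2)
    fix x :: real
    have "C / (1 + \<bar>x\<bar>)\<^sup>2 \<le> \<bar>C\<bar> / (1 + \<bar>x\<bar>)\<^sup>2" by (intro divide_right_mono) auto
    also have "\<dots> \<le> \<bar>C\<bar> / (1 + x\<^sup>2)"
      by (intro divide_left_mono mult_pos_pos)
         (auto simp: power2_eq_square algebra_simps abs_mult_self_eq add_pos_nonneg)
    finally show "norm (f x) \<le> norm (\<bar>C\<bar> * (1 / (1 + x\<^sup>2)))"
      using assms(2)[of x] by (simp add: abs_mult)
  qed
qed (use assms in simp)

text \<open>With d the distance from x to z, the triangle inequality gives 1 + |x| \<le> (1 + |z|) +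
  d, and d \<ge> |Im z| absorbs the first summand into a multiple of d.\<close>

lemma cauchy_kernel_bound:
  fixes z :: complex and x :: real
  assumes "Im z \<noteq> 0"
  shows "norm (1 / (of_real x - z)) \<le> ((1 + norm z) / \<bar>Im z\<bar> + 1) / (1 + \<bar>x\<bar>)"
proof -
  define d where "d = norm (of_real x - z)"
  have d1: "\<bar>Im z\<bar> \<le> d" using abs_Im_le_cmod[of "of_real x - z"] by (simp add: d_def)
  have d2: "\<bar>x\<bar> - norm z \<le> d" using norm_triangle_ineq2[of "of_real x" z] by (simp add: d_def)
  have "0 < \<bar>Im z\<bar>" using assms by simp
  then have "0 < d" using d1 by linarith
  have "1 + \<bar>x\<bar> \<le> (1 + norm z) + d" using d2 by simp
  also have "\<dots> \<le> (1 + norm z) * (d / \<bar>Im z\<bar>) + d"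
  proof -
    have "1 \<le> d / \<bar>Im z\<bar>" using d1 \<open>0 < \<bar>Im z\<bar>\<close> by simp
    then have "(1 + norm z) * 1 \<le> (1 + norm z) * (d / \<bar>Im z\<bar>)" by (intro mult_left_mono) auto
    then show ?thesis by simp
  qed
  also have "\<dots> = ((1 + norm z) / \<bar>Im z\<bar> + 1) * d" by (simp add: algebra_simps)
  finally have "1 + \<bar>x\<bar> \<le> ((1 + norm z) / \<bar>Im z\<bar> + 1) * d" .
  then show ?thesis using \<open>0 < d\<close> by (simp add: norm_divide d_def[symmetric] field_simps)
qed

lemma cauchy_kernel_bound':
  assumes "Im z \<noteq> 0"
  obtains C where "0 < C" "\<And>x::real. norm (1 / (of_real x - z)) \<le> C / (1 + \<bar>x\<bar>)"
proof
  show "0 < (1 + norm z) / \<bar>Im z\<bar> + 1" by (simp add: add_nonneg_pos)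
qed (use cauchy_kernel_bound[OF assms] in blast)

lemma complex_line_minus_nonzero: "Im z \<noteq> 0 \<Longrightarrow> of_real x - z \<noteq> 0"
  by auto

lemma cauchy_kernel_product_bound:
  fixes F :: "real \<Rightarrow> complex"
  assumes "Im z \<noteq> 0" "Im w \<noteq> 0" and "\<And>x. norm (F x) \<le> B"
  obtains C where "\<And>x. norm (F x / ((of_real x - z) * (of_real x - w))) \<le> C / (1 + \<bar>x\<bar>)\<^sup>2"
proof -
  obtain C1 where C1: "0 < C1" "\<And>x::real. norm (1 / (of_real x - z)) \<le> C1 / (1 + \<bar>x\<bar>)"
    using cauchy_kernel_bound'[OF assms(1)] by blast
  obtain C2 where C2: "0 < C2" "\<And>x::real. norm (1 / (of_real x - w)) \<le> C2 / (1 + \<bar>x\<bar>)"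
    using cauchy_kernel_bound'[OF assms(2)] by blast
  show thesis
  proof
    fix x :: real
    have "norm (F x / ((of_real x - z) * (of_real x - w)))
      = norm (F x) * (norm (1 / (of_real x - z)) * norm (1 / (of_real x - w)))"
      by (simp add: norm_mult norm_divide)
    also have "\<dots> \<le> B * ((C1 / (1 + \<bar>x\<bar>)) * (C2 / (1 + \<bar>x\<bar>)))"
      using C1 C2 assms(3)[of x] norm_ge_zero[of "F x"]
      by (intro mult_mono) (auto intro: order_trans[of 0 "norm (F x)"])
    also have "\<dots> = (B * C1 * C2) / (1 + \<bar>x\<bar>)\<^sup>2" by (simp add: power2_eq_square)
    finally show "norm (F x / ((of_real x - z) * (of_real x - w))) \<le> (B * C1 * C2) / (1 + \<bar>x\<bar>)\<^sup>2" .
  qed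
qed

lemma integrable_cauchy_kernel_product:
  fixes F :: "real \<Rightarrow> complex"
  assumes "Im z \<noteq> 0" "Im w \<noteq> 0" and "\<And>x. norm (F x) \<le> B" and [measurable]: "F \<in> borel_measurable borel"
  shows "integrable lborel (\<lambda>x. F x / ((of_real x - z) * (of_real x - w)))"
proof -
  obtain C where "\<And>x. norm (F x / ((of_real x - z) * (of_real x - w))) \<le> C / (1 + \<bar>x\<bar>)\<^sup>2"
    using cauchy_kernel_product_bound[OF assms(1,2), of F B] assms(3) by blast
  then show ?thesis by (intro integrable_bound_inverse_square[of _ C]) measurable
qed

text \<open>Takes the place of contour integration: the kernels below have explicit primitives with
  equal limits at both ends of the line.\<close>

lemma integral_line_eq_0_FTC:
  fixes f F :: "real \<Rightarrow> complex"
  assumes "\<And>x. (F has_vector_derivative f x) (at x)" "\<And>x. isCont f x" "integrable lborel f"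
    and "(F \<longlongrightarrow> A) at_top" "(F \<longlongrightarrow> A) at_bot"
  shows "(LINT x|lborel. f x) = 0"
proof -
  have "(LBINT x=-\<infinity>..\<infinity>. f x) = A - A"
    by (rule interval_integral_FTC_integrable[where F=F])
       (use assms in \<open>auto simp: set_integrable_def einterval_def at_left_PInf at_right_MInf
          filterlim_filtermap o_def\<close>)
  then show ?thesis
    by (simp add: interval_lebesgue_integral_def set_lebesgue_integral_def einterval_def)
qed

lemma tendsto_cauchy_kernel:
  "((\<lambda>x. 1 / (of_real x - z)) \<longlongrightarrow> (0::complex)) at_top"
  "((\<lambda>x. 1 / (of_real x - z)) \<longlongrightarrow> (0::complex)) at_bot"
proof -
  have "filterlim (\<lambda>x. x + (- z)) at_infinity at_infinity"
    by (intro tendsto_add_filterlim_at_infinity'[OF filterlim_ident tendsto_const])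
  then have *: "((\<lambda>x. 1 / (x - z)) \<longlongrightarrow> 0) at_infinity"
    by (intro tendsto_divide_0[OF tendsto_const]) simp
  show "((\<lambda>x. 1 / (of_real x - z)) \<longlongrightarrow> (0::complex)) at_top"
    by (rule filterlim_compose[OF *], subst filterlim_at_infinity_conv_norm_at_top)
       (simp add: filterlim_abs_real)
  show "((\<lambda>x. 1 / (of_real x - z)) \<longlongrightarrow> (0::complex)) at_bot"
    by (rule filterlim_compose[OF *], subst filterlim_at_infinity_conv_norm_at_top)
       (simp add: filterlim_abs_real filterlim_at_bot_mirror)
qed

lemma integral_cauchy_kernel_square:
  assumes "Im z < 0"
  shows "(LINT x|lborel. 1 / ((of_real x - z) * (of_real x - z))) = 0"
proof (rule integral_line_eq_0_FTC)
  show "((\<lambda>x. - (1 / (of_real x - z))) has_vector_derivative 1 / ((of_real x - z) * (of_real x - z))) (at x)" for x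
    using complex_line_minus_nonzero[of z x] assms
    by (auto intro!: derivative_eq_intros has_vector_derivative_real_field simp: field_simps)
  show "isCont (\<lambda>x. 1 / ((of_real x - z) * (of_real x - z))) x" for x :: real
    using complex_line_minus_nonzero[of z x] assms by (intro continuous_intros) auto
  show "integrable lborel (\<lambda>x. 1 / ((of_real x - z) * (of_real x - z)))"
    using assms by (intro integrable_cauchy_kernel_product[of z z "\<lambda>_. 1" 1]) auto
  show "((\<lambda>x. - (1 / (of_real x - z))) \<longlongrightarrow> - 0) at_top" "((\<lambda>x. - (1 / (of_real x - z))) \<longlongrightarrow> - 0) at_bot"
    by (intro tendsto_minus tendsto_cauchy_kernel)+
qed

lemma integral_cauchy_kernel_cube:
  assumes "Im z < 0"
  shows "(LINT x|lborel. (1 / (of_real x - z)) / ((of_real x - z) * (of_real x - z))) = 0"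
proof (rule integral_line_eq_0_FTC)
  show "((\<lambda>x. - (1/2) * (1 / (of_real x - z))^2) has_vector_derivative (1 / (of_real x - z)) / ((of_real x - z) * (of_real x - z))) (at x)" for x
  proof (rule has_vector_derivative_real_field)
    have nz: "of_real x - z \<noteq> 0" using complex_line_minus_nonzero[of z x] assms by simp
    then have "((\<lambda>u. 1 / (u - z)) has_field_derivative - (1 / ((of_real x - z) * (of_real x - z)))) (at (of_real x))"
      by (auto intro!: derivative_eq_intros)
    from DERIV_cmult[OF DERIV_power[OF this, of 2], of "- (1/2)"]
    show "((\<lambda>u. - (1/2) * (1 / (u - z))^2) has_field_derivative
        (1 / (of_real x - z)) / ((of_real x - z) * (of_real x - z))) (at (of_real x))"
      by (simp add: divide_simps mult.assoc)
  qed
  show "isCont (\<lambda>x. (1 / (of_real x - z)) / ((of_real x - z) * (of_real x - z))) x" for x :: real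
    using complex_line_minus_nonzero[of z x] assms by (intro continuous_intros) auto
  obtain C where C: "0 < C" "\<And>x::real. norm (1 / (of_real x - z)) \<le> C / (1 + \<bar>x\<bar>)"
    using assms cauchy_kernel_bound'[of z] by auto
  have "norm (1 / (of_real x - z)) \<le> C" for x :: real
    using order_trans[OF C(2)[of x]] C(1) by (simp add: field_simps)
  then show "integrable lborel (\<lambda>x. (1 / (of_real x - z)) / ((of_real x - z) * (of_real x - z)))"
    using assms by (intro integrable_cauchy_kernel_product[of z z _ C]) auto
  have "((\<lambda>x. - (1/2) * (1 / (of_real x - z))^2) \<longlongrightarrow> - (1/2) * 0^2) at_top"
    "((\<lambda>x. - (1/2) * (1 / (of_real x - z))^2) \<longlongrightarrow> - (1/2) * 0^2) at_bot"
    by (intro tendsto_mult tendsto_power tendsto_const tendsto_cauchy_kernel)+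
  then show "((\<lambda>x. - (1/2) * (1 / (of_real x - z))^2) \<longlongrightarrow> 0) at_top"
    "((\<lambda>x. - (1/2) * (1 / (of_real x - z))^2) \<longlongrightarrow> 0) at_bot" by simp_all
qed

text \<open>For z \<noteq> w a primitive is Ln ((x - z) / (x - w)) / (z - w). The quotient avoids
  the branch cut, since a nonpositive real value r would give Im z = r Im w \<ge> 0, and it tends to
  1 at both ends.\<close>

lemma integral_cauchy_kernel_product:
  assumes z: "Im z < 0" and w: "Im w < 0"
  shows "(LINT x|lborel. 1 / ((of_real x - z) * (of_real x - w))) = 0"
proof (cases "z = w")
  case True
  then show ?thesis using integral_cauchy_kernel_square[OF z] by simp
next
  case False
  let ?q = "\<lambda>x::real. (of_real x - z) / (of_real x - w)"
  have nz: "of_real x - z \<noteq> 0" "of_real x - w \<noteq> 0" for x :: real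
    using z w by auto
  have nonpos: "?q x \<notin> \<real>\<^sub>\<le>\<^sub>0" for x
  proof
    assume "?q x \<in> \<real>\<^sub>\<le>\<^sub>0"
    then obtain r where r: "r \<le> 0" "?q x = of_real r" by (auto elim: nonpos_Reals_cases)
    then have "of_real x - z = of_real r * (of_real x - w)" using nz by (simp add: field_simps)
    then have "Im (of_real x - z) = Im (of_real r * (of_real x - w))" by simp
    then have "Im z = r * Im w" by simp
    moreover have "0 \<le> r * Im w" using r(1) w by (simp add: mult_nonpos_nonpos)
    ultimately show False using z by simp
  qed
  have q1: "(?q \<longlongrightarrow> 1) at_top" "(?q \<longlongrightarrow> 1) at_bot"
  proof -
    have eq: "?q = (\<lambda>x. 1 + (w - z) * (1 / (of_real x - w)))" using nz by (auto simp: field_simps)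
    show "(?q \<longlongrightarrow> 1) at_top" "(?q \<longlongrightarrow> 1) at_bot" unfolding eq
      using tendsto_add[OF tendsto_const tendsto_mult[OF tendsto_const tendsto_cauchy_kernel(1)], of 1 "w - z" w]
        tendsto_add[OF tendsto_const tendsto_mult[OF tendsto_const tendsto_cauchy_kernel(2)], of 1 "w - z" w]
      by simp_all
  qed
  show ?thesis
  proof (rule integral_line_eq_0_FTC)
    show "((\<lambda>x. Ln (?q x) / (z - w)) has_vector_derivative 1 / ((of_real x - z) * (of_real x - w))) (at x)" for x
    proof (rule has_vector_derivative_real_field)
      have nz': "of_real x - z \<noteq> 0" "of_real x - w \<noteq> 0" "z - w \<noteq> 0" using nz[of x] False by auto
      have "((\<lambda>u. (u - z) / (u - w)) has_field_derivative (z - w) / ((of_real x - w) * (of_real x - w))) (at (of_real x))"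
        using nz' by (auto intro!: derivative_eq_intros)
      from DERIV_cdivide[OF DERIV_chain2[OF has_field_derivative_Ln[OF nonpos[of x]] this], of "z - w"]
      show "((\<lambda>u. Ln ((u - z) / (u - w)) / (z - w)) has_field_derivative
          1 / ((of_real x - z) * (of_real x - w))) (at (of_real x))"
        using nz' by (simp add: divide_simps mult.assoc)
    qed
    show "isCont (\<lambda>x. 1 / ((of_real x - z) * (of_real x - w))) x" for x :: real
      using nz[of x] by (intro continuous_intros) auto
    show "integrable lborel (\<lambda>x. 1 / ((of_real x - z) * (of_real x - w)))"
      using z w by (intro integrable_cauchy_kernel_product[of z w "\<lambda>_. 1" 1]) auto
    have nz': "z - w \<noteq> 0" and one: "(1::complex) \<notin> \<real>\<^sub>\<le>\<^sub>0" using False by auto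
    note tendsto_divide[OF tendsto_Ln[OF q1(1) one] tendsto_const nz']
      tendsto_divide[OF tendsto_Ln[OF q1(2) one] tendsto_const nz']
    then show "((\<lambda>x. Ln (?q x) / (z - w)) \<longlongrightarrow> 0) at_top" "((\<lambda>x. Ln (?q x) / (z - w)) \<longlongrightarrow> 0) at_bot"
      by simp_all
  qed
qed

lemma integral_cauchy_kernel_triple_distinct:
  assumes z: "Im z < 0" and w: "Im w < 0" and v: "Im v < 0" and "v \<noteq> z"
  shows "(LINT x|lborel. (1 / (of_real x - v)) / ((of_real x - z) * (of_real x - w))) = 0"
proof -
  have nz: "of_real x - z \<noteq> 0" "of_real x - w \<noteq> 0" "of_real x - v \<noteq> 0" for x :: real
    using z w v by auto
  have pf: "1 / a / (b * c) = (1 / (a * c) - 1 / (b * c)) / (b - a)"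
    if "a \<noteq> 0" "b \<noteq> 0" "c \<noteq> 0" "a \<noteq> b" for a b c :: complex
    using that by (simp add: divide_simps)
  have eq: "(1 / (of_real x - v)) / ((of_real x - z) * (of_real x - w))
    = (1 / ((of_real x - v) * (of_real x - w)) - 1 / ((of_real x - z) * (of_real x - w))) / (v - z)"
    for x :: real
    using pf[of "of_real x - v" "of_real x - z" "of_real x - w"] nz[of x] assms(4) by simp
  have "integrable lborel (\<lambda>x. 1 / ((of_real x - z) * (of_real x - w)))"
    "integrable lborel (\<lambda>x. 1 / ((of_real x - v) * (of_real x - w)))"
    using z w v integrable_cauchy_kernel_product[of _ w "\<lambda>_. 1" 1] by auto
  then show ?thesis
    unfolding eq using integral_cauchy_kernel_product z w v by simp
qed

text \<open>Unless all three poles coincide, v differs from z or from w, and partial fractions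
  reduce to products of two kernels; the triple pole has an elementary primitive.\<close>

lemma integral_cauchy_kernel_triple:
  assumes z: "Im z < 0" and w: "Im w < 0" and v: "Im v < 0"
  shows "(LINT x|lborel. (1 / (of_real x - v)) / ((of_real x - z) * (of_real x - w))) = 0"
proof (cases "v = z \<and> v = w")
  case True
  then have "z = v" "w = v" by auto
  then show ?thesis using integral_cauchy_kernel_cube[OF v] by simp
next
  case False
  then show ?thesis
    using integral_cauchy_kernel_triple_distinct[OF z w v] integral_cauchy_kernel_triple_distinct[OF w z v]
    by (auto simp: mult.commute)
qed

subsection \<open>The involution and periodization of integrable functions\<close>

text \<open>The substitution y = -\<beta> / x maps the punctured line bijectively onto itself with
  derivative \<beta> / x^2. It is carried out for the completed measure and brought back by Borel
  measurability.\<close>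

lemma J_fun_real:
  fixes f :: "real \<Rightarrow> real"
  assumes \<beta>: "0 < \<beta>" and f: "integrable lborel f"
  shows "integrable lborel (\<lambda>x. \<beta> / x\<^sup>2 * f (- \<beta> / x))"
    and "(LINT x|lborel. \<beta> / x\<^sup>2 * f (- \<beta> / x)) = (LINT x|lborel. f x)"
proof -
  note [measurable] = borel_measurable_integrable[OF f]
  define g where "g = (\<lambda>x::real. - \<beta> / x)"
  define S where "S = - {0::real}"
  have der: "(g has_field_derivative \<beta> / x\<^sup>2) (at x within S)" if "x \<in> S" for x
    using that unfolding g_def S_def
    by (auto intro!: derivative_eq_intros simp: power2_eq_square)
  have inj: "inj_on g S" using \<beta> by (auto simp: g_def S_def inj_on_def field_simps)
  have img: "g ` S = S"
  proof
    show "g ` S \<subseteq> S" using \<beta> by (auto simp: g_def S_def)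
    show "S \<subseteq> g ` S"
    proof
      fix y assume "y \<in> S"
      then have "y = g (- \<beta> / y)" "- \<beta> / y \<in> S" using \<beta> by (auto simp: g_def S_def)
      then show "y \<in> g ` S" by blast
    qed
  qed
  have S: "S \<in> sets lebesgue" by (simp add: S_def)
  have ae: "AE x in lborel. x \<in> S" using AE_lborel_singleton[of "0::real"] by (simp add: S_def)
  have ae': "AE x in lebesgue. x \<in> S" using ae by (rule AE_completion)
  have fL: "integrable lebesgue f" "integral\<^sup>L lebesgue f = integral\<^sup>L lborel f"
    using f by (simp_all add: integrable_completion integral_completion)
  have fS: "f absolutely_integrable_on S"
    unfolding set_integrable_def using fL(1) S by (intro integrable_mult_indicator)
  have iS: "integral S f = integral\<^sup>L lborel f"
  proof -
    have "integral S f = (LINT x:S|lebesgue. f x)" using fS by (rule set_lebesgue_integral_eq_integral(2)[symmetric])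
    also have "\<dots> = integral\<^sup>L lebesgue f"
      unfolding set_lebesgue_integral_def using ae' S fL(1)
      by (intro integral_cong_AE) (auto intro!: borel_measurable_scaleR dest: borel_measurable_integrable)
    finally show ?thesis using fL by simp
  qed
  have main: "(\<lambda>x. \<bar>\<beta> / x\<^sup>2\<bar> * f (g x)) absolutely_integrable_on S \<and>
      integral S (\<lambda>x. \<bar>\<beta> / x\<^sup>2\<bar> * f (g x)) = integral\<^sup>L lborel f"
    using has_absolute_integral_change_of_variables_1'[OF S der inj, of f "integral\<^sup>L lborel f"] fS iS img by simp
  let ?h = "\<lambda>x. \<beta> / x\<^sup>2 * f (- \<beta> / x)"
  \<comment> \<open>At the removed point 0 both sides are 0, the right one because division by 0
    gives 0.\<close>
  have eq: "indicat_real S x *\<^sub>R (\<bar>\<beta> / x\<^sup>2\<bar> * f (g x)) = ?h x" for x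
    using \<beta> by (auto simp: S_def g_def indicator_def)
  have hL: "integrable lebesgue ?h" using main unfolding set_integrable_def eq by blast
  have [measurable]: "?h \<in> borel_measurable borel" by measurable
  show int: "integrable lborel ?h" using hL by (subst (asm) integrable_completion) auto
  have "integral\<^sup>L lborel ?h = integral\<^sup>L lebesgue ?h" by (subst integral_completion) auto
  also have "\<dots> = (LINT x:S|lebesgue. \<bar>\<beta> / x\<^sup>2\<bar> * f (g x))" unfolding set_lebesgue_integral_def eq ..
  also have "\<dots> = integral S (\<lambda>x. \<bar>\<beta> / x\<^sup>2\<bar> * f (g x))"
    using main by (intro set_lebesgue_integral_eq_integral(2)) blast
  finally show "integral\<^sup>L lborel ?h = integral\<^sup>L lborel f" using main by simp
qed

lemma J_fun_integral:
  assumes \<beta>: "0 < \<beta>" and f: "integrable lborel f"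
  shows "integrable lborel (J_fun \<beta> f)" and "(LINT x|lborel. J_fun \<beta> f x) = (LINT x|lborel. f x)"
proof -
  have R: "integrable lborel (\<lambda>x. Re (f x))" and I: "integrable lborel (\<lambda>x. Im (f x))" using f by auto
  note r = J_fun_real[OF \<beta> R] and i = J_fun_real[OF \<beta> I]
  have eq: "J_fun \<beta> f = (\<lambda>x. of_real (\<beta> / x\<^sup>2 * Re (f (- \<beta> / x))) + \<i> * of_real (\<beta> / x\<^sup>2 * Im (f (- \<beta> / x))))"
    by (auto simp: J_fun_def complex_eq_iff fun_eq_iff)
  show "integrable lborel (J_fun \<beta> f)" unfolding eq
    by (intro Bochner_Integration.integrable_add integrable_mult_right integrable_of_real r(1) i(1))
  have "(LINT x|lborel. J_fun \<beta> f x) = of_real (LINT x|lborel. Re (f x)) + \<i> * of_real (LINT x|lborel. Im (f x))"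
    unfolding eq
    by (subst Bochner_Integration.integral_add)
       (intro integrable_mult_right integrable_of_real r(1) i(1) | simp only: integral_mult_right_zero integral_complex_of_real r(2) i(2))+
  also have "\<dots> = (LINT x|lborel. f x)"
    using f by (simp add: complex_eq_iff)
  finally show "(LINT x|lborel. J_fun \<beta> f x) = (LINT x|lborel. f x)" .
qed

text \<open>The inversion is an involution, so a factor b(-\<beta> / x) inside \<open>J_fun\<close>
  comes out as b(x). In this form the operator moves onto the bounded factor of a pairing.\<close>

lemma J_fun_pairing:
  assumes \<beta>: "0 < \<beta>" and f: "integrable lborel (\<lambda>x. b (- \<beta> / x) * f x)"
  shows "(LINT x|lborel. b x * J_fun \<beta> f x) = (LINT x|lborel. b (- \<beta> / x) * f x)"
    and "integrable lborel (\<lambda>x. b x * J_fun \<beta> f x)"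
proof -
  have eq: "J_fun \<beta> (\<lambda>x. b (- \<beta> / x) * f x) = (\<lambda>x. b x * J_fun \<beta> f x)"
    using \<beta> by (auto simp: J_fun_def fun_eq_iff)
  show "(LINT x|lborel. b x * J_fun \<beta> f x) = (LINT x|lborel. b (- \<beta> / x) * f x)"
   "integrable lborel (\<lambda>x. b x * J_fun \<beta> f x)"
    using J_fun_integral[OF \<beta> f] unfolding eq by auto
qed

section \<open>Reduction modulo 2 and unfolding of integrals over a period\<close>

definition pi2 :: "real \<Rightarrow> real" where "pi2 x = x - 2 * of_int \<lfloor>(x + 1) / 2\<rfloor>"

lemma pi2_measurable [measurable]: "pi2 \<in> borel_measurable borel"
  unfolding pi2_def by measurable

lemma floor_half_bounds:
  fixes y :: real
  assumes "m = \<lfloor>y / 2\<rfloor>"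
  shows "2 * of_int m \<le> y" "y < 2 * of_int m + 2"
  using floor_correct[of "y / 2"] unfolding assms[symmetric] by simp_all

lemma pi2_bounds: "-1 \<le> pi2 x" "pi2 x < 1"
proof -
  show "-1 \<le> pi2 x" using floor_half_bounds(1)[OF refl, of "x + 1"] by (simp add: pi2_def)
  show "pi2 x < 1" using floor_half_bounds(2)[OF refl, of "x + 1"] by (simp add: pi2_def)
qed

lemma pi2_unique: "-1 \<le> x \<Longrightarrow> x < 1 \<Longrightarrow> pi2 (x + 2 * of_int j) = x"
proof -
  assume "-1 \<le> x" "x < 1"
  then have "\<lfloor>(x + 2 * of_int j + 1) / 2\<rfloor> = j" by (intro floor_unique) auto
  then show ?thesis by (simp add: pi2_def)
qed

lemma pi2_ident: "-1 \<le> x \<Longrightarrow> x < 1 \<Longrightarrow> pi2 x = x"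
  using pi2_unique[of x 0] by simp

lemma pi2_decomp: obtains j where "x = pi2 x + 2 * of_int j"
  by (rule that[of "\<lfloor>(x + 1) / 2\<rfloor>"]) (simp add: pi2_def)

lemma periodic_int_shift:
  fixes \<psi> :: "real \<Rightarrow> 'a"
  assumes "\<And>x. \<psi> (x + 2) = \<psi> x"
  shows "\<psi> (x + 2 * of_int j) = \<psi> x"
proof -
  have *: "\<psi> (y + 2 * of_nat n) = \<psi> y" for y n
  proof (induction n)
    case (Suc n)
    have "\<psi> (y + 2 * of_nat (Suc n)) = \<psi> ((y + 2 * of_nat n) + 2)" by (simp add: algebra_simps)
    then show ?case using assms Suc by simp
  qed simp
  show ?thesis
  proof (cases "j \<ge> 0")
    case True
    then show ?thesis using *[of x "nat j"] by simp
  next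
    case False
    then show ?thesis using *[of "x + 2 * of_int j" "nat (- j)"] by simp
  qed
qed

lemma periodic_pi2:
  fixes \<psi> :: "real \<Rightarrow> 'a"
  assumes "\<And>x. \<psi> (x + 2) = \<psi> x"
  shows "\<psi> (pi2 x) = \<psi> x"
  using periodic_int_shift[of \<psi>, OF assms, of "pi2 x"] pi2_decomp[of x] by metis

text \<open>Tonelli: the sum of the norms has finite integral, hence is finite almost
  everywhere.\<close>

lemma AE_summable_norm:
  fixes c :: "nat \<Rightarrow> 'a \<Rightarrow> complex"
  assumes int: "\<And>n. integrable M (c n)" and sm: "summable (\<lambda>n. LINT x|M. norm (c n x))"
  shows "AE x in M. summable (\<lambda>n. norm (c n x))"
proof -
  have [measurable]: "c n \<in> borel_measurable M" for n using int by auto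
  have "(\<integral>\<^sup>+x. (\<Sum>n. ennreal (norm (c n x))) \<partial>M) = (\<Sum>n. \<integral>\<^sup>+x. ennreal (norm (c n x)) \<partial>M)"
    by (intro nn_integral_suminf) measurable
  also have "\<dots> = (\<Sum>n. ennreal (LINT x|M. norm (c n x)))"
    using int by (intro suminf_cong nn_integral_eq_integral) auto
  also have "\<dots> = ennreal (\<Sum>n. LINT x|M. norm (c n x))"
    using sm by (intro suminf_ennreal2) auto
  finally have "(\<integral>\<^sup>+x. (\<Sum>n. ennreal (norm (c n x))) \<partial>M) \<noteq> \<infinity>" by simp
  then have "AE x in M. (\<Sum>n. ennreal (norm (c n x))) \<noteq> \<infinity>"
    by (intro nn_integral_PInf_AE) auto
  then show ?thesis
    by eventually_elim (auto intro: summable_suminf_not_top)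
qed

text \<open>An enumeration of the integers turns the unconditional sum into a series, which makes
  measurability accessible. For complex terms unconditional and absolute convergence agree, and
  \<open>infsum\<close> is 0 when they fail, so the case distinction is exact.\<close>

lemma Pi2_fun_suminf:
  "Pi2_fun F x = (if summable (\<lambda>n. norm (F (x + 2 * of_int (int_decode n))))
     then (\<Sum>n. F (x + 2 * of_int (int_decode n))) else 0)"
proof -
  let ?f = "\<lambda>j::int. F (x + 2 * of_int j)" and ?g = "\<lambda>n. F (x + 2 * of_int (int_decode n))"
  have "Pi2_fun F x = infsum ?g UNIV"
    unfolding Pi2_fun_def using infsum_reindex_bij_betw[OF bij_int_decode, of ?f] by simp
  also have "\<dots> = (if summable (\<lambda>n. norm (?g n)) then suminf ?g else 0)"
  proof (cases "summable (\<lambda>n. norm (?g n))")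
    case True
    then have "(?g has_sum suminf ?g) UNIV"
      using norm_summable_imp_has_sum[OF True summable_sums[OF summable_norm_cancel[OF True]]] by blast
    then show ?thesis using True by (simp add: infsumI)
  next
    case False
    then have "\<not> (\<lambda>n. norm (?g n)) summable_on UNIV"
      by (simp add: summable_on_UNIV_nonneg_real_iff)
    then have "\<not> ?g summable_on UNIV"
      using summable_on_iff_abs_summable_on_complex[of ?g UNIV] by simp
    then show ?thesis using False by (simp add: infsum_not_exists)
  qed
  finally show ?thesis .
qed

lemma Pi2_fun_measurable [measurable]:
  assumes [measurable]: "F \<in> borel_measurable borel"
  shows "Pi2_fun F \<in> borel_measurable borel"
proof -
  have "summable (\<lambda>n. norm (F (x + 2 * of_int (int_decode n)))) \<longleftrightarrow>
      (\<Sum>n. ennreal (norm (F (x + 2 * of_int (int_decode n))))) \<noteq> top" for x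
    by (auto intro: summable_suminf_not_top simp: suminf_ennreal2)
  then show ?thesis
    unfolding Pi2_fun_suminf[abs_def] by simp
qed

lemma lborel_integral_shift:
  fixes f :: "real \<Rightarrow> 'b::{banach, second_countable_topology}"
  shows "(LINT x|lborel. f (x + t)) = (LINT x|lborel. f x)"
  using lborel_integral_real_affine[of 1 f t] by (simp add: add.commute)

lemma lborel_integrable_shift:
  fixes f :: "real \<Rightarrow> 'b::{banach, second_countable_topology}"
  shows "integrable lborel f \<Longrightarrow> integrable lborel (\<lambda>x. f (x + t))"
  using lborel_integrable_real_affine[of f 1 t] by (simp add: add.commute)

lemma lborel_integral_Ico_shift:
  fixes h :: "real \<Rightarrow> 'b::{banach, second_countable_topology}"
  shows "(LINT x|lborel. indicat_real {t - 1..<t + 1} x *\<^sub>R h x)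
    = (LINT x|lborel. indicat_real {-1..<1} x *\<^sub>R h (x + t))"
  by (subst lborel_integral_shift[symmetric, of _ t])
     (rule Bochner_Integration.integral_cong, auto simp: indicator_def)

text \<open>Unfolding: the translates of [-1, 1[ tile the line, and b composed with
  \<open>pi2\<close> is the 2-periodic extension of b from one period. The points where the defining
  sum diverges form a null set by Tonelli.\<close>

lemma Pi2_fun_pairing:
  assumes F: "integrable lborel F" and b[measurable]: "b \<in> borel_measurable borel"
    and B: "\<And>x. norm (b x) \<le> B"
  shows "integrable lborel (\<lambda>x. indicat_real {-1..<1} x *\<^sub>R (b x * Pi2_fun F x))"
    and "(LINT x|lborel. indicat_real {-1..<1} x *\<^sub>R (b x * Pi2_fun F x)) = (LINT x|lborel. b (pi2 x) * F x)"
proof -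
  note [measurable] = borel_measurable_integrable[OF F]
  define e where "e n = (of_int (int_decode n) :: real)" for n
  define A where "A n = {2 * e n - 1 ..< 2 * e n + 1}" for n
  define G where "G x = b (pi2 x) * F x" for x
  have [measurable]: "G \<in> borel_measurable borel" unfolding G_def by measurable
  have [measurable]: "A n \<in> sets borel" for n by (simp add: A_def)
  have disj: "A i \<inter> A j = {}" if "i \<noteq> j" for i j
  proof (rule ccontr)
    assume "A i \<inter> A j \<noteq> {}"
    then obtain x where "x \<in> A i" "x \<in> A j" by auto
    then have "e i < e j + 1" "e j < e i + 1" by (auto simp: A_def)
    then have "int_decode i < int_decode j + 1" "int_decode j < int_decode i + 1" unfolding e_def by linarith+
    then have "int_decode i = int_decode j" by linarith
    then have "i = j" by (metis int_decode_inverse)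
    with that show False by simp
  qed
  have cover: "(\<Union>n. A n) = UNIV"
  proof -
    have "x \<in> A (int_encode \<lfloor>(x + 1) / 2\<rfloor>)" for x
      unfolding A_def e_def int_encode_inverse atLeastLessThan_iff
      using floor_half_bounds[OF refl, of "x + 1"] by simp
    then show ?thesis by blast
  qed
  have G: "integrable lborel G"
    by (rule Bochner_Integration.integrable_bound[of _ "\<lambda>x. B * norm (F x)"])
       (use F B in \<open>auto simp: G_def norm_mult intro!: AE_I2 order_trans[OF mult_right_mono[OF B]]\<close>)
  have shifti: "integrable lborel (\<lambda>x. indicat_real {-1..<1} x *\<^sub>R h (x + 2 * e n))" if "integrable lborel h"
    for h :: "real \<Rightarrow> complex" and n
    using lborel_integrable_shift[OF that, of "2 * e n"]
    by (intro integrable_mult_indicator) auto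
  have sumF: "summable (\<lambda>n. LINT x|lborel. norm (indicat_real {-1..<1} x *\<^sub>R F (x + 2 * e n)))"
  proof (rule summableI_nonneg_bounded)
    fix N :: nat
    have "(\<Sum>n<N. LINT x|lborel. norm (indicat_real {-1..<1} x *\<^sub>R F (x + 2 * e n)))
      = (\<Sum>n<N. LINT x|lborel. indicat_real (A n) x *\<^sub>R norm (F x))"
      unfolding A_def lborel_integral_Ico_shift by simp
    also have "\<dots> = (LINT x|lborel. (\<Sum>n<N. indicat_real (A n) x *\<^sub>R norm (F x)))"
      using F by (intro Bochner_Integration.integral_sum[symmetric] integrable_mult_indicator) auto
    also have "\<dots> \<le> (LINT x|lborel. norm (F x))"
    proof (intro integral_mono Bochner_Integration.integrable_sum integrable_mult_indicator)
      fix x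
      have "(\<Sum>n<N. indicat_real (A n) x) = indicat_real (\<Union>n<N. A n) x"
        by (rule indicator_UN_disjoint[symmetric]) (use disj in \<open>auto simp: disjoint_family_on_def\<close>)
      then have "(\<Sum>n<N. indicat_real (A n) x) \<le> 1" by (simp add: indicator_def)
      then have "(\<Sum>n<N. indicat_real (A n) x) * norm (F x) \<le> 1 * norm (F x)" by (intro mult_right_mono) auto
      then show "(\<Sum>n<N. indicat_real (A n) x *\<^sub>R norm (F x)) \<le> norm (F x)"
        by (simp add: sum_distrib_right)
    qed (use F in auto)
    finally show "(\<Sum>n<N. LINT x|lborel. norm (indicat_real {-1..<1} x *\<^sub>R F (x + 2 * e n))) \<le> (LINT x|lborel. norm (F x))" .
  qed auto
  have aeF: "AE x in lborel. summable (\<lambda>n. norm (indicat_real {-1..<1} x *\<^sub>R F (x + 2 * e n)))"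
    using AE_summable_norm[OF shifti[OF F] sumF] .
  define c where "c n x = indicat_real {-1..<1} x *\<^sub>R (b x * F (x + 2 * e n))" for n x
  \<comment> \<open>On the period, b(x) is b composed with \<open>pi2\<close> at the translated
    point, so every term is a translate of the single function G, and its integral is that of G over
    one tile.\<close>
  have c_eq: "c n x = indicat_real {-1..<1} x *\<^sub>R G (x + 2 * e n)" for n x
    using pi2_unique[of x "int_decode n"] by (auto simp: c_def G_def indicator_def e_def)
  have cint: "integrable lborel (c n)" for n
    unfolding c_eq[abs_def] by (rule shifti[OF G])
  have cle: "norm (c n x) \<le> B * norm (indicat_real {-1..<1} x *\<^sub>R F (x + 2 * e n))" for n x
    using mult_right_mono[OF B[of x], of "norm (F (x + 2 * e n))"] by (auto simp: c_def norm_mult indicator_def)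
  have csum: "summable (\<lambda>n. LINT x|lborel. norm (c n x))"
  proof (rule summable_comparison_test')
    show "summable (\<lambda>n. B * (LINT x|lborel. norm (indicat_real {-1..<1} x *\<^sub>R F (x + 2 * e n))))"
      using sumF by (rule summable_mult)
    fix n
    have "(LINT x|lborel. norm (c n x)) \<le> (LINT x|lborel. B * norm (indicat_real {-1..<1} x *\<^sub>R F (x + 2 * e n)))"
      by (intro integral_mono integrable_norm cint integrable_mult_right shifti F cle)
    then show "norm (LINT x|lborel. norm (c n x)) \<le> B * (LINT x|lborel. norm (indicat_real {-1..<1} x *\<^sub>R F (x + 2 * e n)))"
      by simp
  qed
  have cae: "AE x in lborel. summable (\<lambda>n. norm (c n x))" using AE_summable_norm[OF cint csum] .
  have ceq: "AE x in lborel. (\<Sum>n. c n x) = indicat_real {-1..<1} x *\<^sub>R (b x * Pi2_fun F x)"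
    using aeF
  proof eventually_elim
    case (elim x)
    show ?case
    proof (cases "x \<in> {-1..<1}")
      case True
      then have "summable (\<lambda>n. norm (F (x + 2 * e n)))" using elim by simp
      then have "Pi2_fun F x = (\<Sum>n. F (x + 2 * e n))" "summable (\<lambda>n. F (x + 2 * e n))"
        using summable_norm_cancel[of "\<lambda>n. F (x + 2 * e n)"] by (simp_all add: Pi2_fun_suminf e_def)
      then show ?thesis using True by (simp add: c_def suminf_mult)
    qed (simp add: c_def)
  qed
  have i1: "integrable lborel (\<lambda>x. \<Sum>n. c n x)"
    using integrable_suminf[OF cint cae csum] .
  show "integrable lborel (\<lambda>x. indicat_real {-1..<1} x *\<^sub>R (b x * Pi2_fun F x))"
    using i1 by (rule integrable_cong_AE_imp) (use ceq in \<open>auto\<close>)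
  have "(LINT x|lborel. indicat_real {-1..<1} x *\<^sub>R (b x * Pi2_fun F x)) = (LINT x|lborel. (\<Sum>n. c n x))"
    by (rule integral_cong_AE) (use ceq i1 in \<open>auto\<close>)
  also have "\<dots> = (\<Sum>n. LINT x|lborel. c n x)"
    using integral_suminf[OF cint cae csum] .
  also have "\<dots> = (\<Sum>n. LINT x:A n|lborel. G x)"
    unfolding c_eq[abs_def] set_lebesgue_integral_def A_def lborel_integral_Ico_shift ..
  also have "\<dots> = (LINT x:(\<Union>n. A n)|lborel. G x)"
    by (rule lebesgue_integral_countable_add[symmetric])
       (use disj G in \<open>auto simp: cover set_integrable_def\<close>)
  also have "\<dots> = (LINT x|lborel. G x)" by (simp add: cover set_lebesgue_integral_def)
  finally show "(LINT x|lborel. indicat_real {-1..<1} x *\<^sub>R (b x * Pi2_fun F x)) = (LINT x|lborel. b (pi2 x) * F x)"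
    by (simp add: G_def)
qed

subsection \<open>Bounded Hardy functions\<close>

text \<open>Factors that tend to 1 boundedly and supply decay, without leaving the Hardy class below.\<close>

definition cut :: "nat \<Rightarrow> real \<Rightarrow> complex" where
  "cut n x = \<i> * of_nat (Suc n) / (of_real x + \<i> * of_nat (Suc n))"

lemma cut_denominator_nonzero: "of_real x + \<i> * of_nat (Suc n) \<noteq> 0"
  using complex_line_minus_nonzero[of "- \<i> * of_nat (Suc n)" x] by simp

lemma cut_measurable [measurable]: "cut n \<in> borel_measurable borel"
  unfolding cut_def by measurable

lemma norm_cut_le_1: "norm (cut n x) \<le> 1"
proof -
  have "norm (\<i> * of_nat (Suc n)) = \<bar>Im (of_real x + \<i> * of_nat (Suc n))\<bar>"
    by (simp add: norm_mult del: of_nat_Suc)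
  also have "\<dots> \<le> norm (of_real x + \<i> * of_nat (Suc n))" by (rule abs_Im_le_cmod)
  finally show ?thesis using cut_denominator_nonzero[of x n]
    by (simp add: cut_def norm_divide divide_le_eq_1)
qed

lemma cut_tendsto_1: "(\<lambda>n. cut n x) \<longlonglongrightarrow> 1"
proof -
  have "(\<lambda>n. 1 / (of_real x * (- \<i> * inverse (of_nat (Suc n))) + 1)) \<longlonglongrightarrow> 1 / (of_real x * (- \<i> * 0) + (1::complex))"
    by (intro tendsto_intros LIMSEQ_inverse_real_of_nat LIMSEQ_Suc[OF lim_inverse_n]) simp
  moreover have "cut n x = 1 / (of_real x * (- \<i> * inverse (of_nat (Suc n))) + 1)" for n
  proof -
    have a: "\<i> * of_nat (Suc n) \<noteq> 0" by (simp del: of_nat_Suc)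
    have "cut n x = 1 / ((of_real x + \<i> * of_nat (Suc n)) / (\<i> * of_nat (Suc n)))"
      by (simp add: cut_def)
    also have "(of_real x + \<i> * of_nat (Suc n)) / (\<i> * of_nat (Suc n)) = of_real x * (- \<i> * inverse (of_nat (Suc n))) + 1"
    proof -
      have "inverse (\<i> * of_nat (Suc n)) = - \<i> * inverse (of_nat (Suc n))"
        by (simp del: of_nat_Suc)
      then show ?thesis
        using a by (simp add: add_divide_distrib divide_inverse[of "of_real x"] del: of_nat_Suc)
    qed
    finally show ?thesis .
  qed
  ultimately show ?thesis by simp
qed

lemma cut_eq: "cut n x = (\<i> * of_nat (Suc n)) * (1 / (of_real x - (- \<i> * of_nat (Suc n))))"
  by (simp add: cut_def)

lemma integral_cut_tendsto:
  assumes f: "integrable lborel f"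
  shows "(\<lambda>n. LINT x|lborel. f x * cut n x) \<longlonglongrightarrow> (LINT x|lborel. f x)"
proof (rule integral_dominated_convergence[where w="\<lambda>x. norm (f x)"])
  note [measurable] = borel_measurable_integrable[OF f]
  show "f \<in> borel_measurable lborel" "\<And>n. (\<lambda>x. f x * cut n x) \<in> borel_measurable lborel" by measurable
  show "integrable lborel (\<lambda>x. norm (f x))" using f by simp
  show "AE x in lborel. (\<lambda>n. f x * cut n x) \<longlonglongrightarrow> f x"
    by (rule AE_I2) (auto intro!: tendsto_eq_intros cut_tendsto_1)
  show "AE x in lborel. norm (f x * cut n x) \<le> norm (f x)" for n
    by (rule AE_I2) (simp add: norm_mult mult_left_le norm_cut_le_1)
qed

lemma integral_eq_0_if_cut:
  assumes "integrable lborel f" and "\<And>n. (LINT x|lborel. f x * cut n x) = 0"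
  shows "(LINT x|lborel. f x) = 0"
  using LIMSEQ_unique[OF integral_cut_tendsto[OF assms(1)]] assms(2) by simp

text \<open>
  Boundary values of bounded holomorphic functions on the upper half-plane. The test kernel decays
  quadratically, so that constants qualify and the class is invariant under \<open>x \<mapsto> - \<beta> / x\<close>.
\<close>

definition hardy :: "(real \<Rightarrow> complex) \<Rightarrow> bool" where
  "hardy F \<longleftrightarrow> F \<in> borel_measurable borel \<and> (\<exists>B. \<forall>x. norm (F x) \<le> B) \<and>
    (\<forall>z w. Im z < 0 \<longrightarrow> Im w < 0 \<longrightarrow>
      (LINT x|lborel. F x / ((of_real x - z) * (of_real x - w))) = 0)"

lemma hardyI:
  assumes "F \<in> borel_measurable borel" "\<And>x. norm (F x) \<le> B"
    "\<And>z w. Im z < 0 \<Longrightarrow> Im w < 0 \<Longrightarrow> (LINT x|lborel. F x / ((of_real x - z) * (of_real x - w))) = 0"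
  shows "hardy F"
  using assms unfolding hardy_def by blast

lemma hardyD:
  assumes "hardy F"
  shows "F \<in> borel_measurable borel"
    and "Im z < 0 \<Longrightarrow> Im w < 0 \<Longrightarrow> (LINT x|lborel. F x / ((of_real x - z) * (of_real x - w))) = 0"
    and "Im z < 0 \<Longrightarrow> Im w < 0 \<Longrightarrow> integrable lborel (\<lambda>x. F x / ((of_real x - z) * (of_real x - w)))"
proof -
  show 1: "F \<in> borel_measurable borel" using assms by (simp add: hardy_def)
  show "Im z < 0 \<Longrightarrow> Im w < 0 \<Longrightarrow> (LINT x|lborel. F x / ((of_real x - z) * (of_real x - w))) = 0"
    using assms by (simp add: hardy_def)
  assume "Im z < 0" "Im w < 0"
  moreover obtain B where "\<And>x. norm (F x) \<le> B" using assms by (auto simp: hardy_def)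
  ultimately show "integrable lborel (\<lambda>x. F x / ((of_real x - z) * (of_real x - w)))"
    using 1 by (intro integrable_cauchy_kernel_product) auto
qed

lemma hardy_bounded:
  assumes "hardy F" obtains B where "0 \<le> B" "\<And>x. norm (F x) \<le> B"
  using assms unfolding hardy_def by (meson norm_ge_zero order_trans)

lemma hardy_const: "hardy (\<lambda>_. c)"
proof (rule hardyI)
  fix z w assume zw: "Im z < 0" "Im w < 0"
  have "(LINT x|lborel. c / ((complex_of_real x - z) * (complex_of_real x - w)))
     = (LINT x|lborel. c * (1 / ((complex_of_real x - z) * (complex_of_real x - w))))" by simp
  also have "\<dots> = 0" using integral_cauchy_kernel_product[OF zw] by (simp only: integral_mult_right_zero mult_zero_right)
  finally show "(LINT x|lborel. c / ((complex_of_real x - z) * (complex_of_real x - w))) = 0" .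
qed auto

lemma hardy_add:
  assumes "hardy F" "hardy G"
  shows "hardy (\<lambda>x. F x + G x)"
proof -
  obtain B1 B2 where B: "\<And>x. norm (F x) \<le> B1" "\<And>x. norm (G x) \<le> B2"
    using hardy_bounded assms by metis
  note [measurable] = hardyD(1)[OF assms(1)] hardyD(1)[OF assms(2)]
  show ?thesis
  proof (rule hardyI)
    show "norm (F x + G x) \<le> B1 + B2" for x using B norm_triangle_mono by blast
    fix z w assume "Im z < 0" "Im w < 0"
    then show "(LINT x|lborel. (F x + G x) / ((of_real x - z) * (of_real x - w))) = 0"
      using hardyD[OF assms(1)] hardyD[OF assms(2)] by (simp add: add_divide_distrib)
  qed simp
qed

lemma hardy_cmult:
  assumes "hardy F" shows "hardy (\<lambda>x. c * F x)"
proof -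
  obtain B where B: "\<And>x. norm (F x) \<le> B" using hardy_bounded assms by metis
  note [measurable] = hardyD(1)[OF assms(1)]
  show ?thesis
  proof (rule hardyI)
    show "norm (c * F x) \<le> norm c * B" for x using B by (simp add: norm_mult mult_left_mono)
    fix z w assume "Im z < 0" "Im w < 0"
    then show "(LINT x|lborel. (c * F x) / ((of_real x - z) * (of_real x - w))) = 0"
      using hardyD(2)[OF assms] by (simp add: times_divide_eq_right[symmetric] del: times_divide_eq_right)
  qed simp
qed

lemma hardy_diff:
  assumes "hardy F" "hardy G" shows "hardy (\<lambda>x. F x - G x)"
  using hardy_add[OF assms(1) hardy_cmult[OF assms(2), of "-1"]] by simp

lemma hardy_sum:
  assumes "\<And>i. i \<in> I \<Longrightarrow> hardy (F i)"
  shows "hardy (\<lambda>x. \<Sum>i\<in>I. F i x)"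
  using assms
proof (induction I rule: infinite_finite_induct)
  case (insert i I)
  then have "hardy (\<lambda>x. F i x + (\<Sum>i\<in>I. F i x))" by (intro hardy_add) auto
  then show ?case using insert.hyps by simp
qed (simp_all add: hardy_const)

lemma hardy_shift:
  assumes "hardy F" shows "hardy (\<lambda>x. F (x + t))"
proof -
  obtain B where B: "\<And>x. norm (F x) \<le> B" using hardy_bounded assms by metis
  note [measurable] = hardyD(1)[OF assms(1)]
  show ?thesis
  proof (rule hardyI)
    fix z w assume zw: "Im z < 0" "Im w < 0"
    have "(LINT x|lborel. F (x + t) / ((of_real x - z) * (of_real x - w)))
      = (LINT x|lborel. F (x + t) / ((of_real (x + t) - (z + t)) * (of_real (x + t) - (w + t))))" by simp
    also have "\<dots> = 0" using zw hardyD(2)[OF assms] by (subst lborel_integral_shift) simp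
    finally show "(LINT x|lborel. F (x + t) / ((of_real x - z) * (of_real x - w))) = 0" .
  qed (use B in auto)
qed

lemma Im_inversion_neg: "0 < \<beta> \<Longrightarrow> Im z < 0 \<Longrightarrow> Im (- of_real \<beta> / z) < 0"
proof -
  assume "0 < \<beta>" "Im z < 0"
  then have "0 < (Re z)\<^sup>2 + (Im z)\<^sup>2" by (simp add: add_nonneg_pos)
  moreover have "Im (- of_real \<beta> / z) = \<beta> * Im z / ((Re z)\<^sup>2 + (Im z)\<^sup>2)"
    by (simp add: Im_divide)
  ultimately show ?thesis using \<open>0 < \<beta>\<close> \<open>Im z < 0\<close> by (simp add: mult_pos_neg divide_neg_pos)
qed

text \<open>The substitution sends the pair of poles z, w to -\<beta> / z, -\<beta> / w, again in
  the lower half-plane. Each Cauchy kernel produces a factor x, and the Jacobian \<beta> / x^2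
  cancels exactly two of them; this fixes the number of kernels in \<open>hardy\<close>.\<close>

lemma hardy_inversion:
  assumes \<beta>: "0 < \<beta>" and "hardy F" shows "hardy (\<lambda>x. F (- \<beta> / x))"
proof -
  obtain B where B: "\<And>x. norm (F x) \<le> B" using hardy_bounded assms by metis
  note [measurable] = hardyD(1)[OF assms(2)]
  show ?thesis
  proof (rule hardyI)
    fix z w assume zw: "Im z < 0" "Im w < 0"
    define f where "f x = 1 / ((of_real x - z) * (of_real x - w))" for x :: real
    define z' where "z' = - of_real \<beta> / z"
    define w' where "w' = - of_real \<beta> / w"
    have nz: "z \<noteq> 0" "w \<noteq> 0" using zw by auto
    have zw': "Im z' < 0" "Im w' < 0" unfolding z'_def w'_def using zw \<beta> Im_inversion_neg by auto
    have "integrable lborel (\<lambda>x. F (- \<beta> / x) / ((of_real x - z) * (of_real x - w)))"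
      using zw B by (intro integrable_cauchy_kernel_product[where B=B]) auto
    then have i: "integrable lborel (\<lambda>x. F (- \<beta> / x) * f x)" by (simp add: f_def)
    have key: "J_fun \<beta> f x = (of_real \<beta> / (z * w)) * (1 / ((of_real x - z') * (of_real x - w')))" if "x \<noteq> 0" for x
    proof -
      define X where "X = complex_of_real x"
      have X: "X \<noteq> 0" using that by (simp add: X_def)
      have e1: "- of_real \<beta> / X - z = - (z / X) * (X - z')" "- of_real \<beta> / X - w = - (w / X) * (X - w')"
        using X nz by (simp_all add: z'_def w'_def field_simps)
      have "J_fun \<beta> f x = of_real \<beta> / X\<^sup>2 * (1 / ((- of_real \<beta> / X - z) * (- of_real \<beta> / X - w)))"
        by (simp add: J_fun_def f_def X_def)
      also have "\<dots> = of_real \<beta> / X\<^sup>2 * (1 / ((- (z / X) * (X - z')) * (- (w / X) * (X - w'))))"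
        unfolding e1 ..
      also have "\<dots> = (of_real \<beta> / (z * w)) * (1 / ((X - z') * (X - w')))"
        using X by (simp add: power2_eq_square)
      finally show ?thesis unfolding X_def .
    qed
    have "(LINT x|lborel. F (- \<beta> / x) / ((of_real x - z) * (of_real x - w))) = (LINT x|lborel. F (- \<beta> / x) * f x)"
      by (simp add: f_def)
    also have "\<dots> = (LINT x|lborel. F x * J_fun \<beta> f x)" using J_fun_pairing(1)[OF \<beta> i] by simp
    also have "\<dots> = (LINT x|lborel. (of_real \<beta> / (z * w)) * (F x / ((of_real x - z') * (of_real x - w'))))"
    proof (rule integral_cong_AE)
      show "(\<lambda>x. F x * J_fun \<beta> f x) \<in> borel_measurable lborel"
        using J_fun_pairing(2)[OF \<beta> i] by (rule borel_measurable_integrable)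
      show "AE x in lborel. F x * J_fun \<beta> f x = (of_real \<beta> / (z * w)) * (F x / ((of_real x - z') * (of_real x - w')))"
        using AE_lborel_singleton[of 0] by eventually_elim (simp add: key)
    qed simp
    also have "\<dots> = 0" using hardyD(2)[OF assms(2) zw'] by (simp only: integral_mult_right_zero mult_zero_right)
    finally show "(LINT x|lborel. F (- \<beta> / x) / ((of_real x - z) * (of_real x - w))) = 0" .
  qed (use B in auto)
qed

lemma hardy_triple_distinct:
  assumes F: "hardy F" and z: "Im z < 0" and w: "Im w < 0" and v: "Im v < 0" and "v \<noteq> z"
  shows "(LINT x|lborel. F x * (1 / (of_real x - v)) / ((of_real x - z) * (of_real x - w))) = 0"
proof -
  have nz: "of_real x - z \<noteq> 0" "of_real x - w \<noteq> 0" "of_real x - v \<noteq> 0" for x :: real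
    using z w v by auto
  have pf: "f * (1 / a) / (b * c) = (f / (a * c) - f / (b * c)) / (b - a)"
    if "a \<noteq> 0" "b \<noteq> 0" "c \<noteq> 0" "a \<noteq> b" for a b c f :: complex
    using that by (simp add: divide_simps) (simp add: algebra_simps)
  have eq: "F x * (1 / (of_real x - v)) / ((of_real x - z) * (of_real x - w))
    = (F x / ((of_real x - v) * (of_real x - w)) - F x / ((of_real x - z) * (of_real x - w))) / (v - z)"
    for x :: real
    using pf[of "of_real x - v" "of_real x - z" "of_real x - w" "F x"] nz[of x] assms(5) by simp
  show ?thesis
    unfolding eq using hardyD(2,3)[OF F] z w v by simp
qed

text \<open>A third kernel is split off by partial fractions if its pole differs from z. The
  confluent case is a limit: the poles u n approach v from below, so all kernels stay bounded by 1 /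
  |Im v|.\<close>

lemma hardy_triple:
  assumes F: "hardy F" and z: "Im z < 0" and w: "Im w < 0" and v: "Im v < 0"
  shows "(LINT x|lborel. F x * (1 / (of_real x - v)) / ((of_real x - z) * (of_real x - w))) = 0"
proof (cases "v = z")
  case False
  then show ?thesis using hardy_triple_distinct[OF F z w v] by blast
next
  case True
  obtain B where B: "0 \<le> B" "\<And>x. norm (F x) \<le> B" using hardy_bounded F by metis
  note [measurable] = hardyD(1)[OF F]
  define u where "u n = v - \<i> * of_real (inverse (real (Suc n)))" for n
  have Im_u: "Im (u n) \<le> Im v" and u_neq: "u n \<noteq> v" for n by (auto simp: u_def simp del: of_nat_Suc)
  have u_lim: "u \<longlonglongrightarrow> v"
    using tendsto_diff[OF tendsto_const tendsto_mult[OF tendsto_const tendsto_of_real[OF LIMSEQ_inverse_real_of_nat]], of v \<i>]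
    by (simp add: u_def[abs_def] del: of_nat_Suc)
  have kb: "norm (F x * (1 / (of_real x - u n))) \<le> B / \<bar>Im v\<bar>" for x n
  proof -
    have "\<bar>Im v\<bar> \<le> \<bar>Im (u n)\<bar>" using Im_u[of n] v by simp
    also have "\<dots> \<le> norm (of_real x - u n)" using abs_Im_le_cmod[of "of_real x - u n"] by simp
    finally have "inverse (norm (of_real x - u n)) \<le> inverse \<bar>Im v\<bar>" using v by (intro le_imp_inverse_le) auto
    then have "norm (F x) * inverse (norm (of_real x - u n)) \<le> B * inverse \<bar>Im v\<bar>"
      using B by (intro mult_mono) auto
    then show ?thesis by (simp add: norm_mult norm_divide divide_inverse norm_inverse)
  qed
  have "(\<lambda>n. LINT x|lborel. F x * (1 / (of_real x - u n)) / ((of_real x - z) * (of_real x - w)))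
    \<longlonglongrightarrow> (LINT x|lborel. F x * (1 / (of_real x - v)) / ((of_real x - z) * (of_real x - w)))"
  proof (rule integral_dominated_convergence)
    show "integrable lborel (\<lambda>x. norm ((of_real (B / \<bar>Im v\<bar>)) / ((complex_of_real x - z) * (of_real x - w))))"
      using z w by (intro integrable_norm integrable_cauchy_kernel_product[where B="norm (complex_of_real (B / \<bar>Im v\<bar>))"]) auto
    show "AE x in lborel. (\<lambda>n. F x * (1 / (of_real x - u n)) / ((of_real x - z) * (of_real x - w)))
      \<longlonglongrightarrow> F x * (1 / (of_real x - v)) / ((of_real x - z) * (of_real x - w))"
      using complex_line_minus_nonzero[of z] complex_line_minus_nonzero[of w] complex_line_minus_nonzero[of v] z w v
      by (intro AE_I2 tendsto_intros u_lim) auto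
    show "AE x in lborel. norm (F x * (1 / (of_real x - u n)) / ((of_real x - z) * (of_real x - w)))
      \<le> norm ((of_real (B / \<bar>Im v\<bar>)) / ((complex_of_real x - z) * (of_real x - w)))" for n
    proof (rule AE_I2)
      fix x
      have "norm (F x * (1 / (of_real x - u n))) \<le> norm (complex_of_real (B / \<bar>Im v\<bar>))"
        using kb[of x n] B(1) by (simp add: norm_divide norm_of_real)
      then show "norm (F x * (1 / (of_real x - u n)) / ((of_real x - z) * (of_real x - w)))
        \<le> norm ((of_real (B / \<bar>Im v\<bar>)) / ((complex_of_real x - z) * (of_real x - w)))"
        unfolding norm_divide[of "_ * _"] norm_divide[of "of_real (B / \<bar>Im v\<bar>)"] by (intro divide_right_mono) auto
    qed
  qed measurable
  moreover have "(LINT x|lborel. F x * (1 / (of_real x - u n)) / ((of_real x - z) * (of_real x - w))) = 0" for n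
    using hardy_triple_distinct[OF F z w, of "u n"] Im_u[of n] u_neq[of n] v True by auto
  ultimately show ?thesis by (simp only: LIMSEQ_const_iff)
qed

lemma hardy_times_cauchy_kernel:
  assumes F: "hardy F" and v: "Im v < 0"
  shows "hardy (\<lambda>x. F x * (1 / (of_real x - v)))"
proof -
  obtain B where B: "0 \<le> B" "\<And>x. norm (F x) \<le> B" using hardy_bounded F by metis
  note [measurable] = hardyD(1)[OF F]
  obtain C where C: "0 < C" "\<And>x::real. norm (1 / (of_real x - v)) \<le> C / (1 + \<bar>x\<bar>)"
    using v cauchy_kernel_bound'[of v] by auto
  show ?thesis
  proof (rule hardyI)
    fix x
    have "norm (1 / (of_real x - v)) \<le> C"
      using order_trans[OF C(2)[of x]] C(1) by (simp add: field_simps)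
    then have "norm (F x) * norm (1 / (of_real x - v)) \<le> B * C" using B by (intro mult_mono) auto
    then show "norm (F x * (1 / (of_real x - v))) \<le> B * C" by (simp only: norm_mult)
  qed (use hardy_triple[OF F _ _ v] in auto)
qed

lemma hardy_times_cut:
  assumes "hardy F" shows "hardy (\<lambda>x. F x * cut n x)"
proof -
  let ?c = "\<i> * of_nat (Suc n)"
  have "F x * cut n x = ?c * (F x * (1 / (of_real x - (- ?c))))" for x
    unfolding cut_eq by (simp only: mult.left_commute mult_minus_left)
  moreover have "hardy (\<lambda>x. ?c * (F x * (1 / (of_real x - (- ?c)))))"
    by (rule hardy_cmult, rule hardy_times_cauchy_kernel[OF assms]) simp
  ultimately show ?thesis by presburger
qed

lemma hardy_limit:
  assumes G: "\<And>n. hardy (G n)" and F[measurable]: "F \<in> borel_measurable borel" and B: "\<And>x. norm (F x) \<le> B"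
    and C: "\<And>n x. norm (G n x) \<le> C * (1 + \<bar>x\<bar>)" and lim: "AE x in lborel. (\<lambda>n. G n x) \<longlonglongrightarrow> F x"
  shows "hardy F"
proof (rule hardyI[OF F B])
  fix z w assume z: "Im z < 0" and w: "Im w < 0"
  note [measurable] = hardyD(1)[OF G]
  have triple: "(LINT x|lborel. F x * (1 / (of_real x - v)) / ((of_real x - z) * (of_real x - w))) = 0" if v: "Im v < 0" for v
  proof -
    obtain D where D: "0 < D" "\<And>x::real. norm (1 / (of_real x - v)) \<le> D / (1 + \<bar>x\<bar>)"
      using v cauchy_kernel_bound'[of v] by auto
    have "0 \<le> C" using order_trans[OF norm_ge_zero C[of _ 0]] by simp
    have "(\<lambda>n. LINT x|lborel. G n x * (1 / (of_real x - v)) / ((of_real x - z) * (of_real x - w)))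
      \<longlonglongrightarrow> (LINT x|lborel. F x * (1 / (of_real x - v)) / ((of_real x - z) * (of_real x - w)))"
    proof (rule integral_dominated_convergence)
      show "integrable lborel (\<lambda>x. norm ((of_real (C * D)) / ((complex_of_real x - z) * (of_real x - w))))"
        using z w by (intro integrable_norm integrable_cauchy_kernel_product[where B="norm (complex_of_real (C * D))"]) auto
      show "AE x in lborel. (\<lambda>n. G n x * (1 / (of_real x - v)) / ((of_real x - z) * (of_real x - w)))
        \<longlonglongrightarrow> F x * (1 / (of_real x - v)) / ((of_real x - z) * (of_real x - w))"
        using lim by eventually_elim (use z w in \<open>intro tendsto_intros, auto\<close>)
      show "AE x in lborel. norm (G n x * (1 / (of_real x - v)) / ((of_real x - z) * (of_real x - w)))
        \<le> norm ((of_real (C * D)) / ((complex_of_real x - z) * (of_real x - w)))" for n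
      proof (rule AE_I2)
        fix x :: real
        have "norm (G n x) * norm (1 / (of_real x - v)) \<le> (C * (1 + \<bar>x\<bar>)) * (D / (1 + \<bar>x\<bar>))"
          using C D \<open>0 \<le> C\<close> by (intro mult_mono) auto
        also have "\<dots> = C * D"
        proof -
          have "1 + \<bar>x\<bar> \<noteq> 0" using abs_ge_zero[of x] by linarith
          then show ?thesis by simp
        qed
        also have "\<dots> = norm (complex_of_real (C * D))" using \<open>0 \<le> C\<close> D(1) by (simp only: norm_of_real) simp
        finally have "norm (G n x * (1 / (of_real x - v))) \<le> norm (complex_of_real (C * D))" by (simp only: norm_mult)
        then show "norm (G n x * (1 / (of_real x - v)) / ((of_real x - z) * (of_real x - w)))
          \<le> norm ((of_real (C * D)) / ((complex_of_real x - z) * (of_real x - w)))"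
          unfolding norm_divide[of "_ * _"] norm_divide[of "of_real (C * D)"] by (intro divide_right_mono) auto
      qed
    qed measurable
    then have "(\<lambda>n. 0) \<longlonglongrightarrow> (LINT x|lborel. F x * (1 / (of_real x - v)) / ((of_real x - z) * (of_real x - w)))"
      by (simp only: hardy_triple[OF G z w v])
    then show ?thesis by (simp only: LIMSEQ_const_iff)
  qed
  show "(LINT x|lborel. F x / ((of_real x - z) * (of_real x - w))) = 0"
  proof (rule integral_eq_0_if_cut)
    show "integrable lborel (\<lambda>x. F x / ((of_real x - z) * (of_real x - w)))"
      using z w B by (intro integrable_cauchy_kernel_product[where B=B]) auto
    fix n
    let ?v = "- \<i> * of_nat (Suc n)"
    have "(LINT x|lborel. F x / ((of_real x - z) * (of_real x - w)) * cut n x)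
      = (LINT x|lborel. (\<i> * of_nat (Suc n)) * (F x * (1 / (of_real x - ?v)) / ((of_real x - z) * (of_real x - w))))"
      unfolding cut_eq by (intro Bochner_Integration.integral_cong) (simp_all add: mult_ac del: of_nat_Suc)
    also have "\<dots> = 0" using triple[of ?v] by (simp only: integral_mult_right_zero) (simp del: of_nat_Suc)
    finally show "(LINT x|lborel. F x / ((of_real x - z) * (of_real x - w)) * cut n x) = 0" .
  qed
qed

text \<open>For a decaying F one kernel suffices: \<open>cut n\<close> is a multiple of a Cauchy
  kernel and serves as the second one until it is sent to 1.\<close>

lemma hardy_decay_cauchy:
  assumes F: "hardy F" and C: "\<And>x. norm (F x) \<le> C / (1 + \<bar>x\<bar>)" and v: "Im v < 0"
  shows "(LINT x|lborel. F x / (of_real x - v)) = 0"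
proof (rule integral_eq_0_if_cut)
  note [measurable] = hardyD(1)[OF F]
  obtain D where D: "0 < D" "\<And>x::real. norm (1 / (of_real x - v)) \<le> D / (1 + \<bar>x\<bar>)"
    using v cauchy_kernel_bound'[of v] by auto
  have "norm (F x / (of_real x - v)) \<le> (C * D) / (1 + \<bar>x\<bar>)\<^sup>2" for x
  proof -
    have "norm (F x / (of_real x - v)) = norm (F x) * norm (1 / (of_real x - v))" by (simp add: norm_mult norm_divide)
    also have "\<dots> \<le> (C / (1 + \<bar>x\<bar>)) * (D / (1 + \<bar>x\<bar>))"
      using C D order_trans[OF norm_ge_zero C] by (intro mult_mono) auto
    finally show ?thesis by (simp add: power2_eq_square)
  qed
  then show "integrable lborel (\<lambda>x. F x / (of_real x - v))" by (intro integrable_bound_inverse_square) auto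
  fix n
  let ?v = "- \<i> * of_nat (Suc n)"
  have "(LINT x|lborel. F x / (of_real x - v) * cut n x)
      = (LINT x|lborel. (\<i> * of_nat (Suc n)) * (F x / ((of_real x - v) * (of_real x - ?v))))"
    unfolding cut_eq by (intro Bochner_Integration.integral_cong) (simp_all add: mult_ac del: of_nat_Suc)
  also have "\<dots> = 0" using hardyD(2)[OF F v, of ?v] by (simp only: integral_mult_right_zero) (simp del: of_nat_Suc)
  finally show "(LINT x|lborel. F x / (of_real x - v) * cut n x) = 0" .
qed

subsection \<open>The Hilbert transform of Lipschitz functions\<close>

text \<open>Limits along \<open>at a within S\<close> are sequential, which reduces this to
  dominated convergence for sequences. It serves both the principal values, with S a right
  half-line, and difference quotients in a parameter.\<close>

lemma integral_dominated_convergence_within: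
  fixes s :: "real \<Rightarrow> 'a \<Rightarrow> complex"
  assumes [measurable]: "\<And>y. s y \<in> borel_measurable M" "f \<in> borel_measurable M"
    and w: "integrable M w" and bound: "\<And>y. y \<in> S \<Longrightarrow> AE x in M. norm (s y x) \<le> w x"
    and lim: "AE x in M. ((\<lambda>y. s y x) \<longlongrightarrow> f x) (at a within S)"
  shows "((\<lambda>y. LINT x|M. s y x) \<longlongrightarrow> (LINT x|M. f x)) (at a within S)"
  unfolding tendsto_at_iff_sequentially o_def
proof (intro allI impI)
  fix X :: "nat \<Rightarrow> real"
  assume X: "\<forall>i. X i \<in> S - {a}" "X \<longlonglongrightarrow> a"
  show "(\<lambda>n. LINT x|M. s (X n) x) \<longlonglongrightarrow> (LINT x|M. f x)"
  proof (rule integral_dominated_convergence[where w=w])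
    show "AE x in M. (\<lambda>n. s (X n) x) \<longlonglongrightarrow> f x"
      using lim by eventually_elim (use X in \<open>auto simp: tendsto_at_iff_sequentially o_def\<close>)
    show "AE x in M. norm (s (X n) x) \<le> w x" for n using bound X by blast
  qed (use w in auto)
qed

text \<open>If f is not integrable its integral is 0 by convention, so the bound holds in that case
  too and only the majorant has to be examined.\<close>

lemma norm_integral_le:
  fixes f :: "'a \<Rightarrow> complex"
  assumes g: "integrable M g" and le: "\<And>x. norm (f x) \<le> g x"
  shows "norm (LINT x|M. f x) \<le> (LINT x|M. g x)"
proof (cases "integrable M f")
  case True
  then have "(LINT x|M. norm (f x)) \<le> (LINT x|M. g x)" using g le by (intro integral_mono) auto
  then show ?thesis using integral_norm_bound[of M f] by linarith
next
  case False
  then show ?thesis using Bochner_Integration.integral_nonneg[of M g] order_trans[OF norm_ge_zero le]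
    by (simp add: not_integrable_integral_eq)
qed

lemma integrable_product_bound:
  fixes f :: "real \<times> real \<Rightarrow> complex" and g h :: "real \<Rightarrow> real"
  assumes f: "f \<in> borel_measurable (lborel \<Otimes>\<^sub>M lborel)"
    and g: "integrable lborel g" and h: "integrable lborel h"
    and le: "\<And>x t. norm (f (x, t)) \<le> g x * h t"
  shows "integrable (lborel \<Otimes>\<^sub>M lborel) f"
proof -
  note [measurable] = borel_measurable_integrable[OF g] borel_measurable_integrable[OF h]
  have "integrable (lborel \<Otimes>\<^sub>M lborel) (\<lambda>(x, t). g x * h t)"
  proof (rule lborel_pair.Fubini_integrable)
    show "integrable lborel (\<lambda>x. LINT t|lborel. norm (case (x, t) of (x, t) \<Rightarrow> g x * h t))"
      using g by (simp add: abs_mult)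
    show "AE x in lborel. integrable lborel (\<lambda>t. case (x, t) of (x, t) \<Rightarrow> g x * h t)"
      using h by simp
  qed measurable
  then show ?thesis
    by (rule Bochner_Integration.integrable_bound) (use f le in \<open>auto intro!: AE_I2 order_trans[OF le]\<close>)
qed

lemma Fubini_product_bound:
  fixes f :: "real \<Rightarrow> real \<Rightarrow> complex" and g h :: "real \<Rightarrow> real"
  assumes f: "(\<lambda>(x, t). f x t) \<in> borel_measurable (lborel \<Otimes>\<^sub>M lborel)"
    and g: "integrable lborel g" and h: "integrable lborel h"
    and le: "\<And>x t. norm (f x t) \<le> g x * h t"
  shows "(LINT x|lborel. LINT t|lborel. f x t) = (LINT t|lborel. LINT x|lborel. f x t)"
    and "integrable lborel (\<lambda>x. LINT t|lborel. f x t)"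
    and "integrable lborel (\<lambda>t. LINT x|lborel. f x t)"
proof -
  have *: "integrable (lborel \<Otimes>\<^sub>M lborel) (\<lambda>(x, t). f x t)"
    using integrable_product_bound[OF f g h] le by simp
  show "(LINT x|lborel. LINT t|lborel. f x t) = (LINT t|lborel. LINT x|lborel. f x t)"
    using lborel_pair.Fubini_integral[OF *] by simp
  show "integrable lborel (\<lambda>x. LINT t|lborel. f x t)"
    using lborel_pair.integrable_fst'[OF *] by simp
  show "integrable lborel (\<lambda>t. LINT x|lborel. f x t)"
    using lborel_pair.integrable_snd[OF *] by simp
qed

lemma lborel_integral_reflect:
  fixes f :: "real \<Rightarrow> complex"
  shows "(LINT t|lborel. f t) = (LINT s|lborel. f (x - s))"
  using lborel_integral_real_affine[of "-1" f x] by simp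

lemma lborel_integrable_reflect:
  fixes f :: "real \<Rightarrow> complex"
  shows "integrable lborel f \<Longrightarrow> integrable lborel (\<lambda>s. f (x - s))"
  using lborel_integrable_real_affine[of f "-1" x] by simp

lemma integrable_bounded_support:
  fixes f :: "real \<Rightarrow> complex"
  assumes [measurable]: "f \<in> borel_measurable borel" and B: "\<And>x. norm (f x) \<le> B"
    and R: "\<And>x. R < \<bar>x\<bar> \<Longrightarrow> f x = 0"
  shows "integrable lborel f" "norm (LINT x|lborel. f x) \<le> B * (2 * \<bar>R\<bar>)"
    "(LINT x|lborel. norm (f x)) \<le> B * (2 * \<bar>R\<bar>)"
proof -
  have i: "integrable lborel (\<lambda>x. B * indicat_real {-\<bar>R\<bar>..\<bar>R\<bar>} x)"
    by (intro integrable_mult_right integrable_real_indicator) auto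
  have le: "norm (f x) \<le> B * indicat_real {-\<bar>R\<bar>..\<bar>R\<bar>} x" for x
    using B[of x] R[of x] by (cases "\<bar>x\<bar> \<le> \<bar>R\<bar>") (auto simp: indicator_def)
  show fi: "integrable lborel f"
    by (rule Bochner_Integration.integrable_bound[OF i]) (auto intro!: AE_I2 order_trans[OF le])
  have "(LINT x|lborel. norm (f x)) \<le> (LINT x|lborel. B * indicat_real {-\<bar>R\<bar>..\<bar>R\<bar>} x)"
    using fi i le by (intro integral_mono) auto
  also have "\<dots> = B * (2 * \<bar>R\<bar>)" by simp
  finally show *: "(LINT x|lborel. norm (f x)) \<le> B * (2 * \<bar>R\<bar>)" .
  show "norm (LINT x|lborel. f x) \<le> B * (2 * \<bar>R\<bar>)"
    using integral_norm_bound[of lborel f] * by linarith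
qed

text \<open>Average the integral with its reflection. For Lipschitz \<phi> the difference vanishes
  to first order at s = 0 and can absorb a simple pole of k.\<close>

lemma antisymmetrize:
  fixes \<phi> :: "real \<Rightarrow> complex" and k :: "real \<Rightarrow> real"
  assumes k: "k \<in> borel_measurable borel" and i: "integrable lborel (\<lambda>s. \<phi> (x - s) * of_real (k s))"
    and odd: "\<And>s. k (- s) = - k s"
  shows "(LINT s|lborel. \<phi> (x - s) * of_real (k s)) = (LINT s|lborel. (\<phi> (x - s) - \<phi> (x + s)) * of_real (k s)) / 2"
proof -
  let ?I = "LINT s|lborel. \<phi> (x - s) * of_real (k s)"
  have "?I = (LINT s|lborel. \<phi> (x + s) * of_real (k (- s)))"
    using lborel_integral_reflect[of "\<lambda>s. \<phi> (x - s) * of_real (k s)" 0] by simp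
  then have e: "?I = - (LINT s|lborel. \<phi> (x + s) * of_real (k s))" by (simp add: odd)
  have i': "integrable lborel (\<lambda>s. \<phi> (x + s) * of_real (k s))"
    using lborel_integrable_reflect[OF i, of 0] by (simp add: odd)
  have "(LINT s|lborel. (\<phi> (x - s) - \<phi> (x + s)) * of_real (k s)) = ?I + ?I"
    using i i' e by (simp add: left_diff_distrib)
  then show ?thesis by simp
qed

text \<open>All constants below are explicit in M and L, so the bounds for the extension to the
  upper half-plane are uniform in the height y.\<close>

locale compact_lipschitz =
  fixes \<phi> :: "real \<Rightarrow> complex" and M L :: real
  assumes M: "0 < M" and supp: "\<And>x. M \<le> \<bar>x\<bar> \<Longrightarrow> \<phi> x = 0"
    and lip: "\<And>x y. norm (\<phi> x - \<phi> y) \<le> L * \<bar>x - y\<bar>"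
begin

lemma L: "0 \<le> L"
  using order_trans[OF norm_ge_zero lip[of 1 0]] by simp

lemma cont: "continuous_on UNIV \<phi>"
  by (rule lipschitz_on_continuous_on[of L]) (use lip L in \<open>auto simp: lipschitz_on_def dist_norm\<close>)

lemma measurable [measurable]: "\<phi> \<in> borel_measurable borel"
  using cont by (rule borel_measurable_continuous_onI)

text \<open>A bound for |\<phi>|: \<phi> vanishes at M, and no point of the support is farther than
  2 M from there.\<close>

definition B :: real where "B = 2 * L * M"

lemma B: "0 \<le> B" "norm (\<phi> x) \<le> B"
proof -
  show "0 \<le> B" using L M by (simp add: B_def)
  show "norm (\<phi> x) \<le> B"
  proof (cases "M \<le> \<bar>x\<bar>")
    case False
    have "norm (\<phi> x) = norm (\<phi> x - \<phi> M)" using supp[of M] M by simp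
    also have "\<dots> \<le> L * \<bar>x - M\<bar>" by (rule lip)
    also have "\<dots> \<le> L * (2 * M)" using False L M by (intro mult_left_mono) auto
    finally show ?thesis by (simp add: B_def)
  qed (use \<open>0 \<le> B\<close> supp in simp)
qed

lemma integrable: "integrable lborel \<phi>"
  by (rule integrable_bounded_support[of _ B M]) (use B supp in auto)

definition diff_quot :: "real \<Rightarrow> real \<Rightarrow> complex" where
  "diff_quot x s = (\<phi> (x - s) - \<phi> (x + s)) / of_real s"

lemma diff_quot_measurable [measurable]: "(\<lambda>s. diff_quot x s) \<in> borel_measurable borel"
  unfolding diff_quot_def by measurable

lemma diff_quot_bound: "norm (diff_quot x s) \<le> 2 * L"
proof (cases "s = 0")
  case False
  have "norm (\<phi> (x - s) - \<phi> (x + s)) \<le> 2 * L * \<bar>s\<bar>" using lip[of "x - s" "x + s"] by (simp add: abs_mult)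
  then show ?thesis using False by (simp add: diff_quot_def norm_divide field_simps)
qed (use L in \<open>simp add: diff_quot_def\<close>)

lemma diff_quot_supp: "\<bar>x\<bar> + M < \<bar>s\<bar> \<Longrightarrow> diff_quot x s = 0"
  using supp[of "x - s"] supp[of "x + s"] by (simp add: diff_quot_def)

lemma diff_quot_integrable: "integrable lborel (diff_quot x)"
  by (rule integrable_bounded_support[of _ "2 * L" "\<bar>x\<bar> + M"]) (use diff_quot_bound diff_quot_supp in auto)

lemma diff_quot_norm_integral: "(LINT s|lborel. norm (diff_quot x s)) \<le> 2 * L * (2 * \<bar>\<bar>x\<bar> + M\<bar>)"
  by (rule integrable_bounded_support) (use diff_quot_bound diff_quot_supp in auto)

text \<open>The principal value as an absolutely convergent integral, by antisymmetrization about \<open>x\<close>.\<close>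

definition hilbert_int :: "real \<Rightarrow> complex" where
  "hilbert_int x = of_real (1 / (2 * pi)) * (LINT s|lborel. diff_quot x s)"

lemma truncated:
  assumes "0 < \<epsilon>"
  shows "(LINT t:{t. \<bar>x - t\<bar> > \<epsilon>}|lborel. \<phi> t / of_real (x - t))
    = (LINT s|lborel. indicat_real {s. \<epsilon> < \<bar>s\<bar>} s *\<^sub>R diff_quot x s) / 2"
proof -
  let ?k = "\<lambda>s. indicat_real {s. \<epsilon> < \<bar>s\<bar>} s / s"
  have k: "?k \<in> borel_measurable borel" by measurable
  have i: "integrable lborel (\<lambda>s. \<phi> (x - s) * of_real (?k s))"
  proof (rule integrable_bounded_support)
    show "norm (\<phi> (x - s) * of_real (?k s)) \<le> B * (1 / \<epsilon>)" for s
    proof -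
      have "\<bar>?k s\<bar> \<le> 1 / \<epsilon>" using assms by (auto simp: indicator_def frac_le)
      then show ?thesis unfolding norm_mult norm_of_real using B by (intro mult_mono) auto
    qed
    show "\<phi> (x - s) * of_real (?k s) = 0" if "\<bar>x\<bar> + M < \<bar>s\<bar>" for s using that supp[of "x - s"] by simp
  qed (use k in measurable)
  have "(LINT t:{t. \<bar>x - t\<bar> > \<epsilon>}|lborel. \<phi> t / of_real (x - t)) = (LINT s|lborel. \<phi> (x - s) * of_real (?k s))"
    unfolding set_lebesgue_integral_def
    by (subst lborel_integral_reflect[of _ x]) (auto intro!: Bochner_Integration.integral_cong simp: indicator_def)
  also have "\<dots> = (LINT s|lborel. (\<phi> (x - s) - \<phi> (x + s)) * of_real (?k s)) / 2"
    by (rule antisymmetrize[OF k i]) (simp add: indicator_def)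
  also have "(LINT s|lborel. (\<phi> (x - s) - \<phi> (x + s)) * of_real (?k s)) = (LINT s|lborel. indicat_real {s. \<epsilon> < \<bar>s\<bar>} s *\<^sub>R diff_quot x s)"
    by (intro Bochner_Integration.integral_cong) (auto simp: indicator_def diff_quot_def)
  finally show ?thesis .
qed

lemma truncated_tendsto:
  "((\<lambda>\<epsilon>. LINT t:{t. \<bar>x - t\<bar> > \<epsilon>}|lborel. \<phi> t / of_real (x - t)) \<longlongrightarrow> (LINT s|lborel. diff_quot x s) / 2) (at_right 0)"
proof -
  have "((\<lambda>\<epsilon>. LINT s|lborel. indicat_real {s. \<epsilon> < \<bar>s\<bar>} s *\<^sub>R diff_quot x s) \<longlongrightarrow> (LINT s|lborel. diff_quot x s)) (at_right 0)"
  proof (rule integral_dominated_convergence_within)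
    show "integrable lborel (\<lambda>s. norm (diff_quot x s))" using diff_quot_integrable by simp
    show "AE s in lborel. ((\<lambda>\<epsilon>. indicat_real {s. \<epsilon> < \<bar>s\<bar>} s *\<^sub>R diff_quot x s) \<longlongrightarrow> diff_quot x s) (at_right 0)"
    proof (rule AE_I2)
      fix s :: real
      show "((\<lambda>\<epsilon>. indicat_real {s. \<epsilon> < \<bar>s\<bar>} s *\<^sub>R diff_quot x s) \<longlongrightarrow> diff_quot x s) (at_right 0)"
      proof (cases "s = 0")
        case False
        then have "eventually (\<lambda>\<epsilon>. \<epsilon> \<in> {0<..<\<bar>s\<bar>}) (at_right 0)" by (intro eventually_at_right_real) auto
        then have "eventually (\<lambda>\<epsilon>. indicat_real {s. \<epsilon> < \<bar>s\<bar>} s *\<^sub>R diff_quot x s = diff_quot x s) (at_right 0)"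
          by eventually_elim (auto simp: indicator_def)
        then show ?thesis by (rule tendsto_eventually)
      qed (simp add: diff_quot_def)
    qed
  qed (auto simp: indicator_def)
  then have "((\<lambda>\<epsilon>. (LINT s|lborel. indicat_real {s. \<epsilon> < \<bar>s\<bar>} s *\<^sub>R diff_quot x s) / 2) \<longlongrightarrow> (LINT s|lborel. diff_quot x s) / 2) (at_right 0)"
    by (intro tendsto_intros) auto
  moreover have "eventually (\<lambda>\<epsilon>. (LINT s|lborel. indicat_real {s. \<epsilon> < \<bar>s\<bar>} s *\<^sub>R diff_quot x s) / 2
      = (LINT t:{t. \<bar>x - t\<bar> > \<epsilon>}|lborel. \<phi> t / of_real (x - t))) (at_right 0)"
    using eventually_at_right_less[of 0] by eventually_elim (rule truncated[symmetric])
  ultimately show ?thesis by (rule Lim_transform_eventually)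
qed

lemma hilbert_eq: "hilbert \<phi> x = hilbert_int x"
proof -
  have "Lim (at_right 0) (\<lambda>\<epsilon>. LINT t:{t. \<bar>x - t\<bar> > \<epsilon>}|lborel. \<phi> t / of_real (x - t)) = (LINT s|lborel. diff_quot x s) / 2"
    by (rule tendsto_Lim[OF _ truncated_tendsto]) simp
  then show ?thesis unfolding hilbert_def hilbert_int_def by (simp only:) simp
qed

text \<open>Once \<epsilon> < \<delta>, the removed neighbourhood of x misses the support, so the
  truncated integral no longer depends on \<epsilon>.\<close>

lemma hilbert_off_support:
  assumes "0 < \<delta>" "\<And>t. \<phi> t \<noteq> 0 \<Longrightarrow> \<delta> \<le> \<bar>x - t\<bar>"
  shows "hilbert_int x = of_real (1 / pi) * (LINT t|lborel. \<phi> t / of_real (x - t))"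
proof -
  have "eventually (\<lambda>\<epsilon>. \<epsilon> \<in> {0<..<\<delta>}) (at_right 0)" using assms(1) by (intro eventually_at_right_real) auto
  then have "eventually (\<lambda>\<epsilon>. (LINT t:{t. \<bar>x - t\<bar> > \<epsilon>}|lborel. \<phi> t / of_real (x - t)) = (LINT t|lborel. \<phi> t / of_real (x - t))) (at_right 0)"
  proof eventually_elim
    case (elim \<epsilon>)
    show ?case unfolding set_lebesgue_integral_def
      using assms(2) elim by (intro Bochner_Integration.integral_cong) (force simp: indicator_def)+
  qed
  then have "((\<lambda>\<epsilon>. LINT t:{t. \<bar>x - t\<bar> > \<epsilon>}|lborel. \<phi> t / of_real (x - t)) \<longlongrightarrow> (LINT t|lborel. \<phi> t / of_real (x - t))) (at_right 0)"
    by (rule tendsto_eventually)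
  from tendsto_unique[OF _ this truncated_tendsto[of x]]
  have "(LINT t|lborel. \<phi> t / of_real (x - t)) = (LINT s|lborel. diff_quot x s) / 2" by simp
  then show ?thesis unfolding hilbert_int_def by (simp only:) simp
qed

text \<open>The value y = 0 is included, so that one estimate controls the tail of the Hilbert
  transform as well as that of its holomorphic extension.\<close>

lemma far_bound:
  assumes "2 * M \<le> \<bar>x\<bar>" "0 \<le> y"
  shows "norm (LINT t|lborel. \<phi> t / (of_real (x - t) + \<i> * of_real y)) \<le> (B * (2 * \<bar>M\<bar>)) * (2 / \<bar>x\<bar>)"
proof -
  have le: "norm (\<phi> t / (of_real (x - t) + \<i> * of_real y)) \<le> norm (\<phi> t) * (2 / \<bar>x\<bar>)" for t
  proof (cases "M \<le> \<bar>t\<bar>")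
    case False
    have "\<bar>x\<bar> / 2 \<le> \<bar>x - t\<bar>" using assms False by linarith
    also have "\<dots> \<le> norm (of_real (x - t) + \<i> * of_real y)"
      using abs_Re_le_cmod[of "of_real (x - t) + \<i> * of_real y"] by simp
    finally have "\<bar>x\<bar> / 2 \<le> norm (of_real (x - t) + \<i> * of_real y)" .
    then have "inverse (norm (of_real (x - t) + \<i> * of_real y)) \<le> inverse (\<bar>x\<bar> / 2)"
      using assms M by (intro le_imp_inverse_le) auto
    then have "norm (\<phi> t) * inverse (norm (of_real (x - t) + \<i> * of_real y)) \<le> norm (\<phi> t) * inverse (\<bar>x\<bar> / 2)"
      by (intro mult_left_mono) auto
    moreover have "norm (\<phi> t / (of_real (x - t) + \<i> * of_real y)) = norm (\<phi> t) * inverse (norm (of_real (x - t) + \<i> * of_real y))"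
      by (simp only: norm_divide divide_inverse[of "norm _"])
    moreover have "inverse (\<bar>x\<bar> / 2) = 2 / \<bar>x\<bar>" by simp
    ultimately show ?thesis by (simp only:)
  qed (simp add: supp)
  have i: "integrable lborel (\<lambda>t. norm (\<phi> t) * (2 / \<bar>x\<bar>))" using integrable by simp
  have "norm (LINT t|lborel. \<phi> t / (of_real (x - t) + \<i> * of_real y)) \<le> (LINT t|lborel. norm (\<phi> t) * (2 / \<bar>x\<bar>))"
    by (rule norm_integral_le[OF i le])
  also have "\<dots> = (LINT t|lborel. norm (\<phi> t)) * (2 / \<bar>x\<bar>)" by simp
  also have "\<dots> \<le> (B * (2 * \<bar>M\<bar>)) * (2 / \<bar>x\<bar>)"
    using integrable_bounded_support(3)[of \<phi> B M] B supp by (intro mult_right_mono) auto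
  finally show ?thesis .
qed

text \<open>The holomorphic extension of \<open>\<phi> + \<i> H \<phi>\<close> to the upper half-plane, on the line of height \<open>y\<close>.\<close>

definition cauchy_ext :: "real \<Rightarrow> real \<Rightarrow> complex" where
  "cauchy_ext y x = (\<i> / of_real pi) * (LINT t|lborel. \<phi> t / (of_real (x - t) + \<i> * of_real y))"

text \<open>The first summand treats |x| \<ge> 2 M, where (1 + |x|) / |x| \<le> 1 + 1 / (2 M); the
  second treats |x| < 2 M, where 1 + |x| \<le> 1 + 2 M. There B bounds the Poisson part, and 6 M is
  the length bound for the support of the difference quotient, from |x| + M < 3 M.\<close>

definition hilbert_const :: real where
  "hilbert_const = (B * (2 * \<bar>M\<bar>)) * 2 * (1 + 1 / (2 * M)) + (B + L * (6 * M)) * (1 + 2 * M)"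

text \<open>The Cauchy kernel splits into the Poisson and the conjugate Poisson kernel. The first is
  rescaled by s = y r, so that it becomes an approximate identity with a fixed majorant; the second
  is odd and is antisymmetrized, which leaves the factor s^2 / (s^2 + y^2) \<le> 1.\<close>

lemma cauchy_ext_split:
  assumes y: "0 < y"
  shows "cauchy_ext y x = (LINT r|lborel. \<phi> (x - y * r) / of_real (1 + r\<^sup>2)) / of_real pi
     + \<i> * of_real (1 / (2 * pi)) * (LINT s|lborel. diff_quot x s * of_real (s\<^sup>2 / (s\<^sup>2 + y\<^sup>2)))"
proof -
  let ?P = "\<lambda>s. y / (s\<^sup>2 + y\<^sup>2)" and ?Q = "\<lambda>s. s / (s\<^sup>2 + y\<^sup>2)"
  have pos: "0 < s\<^sup>2 + y\<^sup>2" for s using y by (simp add: add_nonneg_pos)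
  have bP: "\<bar>?P s\<bar> \<le> 1 / y" for s
  proof -
    have "y * y \<le> s\<^sup>2 + y\<^sup>2" by (simp add: power2_eq_square)
    then show ?thesis using y pos[of s] by (simp add: field_simps)
  qed
  have bQ: "\<bar>?Q s\<bar> \<le> 1 / y" for s
  proof -
    have "0 \<le> (\<bar>s\<bar> - y)\<^sup>2" by simp
    then have "2 * (\<bar>s\<bar> * y) \<le> s\<^sup>2 + y\<^sup>2" by (simp add: power2_diff)
    moreover have "0 \<le> \<bar>s\<bar> * y" using y by simp
    ultimately have "\<bar>s\<bar> * y \<le> s\<^sup>2 + y\<^sup>2" by linarith
    then show ?thesis using y pos[of s] by (simp add: field_simps)
  qed
  have int: "integrable lborel (\<lambda>s. \<phi> (x - s) * of_real (k s))"
    if [measurable]: "k \<in> borel_measurable borel" and k: "\<And>s. \<bar>k s\<bar> \<le> 1 / y" for k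
  proof (rule integrable_bounded_support)
    show "norm (\<phi> (x - s) * of_real (k s)) \<le> B * (1 / y)" for s
      unfolding norm_mult norm_of_real using k B by (intro mult_mono) auto
    show "\<phi> (x - s) * of_real (k s) = 0" if "\<bar>x\<bar> + M < \<bar>s\<bar>" for s using that supp[of "x - s"] by simp
  qed measurable
  have iP: "integrable lborel (\<lambda>s. \<phi> (x - s) * of_real (?P s))" by (rule int) (use bP in auto)
  have iQ: "integrable lborel (\<lambda>s. \<phi> (x - s) * of_real (?Q s))" by (rule int) (use bQ in auto)
  have residual_ker: "1 / (of_real s + \<i> * of_real y) = of_real (?Q s) - \<i> * of_real (?P s)" for s
    using pos[of s] by (simp add: complex_eq_iff Re_divide Im_divide power2_eq_square)
  have "(LINT t|lborel. \<phi> t / (of_real (x - t) + \<i> * of_real y))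
      = (LINT s|lborel. \<phi> (x - s) * (1 / (of_real s + \<i> * of_real y)))"
    by (subst lborel_integral_reflect[of _ x]) simp
  also have "\<dots> = (LINT s|lborel. \<phi> (x - s) * of_real (?Q s) - \<i> * (\<phi> (x - s) * of_real (?P s)))"
    unfolding residual_ker by (intro Bochner_Integration.integral_cong) (simp_all add: algebra_simps)
  also have "\<dots> = (LINT s|lborel. \<phi> (x - s) * of_real (?Q s)) - \<i> * (LINT s|lborel. \<phi> (x - s) * of_real (?P s))"
    using iP iQ by (subst Bochner_Integration.integral_diff) (simp_all del: of_real_divide)
  finally have 1: "(LINT t|lborel. \<phi> t / (of_real (x - t) + \<i> * of_real y))
    = (LINT s|lborel. \<phi> (x - s) * of_real (?Q s)) - \<i> * (LINT s|lborel. \<phi> (x - s) * of_real (?P s))" .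
  have 2: "(LINT s|lborel. \<phi> (x - s) * of_real (?Q s)) = (LINT s|lborel. diff_quot x s * of_real (s\<^sup>2 / (s\<^sup>2 + y\<^sup>2))) / 2"
  proof -
    have "(\<phi> (x - s) - \<phi> (x + s)) * of_real (?Q s) = diff_quot x s * of_real (s\<^sup>2 / (s\<^sup>2 + y\<^sup>2))" for s
      by (cases "s = 0") (simp_all add: diff_quot_def power2_eq_square)
    then have "(LINT s|lborel. (\<phi> (x - s) - \<phi> (x + s)) * of_real (?Q s)) = (LINT s|lborel. diff_quot x s * of_real (s\<^sup>2 / (s\<^sup>2 + y\<^sup>2)))"
      by (simp only:)
    moreover have "(LINT s|lborel. \<phi> (x - s) * of_real (?Q s)) = (LINT s|lborel. (\<phi> (x - s) - \<phi> (x + s)) * of_real (?Q s)) / 2"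
      by (rule antisymmetrize[OF _ iQ]) simp_all
    ultimately show ?thesis by (simp only:)
  qed
  have 3: "(LINT s|lborel. \<phi> (x - s) * of_real (?P s)) = (LINT r|lborel. \<phi> (x - y * r) / of_real (1 + r\<^sup>2))"
  proof -
    have e: "y * (y / (y * y + (y * r)\<^sup>2)) = 1 / (1 + r\<^sup>2)" for r
    proof -
      have "y * y + (y * r)\<^sup>2 = (y * y) * (1 + r\<^sup>2)" by (simp add: power2_eq_square algebra_simps)
      then show ?thesis using y by simp
    qed
    have "(LINT s|lborel. \<phi> (x - s) * of_real (?P s)) = y *\<^sub>R (LINT r|lborel. \<phi> (x - y * r) * of_real (?P (y * r)))"
      using y lborel_integral_real_affine[of y "\<lambda>s. \<phi> (x - s) * of_real (?P s)" 0] by simp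
    also have "\<dots> = (LINT r|lborel. \<phi> (x - y * r) * of_real (y * ?P (y * r)))"
      unfolding integral_scaleR_right[symmetric] by (simp add: scaleR_conv_of_real mult_ac)
    also have "\<dots> = (LINT r|lborel. \<phi> (x - y * r) / of_real (1 + r\<^sup>2))"
      using e by (intro Bochner_Integration.integral_cong) (simp_all add: power2_eq_square add.commute del: of_real_add of_real_mult of_real_divide, simp add: divide_inverse)
    finally show ?thesis .
  qed
  have alg: "\<i> / of_real pi * (a - \<i> * b) = b / of_real pi + \<i> * of_real (1 / pi) * a" for a b
    by (simp add: field_simps)
  show ?thesis unfolding cauchy_ext_def 1 alg 2 3 by simp
qed

lemma hilbert_const_far:
  assumes "2 * M \<le> \<bar>x\<bar>" and K: "K \<le> (B * (2 * \<bar>M\<bar>)) * (2 / \<bar>x\<bar>)"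
  shows "K \<le> hilbert_const / (1 + \<bar>x\<bar>)"
proof -
  have x: "0 < \<bar>x\<bar>" using assms(1) M by linarith
  have "1 / \<bar>x\<bar> \<le> 1 / (2 * M)" using assms(1) M by (intro frac_le) auto
  then have "(1 + \<bar>x\<bar>) / \<bar>x\<bar> \<le> 1 + 1 / (2 * M)" using x by (simp add: add_divide_distrib)
  then have "1 / \<bar>x\<bar> \<le> (1 + 1 / (2 * M)) / (1 + \<bar>x\<bar>)" using x by (simp add: field_simps)
  then have "(B * (2 * \<bar>M\<bar>)) * 2 * (1 / \<bar>x\<bar>) \<le> (B * (2 * \<bar>M\<bar>)) * 2 * ((1 + 1 / (2 * M)) / (1 + \<bar>x\<bar>))"
    using B by (intro mult_left_mono) auto
  also have "\<dots> = ((B * (2 * \<bar>M\<bar>)) * 2 * (1 + 1 / (2 * M))) / (1 + \<bar>x\<bar>)" by (simp only: times_divide_eq_right)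
  also have "\<dots> \<le> hilbert_const / (1 + \<bar>x\<bar>)"
    unfolding hilbert_const_def using B L M by (intro divide_right_mono) auto
  finally show ?thesis using K by simp
qed

lemma hilbert_const_near:
  assumes "\<bar>x\<bar> < 2 * M" and K: "K \<le> B + L * (6 * M)"
  shows "K \<le> hilbert_const / (1 + \<bar>x\<bar>)"
proof -
  have "(B + L * (6 * M)) * (1 + \<bar>x\<bar>) \<le> (B + L * (6 * M)) * (1 + 2 * M)"
    using assms(1) B L M by (intro mult_left_mono) auto
  also have "\<dots> \<le> hilbert_const" unfolding hilbert_const_def using B L M by auto
  finally have "B + L * (6 * M) \<le> hilbert_const / (1 + \<bar>x\<bar>)" by (simp add: pos_le_divide_eq add_pos_nonneg)
  then show ?thesis using K by linarith
qed

lemma diff_quot_term_bound: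
  assumes "\<bar>x\<bar> < 2 * M" and "\<And>s. norm (c s :: complex) \<le> 1"
  shows "norm (of_real (1 / (2 * pi)) * (LINT s|lborel. diff_quot x s * c s)) \<le> L * (6 * M)"
proof -
  have "norm (LINT s|lborel. diff_quot x s * c s) \<le> (LINT s|lborel. norm (diff_quot x s))"
  proof (rule norm_integral_le)
    show "norm (diff_quot x s * c s) \<le> norm (diff_quot x s)" for s
      using mult_left_mono[OF assms(2)[of s], of "norm (diff_quot x s)"] by (simp add: norm_mult)
  qed (use diff_quot_integrable in auto)
  also have "\<dots> \<le> 2 * L * (2 * \<bar>\<bar>x\<bar> + M\<bar>)" by (rule diff_quot_norm_integral)
  also have "\<dots> \<le> 2 * L * (2 * (3 * M))" using assms(1) L M by (intro mult_left_mono) auto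
  finally have "norm (LINT s|lborel. diff_quot x s * c s) \<le> 2 * (L * (6 * M))" by simp
  moreover have "2 * (L * (6 * M)) \<le> (2 * pi) * (L * (6 * M))"
    using pi_gt3 L M by (intro mult_right_mono) auto
  ultimately have "norm (LINT s|lborel. diff_quot x s * c s) \<le> (2 * pi) * (L * (6 * M))" by linarith
  then have "norm (LINT s|lborel. diff_quot x s * c s) / (2 * pi) \<le> L * (6 * M)"
    by (simp add: pos_divide_le_eq mult.commute)
  then show ?thesis by (simp add: norm_mult norm_divide)
qed

lemma hilbert_int_bound: "norm (hilbert_int x) \<le> hilbert_const / (1 + \<bar>x\<bar>)"
proof (cases "2 * M \<le> \<bar>x\<bar>")
  case True
  have off: "hilbert_int x = of_real (1 / pi) * (LINT t|lborel. \<phi> t / of_real (x - t))"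
  proof (rule hilbert_off_support[OF M])
    fix t assume "\<phi> t \<noteq> 0"
    then have "\<not> M \<le> \<bar>t\<bar>" using supp by blast
    then show "M \<le> \<bar>x - t\<bar>" using True by linarith
  qed
  have "norm (hilbert_int x) \<le> 1 * norm (LINT t|lborel. \<phi> t / of_real (x - t))"
    unfolding off norm_mult using pi_gt3 by (intro mult_right_mono) (auto simp: norm_divide)
  also have "\<dots> \<le> (B * (2 * \<bar>M\<bar>)) * (2 / \<bar>x\<bar>)" using far_bound[OF True, of 0] by simp
  finally show ?thesis by (rule hilbert_const_far[OF True])
next
  case False
  then have "norm (hilbert_int x) \<le> L * (6 * M)" using diff_quot_term_bound[of x "\<lambda>_. 1"] by (simp add: hilbert_int_def)
  then show ?thesis using False B by (intro hilbert_const_near) auto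
qed

lemma hilbert_const: "0 \<le> hilbert_const"
  using order_trans[OF norm_ge_zero hilbert_int_bound[of 0]] by simp

lemma hilbert_int_bounded: "norm (hilbert_int x) \<le> hilbert_const"
proof -
  have "hilbert_const * 1 \<le> hilbert_const * (1 + \<bar>x\<bar>)" using hilbert_const by (intro mult_left_mono) auto
  then have "hilbert_const / (1 + \<bar>x\<bar>) \<le> hilbert_const" by (simp add: pos_divide_le_eq add_pos_nonneg)
  then show ?thesis using hilbert_int_bound[of x] by linarith
qed

lemma poisson_bound: "norm ((LINT r|lborel. \<phi> (x - y * r) / of_real (1 + r\<^sup>2)) / of_real pi) \<le> B"
proof -
  have "norm (LINT r|lborel. \<phi> (x - y * r) / of_real (1 + r\<^sup>2)) \<le> (LINT r|lborel. B * (1 / (1 + r\<^sup>2)))"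
  proof (rule norm_integral_le)
    show "integrable lborel (\<lambda>r::real. B * (1 / (1 + r\<^sup>2)))"
      using integrable_inverse_1_plus_square_line by (rule integrable_mult_right)
    show "norm (\<phi> (x - y * r) / of_real (1 + r\<^sup>2)) \<le> B * (1 / (1 + r\<^sup>2))" for r
      using B by (simp add: norm_divide divide_right_mono abs_mult del: of_real_add)
  qed
  also have "\<dots> = B * pi" using integral_inverse_1_plus_square_line by (simp only: integral_mult_right_zero)
  finally show ?thesis by (simp add: norm_divide pos_divide_le_eq)
qed

lemma cauchy_ext_bound:
  assumes y: "0 < y"
  shows "norm (cauchy_ext y x) \<le> hilbert_const / (1 + \<bar>x\<bar>)"
proof (cases "2 * M \<le> \<bar>x\<bar>")
  case True
  have "norm (cauchy_ext y x) \<le> 1 * norm (LINT t|lborel. \<phi> t / (of_real (x - t) + \<i> * of_real y))"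
    unfolding cauchy_ext_def norm_mult using pi_gt3 by (intro mult_right_mono) (auto simp: norm_divide)
  also have "\<dots> \<le> (B * (2 * \<bar>M\<bar>)) * (2 / \<bar>x\<bar>)" using far_bound[OF True, of y] y by simp
  finally show ?thesis by (rule hilbert_const_far[OF True])
next
  case False
  have k: "norm (complex_of_real (s\<^sup>2 / (s\<^sup>2 + y\<^sup>2))) \<le> 1" for s
    unfolding norm_of_real using y by (simp add: divide_le_eq_1 add_nonneg_pos)
  let ?I = "of_real (1 / (2 * pi)) * (LINT s|lborel. diff_quot x s * of_real (s\<^sup>2 / (s\<^sup>2 + y\<^sup>2)))"
  have "norm ?I \<le> L * (6 * M)" by (rule diff_quot_term_bound[OF _ k]) (use False in simp)
  moreover have "norm (\<i> * ?I) = norm ?I" by (simp only: norm_mult[of \<i>] norm_ii mult_1_left)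
  ultimately have "norm (cauchy_ext y x) \<le> B + L * (6 * M)"
    unfolding cauchy_ext_split[OF y] mult.assoc[of \<i>] by (intro norm_triangle_mono[OF poisson_bound]) linarith
  then show ?thesis using False by (intro hilbert_const_near) auto
qed

text \<open>The Plemelj formula, by dominated convergence in each half of
  \<open>cauchy_ext_split\<close>.\<close>

lemma cauchy_ext_tendsto: "(\<lambda>n. cauchy_ext (inverse (real (Suc n))) x) \<longlonglongrightarrow> \<phi> x + \<i> * hilbert_int x"
proof -
  define e where "e n = inverse (real (Suc n))" for n
  have e: "0 < e n" for n by (simp add: e_def)
  have e0: "e \<longlonglongrightarrow> 0" unfolding e_def by (rule LIMSEQ_inverse_real_of_nat)
  have "(\<lambda>n. LINT r|lborel. \<phi> (x - e n * r) / of_real (1 + r\<^sup>2)) \<longlonglongrightarrow> (LINT r|lborel. \<phi> x / of_real (1 + r\<^sup>2))"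
  proof (rule integral_dominated_convergence[where w="\<lambda>r. B * (1 / (1 + r\<^sup>2))"])
    show "integrable lborel (\<lambda>r::real. B * (1 / (1 + r\<^sup>2)))"
      using integrable_inverse_1_plus_square_line by (rule integrable_mult_right)
    show "AE r in lborel. norm (\<phi> (x - e n * r) / of_real (1 + r\<^sup>2)) \<le> B * (1 / (1 + r\<^sup>2))" for n
      using B by (intro AE_I2) (simp add: norm_divide divide_right_mono abs_mult del: of_real_add)
    show "AE r in lborel. (\<lambda>n. \<phi> (x - e n * r) / of_real (1 + r\<^sup>2)) \<longlonglongrightarrow> \<phi> x / of_real (1 + r\<^sup>2)"
    proof (rule AE_I2)
      fix r :: real
      have "(\<lambda>n. x - e n * r) \<longlonglongrightarrow> x - 0 * r" by (intro tendsto_intros e0)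
      then have "(\<lambda>n. \<phi> (x - e n * r)) \<longlonglongrightarrow> \<phi> (x - 0 * r)"
        using cont by (intro continuous_on_tendsto_compose[of UNIV \<phi>]) auto
      moreover have "complex_of_real (1 + r\<^sup>2) \<noteq> 0" unfolding of_real_eq_0_iff by (simp add: add_nonneg_eq_0_iff)
      ultimately show "(\<lambda>n. \<phi> (x - e n * r) / of_real (1 + r\<^sup>2)) \<longlonglongrightarrow> \<phi> x / of_real (1 + r\<^sup>2)"
        by (intro tendsto_divide tendsto_const) auto
    qed
  qed measurable
  also have "(LINT r|lborel. \<phi> x / of_real (1 + r\<^sup>2)) = \<phi> x * of_real pi"
  proof -
    have "(LINT r|lborel. \<phi> x / of_real (1 + r\<^sup>2)) = (LINT r|lborel. \<phi> x * of_real (1 / (1 + r\<^sup>2)))"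
      by (simp add: divide_inverse)
    then show ?thesis
      using integral_inverse_1_plus_square_line
      by (simp only: integral_mult_right_zero integral_complex_of_real)
  qed
  finally have 1: "(\<lambda>n. LINT r|lborel. \<phi> (x - e n * r) / of_real (1 + r\<^sup>2)) \<longlonglongrightarrow> \<phi> x * of_real pi" .
  have 2: "(\<lambda>n. LINT s|lborel. diff_quot x s * of_real (s\<^sup>2 / (s\<^sup>2 + (e n)\<^sup>2))) \<longlonglongrightarrow> (LINT s|lborel. diff_quot x s)"
  proof (rule integral_dominated_convergence[where w="\<lambda>s. norm (diff_quot x s)"])
    show "integrable lborel (\<lambda>s. norm (diff_quot x s))" using diff_quot_integrable by simp
    show "AE s in lborel. norm (diff_quot x s * of_real (s\<^sup>2 / (s\<^sup>2 + (e n)\<^sup>2))) \<le> norm (diff_quot x s)" for n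
    proof (rule AE_I2)
      fix s
      have "0 < s\<^sup>2 + (e n)\<^sup>2" using e[of n] by (simp add: add_nonneg_pos)
      then have "\<bar>s\<^sup>2 / (s\<^sup>2 + (e n)\<^sup>2)\<bar> \<le> 1" by (simp add: divide_le_eq_1)
      then show "norm (diff_quot x s * of_real (s\<^sup>2 / (s\<^sup>2 + (e n)\<^sup>2))) \<le> norm (diff_quot x s)"
        unfolding norm_mult norm_of_real by (intro mult_left_le) auto
    qed
    show "AE s in lborel. (\<lambda>n. diff_quot x s * of_real (s\<^sup>2 / (s\<^sup>2 + (e n)\<^sup>2))) \<longlonglongrightarrow> diff_quot x s"
    proof (rule AE_I2)
      fix s :: real
      show "(\<lambda>n. diff_quot x s * of_real (s\<^sup>2 / (s\<^sup>2 + (e n)\<^sup>2))) \<longlonglongrightarrow> diff_quot x s"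
      proof (cases "s = 0")
        case False
        then have "(\<lambda>n. diff_quot x s * of_real (s\<^sup>2 / (s\<^sup>2 + (e n)\<^sup>2))) \<longlonglongrightarrow> diff_quot x s * of_real (s\<^sup>2 / (s\<^sup>2 + 0\<^sup>2))"
          by (intro tendsto_intros e0) auto
        then show ?thesis using False by simp
      qed (simp add: diff_quot_def)
    qed
  qed measurable
  have "(\<lambda>n. (LINT r|lborel. \<phi> (x - e n * r) / of_real (1 + r\<^sup>2)) / of_real pi
      + \<i> * of_real (1 / (2 * pi)) * (LINT s|lborel. diff_quot x s * of_real (s\<^sup>2 / (s\<^sup>2 + (e n)\<^sup>2))))
     \<longlonglongrightarrow> \<phi> x * of_real pi / of_real pi + \<i> * of_real (1 / (2 * pi)) * (LINT s|lborel. diff_quot x s)"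
    by (intro tendsto_intros 1 2) simp
  then show ?thesis
    unfolding cauchy_ext_split[OF e, symmetric] by (simp add: e_def hilbert_int_def)
qed

lemma hilbert_int_cont: "continuous_on UNIV hilbert_int"
proof (intro continuous_at_imp_continuous_on ballI)
  fix a :: real
  have "((\<lambda>x. LINT s|lborel. diff_quot x s) \<longlongrightarrow> (LINT s|lborel. diff_quot a s)) (at a within ball a 1)"
  proof (rule integral_dominated_convergence_within)
    show "integrable lborel (\<lambda>s. (2 * L) * indicat_real {-(\<bar>a\<bar> + 1 + M)..\<bar>a\<bar> + 1 + M} s)"
      by (intro integrable_mult_right integrable_real_indicator) (auto simp: emeasure_lborel_Icc_eq)
    show "AE s in lborel. norm (diff_quot y s) \<le> (2 * L) * indicat_real {-(\<bar>a\<bar> + 1 + M)..\<bar>a\<bar> + 1 + M} s" if "y \<in> ball a 1" for y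
    proof (rule AE_I2)
      fix s
      have "\<bar>y\<bar> \<le> \<bar>a\<bar> + 1" using that by (auto simp: dist_real_def)
      then show "norm (diff_quot y s) \<le> (2 * L) * indicat_real {-(\<bar>a\<bar> + 1 + M)..\<bar>a\<bar> + 1 + M} s"
        using diff_quot_bound[of y s] diff_quot_supp[of y s] by (auto simp: indicator_def)
    qed
    show "AE s in lborel. ((\<lambda>y. diff_quot y s) \<longlongrightarrow> diff_quot a s) (at a within ball a 1)"
    proof (rule AE_I2)
      fix s
      have c: "continuous_on UNIV (\<lambda>y. \<phi> (y - s) - \<phi> (y + s))"
        by (intro continuous_intros continuous_on_compose2[OF cont]) auto
      then have "((\<lambda>y. \<phi> (y - s) - \<phi> (y + s)) \<longlongrightarrow> \<phi> (a - s) - \<phi> (a + s)) (at a within ball a 1)"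
        by (meson UNIV_I continuous_on_def subset_UNIV tendsto_within_subset)
      then show "((\<lambda>y. diff_quot y s) \<longlongrightarrow> diff_quot a s) (at a within ball a 1)"
        unfolding diff_quot_def by (cases "s = 0") (auto intro!: tendsto_divide)
    qed
  qed measurable
  then have "((\<lambda>x. LINT s|lborel. diff_quot x s) \<longlongrightarrow> (LINT s|lborel. diff_quot a s)) (at a)"
    by (subst (asm) at_within_open) auto
  then show "isCont hilbert_int a" unfolding isCont_def hilbert_int_def by (intro tendsto_intros)
qed

lemma hilbert_int_measurable [measurable]: "hilbert_int \<in> borel_measurable borel"
  using hilbert_int_cont by (rule borel_measurable_continuous_onI)

lemma cauchy_ext_measurable [measurable]: "cauchy_ext y \<in> borel_measurable borel"
  unfolding cauchy_ext_def by measurable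

text \<open>
  The functions \<open>cauchy_ext y\<close> are superpositions of the kernels \<open>1 / (x - \<zeta>)\<close> with \<open>\<zeta>\<close> in the lower half-plane,
  and they converge to \<open>\<phi> + \<i> H \<phi>\<close> as \<open>y\<close> tends to 0.
\<close>

lemma pairing_eq_0:
  fixes F :: "real \<Rightarrow> complex"
  assumes [measurable]: "F \<in> borel_measurable borel" and C: "\<And>x. norm (F x) \<le> C / (1 + \<bar>x\<bar>)"
    and F0: "\<And>v. Im v < 0 \<Longrightarrow> (LINT x|lborel. F x / (of_real x - v)) = 0"
  shows "(LINT x|lborel. F x * (\<phi> x + \<i> * hilbert_int x)) = 0"
proof -
  have C0: "0 \<le> C" using order_trans[OF norm_ge_zero C[of 0]] by simp
  have zero: "(LINT x|lborel. F x * cauchy_ext y x) = 0" if y: "0 < y" for y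
  proof -
    obtain D where D: "0 < D" "\<And>x::real. norm (1 / (of_real x - (- \<i> * of_real y))) \<le> D / (1 + \<bar>x\<bar>)"
      using y cauchy_kernel_bound'[of "- \<i> * of_real y"] by auto
    let ?f = "\<lambda>x t. F x * (\<phi> t / (of_real (x - t) + \<i> * of_real y))"
    have le: "norm (?f x t) \<le> (C * D * (1 + M)) * (1 / (1 + x\<^sup>2)) * norm (\<phi> t)" for x t
    proof (cases "M \<le> \<bar>t\<bar>")
      case False
      have pos: "0 < 1 + \<bar>x\<bar>" "0 < 1 + \<bar>x - t\<bar>" by simp_all
      \<comment> \<open>As |t| < M, decay in x - t is converted into decay in x at the price of the
        factor 1 + M, uniformly in t; this provides the product majorant for Fubini.\<close>
      have "1 + \<bar>x\<bar> \<le> (1 + \<bar>x - t\<bar>) * (1 + M)"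
      proof -
        have "(1 + \<bar>x - t\<bar>) + M \<le> (1 + \<bar>x - t\<bar>) * (1 + M)" using M by (simp add: algebra_simps)
        then show ?thesis using False by linarith
      qed
      then have "D * (1 + \<bar>x\<bar>) \<le> (D * (1 + M)) * (1 + \<bar>x - t\<bar>)"
        using mult_left_mono[of "1 + \<bar>x\<bar>" "(1 + \<bar>x - t\<bar>) * (1 + M)" D] D(1) by (simp add: mult_ac)
      moreover have "a / p \<le> b / q" if "0 < p" "0 < q" "a * q \<le> b * p" for a b p q :: real
        using that by (simp add: field_simps)
      ultimately have "D / (1 + \<bar>x - t\<bar>) \<le> D * (1 + M) / (1 + \<bar>x\<bar>)" using pos by blast
      then have k: "norm (1 / (of_real (x - t) + \<i> * of_real y)) \<le> D * (1 + M) / (1 + \<bar>x\<bar>)"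
        using D(2)[of "x - t"] by simp
      have "norm (?f x t) = norm (F x) * (norm (1 / (of_real (x - t) + \<i> * of_real y)) * norm (\<phi> t))"
        by (simp add: norm_mult norm_divide)
      also have "\<dots> \<le> (C / (1 + \<bar>x\<bar>)) * ((D * (1 + M) / (1 + \<bar>x\<bar>)) * norm (\<phi> t))"
        using C k C0 D(1) M by (intro mult_mono) (auto intro!: divide_nonneg_nonneg mult_nonneg_nonneg)
      also have "\<dots> = (C * D * (1 + M) * norm (\<phi> t)) * (1 / (1 + \<bar>x\<bar>)\<^sup>2)"
        by (simp add: power2_eq_square)
      also have "\<dots> \<le> (C * D * (1 + M) * norm (\<phi> t)) * (1 / (1 + x\<^sup>2))"
      proof (intro mult_left_mono divide_left_mono)
        show "1 + x\<^sup>2 \<le> (1 + \<bar>x\<bar>)\<^sup>2" by (simp add: power2_sum)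
      qed (use C0 D M in \<open>auto intro!: mult_pos_pos add_pos_nonneg\<close>)
      finally show ?thesis by (simp add: mult_ac)
    qed (simp add: supp)
    have i1: "integrable lborel (\<lambda>x::real. (C * D * (1 + M)) * (1 / (1 + x\<^sup>2)))"
      using integrable_inverse_1_plus_square_line by (rule integrable_mult_right)
    have i2: "integrable lborel (\<lambda>t. norm (\<phi> t))" using integrable by simp
    have m: "(\<lambda>(x, t). ?f x t) \<in> borel_measurable (lborel \<Otimes>\<^sub>M lborel)" by measurable
    have "(LINT x|lborel. LINT t|lborel. ?f x t) = (LINT t|lborel. LINT x|lborel. ?f x t)"
      by (rule Fubini_product_bound(1)[OF m i1 i2 le])
    also have "\<dots> = (LINT t|lborel. \<phi> t * 0)"
    proof (intro Bochner_Integration.integral_cong refl)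
      fix t
      have "(LINT x|lborel. ?f x t) = (LINT x|lborel. \<phi> t * (F x / (of_real x - (of_real t - \<i> * of_real y))))"
        by (intro Bochner_Integration.integral_cong) (simp_all add: algebra_simps)
      then show "(LINT x|lborel. ?f x t) = \<phi> t * 0"
        using F0[of "of_real t - \<i> * of_real y"] y by (simp only: integral_mult_right_zero) simp
    qed
    finally have "(LINT x|lborel. LINT t|lborel. ?f x t) = 0" by simp
    moreover have "F x * cauchy_ext y x = (\<i> / of_real pi) * (LINT t|lborel. ?f x t)" for x
      unfolding cauchy_ext_def integral_mult_right_zero by (simp add: mult_ac)
    ultimately show ?thesis by (simp only: integral_mult_right_zero mult_zero_right)
  qed
  have "(\<lambda>n. LINT x|lborel. F x * cauchy_ext (inverse (real (Suc n))) x) \<longlonglongrightarrow> (LINT x|lborel. F x * (\<phi> x + \<i> * hilbert_int x))"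
  proof (rule integral_dominated_convergence[where w="\<lambda>x. (C * hilbert_const) * (1 / (1 + x\<^sup>2))"])
    show "integrable lborel (\<lambda>x::real. (C * hilbert_const) * (1 / (1 + x\<^sup>2)))"
      using integrable_inverse_1_plus_square_line by (rule integrable_mult_right)
    show "AE x in lborel. norm (F x * cauchy_ext (inverse (real (Suc n))) x) \<le> (C * hilbert_const) * (1 / (1 + x\<^sup>2))" for n
    proof (rule AE_I2)
      fix x :: real
      have "norm (F x * cauchy_ext (inverse (real (Suc n))) x) \<le> (C / (1 + \<bar>x\<bar>)) * (hilbert_const / (1 + \<bar>x\<bar>))"
        unfolding norm_mult using C cauchy_ext_bound[of "inverse (real (Suc n))" x] C0 by (intro mult_mono) auto
      also have "\<dots> = (C * hilbert_const) * (1 / (1 + \<bar>x\<bar>)\<^sup>2)" by (simp add: power2_eq_square)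
      also have "\<dots> \<le> (C * hilbert_const) * (1 / (1 + x\<^sup>2))"
      proof (intro mult_left_mono divide_left_mono)
        show "1 + x\<^sup>2 \<le> (1 + \<bar>x\<bar>)\<^sup>2" by (simp add: power2_sum)
      qed (use C0 hilbert_const in \<open>auto intro!: mult_pos_pos add_pos_nonneg\<close>)
      finally show "norm (F x * cauchy_ext (inverse (real (Suc n))) x) \<le> (C * hilbert_const) * (1 / (1 + x\<^sup>2))" .
    qed
    show "AE x in lborel. (\<lambda>n. F x * cauchy_ext (inverse (real (Suc n))) x) \<longlonglongrightarrow> F x * (\<phi> x + \<i> * hilbert_int x)"
      by (intro AE_I2 tendsto_intros cauchy_ext_tendsto)
  qed measurable
  then show ?thesis by (simp only: zero LIMSEQ_const_iff inverse_positive_iff_positive of_nat_0_less_iff zero_less_Suc)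
qed

text \<open>\<open>pairing_eq_0\<close> is applied with F the product of the two test kernels, whose
  integral against any third Cauchy kernel vanishes by
  \<open>integral_cauchy_kernel_triple\<close>.\<close>

lemma hardy_hilbert: "hardy (\<lambda>x. \<phi> x + \<i> * hilbert_int x)"
proof (rule hardyI)
  show "norm (\<phi> x + \<i> * hilbert_int x) \<le> B + hilbert_const" for x
    using B(2)[of x] hilbert_int_bounded[of x] by (intro norm_triangle_mono) (auto simp: norm_mult)
  fix z w assume zw: "Im z < 0" "Im w < 0"
  obtain C where C: "\<And>x. norm (1 / ((of_real x - z) * (of_real x - w))) \<le> C / (1 + \<bar>x\<bar>)\<^sup>2"
    using cauchy_kernel_product_bound[of z w "\<lambda>_. 1" 1] zw by auto
  have C0: "0 \<le> C" using order_trans[OF norm_ge_zero C[of 0]] by simp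
  have "(LINT x|lborel. (1 / ((of_real x - z) * (of_real x - w))) * (\<phi> x + \<i> * hilbert_int x)) = 0"
  proof (rule pairing_eq_0)
    fix x :: real
    have "C / (1 + \<bar>x\<bar>)\<^sup>2 \<le> C / (1 + \<bar>x\<bar>)"
    proof (rule divide_left_mono)
      have "(1 + \<bar>x\<bar>) * 1 \<le> (1 + \<bar>x\<bar>) * (1 + \<bar>x\<bar>)" by (intro mult_left_mono) auto
      then show "1 + \<bar>x\<bar> \<le> (1 + \<bar>x\<bar>)\<^sup>2" by (simp add: power2_eq_square)
    qed (use C0 in \<open>auto intro!: mult_pos_pos add_pos_nonneg\<close>)
    then show "norm (1 / ((of_real x - z) * (of_real x - w))) \<le> C / (1 + \<bar>x\<bar>)" using C[of x] by linarith
  next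
    fix v assume "Im v < 0"
    from integral_cauchy_kernel_triple[OF zw this]
    show "(LINT x|lborel. 1 / ((of_real x - z) * (of_real x - w)) / (of_real x - v)) = 0" by (simp add: mult_ac)
  qed measurable
  then show "(LINT x|lborel. (\<phi> x + \<i> * hilbert_int x) / ((of_real x - z) * (of_real x - w))) = 0" by simp
qed measurable

end

subsection \<open>Smooth functions and mollifiers\<close>

definition vderiv :: "(real \<Rightarrow> complex) \<Rightarrow> real \<Rightarrow> complex" where
  "vderiv h = (\<lambda>t. vector_derivative h (at t))"

lemma smooth_iff_vderiv: "smooth \<phi> \<longleftrightarrow> (\<forall>n x. (vderiv ^^ n) \<phi> differentiable (at x))"
  unfolding smooth_def vderiv_def[abs_def] ..

lemma smooth_has_vderiv: "smooth \<phi> \<Longrightarrow> (\<phi> has_vector_derivative vderiv \<phi> x) (at x)"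
  unfolding smooth_iff_vderiv vderiv_def vector_derivative_works[symmetric] by (drule spec[of _ 0]) simp

lemma smooth_vderiv: "smooth \<phi> \<Longrightarrow> smooth (vderiv \<phi>)"
  unfolding smooth_iff_vderiv by (metis funpow_Suc_right o_apply)

lemma vderiv_eqI: "(\<And>x. (f has_vector_derivative f' x) (at x)) \<Longrightarrow> vderiv f = f'"
  unfolding vderiv_def by (auto intro: vector_derivative_at)

text \<open>A set of functions closed under differentiation consists of smooth functions, since all
  iterated derivatives stay inside. Proving smoothness thus reduces to finding an invariant set,
  without formulas for higher derivatives.\<close>

lemma smooth_coinduct:
  assumes "f \<in> S" and "\<And>f. f \<in> S \<Longrightarrow> \<exists>f'\<in>S. \<forall>x. (f has_vector_derivative f' x) (at x)"
  shows "smooth f"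
proof -
  have "(vderiv ^^ n) f \<in> S" for n
  proof (induction n)
    case (Suc n)
    then obtain f' where "f' \<in> S" "\<And>x. ((vderiv ^^ n) f has_vector_derivative f' x) (at x)"
      using assms(2) by blast
    then show ?case using vderiv_eqI by (metis funpow.simps(2) o_apply)
  qed (simp add: assms(1))
  then have "(vderiv ^^ n) f differentiable (at x)" for n x
    using assms(2) by (meson differentiableI_vector)
  then show ?thesis by (simp add: smooth_iff_vderiv)
qed

lemma smooth_continuous_on: "smooth \<phi> \<Longrightarrow> continuous_on S \<phi>"
  using smooth_has_vderiv by (meson continuous_at_imp_continuous_on has_vector_derivative_continuous)

lemma smooth_measurable: "smooth \<phi> \<Longrightarrow> \<phi> \<in> borel_measurable borel"
  by (intro borel_measurable_continuous_onI smooth_continuous_on)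

lemma smooth_affine:
  assumes "smooth \<phi>" shows "smooth (\<lambda>x. c * \<phi> (a * x + b))"
proof (rule smooth_coinduct[where S = "{\<lambda>x. c * \<phi> (a * x + b) |c \<phi>. smooth \<phi>}"])
  fix f assume "f \<in> {\<lambda>x. c * \<phi> (a * x + b) |c \<phi>. smooth \<phi>}"
  then obtain c \<phi> where f: "f = (\<lambda>x. c * \<phi> (a * x + b))" and s: "smooth \<phi>" by blast
  have "(f has_vector_derivative (c * of_real a) * vderiv \<phi> (a * x + b)) (at x)" for x
  proof -
    have 1: "((\<lambda>x. a * x + b) has_vector_derivative a) (at x)"
      by (auto intro!: derivative_eq_intros simp flip: has_real_derivative_iff_has_vector_derivative)
    from vector_diff_chain_at[OF 1 smooth_has_vderiv[OF s]]
    have "((\<lambda>x. \<phi> (a * x + b)) has_vector_derivative a *\<^sub>R vderiv \<phi> (a * x + b)) (at x)" by (simp add: o_def)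
    from has_vector_derivative_mult_right[OF this, of c]
    show ?thesis unfolding f by (simp add: scaleR_conv_of_real mult_ac)
  qed
  note der = this
  have mem: "(\<lambda>x. (c * of_real a) * vderiv \<phi> (a * x + b)) \<in> {\<lambda>x. c * \<phi> (a * x + b) |c \<phi>. smooth \<phi>}"
    using smooth_vderiv[OF s] by blast
  show "\<exists>f'\<in>{\<lambda>x. c * \<phi> (a * x + b) |c \<phi>. smooth \<phi>}. \<forall>x. (f has_vector_derivative f' x) (at x)"
    by (rule bexI[rotated, OF mem], rule allI, rule der)
qed (use assms in blast)

text \<open>Products alone are not closed under differentiation because of the Leibniz rule; finite
  sums of products are, which makes this the invariant set for \<open>smooth_mult\<close>.\<close>

inductive_set product_sums :: "(real \<Rightarrow> complex) set" where
  prod: "smooth f \<Longrightarrow> smooth g \<Longrightarrow> (\<lambda>x. f x * g x) \<in> product_sums"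
| sum: "f \<in> product_sums \<Longrightarrow> g \<in> product_sums \<Longrightarrow> (\<lambda>x. f x + g x) \<in> product_sums"

lemma smooth_mult:
  assumes "smooth f" "smooth g" shows "smooth (\<lambda>x. f x * g x)"
proof (rule smooth_coinduct[of _ product_sums])
  fix h assume "h \<in> product_sums"
  then show "\<exists>h'\<in>product_sums. \<forall>x. (h has_vector_derivative h' x) (at x)"
  proof induction
    case (prod f g)
    have der: "((\<lambda>x. f x * g x) has_vector_derivative f x * vderiv g x + vderiv f x * g x) (at x)" for x
      using prod smooth_has_vderiv by (intro has_vector_derivative_mult) auto
    have mem: "(\<lambda>x. f x * vderiv g x + vderiv f x * g x) \<in> product_sums"
      using prod smooth_vderiv by (intro product_sums.intros) auto
    show ?case by (rule bexI[rotated, OF mem], rule allI, rule der)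
  next
    case (sum f g)
    then obtain f' g' where "f' \<in> product_sums" "g' \<in> product_sums"
      "\<forall>x. (f has_vector_derivative f' x) (at x)" "\<forall>x. (g has_vector_derivative g' x) (at x)" by blast
    then have mem: "(\<lambda>x. f' x + g' x) \<in> product_sums" and der: "((\<lambda>x. f x + g x) has_vector_derivative f' x + g' x) (at x)" for x
      by (auto intro: product_sums.intros has_vector_derivative_add)
    show ?case by (rule bexI[rotated, OF mem], rule allI, rule der)
  qed
qed (use assms product_sums.prod in blast)

lemma smooth_linear_image:
  assumes "bounded_linear T" and "smooth f" shows "smooth (\<lambda>x. T (f x))"
proof (rule smooth_coinduct[where S = "{\<lambda>x. T (f x) |f. smooth f}"])
  fix h assume "h \<in> {\<lambda>x. T (f x) |f. smooth f}"
  then obtain f where h: "h = (\<lambda>x. T (f x))" and s: "smooth f" by blast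
  have der: "(h has_vector_derivative T (vderiv f x)) (at x)" for x
    unfolding h by (rule bounded_linear.has_vector_derivative[OF assms(1) smooth_has_vderiv[OF s]])
  have mem: "(\<lambda>x. T (vderiv f x)) \<in> {\<lambda>x. T (f x) |f. smooth f}" using smooth_vderiv[OF s] by blast
  show "\<exists>h'\<in>{\<lambda>x. T (f x) |f. smooth f}. \<forall>x. (h has_vector_derivative h' x) (at x)"
    by (rule bexI[rotated, OF mem], rule allI, rule der)
qed (use assms in blast)

section \<open>A smooth bump function and its rescalings\<close>

definition flat :: "real poly \<Rightarrow> real \<Rightarrow> real" where
  "flat p x = (if x > 0 then poly p (1 / x) * exp (- (1 / x)) else 0)"

lemma tendsto_poly_exp: "((\<lambda>y. poly p y * exp (- y)) \<longlongrightarrow> (0::real)) at_top"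
proof -
  have "((\<lambda>y. \<Sum>i\<le>degree p. coeff p i * (y ^ i / exp y)) \<longlongrightarrow> (\<Sum>i\<le>degree p. coeff p i * 0)) at_top"
    by (intro tendsto_intros tendsto_power_div_exp_0)
  then show ?thesis
    by (simp add: poly_altdef sum_distrib_right exp_minus divide_inverse mult.assoc)
qed

text \<open>For y = 1 / x the derivative of p(y) exp(-y) with respect to x is y^2 (p - p')(y)
  exp(-y), so the family indexed by polynomials is closed under differentiation. At 0 the
  exponential beats every polynomial in 1 / x.\<close>

lemma has_real_derivative_flat:
  "(flat p has_real_derivative flat (monom 1 2 * (p - pderiv p)) x) (at x)"
proof (cases x "0::real" rule: linorder_cases)
  case greater
  have "((\<lambda>x. poly p (1 / x) * exp (- (1 / x))) has_real_derivative flat (monom 1 2 * (p - pderiv p)) x) (at x)"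
    using greater by (auto intro!: derivative_eq_intros simp: flat_def poly_monom power2_eq_square field_simps)
  then show ?thesis
    by (rule has_field_derivative_transform_within_open[of _ _ _ "{0<..}"]) (use greater in \<open>auto simp: flat_def\<close>)
next
  case less
  have "((\<lambda>x. 0) has_real_derivative flat (monom 1 2 * (p - pderiv p)) x) (at x)"
    using less by (auto intro!: derivative_eq_intros simp: flat_def)
  then show ?thesis
    by (rule has_field_derivative_transform_within_open[of _ _ _ "{..<0}"]) (use less in \<open>auto simp: flat_def\<close>)
next
  case equal
  have "((\<lambda>h. flat p h / h) \<longlongrightarrow> 0) (at_left 0)"
  proof (rule tendsto_eventually)
    show "\<forall>\<^sub>F h in at_left 0. flat p h / h = 0"
      by (auto simp: eventually_at_filter flat_def)
  qed
  moreover have "((\<lambda>h. flat p h / h) \<longlongrightarrow> 0) (at_right 0)"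
  proof -
    have "((\<lambda>h. poly (monom 1 1 * p) (inverse h) * exp (- inverse h)) \<longlongrightarrow> 0) (at_right 0)"
      by (rule filterlim_compose[OF tendsto_poly_exp filterlim_inverse_at_top_right])
    moreover have "\<forall>\<^sub>F h in at_right 0. poly (monom 1 1 * p) (inverse h) * exp (- inverse h) = flat p h / h"
      using eventually_at_right_less[of 0] by eventually_elim (simp add: flat_def poly_monom field_simps)
    ultimately show ?thesis by (rule Lim_transform_eventually)
  qed
  ultimately have "((\<lambda>h. flat p h / h) \<longlongrightarrow> 0) (at 0)" by (simp add: filterlim_split_at)
  then show ?thesis unfolding equal by (simp add: DERIV_def flat_def)
qed

lemma smooth_flat: "smooth (\<lambda>x. of_real (flat p x))"
proof (rule smooth_coinduct[where S = "range (\<lambda>p x. complex_of_real (flat p x))"])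
  fix f assume "f \<in> range (\<lambda>p x. complex_of_real (flat p x))"
  then obtain p where f: "f = (\<lambda>x. of_real (flat p x))" by blast
  have der: "(f has_vector_derivative of_real (flat (monom 1 2 * (p - pderiv p)) x)) (at x)" for x
    unfolding f using has_real_derivative_flat
    by (intro has_vector_derivative_of_real) (simp add: has_real_derivative_iff_has_vector_derivative)
  show "\<exists>f'\<in>range (\<lambda>p x. complex_of_real (flat p x)). \<forall>x. (f has_vector_derivative f' x) (at x)"
    by (rule bexI[rotated, OF rangeI], rule allI, rule der)
qed blast

text \<open>The arguments are written as affine expressions with explicit coefficients so that
  \<open>smooth_affine\<close> and \<open>smooth_mult\<close> apply directly.\<close>

definition bump0 :: "real \<Rightarrow> real" where
  "bump0 x = flat [:1:] (1 * x + 1) * flat [:1:] ((-1) * x + 1)"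

lemma bump0_pos: "\<bar>x\<bar> < 1 \<Longrightarrow> 0 < bump0 x"
  by (auto simp: bump0_def flat_def)

lemma bump0_supp: "1 \<le> \<bar>x\<bar> \<Longrightarrow> bump0 x = 0"
  by (auto simp: bump0_def flat_def)

lemma bump0_nonneg: "0 \<le> bump0 x"
  by (auto simp: bump0_def flat_def)

lemma smooth_bump0: "smooth (\<lambda>x. of_real (bump0 x))"
proof -
  have 1: "smooth (\<lambda>x. 1 * complex_of_real (flat [:1:] (a * x + b)))" for a b
    by (rule smooth_affine[OF smooth_flat])
  show ?thesis
    using smooth_mult[OF 1[of 1 1] 1[of "-1" 1]] by (simp add: bump0_def)
qed

lemma bump0_continuous: "continuous_on S bump0"
proof -
  have "continuous_on S (\<lambda>x. Re (complex_of_real (bump0 x)))"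
    by (intro continuous_intros smooth_continuous_on smooth_bump0)
  then show ?thesis by simp
qed

lemma bump0_measurable [measurable]: "bump0 \<in> borel_measurable borel"
  using bump0_continuous by (rule borel_measurable_continuous_onI)

lemma bump0_le_1: "bump0 x \<le> 1"
  by (auto simp: bump0_def flat_def intro!: mult_le_one)

lemma bump0_integrable: "integrable lborel (\<lambda>x. complex_of_real (bump0 x))"
  by (rule integrable_bounded_support[of _ 1 1]) (auto simp: bump0_le_1 bump0_nonneg bump0_supp)

lemma bump0_integral_pos: "0 < (LINT x|lborel. bump0 x)"
proof -
  have i: "integrable lborel bump0" using bump0_integrable by (simp add: complex_of_real_integrable_eq)
  have "(LINT x|lborel. bump0 x) \<noteq> 0"
  proof
    assume "(LINT x|lborel. bump0 x) = 0"
    then have "AE x in lborel. bump0 x = 0"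
      using integral_nonneg_eq_0_iff_AE[OF i] bump0_nonneg by auto
    then have "AE x in lborel. x \<notin> {-1<..<1::real}"
      by eventually_elim (use bump0_pos in \<open>force simp: abs_less_iff\<close>)
    then have "{-1<..<1::real} \<in> null_sets lborel" by (subst AE_iff_null_sets) auto
    then have "emeasure lborel {-1<..<1::real} = 0" by (rule null_setsD1)
    then show False by simp
  qed
  moreover have "0 \<le> (LINT x|lborel. bump0 x)" using bump0_nonneg by (intro Bochner_Integration.integral_nonneg) auto
  ultimately show ?thesis by simp
qed

definition bump :: "real \<Rightarrow> real" where
  "bump x = bump0 x / (LINT x|lborel. bump0 x)"

lemma bump_integrable: "integrable lborel bump"
  unfolding bump_def using bump0_integrable by (simp add: complex_of_real_integrable_eq)

lemma bump_integral: "(LINT x|lborel. bump x) = 1"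
  unfolding bump_def using bump0_integral_pos by simp

lemma bump_nonneg: "0 \<le> bump x"
  unfolding bump_def using bump0_integral_pos bump0_nonneg by simp

lemma bump_supp: "1 \<le> \<bar>x\<bar> \<Longrightarrow> bump x = 0"
  by (simp add: bump_def bump0_supp)

lemma bump_measurable [measurable]: "bump \<in> borel_measurable borel"
  unfolding bump_def by measurable

text \<open>The bump of mass 1 and radius e centred at s; it is complex-valued in order to be a test
  function.\<close>

definition mollifier :: "real \<Rightarrow> real \<Rightarrow> real \<Rightarrow> complex" where
  "mollifier e s t = of_real (bump ((t - s) / e) / e)"

lemma mollifier_measurable [measurable]: "mollifier e s \<in> borel_measurable borel"
  unfolding mollifier_def by measurable

lemma mollifier_supp: "0 < e \<Longrightarrow> e \<le> \<bar>t - s\<bar> \<Longrightarrow> mollifier e s t = 0"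
  using bump_supp[of "(t - s) / e"] by (simp add: mollifier_def)

lemma test_functionsI:
  assumes "smooth \<phi>" "compact K" "K \<subseteq> \<Omega>" "\<And>x. x \<notin> K \<Longrightarrow> \<phi> x = 0"
  shows "\<phi> \<in> test_functions \<Omega>"
proof -
  have "closure {x. \<phi> x \<noteq> 0} \<subseteq> K"
    using assms by (intro closure_minimal compact_imp_closed) auto
  moreover from this have "compact (closure {x. \<phi> x \<noteq> 0})"
    using compact_Int_closed[OF assms(2) closed_closure, of "{x. \<phi> x \<noteq> 0}"] by (simp only: Int_absorb1)
  ultimately show ?thesis
    using assms unfolding test_functions_def by blast
qed

lemma mollifier_test:
  assumes e: "0 < e" and "cball s e \<subseteq> \<Omega>"
  shows "mollifier e s \<in> test_functions \<Omega>"
proof (rule test_functionsI)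
  have "smooth (\<lambda>t. complex_of_real (1 / (LINT x|lborel. bump0 x) / e) * complex_of_real (bump0 ((1 / e) * t + - s / e)))"
    by (rule smooth_affine[OF smooth_bump0])
  then show "smooth (mollifier e s)" by (simp add: mollifier_def[abs_def] bump_def diff_divide_distrib mult.commute)
  show "compact (cball s e)" by simp
  show "\<And>x. x \<notin> cball s e \<Longrightarrow> mollifier e s x = 0"
    using e by (intro mollifier_supp) (auto simp: dist_real_def)
qed fact

lemma test_functions_mono: "\<Omega> \<subseteq> \<Omega>' \<Longrightarrow> test_functions \<Omega> \<subseteq> test_functions \<Omega>'"
  unfolding test_functions_def by auto

lemma lipschitz_of_bounded_derivative:
  fixes f :: "real \<Rightarrow> complex"
  assumes "\<And>x. (f has_vector_derivative f' x) (at x)" "\<And>x. norm (f' x) \<le> L"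
  shows "norm (f x - f y) \<le> L * \<bar>x - y\<bar>"
proof -
  have "norm (f x - f y) \<le> L * norm (x - y)"
    by (rule differentiable_bound[of UNIV f "\<lambda>x h. h *\<^sub>R f' x"])
       (use assms in \<open>auto simp: has_vector_derivative_def mult.commute[of L] intro!: onorm_le mult_left_mono\<close>)
  then show ?thesis by simp
qed

lemma test_function_support:
  assumes "\<phi> \<in> test_functions {-a<..<a}" "0 < a"
  obtains b where "0 < b" "b < a" "\<And>x. b \<le> \<bar>x\<bar> \<Longrightarrow> \<phi> x = 0"
proof -
  let ?K = "closure {x. \<phi> x \<noteq> 0}"
  have K: "compact ?K" "?K \<subseteq> {-a<..<a}" using assms by (auto simp: test_functions_def)
  show thesis
  proof (cases "?K = {}")
    case True
    then show ?thesis using that[of "a / 2"] assms by auto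
  next
    case False
    have "\<exists>m\<in>?K. \<forall>x\<in>?K. \<bar>x\<bar> \<le> \<bar>m\<bar>"
      by (rule continuous_attains_sup[OF K(1) False]) (intro continuous_intros)
    then obtain m where m: "m \<in> ?K" "\<And>x. x \<in> ?K \<Longrightarrow> \<bar>x\<bar> \<le> \<bar>m\<bar>" by blast
    then have "m \<in> {-a<..<a}" using K(2) by blast
    then have "\<bar>m\<bar> < a" by auto
    show ?thesis
    proof (rule that[of "(\<bar>m\<bar> + a) / 2"])
      fix x assume "(\<bar>m\<bar> + a) / 2 \<le> \<bar>x\<bar>"
      then have "\<bar>m\<bar> < \<bar>x\<bar>" using \<open>\<bar>m\<bar> < a\<close> by simp
      then have "x \<notin> ?K" using m(2) by force
      then show "\<phi> x = 0" using closure_subset[of "{x. \<phi> x \<noteq> 0}"] by blast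
    qed (use \<open>\<bar>m\<bar> < a\<close> assms in auto)
  qed
qed

lemma test_functions_smooth: "\<phi> \<in> test_functions \<Omega> \<Longrightarrow> smooth \<phi>"
  by (simp add: test_functions_def)

lemma vderiv_support:
  assumes s: "smooth \<phi>" and supp: "\<And>x. b \<le> \<bar>x\<bar> \<Longrightarrow> \<phi> x = 0" and "b < \<bar>x\<bar>"
  shows "vderiv \<phi> x = 0"
proof -
  have "open {x::real. b < \<bar>x\<bar>}" by (intro open_Collect_less continuous_intros)
  moreover have "((\<lambda>x. 0) has_vector_derivative 0) (at x)" by simp
  ultimately have "(\<phi> has_vector_derivative 0) (at x)"
    using has_vector_derivative_transform_within_open[of "\<lambda>_. 0" 0 x "{x. b < \<bar>x\<bar>}" \<phi>] assms by simp
  then show ?thesis unfolding vderiv_def by (rule vector_derivative_at)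
qed

lemma smooth_compact_lipschitz:
  assumes s: "smooth \<phi>" and M: "0 < M" and supp: "\<And>x. M \<le> \<bar>x\<bar> \<Longrightarrow> \<phi> x = 0"
  obtains L where "compact_lipschitz \<phi> M L"
proof -
  have zero: "vderiv \<phi> x = 0" if "M < \<bar>x\<bar>" for x using vderiv_support[OF s supp that] .
  have "bounded (vderiv \<phi> ` {-M..M})"
    by (intro compact_imp_bounded compact_continuous_image smooth_continuous_on smooth_vderiv s) auto
  then obtain L where L: "\<And>x. x \<in> {-M..M} \<Longrightarrow> norm (vderiv \<phi> x) \<le> L" unfolding bounded_iff by blast
  have "0 \<le> L" using order_trans[OF norm_ge_zero L[of 0]] M by simp
  then have "norm (vderiv \<phi> x) \<le> L" for x using L[of x] zero[of x] by (cases "M < \<bar>x\<bar>") (auto simp: abs_le_iff not_less)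
  then have "compact_lipschitz \<phi> M L"
    by unfold_locales (use M supp lipschitz_of_bounded_derivative[OF smooth_has_vderiv[OF s]] in auto)
  then show thesis by (rule that)
qed

lemma test_function_UNIV_support:
  assumes "\<phi> \<in> test_functions UNIV"
  obtains M where "0 < M" "\<And>x. M \<le> \<bar>x\<bar> \<Longrightarrow> \<phi> x = 0"
proof -
  have "bounded {x. \<phi> x \<noteq> 0}" using assms bounded_subset[OF compact_imp_bounded closure_subset]
    by (auto simp: test_functions_def)
  then obtain a where a: "\<And>x. \<phi> x \<noteq> 0 \<Longrightarrow> \<bar>x\<bar> \<le> a" by (auto simp: bounded_iff)
  show thesis
    by (rule that[of "\<bar>a\<bar> + 1"]) (use a in force)+
qed

lemma test_function_compact_lipschitz:
  assumes "\<phi> \<in> test_functions UNIV"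
  obtains M L where "compact_lipschitz \<phi> M L"
proof -
  obtain M where M: "0 < M" "\<And>x. M \<le> \<bar>x\<bar> \<Longrightarrow> \<phi> x = 0"
    using test_function_UNIV_support[OF assms] by blast
  obtain L where "compact_lipschitz \<phi> M L"
    using smooth_compact_lipschitz[OF test_functions_smooth[OF assms] M] by blast
  then show thesis by (rule that)
qed

subsection \<open>Duality with Hardy functions\<close>

lemma bump_even: "bump (- x) = bump x"
  by (simp add: bump_def bump0_def mult.commute add.commute)

lemma mollifier_sym: "mollifier e s t = mollifier e t s"
  using bump_even[of "(t - s) / e"] by (simp add: mollifier_def diff_divide_distrib)

lemma mollifier_shift: "mollifier e s t = mollifier e 0 (t - s)"
  by (simp add: mollifier_def)

lemma mollifier_test_UNIV: "0 < e \<Longrightarrow> mollifier e s \<in> test_functions UNIV"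
  by (rule mollifier_test) auto

lemma hilbert_shift:
  assumes "\<phi> \<in> test_functions UNIV" "\<psi> \<in> test_functions UNIV" "\<And>t. \<psi> t = \<phi> (t - s)"
  shows "hilbert \<psi> t = hilbert \<phi> (t - s)"
proof -
  obtain M L where 1: "compact_lipschitz \<phi> M L" using test_function_compact_lipschitz assms(1) by blast
  obtain M' L' where 2: "compact_lipschitz \<psi> M' L'" using test_function_compact_lipschitz assms(2) by blast
  have "compact_lipschitz.diff_quot \<psi> t = compact_lipschitz.diff_quot \<phi> (t - s)"
    unfolding fun_eq_iff compact_lipschitz.diff_quot_def[OF 1] compact_lipschitz.diff_quot_def[OF 2] assms(3)
    by (simp add: algebra_simps)
  then show ?thesis
    unfolding compact_lipschitz.hilbert_eq[OF 1] compact_lipschitz.hilbert_eq[OF 2]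
      compact_lipschitz.hilbert_int_def[OF 1] compact_lipschitz.hilbert_int_def[OF 2] by simp
qed

lemma hilbert_odd:
  assumes "\<phi> \<in> test_functions UNIV" "\<And>t. \<phi> (- t) = \<phi> t"
  shows "hilbert \<phi> (- x) = - hilbert \<phi> x"
proof -
  obtain M L where 1: "compact_lipschitz \<phi> M L" using test_function_compact_lipschitz assms(1) by blast
  have "compact_lipschitz.diff_quot \<phi> (- x) = (\<lambda>r. - compact_lipschitz.diff_quot \<phi> x r)"
  proof
    fix r
    have "\<phi> (- x - r) = \<phi> (x + r)" "\<phi> (- x + r) = \<phi> (x - r)"
    proof -
      have "- x - r = - (x + r)" "- x + r = - (x - r)" by simp_all
      then show "\<phi> (- x - r) = \<phi> (x + r)" "\<phi> (- x + r) = \<phi> (x - r)" by (simp_all only: assms(2))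
    qed
    then show "compact_lipschitz.diff_quot \<phi> (- x) r = - compact_lipschitz.diff_quot \<phi> x r"
      unfolding compact_lipschitz.diff_quot_def[OF 1] by (simp add: minus_divide_left)
  qed
  then show ?thesis
    unfolding compact_lipschitz.hilbert_eq[OF 1] compact_lipschitz.hilbert_int_def[OF 1] by simp
qed

lemma hilbert_real:
  assumes "\<phi> \<in> test_functions UNIV" "\<And>t. \<phi> t = of_real (p t)"
  shows "Im (hilbert \<phi> x) = 0"
proof -
  obtain M L where 1: "compact_lipschitz \<phi> M L" using test_function_compact_lipschitz assms(1) by blast
  have "compact_lipschitz.diff_quot \<phi> x r = complex_of_real ((p (x - r) - p (x + r)) / r)" for r
    unfolding compact_lipschitz.diff_quot_def[OF 1] assms(2) by simp
  then have "(LINT r|lborel. compact_lipschitz.diff_quot \<phi> x r) = complex_of_real (LINT r|lborel. (p (x - r) - p (x + r)) / r)"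
    by (simp only: integral_complex_of_real)
  then show ?thesis
    unfolding compact_lipschitz.hilbert_eq[OF 1] compact_lipschitz.hilbert_int_def[OF 1] by simp
qed

lemma hilbert_measurable: "\<phi> \<in> test_functions UNIV \<Longrightarrow> hilbert \<phi> \<in> borel_measurable borel"
  using test_function_compact_lipschitz[of \<phi>] compact_lipschitz.hilbert_int_measurable compact_lipschitz.hilbert_eq
  by (metis ext)

lemma hilbert_decay:
  assumes "\<phi> \<in> test_functions UNIV"
  obtains C where "0 \<le> C" "\<And>x. norm (hilbert \<phi> x) \<le> C / (1 + \<bar>x\<bar>)" "\<And>x. norm (hilbert \<phi> x) \<le> C"
proof -
  obtain M L where 1: "compact_lipschitz \<phi> M L" using test_function_compact_lipschitz assms(1) by blast
  show thesis
    by (rule that[of "compact_lipschitz.hilbert_const M L"])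
       (simp_all add: compact_lipschitz.hilbert_eq[OF 1] compact_lipschitz.hilbert_int_bound[OF 1]
          compact_lipschitz.hilbert_int_bounded[OF 1] compact_lipschitz.hilbert_const[OF 1])
qed

lemma mollify_eq:
  assumes "0 < e"
  shows "(LINT s|lborel. F s * mollifier e t s) = (LINT r|lborel. F (t + e * r) * of_real (bump r))"
proof -
  have "(LINT s|lborel. F s * mollifier e t s) = (LINT r|lborel. e *\<^sub>R (F (t + e * r) * mollifier e t (t + e * r)))"
    using lborel_integral_real_affine[of e "\<lambda>s. F s * mollifier e t s" t] assms by simp
  also have "\<dots> = (LINT r|lborel. F (t + e * r) * of_real (bump r))"
    using assms by (intro Bochner_Integration.integral_cong) (simp_all add: mollifier_def scaleR_conv_of_real)
  finally show ?thesis .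
qed

lemma mollify_bound:
  assumes "0 < e" and B: "\<And>x. norm (F x) \<le> B"
  shows "norm (LINT s|lborel. F s * mollifier e t s) \<le> B"
proof -
  have "norm (LINT r|lborel. F (t + e * r) * of_real (bump r)) \<le> (LINT r|lborel. B * bump r)"
    by (rule norm_integral_le) (use bump_integrable B bump_nonneg in \<open>auto simp: norm_mult intro!: mult_right_mono\<close>)
  also have "\<dots> = B" using bump_integral by simp
  finally show ?thesis using mollify_eq[OF assms(1)] by simp
qed

lemma mollify_tendsto:
  assumes [measurable]: "F \<in> borel_measurable borel" and B: "\<And>x. norm (F x) \<le> B" and cont: "isCont F t"
    and e: "\<And>n. 0 < e n" "e \<longlonglongrightarrow> 0"
  shows "(\<lambda>n. LINT s|lborel. F s * mollifier (e n) t s) \<longlonglongrightarrow> F t"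
proof -
  have "(\<lambda>n. LINT r|lborel. F (t + e n * r) * of_real (bump r)) \<longlonglongrightarrow> (LINT r|lborel. F t * of_real (bump r))"
  proof (rule integral_dominated_convergence[where w="\<lambda>r. B * bump r"])
    show "integrable lborel (\<lambda>r. B * bump r)" using bump_integrable by simp
    show "AE r in lborel. norm (F (t + e n * r) * of_real (bump r)) \<le> B * bump r" for n
      by (rule AE_I2) (use B bump_nonneg in \<open>auto simp: norm_mult intro!: mult_right_mono\<close>)
    show "AE r in lborel. (\<lambda>n. F (t + e n * r) * of_real (bump r)) \<longlonglongrightarrow> F t * of_real (bump r)"
    proof (rule AE_I2)
      fix r :: real
      have "(\<lambda>n. t + e n * r) \<longlonglongrightarrow> t + 0 * r" by (intro tendsto_intros e)
      then have "(\<lambda>n. F (t + e n * r)) \<longlonglongrightarrow> F t" using isCont_tendsto_compose[OF cont] by simp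
      then show "(\<lambda>n. F (t + e n * r) * of_real (bump r)) \<longlonglongrightarrow> F t * of_real (bump r)" by (intro tendsto_intros)
    qed
  qed measurable
  also have "(LINT r|lborel. F t * of_real (bump r)) = F t"
    using bump_integral by (simp add: integral_complex_of_real)
  finally show ?thesis using mollify_eq e(1) by simp
qed

text \<open>
  If \<open>F = \<psi> + \<i> h\<close>, with \<open>\<psi>\<close> and \<open>h\<close> real, then \<open>h\<close> plays the role of \<open>H \<psi>\<close>, although \<open>\<psi>\<close> is not a test function.
\<close>

lemma hardy_annihilates:
  assumes hF: "hardy F" and C: "\<And>x. norm (F x) \<le> C / (1 + \<bar>x\<bar>)" and cont: "\<And>x. x \<noteq> 0 \<Longrightarrow> isCont F x"
    and int: "integrable lborel (\<lambda>x. Re (F x))" and \<delta>: "0 < \<delta>" and supp: "\<And>s. Re (F s) \<noteq> 0 \<Longrightarrow> cball s \<delta> \<subseteq> \<Omega>"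
    and f: "integrable lborel f" and g: "integrable lborel g"
    and ann: "\<And>\<rho>. \<rho> \<in> test_functions \<Omega> \<Longrightarrow> (\<And>t. Im (\<rho> t) = 0) \<Longrightarrow> (LINT t|lborel. \<rho> t * f t) = (LINT t|lborel. hilbert \<rho> t * g t)"
  shows "(LINT x|lborel. of_real (Re (F x)) * f x) = (LINT x|lborel. of_real (Im (F x)) * g x)"
proof -
  note [measurable] = hardyD(1)[OF hF] borel_measurable_integrable[OF f] borel_measurable_integrable[OF g]
  obtain B where B: "0 \<le> B" "\<And>x. norm (F x) \<le> B" using hardy_bounded[OF hF] by blast
  \<comment> \<open>Radii at most \<delta>, so that a mollifier centred where Re F is nonzero is a
    test function on \<Omega>.\<close>
  define e where "e n = \<delta> * inverse (real (Suc n))" for n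
  have e: "0 < e n" "e n \<le> \<delta>" for n
    using \<delta> by (auto simp: e_def field_simps)
  have e0: "e \<longlonglongrightarrow> 0"
    using tendsto_mult[OF tendsto_const LIMSEQ_inverse_real_of_nat, of \<delta>] by (simp add: e_def[abs_def])
  define P where "P n t = (LINT s|lborel. F s * mollifier (e n) t s)" for n t
  have Pm[measurable]: "P n \<in> borel_measurable borel" for n
    unfolding P_def mollifier_def by measurable
  have key: "(LINT t|lborel. of_real (Re (P n t)) * f t) = (LINT t|lborel. of_real (Im (P n t)) * g t)" for n
  proof -
    define m where "m = mollifier (e n)"
    define h where "h = hilbert (m 0)"
    have mt: "m t \<in> test_functions UNIV" for t unfolding m_def by (rule mollifier_test_UNIV[OF e(1)])
    have [measurable]: "m t \<in> borel_measurable borel" for t unfolding m_def by measurable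
    have [measurable]: "h \<in> borel_measurable borel" unfolding h_def by (rule hilbert_measurable[OF mt])
    have mshift: "m s t = m 0 (t - s)" for s t unfolding m_def by (rule mollifier_shift)
    have hm: "hilbert (m s) t = h (t - s)" for s t
      unfolding h_def by (rule hilbert_shift[OF mt mt mshift])
    have hodd: "h (- x) = - h x" for x
      unfolding h_def by (rule hilbert_odd[OF mt]) (use bump_even in \<open>simp add: m_def mollifier_def\<close>)
    have mreal: "m s t = of_real (Re (m s t))" for s t unfolding m_def mollifier_def by simp
    have hreal: "h x = of_real (Re (h x))" for x
      using hilbert_real[OF mt mreal, of 0 x] by (simp add: h_def complex_eq_iff)
    obtain hilbert_const where hilbert_const: "0 \<le> hilbert_const" "\<And>x. norm (h x) \<le> hilbert_const" "\<And>x. norm (h x) \<le> hilbert_const / (1 + \<bar>x\<bar>)"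
      unfolding h_def using hilbert_decay[OF mt] by metis
    \<comment> \<open>F is orthogonal to the Hardy function formed from \<open>m t\<close> and its
      transform. Comparing imaginary parts, and using that h is odd, identifies the convolution of
      Re F with h as the imaginary part of the mollified F: the transform has moved from the
      mollifier to F.\<close>
    have adj: "(LINT s|lborel. of_real (Re (F s)) * h (t - s)) = of_real (Im (P n t))" for t
    proof -
      obtain M L where 1: "compact_lipschitz (m t) M L" using test_function_compact_lipschitz[OF mt] by blast
      have z: "(LINT s|lborel. F s * (m t s + \<i> * h (s - t))) = 0"
        using compact_lipschitz.pairing_eq_0[OF 1 hardyD(1)[OF hF] C hardy_decay_cauchy[OF hF C]]
        by (simp add: compact_lipschitz.hilbert_eq[OF 1, symmetric] hm)
      obtain CT where CT: "0 \<le> CT" "\<And>x. norm (hilbert (m t) x) \<le> CT / (1 + \<bar>x\<bar>)"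
        using hilbert_decay[OF mt] by metis
      have C0: "0 \<le> C" using order_trans[OF norm_ge_zero C[of 0]] by simp
      have i1: "integrable lborel (\<lambda>s. F s * m t s)"
        by (rule Bochner_Integration.integrable_bound[of _ "\<lambda>s. B * norm (m t s)"])
           (use compact_lipschitz.integrable[OF 1] B in \<open>auto simp: norm_mult intro!: AE_I2 mult_right_mono order_trans[OF _ abs_ge_self]\<close>)
      have i2: "integrable lborel (\<lambda>s. F s * h (s - t))"
      proof (rule integrable_bound_inverse_square)
        fix s
        have "norm (F s * h (s - t)) \<le> (C / (1 + \<bar>s\<bar>)) * (CT / (1 + \<bar>s\<bar>))"
          unfolding norm_mult hm[symmetric] using C CT C0 by (intro mult_mono) auto
        then show "norm (F s * h (s - t)) \<le> (C * CT) / (1 + \<bar>s\<bar>)\<^sup>2" by (simp add: power2_eq_square)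
      qed measurable
      have "(LINT s|lborel. F s * m t s) + \<i> * (LINT s|lborel. F s * h (s - t)) = (LINT s|lborel. F s * (m t s + \<i> * h (s - t)))"
      proof -
        have "(LINT s|lborel. F s * (m t s + \<i> * h (s - t))) = (LINT s|lborel. F s * m t s + \<i> * (F s * h (s - t)))"
          by (intro Bochner_Integration.integral_cong) (simp_all add: algebra_simps)
        then show ?thesis using i1 i2 by simp
      qed
      then have "P n t + \<i> * (LINT s|lborel. F s * h (s - t)) = 0" using z by (simp add: P_def m_def)
      then have "Im (P n t) = - Re (LINT s|lborel. F s * h (s - t))" by (simp add: complex_eq_iff)
      also have "Re (LINT s|lborel. F s * h (s - t)) = (LINT s|lborel. Re (F s * h (s - t)))"
        by (rule integral_Re[OF i2, symmetric])
      also have "\<dots> = (LINT s|lborel. - (Re (F s) * Re (h (t - s))))"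
      proof (intro Bochner_Integration.integral_cong refl)
        fix s
        have "h (s - t) = - of_real (Re (h (t - s)))" using hodd[of "t - s"] hreal[of "t - s"] by simp
        then show "Re (F s * h (s - t)) = - (Re (F s) * Re (h (t - s)))" by simp
      qed
      finally have "Im (P n t) = (LINT s|lborel. Re (F s) * Re (h (t - s)))" by simp
      then have "of_real (Im (P n t)) = (LINT s|lborel. complex_of_real (Re (F s) * Re (h (t - s))))"
        by (simp only: integral_complex_of_real)
      also have "\<dots> = (LINT s|lborel. of_real (Re (F s)) * h (t - s))"
        using hreal by (intro Bochner_Integration.integral_cong) simp_all
      finally show ?thesis by simp
    qed
    have reP: "(LINT s|lborel. of_real (Re (F s)) * m s t) = of_real (Re (P n t))" for t
    proof -
      obtain M L where 1: "compact_lipschitz (m t) M L" using test_function_compact_lipschitz[OF mt] by blast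
      have i1: "integrable lborel (\<lambda>s. F s * m t s)"
        by (rule Bochner_Integration.integrable_bound[of _ "\<lambda>s. B * norm (m t s)"])
           (use compact_lipschitz.integrable[OF 1] B in \<open>auto simp: norm_mult intro!: AE_I2 mult_right_mono order_trans[OF _ abs_ge_self]\<close>)
      have "Re (P n t) = (LINT s|lborel. Re (F s * m t s))"
        unfolding P_def m_def[symmetric] by (rule integral_Re[OF i1, symmetric])
      also have "\<dots> = (LINT s|lborel. Re (F s) * Re (m t s))"
      proof (intro Bochner_Integration.integral_cong refl)
        fix s
        have "Im (m t s) = 0" using mreal[of t s] by (simp add: complex_eq_iff)
        then show "Re (F s * m t s) = Re (F s) * Re (m t s)" by simp
      qed
      finally have "of_real (Re (P n t)) = (LINT s|lborel. complex_of_real (Re (F s) * Re (m t s)))"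
        by (simp only: integral_complex_of_real)
      also have "\<dots> = (LINT s|lborel. of_real (Re (F s)) * m s t)"
      proof (intro Bochner_Integration.integral_cong refl)
        fix s show "complex_of_real (Re (F s) * Re (m t s)) = of_real (Re (F s)) * m s t"
          using mreal[of t s] mollifier_sym[of "e n" s t] by (simp add: m_def)
      qed
      finally show ?thesis by simp
    qed
    have m2: "(\<lambda>(s, t). of_real (Re (F s)) * m s t * f t) \<in> borel_measurable (lborel \<Otimes>\<^sub>M lborel)"
    proof -
      have "(\<lambda>(s, t). of_real (Re (F s)) * m 0 (t - s) * f t) \<in> borel_measurable (lborel \<Otimes>\<^sub>M lborel)"
        by measurable
      moreover have "(\<lambda>(s, t). of_real (Re (F s)) * m 0 (t - s) * f t) = (\<lambda>(s, t). of_real (Re (F s)) * m s t * f t)"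
        by (intro ext, clarify, simp only: mshift[symmetric])
      ultimately show ?thesis by simp
    qed
    have h2: "(\<lambda>(s, t). of_real (Re (F s)) * h (t - s) * g t) \<in> borel_measurable (lborel \<Otimes>\<^sub>M lborel)"
      by measurable
    obtain M0 L0 where 10: "compact_lipschitz (m 0) M0 L0" using test_function_compact_lipschitz[OF mt] by blast
    define Bm where "Bm = compact_lipschitz.B M0 L0"
    have Bm: "norm (m s t) \<le> Bm" for s t
      unfolding Bm_def mshift[of s t] by (rule compact_lipschitz.B(2)[OF 10])
    have g1: "integrable lborel (\<lambda>s. \<bar>Re (F s)\<bar> * Bm)" "integrable lborel (\<lambda>s. \<bar>Re (F s)\<bar> * hilbert_const)" using int by auto
    have g2: "integrable lborel (\<lambda>t. norm (f t))" "integrable lborel (\<lambda>t. norm (g t))" using f g by auto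
    have l1: "norm (of_real (Re (F s)) * m s t * f t) \<le> \<bar>Re (F s)\<bar> * Bm * norm (f t)" for s t
      unfolding norm_mult norm_of_real using Bm by (intro mult_right_mono mult_left_mono) auto
    have l2: "norm (of_real (Re (F s)) * h (t - s) * g t) \<le> \<bar>Re (F s)\<bar> * hilbert_const * norm (g t)" for s t
      unfolding norm_mult norm_of_real using hilbert_const(2) by (intro mult_right_mono mult_left_mono) auto
    \<comment> \<open>The real part of the mollified F is a superposition of the mollifiers
      \<open>m s\<close> with weights Re F(s). Fubini reduces the claim to a single s, where
      \<open>ann\<close> applies whenever the weight is nonzero.\<close>
    have "(LINT t|lborel. of_real (Re (P n t)) * f t) = (LINT t|lborel. LINT s|lborel. of_real (Re (F s)) * m s t * f t)"
      unfolding reP[symmetric] by simp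
    also have "\<dots> = (LINT s|lborel. LINT t|lborel. of_real (Re (F s)) * m s t * f t)"
      by (rule Fubini_product_bound(1)[OF m2 g1(1) g2(1) l1, symmetric])
    also have "\<dots> = (LINT s|lborel. LINT t|lborel. of_real (Re (F s)) * h (t - s) * g t)"
    proof (rule Bochner_Integration.integral_cong[OF refl])
      fix s
      show "(LINT t|lborel. of_real (Re (F s)) * m s t * f t) = (LINT t|lborel. of_real (Re (F s)) * h (t - s) * g t)"
      proof (cases "Re (F s) = 0")
        case False
        have "cball s (e n) \<subseteq> \<Omega>" using supp[OF False] e(2)[of n] subset_cball by blast
        then have "m s \<in> test_functions \<Omega>" unfolding m_def by (rule mollifier_test[OF e(1)])
        from ann[OF this] mreal[of s] have "(LINT t|lborel. m s t * f t) = (LINT t|lborel. h (t - s) * g t)"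
          by (simp add: hm complex_eq_iff)
        then show ?thesis unfolding mult.assoc integral_mult_right_zero by simp
      qed simp
    qed
    also have "\<dots> = (LINT t|lborel. LINT s|lborel. of_real (Re (F s)) * h (t - s) * g t)"
      by (rule Fubini_product_bound(1)[OF h2 g1(2) g2(2) l2])
    also have "\<dots> = (LINT t|lborel. of_real (Im (P n t)) * g t)"
      unfolding adj[symmetric] by simp
    finally show ?thesis .
  qed
  \<comment> \<open>F may be discontinuous at 0, which is a null set.\<close>
  have Plim: "AE t in lborel. (\<lambda>n. P n t) \<longlonglongrightarrow> F t"
    using AE_lborel_singleton[of "0::real"]
    by eventually_elim (use mollify_tendsto[OF hardyD(1)[OF hF] B(2) cont e(1) e0] in \<open>auto simp: P_def\<close>)
  have PB: "norm (P n t) \<le> B" for n t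
    unfolding P_def by (rule mollify_bound[OF e(1) B(2)])
  have "(\<lambda>n. LINT t|lborel. of_real (Re (P n t)) * f t) \<longlonglongrightarrow> (LINT t|lborel. of_real (Re (F t)) * f t)"
  proof (rule integral_dominated_convergence[where w="\<lambda>t. B * norm (f t)"])
    show "integrable lborel (\<lambda>t. B * norm (f t))" using f by simp
    show "AE t in lborel. norm (of_real (Re (P n t)) * f t) \<le> B * norm (f t)" for n
      unfolding norm_mult norm_of_real
      by (intro AE_I2 mult_right_mono order_trans[OF abs_Re_le_cmod PB]) auto
    show "AE t in lborel. (\<lambda>n. of_real (Re (P n t)) * f t) \<longlonglongrightarrow> of_real (Re (F t)) * f t"
      using Plim by eventually_elim (intro tendsto_intros)
  qed measurable
  moreover have "(\<lambda>n. LINT t|lborel. of_real (Im (P n t)) * g t) \<longlonglongrightarrow> (LINT t|lborel. of_real (Im (F t)) * g t)"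
  proof (rule integral_dominated_convergence[where w="\<lambda>t. B * norm (g t)"])
    show "integrable lborel (\<lambda>t. B * norm (g t))" using g by simp
    show "AE t in lborel. norm (of_real (Im (P n t)) * g t) \<le> B * norm (g t)" for n
      unfolding norm_mult norm_of_real
      by (intro AE_I2 mult_right_mono order_trans[OF abs_Im_le_cmod PB]) auto
    show "AE t in lborel. (\<lambda>n. of_real (Im (P n t)) * g t) \<longlonglongrightarrow> of_real (Im (F t)) * g t"
      using Plim by eventually_elim (intro tendsto_intros)
  qed measurable
  ultimately show ?thesis unfolding key by (rule LIMSEQ_unique)
qed

subsection \<open>The periodic Hilbert transform\<close>

lemma cot_half_periodic: "cot (pi * (x + 2) / 2) = cot (pi * x / 2)"
proof -
  have e: "pi * (x + 2) / 2 = pi * x / 2 + pi" by (simp add: algebra_simps)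
  show ?thesis unfolding e by (simp add: cot_def)
qed

lemma cot_minus_real: "cot (- x) = - cot (x::real)"
  by (simp add: cot_def)

lemma mult_cos_le_sin:
  assumes "0 \<le> x" "x \<le> pi" shows "x * cos x \<le> sin x"
proof -
  have "sin 0 - 0 * cos 0 \<le> sin x - x * cos x"
  proof (rule DERIV_nonneg_imp_nondecreasing[OF assms(1)])
    fix y assume y: "0 \<le> y" "y \<le> x"
    have "((\<lambda>x. sin x - x * cos x) has_real_derivative y * sin y) (at y)"
      by (auto intro!: derivative_eq_intros)
    then show "\<exists>d. ((\<lambda>x. sin x - x * cos x) has_real_derivative d) (at y) \<and> 0 \<le> d"
      using y assms sin_ge_zero[of y] by (intro exI[of _ "y * sin y"]) auto
  qed
  then show ?thesis by simp
qed

text \<open>This is cot x \<le> 1 / x at x = pi s / 2, combined with pi / 2 \<ge> 1.\<close>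

lemma cot_half_bound_pos:
  assumes "0 < s" "s \<le> 1" shows "\<bar>cot (pi * s / 2)\<bar> \<le> 1 / s"
proof -
  let ?x = "pi * s / 2"
  have x: "0 < ?x" "?x \<le> pi / 2" using assms pi_gt_zero by (auto simp: mult_left_le)
  have sp: "0 < sin ?x" using x by (intro sin_gt_zero) auto
  have cp: "0 \<le> cos ?x" using x by (intro cos_ge_zero; linarith)
  have "s * cos ?x \<le> ?x * cos ?x" using assms pi_gt3 cp by (intro mult_right_mono) auto
  also have "\<dots> \<le> sin ?x" using x by (intro mult_cos_le_sin) auto
  finally have "cot ?x \<le> 1 / s" using sp assms by (simp add: cot_def field_simps)
  moreover have "0 \<le> cot ?x" using sp cp by (simp add: cot_def)
  ultimately show ?thesis by simp
qed

lemma cot_half_bound: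
  assumes "s \<noteq> 0" "\<bar>s\<bar> \<le> 1" shows "\<bar>cot (pi * s / 2)\<bar> \<le> 1 / \<bar>s\<bar>"
proof (cases "0 < s")
  case True
  then show ?thesis using cot_half_bound_pos[of s] assms by simp
next
  case False
  then show ?thesis using cot_half_bound_pos[of "- s"] assms cot_minus_real[of "pi * s / 2"] by simp
qed

lemma Pi2_fun_indicator_Ico: "Pi2_fun (\<lambda>x. indicat_real {a - 1..<a + 1} x *\<^sub>R 1) x = 1"
proof -
  obtain m where m: "x - a = pi2 (x - a) + 2 * of_int m" using pi2_decomp by blast
  have eq: "indicat_real {a - 1..<a + 1} (x + 2 * of_int j) *\<^sub>R (1::complex) = (if j = - m then 1 else 0)" for j
  proof -
    have "x + 2 * of_int j - a = pi2 (x - a) + 2 * of_int (m + j)" using m by simp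
    moreover have "x + 2 * of_int j \<in> {a - 1..<a + 1} \<longleftrightarrow> j = - m"
    proof
      assume "x + 2 * of_int j \<in> {a - 1..<a + 1}"
      then have "\<bar>2 * real_of_int (m + j)\<bar> < 2" using pi2_bounds[of "x - a"] calculation by (auto simp: abs_less_iff)
      then have "real_of_int \<bar>m + j\<bar> < real_of_int 1" by (simp del: of_int_add add: abs_mult)
      then show "j = - m" unfolding of_int_less_iff by linarith
    next
      assume "j = - m"
      then show "x + 2 * of_int j \<in> {a - 1..<a + 1}" using pi2_bounds[of "x - a"] m by auto
    qed
    ultimately show ?thesis by (simp add: indicator_def)
  qed
  have "(\<Sum>\<^sub>\<infinity>j::int\<in>UNIV. (if j = - m then 1 else 0)) = (1::complex)"
    by (subst infsum_cong_neutral[where T = "{- m}" and g = "\<lambda>j. if j = - m then 1 else 0"]) auto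
  then show ?thesis unfolding Pi2_fun_def eq .
qed

text \<open>Unfolding the indicator of [a - 1, a + 1[, whose periodization is the constant 1, shows
  that each such interval is a fundamental domain.\<close>

lemma integral_period_shift:
  fixes G :: "real \<Rightarrow> complex"
  assumes per: "\<And>x. G (x + 2) = G x" and m[measurable]: "G \<in> borel_measurable borel" and B: "\<And>x. norm (G x) \<le> B"
  shows "(LINT x|lborel. indicat_real {-1..<1} x *\<^sub>R G x) = (LINT x|lborel. indicat_real {a - 1..<a + 1} x *\<^sub>R G x)"
proof -
  let ?F = "\<lambda>x. indicat_real {a - 1..<a + 1} x *\<^sub>R (1::complex)"
  have iF: "integrable lborel ?F"
    by (rule integrable_bounded_support[of _ 1 "\<bar>a\<bar> + 1"]) (auto simp: indicator_def)
  show ?thesis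
    using Pi2_fun_pairing(2)[OF iF m B] unfolding Pi2_fun_indicator_Ico periodic_pi2[of G, OF per]
    by (simp add: mult.commute scaleR_conv_of_real)
qed

text \<open>Cutting the kernel to one period about its singularity turns the convolution on the
  circle into an integral over the line. The open interval loses nothing, since the cotangent
  vanishes at both end points.\<close>

definition cot_cut :: "real \<Rightarrow> real" where
  "cot_cut s = indicat_real {-1<..<1} s * cot (pi * s / 2)"

lemma cot_cut_measurable [measurable]: "cot_cut \<in> borel_measurable borel"
  unfolding cot_cut_def cot_def by measurable

lemma cot_cut_odd: "cot_cut (- s) = - cot_cut s"
proof -
  have "- s \<in> {-1<..<1} \<longleftrightarrow> s \<in> {-1<..<1}" by auto
  then show ?thesis using cot_minus_real[of "pi * s / 2"] unfolding cot_cut_def indicator_def by simp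
qed

lemma cot_cut_bound: "\<bar>s\<bar> * \<bar>cot_cut s\<bar> \<le> indicat_real {-1<..<1} s"
proof (cases "s \<noteq> 0 \<and> \<bar>s\<bar> < 1")
  case True
  then have ind: "indicat_real {-1<..<1} s = 1" by (simp add: indicator_def abs_less_iff)
  then have "\<bar>cot_cut s\<bar> \<le> 1 / \<bar>s\<bar>" using cot_half_bound[of s] True by (simp add: cot_cut_def)
  with ind show ?thesis using True by (simp add: field_simps)
next
  case False
  show ?thesis
  proof (cases "s = 0")
    case s: False
    then have "s \<notin> {-1<..<1}" using False by (auto simp: abs_less_iff)
    then show ?thesis by (simp add: cot_cut_def)
  qed simp
qed

lemma cot_cut_lipschitz_bound:
  assumes "norm (z::complex) \<le> L * \<bar>s\<bar>" "0 \<le> L"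
  shows "norm (z * of_real (cot_cut s)) \<le> L * indicat_real {-1<..<1} s"
proof -
  have "norm (z * of_real (cot_cut s)) \<le> (L * \<bar>s\<bar>) * \<bar>cot_cut s\<bar>"
    unfolding norm_mult norm_of_real using assms by (intro mult_right_mono) auto
  also have "\<dots> = L * (\<bar>s\<bar> * \<bar>cot_cut s\<bar>)" by simp
  also have "\<dots> \<le> L * indicat_real {-1<..<1} s" using cot_cut_bound assms(2) by (intro mult_left_mono) auto
  finally show ?thesis .
qed

lemma integrable_indicator_I1: "integrable lborel (\<lambda>s::real. L * indicat_real {-1<..<1} s)"
  by (intro integrable_mult_right integrable_real_indicator) auto

lemma periodic_smooth_vderiv:
  assumes s: "smooth \<psi>" and per: "\<And>x. \<psi> (x + 2) = \<psi> x"
  shows "vderiv \<psi> (x + 2) = vderiv \<psi> x"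
proof -
  have 1: "((\<lambda>x. x + 2) has_vector_derivative 1) (at x)"
    by (auto intro!: derivative_eq_intros simp flip: has_real_derivative_iff_has_vector_derivative)
  from vector_diff_chain_at[OF 1 smooth_has_vderiv[OF s]]
  have "(\<psi> has_vector_derivative vderiv \<psi> (x + 2)) (at x)" by (simp add: o_def per)
  then show ?thesis using smooth_has_vderiv[OF s, of x] vector_derivative_unique_at by blast
qed

lemma periodic_smooth_bounded:
  assumes s: "smooth \<psi>" and per: "\<And>x. \<psi> (x + 2) = \<psi> x"
  obtains B where "0 \<le> B" "\<And>x. norm (\<psi> x) \<le> B"
proof -
  have "bounded (\<psi> ` {-1..1})"
    by (intro compact_imp_bounded compact_continuous_image smooth_continuous_on s) auto
  then obtain B where B: "\<And>x. x \<in> {-1..1} \<Longrightarrow> norm (\<psi> x) \<le> B" unfolding bounded_iff by blast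
  have "norm (\<psi> x) \<le> B" for x
    using B[of "pi2 x"] pi2_bounds[of x] periodic_pi2[of \<psi>, OF per] by simp
  then show thesis using that order_trans[OF norm_ge_zero] by blast
qed

lemma periodic_smooth_lipschitz:
  assumes s: "smooth \<psi>" and per: "\<And>x. \<psi> (x + 2) = \<psi> x"
  obtains L where "0 \<le> L" "\<And>x y. norm (\<psi> x - \<psi> y) \<le> L * \<bar>x - y\<bar>"
  using periodic_smooth_bounded[OF smooth_vderiv[OF s] periodic_smooth_vderiv[OF s per]]
    lipschitz_of_bounded_derivative[OF smooth_has_vderiv[OF s]] by metis

text \<open>The periodic principal value as an absolutely convergent integral. Of the factor 1 / 4,
  one half belongs to the definition of \<open>hilbert2\<close> and one half to the
  antisymmetrization.\<close>

definition hilbert2_int :: "(real \<Rightarrow> complex) \<Rightarrow> real \<Rightarrow> complex" where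
  "hilbert2_int \<psi> x = (LINT s|lborel. (\<psi> (x - s) - \<psi> (x + s)) * of_real (cot_cut s)) / 4"

lemma hilbert2_int_integrand_bound:
  fixes \<psi> :: "real \<Rightarrow> complex"
  assumes lip: "\<And>x y. norm (\<psi> x - \<psi> y) \<le> L * \<bar>x - y\<bar>" and "0 \<le> L"
  shows "norm ((\<psi> (x - s) - \<psi> (x + s)) * of_real (cot_cut s)) \<le> 2 * L * indicat_real {-1<..<1} s"
  by (rule cot_cut_lipschitz_bound) (use lip[of "x - s" "x + s"] assms(2) in \<open>auto simp: abs_mult\<close>)

text \<open>Since neighbourhoods of all points congruent to x modulo 2 are removed, the truncated
  integrand is bounded and 2-periodic. The period [-1, 1] may then be exchanged for one centred at
  x, which contains the single singularity x.\<close>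

lemma truncated_periodic:
  fixes \<psi> :: "real \<Rightarrow> complex"
  assumes m[measurable]: "\<psi> \<in> borel_measurable borel" and per: "\<And>x. \<psi> (x + 2) = \<psi> x"
    and B: "\<And>x. norm (\<psi> x) \<le> B" and \<epsilon>: "0 < \<epsilon>" "\<epsilon> < 1"
  shows "(LINT t:{t \<in> {-1..1}. \<forall>k::int. \<bar>x - t - 2 * of_int k\<bar> > \<epsilon>}|lborel. \<psi> t * complex_of_real (cot (pi * (x - t) / 2)))
    = (LINT s|lborel. \<psi> (x - s) * of_real (indicat_real {s. \<epsilon> < \<bar>s\<bar>} s * cot_cut s))"
    and "integrable lborel (\<lambda>s. \<psi> (x - s) * of_real (indicat_real {s. \<epsilon> < \<bar>s\<bar>} s * cot_cut s))"
proof -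
  have B0: "0 \<le> B" using order_trans[OF norm_ge_zero B] .
  define A where "A = {t. \<forall>k::int. \<bar>x - t - 2 * of_int k\<bar> > \<epsilon>}"
  have [measurable]: "A \<in> sets borel" unfolding A_def by measurable
  define G where "G t = indicat_real A t *\<^sub>R (\<psi> t * complex_of_real (cot (pi * (x - t) / 2)))" for t
  have Gm: "G \<in> borel_measurable borel" unfolding G_def cot_def by measurable
  have Aper: "t + 2 \<in> A \<longleftrightarrow> t \<in> A" for t
  proof -
    have e: "x - (t + 2) - 2 * of_int k = x - t - 2 * of_int (k + 1)" for k :: int by simp
    have "(\<forall>k::int. \<bar>x - t - 2 * of_int (k + 1)\<bar> > \<epsilon>) \<longleftrightarrow> (\<forall>k::int. \<bar>x - t - 2 * of_int k\<bar> > \<epsilon>)"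
      by (metis diff_add_cancel)
    then show ?thesis unfolding A_def mem_Collect_eq e .
  qed
  have Gper: "G (t + 2) = G t" for t
  proof -
    have "cot (pi * (x - (t + 2)) / 2) = cot (pi * (x - t) / 2)"
      using cot_half_periodic[of "x - t - 2"] by (simp add: algebra_simps)
    then show ?thesis using Aper[of t] by (simp add: G_def per indicator_def)
  qed
  have GB: "norm (G t) \<le> B * (1 / \<epsilon>)" for t
  proof (cases "t \<in> A")
    case True
    obtain k where k: "x - t = pi2 (x - t) + 2 * of_int k" using pi2_decomp by blast
    have p: "\<epsilon> < \<bar>pi2 (x - t)\<bar>" using True k unfolding A_def by (metis (mono_tags, lifting) add_diff_cancel_right' mem_Collect_eq)
    have "cot (pi * (x - t) / 2) = cot (pi * pi2 (x - t) / 2)"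
      using periodic_pi2[of "\<lambda>u. cot (pi * u / 2)", OF cot_half_periodic] by simp
    moreover have "\<bar>cot (pi * pi2 (x - t) / 2)\<bar> \<le> 1 / \<bar>pi2 (x - t)\<bar>"
      using p \<epsilon> pi2_bounds[of "x - t"] by (intro cot_half_bound) auto
    moreover have "1 / \<bar>pi2 (x - t)\<bar> \<le> 1 / \<epsilon>" using p \<epsilon> by (intro frac_le) auto
    ultimately have "\<bar>cot (pi * (x - t) / 2)\<bar> \<le> 1 / \<epsilon>" by simp
    then have "norm (\<psi> t) * \<bar>cot (pi * (x - t) / 2)\<bar> \<le> B * (1 / \<epsilon>)" using B B0 by (intro mult_mono) auto
    then show ?thesis using True by (simp add: G_def norm_mult del: of_real_divide)
  qed (use B0 \<epsilon> in \<open>simp add: G_def\<close>)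
  have G2: "indicat_real {x - 1..<x + 1} (x - s) *\<^sub>R G (x - s) = \<psi> (x - s) * of_real (indicat_real {s. \<epsilon> < \<bar>s\<bar>} s * cot_cut s)" for s
  proof (cases "\<bar>s\<bar> < 1")
    case True
    have "x - s \<in> A \<longleftrightarrow> \<epsilon> < \<bar>s\<bar>"
    proof
      assume "x - s \<in> A"
      then show "\<epsilon> < \<bar>s\<bar>" unfolding A_def by (auto dest: spec[of _ 0])
    next
      assume s: "\<epsilon> < \<bar>s\<bar>"
      have "\<epsilon> < \<bar>s - 2 * of_int k\<bar>" for k :: int
      proof (cases "k = 0")
        case False
        then have "1 \<le> \<bar>real_of_int k\<bar>" by linarith
        then have "1 \<le> \<bar>s - 2 * of_int k\<bar>" using True by linarith
        then show ?thesis using \<epsilon> by linarith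
      qed (use s in simp)
      then show "x - s \<in> A" by (simp add: A_def)
    qed
    then show ?thesis using True by (auto simp: G_def cot_cut_def indicator_def abs_less_iff)
  next
    case False
    then show ?thesis
    proof (cases "s = 1")
      case s: True
      \<comment> \<open>The included end point x - 1 of the shifted period corresponds to s = 1,
        where the cotangent vanishes.\<close>
      then show ?thesis by (simp add: G_def cot_cut_def cot_def)
    qed (auto simp: cot_cut_def indicator_def)
  qed
  have iG: "integrable lborel (\<lambda>t. indicat_real {x - 1..<x + 1} t *\<^sub>R G t)"
    by (rule integrable_bounded_support[of _ "B * (1 / \<epsilon>)" "\<bar>x\<bar> + 1"])
       (use Gm GB B0 \<epsilon> in \<open>auto simp: indicator_def\<close>)
  show "integrable lborel (\<lambda>s. \<psi> (x - s) * of_real (indicat_real {s. \<epsilon> < \<bar>s\<bar>} s * cot_cut s))"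
    using lborel_integrable_reflect[OF iG, of x] unfolding G2 .
  have "(LINT t:{t \<in> {-1..1}. \<forall>k::int. \<bar>x - t - 2 * of_int k\<bar> > \<epsilon>}|lborel. \<psi> t * complex_of_real (cot (pi * (x - t) / 2)))
    = (LINT t|lborel. indicat_real {-1..1} t *\<^sub>R G t)"
    unfolding set_lebesgue_integral_def G_def A_def
    by (intro Bochner_Integration.integral_cong) (auto simp: indicator_def)
  also have "\<dots> = (LINT t|lborel. indicat_real {-1..<1} t *\<^sub>R G t)"
  proof (rule integral_cong_AE)
    show "AE t in lborel. indicat_real {-1..1} t *\<^sub>R G t = indicat_real {-1..<1} t *\<^sub>R G t"
      using AE_lborel_singleton[of "1::real"] by eventually_elim (auto simp: indicator_def)
  qed (use Gm in measurable)
  also have "\<dots> = (LINT t|lborel. indicat_real {x - 1..<x + 1} t *\<^sub>R G t)"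
    by (rule integral_period_shift[OF Gper Gm GB])
  also have "\<dots> = (LINT s|lborel. \<psi> (x - s) * of_real (indicat_real {s. \<epsilon> < \<bar>s\<bar>} s * cot_cut s))"
    by (subst lborel_integral_reflect[of _ x]) (simp only: G2)
  finally show "(LINT t:{t \<in> {-1..1}. \<forall>k::int. \<bar>x - t - 2 * of_int k\<bar> > \<epsilon>}|lborel. \<psi> t * complex_of_real (cot (pi * (x - t) / 2)))
    = (LINT s|lborel. \<psi> (x - s) * of_real (indicat_real {s. \<epsilon> < \<bar>s\<bar>} s * cot_cut s))" .
qed

lemma hilbert2_eq:
  assumes s: "smooth \<psi>" and per: "\<And>x. \<psi> (x + 2) = \<psi> x"
  shows "hilbert2 \<psi> x = hilbert2_int \<psi> x"
proof -
  have m[measurable]: "\<psi> \<in> borel_measurable borel" by (rule smooth_measurable[OF s])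
  obtain B where B: "0 \<le> B" "\<And>x. norm (\<psi> x) \<le> B" using periodic_smooth_bounded[OF s per] by blast
  obtain L where L: "0 \<le> L" "\<And>x y. norm (\<psi> x - \<psi> y) \<le> L * \<bar>x - y\<bar>" using periodic_smooth_lipschitz[OF s per] by blast
  define D where "D s = (\<psi> (x - s) - \<psi> (x + s)) * of_real (cot_cut s)" for s
  have [measurable]: "D \<in> borel_measurable borel" unfolding D_def by measurable
  have DB: "norm (D s) \<le> 2 * L * indicat_real {-1<..<1} s" for s
    unfolding D_def by (rule hilbert2_int_integrand_bound[OF L(2,1)])
  have "((\<lambda>\<epsilon>. LINT s|lborel. indicat_real {s. \<epsilon> < \<bar>s\<bar>} s *\<^sub>R D s) \<longlongrightarrow> (LINT s|lborel. D s)) (at_right 0)"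
  proof (rule integral_dominated_convergence_within[OF _ _ integrable_indicator_I1[of "2 * L"]])
    show "AE s in lborel. norm (indicat_real {s. y < \<bar>s\<bar>} s *\<^sub>R D s) \<le> 2 * L * indicat_real {-1<..<1} s" for y
      by (intro AE_I2 order_trans[OF _ DB]) (auto simp: indicator_def)
    show "AE s in lborel. ((\<lambda>\<epsilon>. indicat_real {s. \<epsilon> < \<bar>s\<bar>} s *\<^sub>R D s) \<longlongrightarrow> D s) (at_right 0)"
    proof (rule AE_I2)
      fix s :: real
      show "((\<lambda>\<epsilon>. indicat_real {s. \<epsilon> < \<bar>s\<bar>} s *\<^sub>R D s) \<longlongrightarrow> D s) (at_right 0)"
      proof (cases "s = 0")
        case False
        then have "eventually (\<lambda>\<epsilon>. \<epsilon> \<in> {0<..<\<bar>s\<bar>}) (at_right 0)" by (intro eventually_at_right_real) auto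
        then have "eventually (\<lambda>\<epsilon>. indicat_real {s. \<epsilon> < \<bar>s\<bar>} s *\<^sub>R D s = D s) (at_right 0)"
          by eventually_elim (auto simp: indicator_def)
        then show ?thesis by (rule tendsto_eventually)
      qed (simp add: D_def)
    qed
  qed measurable
  then have lim: "((\<lambda>\<epsilon>. (LINT s|lborel. indicat_real {s. \<epsilon> < \<bar>s\<bar>} s *\<^sub>R D s) / 2) \<longlongrightarrow> (LINT s|lborel. D s) / 2) (at_right 0)"
    by (intro tendsto_intros) auto
  have "eventually (\<lambda>\<epsilon>. \<epsilon> \<in> {0<..<1}) (at_right (0::real))" by (intro eventually_at_right_real) auto
  then have "eventually (\<lambda>\<epsilon>. (LINT s|lborel. indicat_real {s. \<epsilon> < \<bar>s\<bar>} s *\<^sub>R D s) / 2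
    = (LINT t:{t \<in> {-1..1}. \<forall>k::int. \<bar>x - t - 2 * of_int k\<bar> > \<epsilon>}|lborel. \<psi> t * complex_of_real (cot (pi * (x - t) / 2)))) (at_right 0)"
  proof eventually_elim
    case (elim \<epsilon>)
    then have e: "0 < \<epsilon>" "\<epsilon> < 1" by auto
    have "(LINT s|lborel. \<psi> (x - s) * of_real (indicat_real {s. \<epsilon> < \<bar>s\<bar>} s * cot_cut s))
      = (LINT s|lborel. (\<psi> (x - s) - \<psi> (x + s)) * of_real (indicat_real {s. \<epsilon> < \<bar>s\<bar>} s * cot_cut s)) / 2"
      by (rule antisymmetrize[OF _ truncated_periodic(2)[OF m per B(2) e]]) (auto simp: cot_cut_odd indicator_def)
    also have "(LINT s|lborel. (\<psi> (x - s) - \<psi> (x + s)) * of_real (indicat_real {s. \<epsilon> < \<bar>s\<bar>} s * cot_cut s))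
      = (LINT s|lborel. indicat_real {s. \<epsilon> < \<bar>s\<bar>} s *\<^sub>R D s)"
      by (intro Bochner_Integration.integral_cong) (auto simp: D_def scaleR_conv_of_real)
    finally show ?case using truncated_periodic(1)[OF m per B(2) e, of x] by simp
  qed
  from tendsto_Lim[OF _ Lim_transform_eventually[OF lim this]]
  have "Lim (at_right 0) (\<lambda>\<epsilon>. LINT t:{t \<in> {-1..1}. \<forall>k::int. \<bar>x - t - 2 * of_int k\<bar> > \<epsilon>}|lborel. \<psi> t * complex_of_real (cot (pi * (x - t) / 2)))
    = (LINT s|lborel. D s) / 2" by simp
  then show ?thesis unfolding hilbert2_def hilbert2_int_def D_def by (simp only:) simp
qed

section \<open>Smoothness of the periodic Hilbert transform\<close>

lemma has_vector_derivative_at_iff: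
  fixes f :: "real \<Rightarrow> complex"
  assumes "((\<lambda>h. (f (x + h) - f x) / of_real h) \<longlongrightarrow> D) (at 0)"
  shows "(f has_vector_derivative D) (at x)"
proof -
  have "((\<lambda>h. norm ((f (x + h) - f x) / of_real h - D)) \<longlongrightarrow> norm (D - D)) (at 0)"
    by (intro tendsto_intros assms)
  then have "((\<lambda>h. norm ((f (x + h) - f x) / of_real h - D)) \<longlongrightarrow> 0) (at 0)" by simp
  moreover have "\<forall>\<^sub>F h in at 0. norm ((f (x + h) - f x) / of_real h - D) = norm (f (x + h) - f x - h *\<^sub>R D) / norm h"
  proof -
    have "norm ((f (x + h) - f x) / of_real h - D) = norm (f (x + h) - f x - h *\<^sub>R D) / norm h" if "h \<noteq> 0" for h
    proof -
      have "(f (x + h) - f x) / of_real h - D = (f (x + h) - f x - h *\<^sub>R D) / of_real h"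
        using that by (simp add: scaleR_conv_of_real diff_divide_distrib)
      then show ?thesis by (simp add: norm_divide)
    qed
    then show ?thesis by (simp add: eventually_at_filter)
  qed
  ultimately have "((\<lambda>h. norm (f (x + h) - f x - h *\<^sub>R D) / norm h) \<longlongrightarrow> 0) (at 0)"
    by (rule Lim_transform_eventually)
  then show ?thesis unfolding has_vector_derivative_def has_derivative_at
    by (simp add: bounded_linear_scaleR_left)
qed

lemma has_vector_derivative_quotient:
  fixes f :: "real \<Rightarrow> complex"
  assumes "(f has_vector_derivative D) (at x)"
  shows "((\<lambda>h. (f (x + h) - f x) / of_real h) \<longlongrightarrow> D) (at 0)"
proof -
  have "((\<lambda>h. norm (f (x + h) - f x - h *\<^sub>R D) / norm h) \<longlongrightarrow> 0) (at 0)"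
    using assms unfolding has_vector_derivative_def has_derivative_at by blast
  moreover have "\<forall>\<^sub>F h in at 0. norm (f (x + h) - f x - h *\<^sub>R D) / norm h = norm ((f (x + h) - f x) / of_real h - D)"
  proof -
    have "norm (f (x + h) - f x - h *\<^sub>R D) / norm h = norm ((f (x + h) - f x) / of_real h - D)" if "h \<noteq> 0" for h
    proof -
      have "(f (x + h) - f x) / of_real h - D = (f (x + h) - f x - h *\<^sub>R D) / of_real h"
        using that by (simp add: scaleR_conv_of_real diff_divide_distrib)
      then show ?thesis by (simp add: norm_divide)
    qed
    then show ?thesis by (simp add: eventually_at_filter)
  qed
  ultimately have "((\<lambda>h. norm ((f (x + h) - f x) / of_real h - D)) \<longlongrightarrow> 0) (at 0)"
    by (rule Lim_transform_eventually)
  then have "((\<lambda>h. (f (x + h) - f x) / of_real h - D) \<longlongrightarrow> 0) (at 0)" by (rule tendsto_norm_zero_cancel)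
  then show ?thesis by (rule LIM_zero_cancel)
qed

text \<open>Differentiation under the integral sign. The difference quotients of \<psi> are
  Lipschitz with the Lipschitz constant of its derivative, uniformly in h, and this compensates for
  the singularity of the kernel in the dominating function.\<close>

lemma hilbert2_int_has_derivative:
  assumes s: "smooth \<psi>" and per: "\<And>x. \<psi> (x + 2) = \<psi> x"
  shows "(hilbert2_int \<psi> has_vector_derivative hilbert2_int (vderiv \<psi>) x) (at x)"
proof (rule has_vector_derivative_at_iff)
  have m[measurable]: "\<psi> \<in> borel_measurable borel" "vderiv \<psi> \<in> borel_measurable borel"
    by (intro smooth_measurable s smooth_vderiv)+
  obtain L where L: "0 \<le> L" "\<And>x y. norm (\<psi> x - \<psi> y) \<le> L * \<bar>x - y\<bar>" using periodic_smooth_lipschitz[OF s per] by blast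
  obtain L2 where L2: "0 \<le> L2" "\<And>x y. norm (vderiv \<psi> x - vderiv \<psi> y) \<le> L2 * \<bar>x - y\<bar>"
    using periodic_smooth_lipschitz[OF smooth_vderiv[OF s] periodic_smooth_vderiv[OF s per]] by blast
  define Q where "Q h y = (\<psi> (y + h) - \<psi> y) / of_real h" for h y
  have [measurable]: "Q h \<in> borel_measurable borel" for h unfolding Q_def by measurable
  have Qlip: "norm (Q h u - Q h v) \<le> L2 * \<bar>u - v\<bar>" for h u v
  proof (cases "h = 0")
    case False
    have "norm ((\<psi> (u + h) - \<psi> u) - (\<psi> (v + h) - \<psi> v)) \<le> (L2 * \<bar>h\<bar>) * \<bar>u - v\<bar>"
    proof (rule lipschitz_of_bounded_derivative[of "\<lambda>u. \<psi> (u + h) - \<psi> u" "\<lambda>u. vderiv \<psi> (u + h) - vderiv \<psi> u"])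
      fix y
      have 1: "((\<lambda>x. x + h) has_vector_derivative 1) (at y)"
        by (auto intro!: derivative_eq_intros simp flip: has_real_derivative_iff_has_vector_derivative)
      from vector_diff_chain_at[OF 1 smooth_has_vderiv[OF s]]
      have "((\<lambda>y. \<psi> (y + h)) has_vector_derivative vderiv \<psi> (y + h)) (at y)" by (simp add: o_def)
      then show "((\<lambda>u. \<psi> (u + h) - \<psi> u) has_vector_derivative vderiv \<psi> (y + h) - vderiv \<psi> y) (at y)"
        by (intro has_vector_derivative_diff smooth_has_vderiv s)
      show "norm (vderiv \<psi> (y + h) - vderiv \<psi> y) \<le> L2 * \<bar>h\<bar>" using L2(2)[of "y + h" y] by simp
    qed
    then show ?thesis using False unfolding Q_def diff_divide_distrib[symmetric] norm_divide
      by (simp add: divide_le_eq mult_ac)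
  qed (use L2(1) in \<open>simp add: Q_def\<close>)
  have intK: "integrable lborel (\<lambda>s. (\<psi> (x - s) - \<psi> (x + s)) * of_real (cot_cut s))" for x
    by (rule Bochner_Integration.integrable_bound[OF integrable_indicator_I1[of "2 * L"]])
       (use hilbert2_int_integrand_bound[OF L(2,1)] in \<open>auto intro!: AE_I2 order_trans[OF _ abs_ge_self]\<close>)
  have quot: "(hilbert2_int \<psi> (x + h) - hilbert2_int \<psi> x) / of_real h = (LINT s|lborel. (Q h (x - s) - Q h (x + s)) * of_real (cot_cut s)) / 4" for h
  proof -
    have a: "hilbert2_int \<psi> (x + h) - hilbert2_int \<psi> x = (LINT s|lborel. (\<psi> (x + h - s) - \<psi> (x + h + s)) * of_real (cot_cut s) - (\<psi> (x - s) - \<psi> (x + s)) * of_real (cot_cut s)) / 4"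
      unfolding hilbert2_int_def by (subst Bochner_Integration.integral_diff) (simp_all add: intK diff_divide_distrib)
    have "(hilbert2_int \<psi> (x + h) - hilbert2_int \<psi> x) / of_real h = (LINT s|lborel. ((\<psi> (x + h - s) - \<psi> (x + h + s)) * of_real (cot_cut s) - (\<psi> (x - s) - \<psi> (x + s)) * of_real (cot_cut s)) / of_real h) / 4"
      unfolding a integral_divide_zero by simp
    also have "(\<lambda>s. ((\<psi> (x + h - s) - \<psi> (x + h + s)) * of_real (cot_cut s) - (\<psi> (x - s) - \<psi> (x + s)) * of_real (cot_cut s)) / of_real h)
      = (\<lambda>s. (Q h (x - s) - Q h (x + s)) * of_real (cot_cut s))"
    proof
      fix s
      have alg: "((p - q) * c - (u - v) * c) / d = ((p - u) / d - (q - v) / d) * c" for p q u v c d :: complex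
        by (cases "d = 0") (simp_all add: field_simps)
      have e: "x - s + h = x + h - s" "x + s + h = x + h + s" by simp_all
      show "((\<psi> (x + h - s) - \<psi> (x + h + s)) * of_real (cot_cut s) - (\<psi> (x - s) - \<psi> (x + s)) * of_real (cot_cut s)) / of_real h
        = (Q h (x - s) - Q h (x + s)) * of_real (cot_cut s)"
        unfolding Q_def e by (rule alg)
    qed
    finally show ?thesis .
  qed
  have "((\<lambda>h. LINT s|lborel. (Q h (x - s) - Q h (x + s)) * of_real (cot_cut s)) \<longlongrightarrow> (LINT s|lborel. (vderiv \<psi> (x - s) - vderiv \<psi> (x + s)) * of_real (cot_cut s))) (at 0)"
  proof (rule integral_dominated_convergence_within[OF _ _ integrable_indicator_I1[of "2 * L2"]])
    show "AE s in lborel. norm ((Q h (x - s) - Q h (x + s)) * of_real (cot_cut s)) \<le> 2 * L2 * indicat_real {-1<..<1} s" for h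
      by (rule AE_I2, rule hilbert2_int_integrand_bound[OF Qlip L2(1)])
    show "AE s in lborel. ((\<lambda>h. (Q h (x - s) - Q h (x + s)) * of_real (cot_cut s)) \<longlongrightarrow> (vderiv \<psi> (x - s) - vderiv \<psi> (x + s)) * of_real (cot_cut s)) (at 0)"
      unfolding Q_def by (intro AE_I2 tendsto_intros has_vector_derivative_quotient smooth_has_vderiv s)
  qed measurable
  then show "((\<lambda>h. (hilbert2_int \<psi> (x + h) - hilbert2_int \<psi> x) / of_real h) \<longlongrightarrow> hilbert2_int (vderiv \<psi>) x) (at 0)"
    unfolding quot unfolding hilbert2_int_def by (intro tendsto_intros) auto
qed

lemma hilbert2_int_periodic:
  assumes "\<And>x. \<psi> (x + 2) = \<psi> x" shows "hilbert2_int \<psi> (x + 2) = hilbert2_int \<psi> x"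
proof -
  have "\<psi> (x + 2 - s) = \<psi> (x - s)" "\<psi> (x + 2 + s) = \<psi> (x + s)" for s
    using assms[of "x - s"] assms[of "x + s"] by (simp_all add: algebra_simps)
  then show ?thesis by (simp add: hilbert2_int_def)
qed

lemma hilbert2_int_smooth:
  assumes s: "smooth \<psi>" and per: "\<And>x. \<psi> (x + 2) = \<psi> x"
  shows "smooth (hilbert2_int \<psi>)"
proof (rule smooth_coinduct[of _ "{hilbert2_int \<psi> |\<psi>. smooth \<psi> \<and> (\<forall>x. \<psi> (x + 2) = \<psi> x)}"])
  show "hilbert2_int \<psi> \<in> {hilbert2_int \<psi> |\<psi>. smooth \<psi> \<and> (\<forall>x. \<psi> (x + 2) = \<psi> x)}" using assms by blast
  fix f assume "f \<in> {hilbert2_int \<psi> |\<psi>. smooth \<psi> \<and> (\<forall>x. \<psi> (x + 2) = \<psi> x)}"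
  then obtain \<psi> where f: "f = hilbert2_int \<psi>" and \<psi>: "smooth \<psi>" "\<And>x. \<psi> (x + 2) = \<psi> x" by blast
  have mem: "hilbert2_int (vderiv \<psi>) \<in> {hilbert2_int \<psi> |\<psi>. smooth \<psi> \<and> (\<forall>x. \<psi> (x + 2) = \<psi> x)}"
    using smooth_vderiv[OF \<psi>(1)] periodic_smooth_vderiv[OF \<psi>] by blast
  show "\<exists>f'\<in>{hilbert2_int \<psi> |\<psi>. smooth \<psi> \<and> (\<forall>x. \<psi> (x + 2) = \<psi> x)}. \<forall>x. (f has_vector_derivative f' x) (at x)"
    by (rule bexI[rotated, OF mem], rule allI) (simp add: f hilbert2_int_has_derivative[OF \<psi>])
qed

text \<open>The functional inside \<open>hilbert2_dist\<close> is evaluated at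
  \<open>hilbert2 \<psi>\<close> and, for the functionals in use, has the default value 0 off the
  periodic test functions; membership ensures that the intended pairing is obtained.\<close>

lemma hilbert2_periodic_test_function:
  assumes "\<psi> \<in> periodic_test_functions"
  shows "hilbert2 \<psi> = hilbert2_int \<psi>" "hilbert2 \<psi> \<in> periodic_test_functions"
proof -
  have \<psi>: "smooth \<psi>" "\<And>x. \<psi> (x + 2) = \<psi> x" using assms by (auto simp: periodic_test_functions_def)
  show 1: "hilbert2 \<psi> = hilbert2_int \<psi>" using hilbert2_eq[OF \<psi>] by blast
  show "hilbert2 \<psi> \<in> periodic_test_functions"
    unfolding 1 periodic_test_functions_def using hilbert2_int_smooth[OF \<psi>] hilbert2_int_periodic[of \<psi>, OF \<psi>(2)] by blast
qed

section \<open>Partial fractions of the cotangent\<close>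

lemma cot_partial_fractions_aux:
  fixes x :: real
  assumes x: "0 < x" "x < 1"
  shows "(\<lambda>m. \<Sum>n<m. inverse (x + of_nat n) - inverse (1 - x + of_nat n)) \<longlonglongrightarrow> pi * cot (pi * x)"
proof -
  have pos: "0 < y \<Longrightarrow> y < 1 \<Longrightarrow> y \<notin> \<int>\<^sub>\<le>\<^sub>0" for y :: real by (auto elim!: nonpos_Ints_cases)
  have sinpos: "0 < sin (pi * y)" if "0 < y" "y < 1" for y using that by (intro sin_gt_zero) auto
  have refl: "Gamma y * Gamma (1 - y) = pi / sin (pi * y)" for y :: real
  proof -
    have "complex_of_real (Gamma y * Gamma (1 - y)) = Gamma (complex_of_real y) * Gamma (1 - complex_of_real y)"
      by (simp flip: Gamma_complex_of_real)
    also have "\<dots> = complex_of_real (pi / sin (pi * y))"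
      unfolding Gamma_reflection_complex by (simp flip: sin_of_real)
    finally show ?thesis unfolding of_real_eq_iff .
  qed
  \<comment> \<open>Both sides of Euler's reflection formula are differentiated. Division by the
    common value gives Digamma (1 - x) - Digamma x = pi cot (pi x), and in the limit formulas for
    Digamma the logarithms cancel.\<close>
  have d1: "((\<lambda>y. Gamma y * Gamma (1 - y)) has_real_derivative Gamma x * Gamma (1 - x) * (Digamma x - Digamma (1 - x))) (at x)"
    using pos[of x] pos[of "1 - x"] x by (auto intro!: derivative_eq_intros simp: algebra_simps)
  have d2: "((\<lambda>y. pi / sin (pi * y)) has_real_derivative - (pi * (pi * cos (pi * x)) / (sin (pi * x))\<^sup>2)) (at x)"
    using sinpos[OF x] by (auto intro!: derivative_eq_intros simp: power2_eq_square)
  have "Gamma x * Gamma (1 - x) * (Digamma x - Digamma (1 - x)) = - (pi * (pi * cos (pi * x)) / (sin (pi * x))\<^sup>2)"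
    using DERIV_unique[OF d1] d2 unfolding refl by blast
  then have "pi / sin (pi * x) * (Digamma x - Digamma (1 - x)) = pi / sin (pi * x) * (- (pi * cot (pi * x)))"
    unfolding refl by (simp add: cot_def power2_eq_square)
  moreover have "pi / sin (pi * x) \<noteq> 0" using sinpos[OF x] by simp
  ultimately have "Digamma x - Digamma (1 - x) = - (pi * cot (pi * x))" using mult_left_cancel by blast
  then have D: "Digamma (1 - x) - Digamma x = pi * cot (pi * x)" by simp
  have "(\<lambda>m. (of_real (ln (real m)) - (\<Sum>n<m. inverse (1 - x + of_nat n))) - (of_real (ln (real m)) - (\<Sum>n<m. inverse (x + of_nat n)))) \<longlonglongrightarrow> Digamma (1 - x) - Digamma x"
    using x by (intro tendsto_diff Digamma_LIMSEQ) auto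
  then show ?thesis unfolding D by (simp add: sum_subtractf)
qed

text \<open>The regular part at 0 of the kernel of the periodic Hilbert transform, with value 0 at 0 as \<open>1 / 0 = 0\<close>.\<close>

definition cot_regular :: "real \<Rightarrow> real" where
  "cot_regular s = cot (pi * s / 2) / 2 - 1 / (pi * s)"

text \<open>The poles at 2 (n + 1) and -2 (n + 1) are taken together; singly, the series would not
  converge absolutely.\<close>

definition cot_term :: "real \<Rightarrow> nat \<Rightarrow> real" where
  "cot_term s n = 1 / (s - 2 * real (Suc n)) + 1 / (s + 2 * real (Suc n))"

lemma cot_regular_measurable [measurable]: "cot_regular \<in> borel_measurable borel"
  unfolding cot_regular_def cot_def by measurable

lemma cot_term_odd: "cot_term (- s) n = - cot_term s n"
proof -
  have e: "- s - a = - (s + a)" "- s + a = - (s - a)" for a by simp_all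
  show ?thesis unfolding cot_term_def e by (simp add: minus_divide_right)
qed

text \<open>With x = s / 2, the first series in \<open>cot_partial_fractions_aux\<close> carries the
  poles at s = -2 n and the second those at s = 2 n + 2. Splitting off the pole at 0 and pairing the
  others leaves the unpaired term 1 / (N + 1 - x), which tends to 0.\<close>

lemma cot_regular_sums_pos:
  assumes s: "0 < s" "s < 2"
  shows "(\<lambda>N. \<Sum>n<N. cot_term s n) \<longlonglongrightarrow> pi * cot_regular s"
proof -
  define x where "x = s / 2"
  have x: "0 < x" "x < 1" using s by (auto simp: x_def)
  have fin: "(\<Sum>n<Suc N. inverse (x + of_nat n) - inverse (1 - x + of_nat n))
      = 1 / x + 2 * (\<Sum>n<N. cot_term s n) - 1 / (real (Suc N) - x)" for N
  proof (induction N)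
    case 0
    then show ?case by (simp add: inverse_eq_divide)
  next
    case (Suc N)
    have e1: "inverse (x + of_nat (Suc N)) = 2 * (1 / (s + 2 * real (Suc N)))" by (simp add: x_def field_simps)
    have e2: "1 / (real (Suc N) - x) = - 2 * (1 / (s - 2 * real (Suc N)))"
    proof -
      have "s - 2 * real (Suc N) \<noteq> 0" "real (Suc N) - x \<noteq> 0" using s x by auto
      then show ?thesis by (simp add: x_def field_simps)
    qed
    have e3: "inverse (1 - x + of_nat (Suc N)) = 1 / (real (Suc (Suc N)) - x)" by (simp add: inverse_eq_divide algebra_simps)
    have "(\<Sum>n<Suc (Suc N). inverse (x + of_nat n) - inverse (1 - x + of_nat n))
      = (1 / x + 2 * (\<Sum>n<N. cot_term s n) - 1 / (real (Suc N) - x)) + (inverse (x + of_nat (Suc N)) - inverse (1 - x + of_nat (Suc N)))"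
      using Suc by simp
    then show ?case unfolding e1 e2 e3 by (simp add: cot_term_def)
  qed
  have "(\<lambda>N. \<Sum>n<Suc N. inverse (x + of_nat n) - inverse (1 - x + of_nat n)) \<longlonglongrightarrow> pi * cot (pi * x)"
    using cot_partial_fractions_aux[OF x] by (rule LIMSEQ_Suc)
  then have "(\<lambda>N. 1 / x + 2 * (\<Sum>n<N. cot_term s n) - 1 / (real (Suc N) - x)) \<longlonglongrightarrow> pi * cot (pi * x)"
    unfolding fin .
  moreover have "(\<lambda>N. 1 / (real (Suc N) - x)) \<longlonglongrightarrow> 0" by real_asymp
  ultimately have "(\<lambda>N. ((1 / x + 2 * (\<Sum>n<N. cot_term s n) - 1 / (real (Suc N) - x)) + 1 / (real (Suc N) - x) - 1 / x) / 2) \<longlonglongrightarrow> (pi * cot (pi * x) + 0 - 1 / x) / 2"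
    by (intro tendsto_intros) auto
  moreover have "(pi * cot (pi * x) + 0 - 1 / x) / 2 = pi * cot_regular s"
    using s by (simp add: cot_regular_def x_def field_simps)
  ultimately show ?thesis by simp
qed

lemma cot_regular_sums:
  assumes "\<bar>s\<bar> < 2"
  shows "(\<lambda>N. \<Sum>n<N. cot_term s n) \<longlonglongrightarrow> pi * cot_regular s"
proof (cases s "0::real" rule: linorder_cases)
  case greater
  then show ?thesis using cot_regular_sums_pos assms by simp
next
  case equal
  moreover have "cot_term 0 n = 0" for n using cot_term_odd[of 0 n] by simp
  ultimately show ?thesis by (simp add: cot_regular_def)
next
  case less
  have "cot_regular s = - cot_regular (- s)" using cot_minus_real[of "pi * s / 2"] by (simp add: cot_regular_def)
  then show ?thesis using tendsto_minus[OF cot_regular_sums_pos[of "- s"]] less assms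
    by (simp add: cot_term_odd sum_negf)
qed

text \<open>For |u| \<le> r < 2 and m = n + 1, the distance from u to the poles 2 m and -2 m is at
  least (2 - r) m, so each summand is Lipschitz with constant 1 / ((2 - r) m)^2. Summation over n
  then produces the Basel value pi^2 / 6.\<close>

lemma cot_term_lipschitz:
  assumes "\<bar>s\<bar> \<le> r" "\<bar>s'\<bar> \<le> r" "r < 2"
  shows "\<bar>cot_term s n - cot_term s' n\<bar> \<le> (2 / (2 - r)\<^sup>2 * \<bar>s - s'\<bar>) * (1 / (real n + 1)\<^sup>2)"
proof -
  define m where "m = real n + 1"
  have m: "1 \<le> m" by (simp add: m_def)
  have low: "(2 - r) * m \<le> \<bar>u + c * (2 * m)\<bar>" if "\<bar>u\<bar> \<le> r" "\<bar>c\<bar> = 1" for u c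
  proof -
    have "r * 1 \<le> r * m" using m that(1) by (intro mult_left_mono) auto
    then have "(2 - r) * m \<le> 2 * m - \<bar>u\<bar>" using that(1) by (simp add: algebra_simps)
    also have "\<dots> = \<bar>c * (2 * m)\<bar> - \<bar>u\<bar>" using that(2) m by (simp add: abs_mult)
    finally show ?thesis by linarith
  qed
  have pos: "0 < (2 - r) * m" using m assms(3) by simp
  have diff: "\<bar>1 / (s + c * (2 * m)) - 1 / (s' + c * (2 * m))\<bar> \<le> \<bar>s - s'\<bar> / ((2 - r)\<^sup>2 * m\<^sup>2)" if c: "\<bar>c\<bar> = 1" for c
  proof -
    let ?a = "s + c * (2 * m)" and ?b = "s' + c * (2 * m)"
    have a: "(2 - r) * m \<le> \<bar>?a\<bar>" "(2 - r) * m \<le> \<bar>?b\<bar>" using low assms c by auto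
    then have nz: "?a \<noteq> 0" "?b \<noteq> 0" using pos by auto
    have "1 / ?a - 1 / ?b = (s' - s) / (?a * ?b)" using nz by (simp add: field_simps)
    then have "\<bar>1 / ?a - 1 / ?b\<bar> = \<bar>s - s'\<bar> / (\<bar>?a\<bar> * \<bar>?b\<bar>)" by (simp add: abs_mult abs_minus_commute)
    also have "\<dots> \<le> \<bar>s - s'\<bar> / (((2 - r) * m) * ((2 - r) * m))"
    proof (rule divide_left_mono)
      show "(2 - r) * m * ((2 - r) * m) \<le> \<bar>?a\<bar> * \<bar>?b\<bar>"
        using a pos by (intro mult_mono) auto
      show "0 < \<bar>?a\<bar> * \<bar>?b\<bar> * ((2 - r) * m * ((2 - r) * m))"
      proof (rule mult_pos_pos[OF _ mult_pos_pos[OF pos pos]])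
        show "0 < \<bar>?a\<bar> * \<bar>?b\<bar>" using nz by simp
      qed
    qed simp
    finally show ?thesis by (simp add: power2_eq_square mult_ac)
  qed
  have "cot_term s n - cot_term s' n = (1 / (s + (-1) * (2 * m)) - 1 / (s' + (-1) * (2 * m))) + (1 / (s + 1 * (2 * m)) - 1 / (s' + 1 * (2 * m)))"
  proof -
    have e: "s + (-1) * (2 * m) = s - 2 * real (Suc n)" "s' + (-1) * (2 * m) = s' - 2 * real (Suc n)"
      "s + 1 * (2 * m) = s + 2 * real (Suc n)" "s' + 1 * (2 * m) = s' + 2 * real (Suc n)"
      by (simp_all add: m_def)
    show ?thesis unfolding e cot_term_def by simp
  qed
  then have "\<bar>cot_term s n - cot_term s' n\<bar> \<le> \<bar>s - s'\<bar> / ((2 - r)\<^sup>2 * m\<^sup>2) + \<bar>s - s'\<bar> / ((2 - r)\<^sup>2 * m\<^sup>2)"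
    using diff[of "-1"] diff[of 1] by linarith
  also have "\<dots> = (2 / (2 - r)\<^sup>2 * \<bar>s - s'\<bar>) * (1 / m\<^sup>2)" by simp
  finally show ?thesis unfolding m_def .
qed

lemma cot_sum_lipschitz:
  assumes "\<bar>s\<bar> \<le> r" "\<bar>s'\<bar> \<le> r" "r < 2"
  shows "\<bar>(\<Sum>n<N. cot_term s n) - (\<Sum>n<N. cot_term s' n)\<bar> \<le> (2 / (2 - r)\<^sup>2 * \<bar>s - s'\<bar>) * (pi\<^sup>2 / 6)"
proof -
  have "\<bar>(\<Sum>n<N. cot_term s n) - (\<Sum>n<N. cot_term s' n)\<bar> = \<bar>\<Sum>n<N. cot_term s n - cot_term s' n\<bar>"
    by (simp add: sum_subtractf)
  also have "\<dots> \<le> (\<Sum>n<N. \<bar>cot_term s n - cot_term s' n\<bar>)" by (rule sum_abs)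
  also have "\<dots> \<le> (\<Sum>n<N. (2 / (2 - r)\<^sup>2 * \<bar>s - s'\<bar>) * (1 / (real n + 1)\<^sup>2))"
    by (intro sum_mono cot_term_lipschitz assms)
  also have "\<dots> = (2 / (2 - r)\<^sup>2 * \<bar>s - s'\<bar>) * (\<Sum>n<N. 1 / (real n + 1)\<^sup>2)" by (simp only: sum_distrib_left)
  also have "\<dots> \<le> (2 / (2 - r)\<^sup>2 * \<bar>s - s'\<bar>) * (pi\<^sup>2 / 6)"
  proof (rule mult_left_mono)
    show "(\<Sum>n<N. 1 / (real n + 1)\<^sup>2) \<le> pi\<^sup>2 / 6"
    using sum_le_suminf[OF sums_summable[OF inverse_squares_sums], of "{..<N}"] sums_unique[OF inverse_squares_sums]
    by (simp add: add.commute)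
  qed simp
  finally show ?thesis .
qed

lemma cot_regular_lipschitz:
  assumes "\<bar>s\<bar> \<le> r" "\<bar>s'\<bar> \<le> r" "r < 2"
  shows "\<bar>cot_regular s - cot_regular s'\<bar> \<le> (2 / (2 - r)\<^sup>2 * (pi\<^sup>2 / 6)) * \<bar>s - s'\<bar>"
proof -
  let ?C = "(2 / (2 - r)\<^sup>2 * \<bar>s - s'\<bar>) * (pi\<^sup>2 / 6)"
  have "(\<lambda>N. \<bar>(\<Sum>n<N. cot_term s n) - (\<Sum>n<N. cot_term s' n)\<bar>) \<longlonglongrightarrow> \<bar>pi * cot_regular s - pi * cot_regular s'\<bar>"
    using assms by (intro tendsto_intros cot_regular_sums) auto
  then have "\<bar>pi * cot_regular s - pi * cot_regular s'\<bar> \<le> ?C"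
    by (rule LIMSEQ_le_const2) (use cot_sum_lipschitz[OF assms] in blast)
  then have le: "pi * \<bar>cot_regular s - cot_regular s'\<bar> \<le> ?C"
    by (simp only: abs_mult right_diff_distrib[symmetric]) simp
  have "1 * \<bar>cot_regular s - cot_regular s'\<bar> \<le> pi * \<bar>cot_regular s - cot_regular s'\<bar>" using pi_gt3 by (intro mult_right_mono) auto
  from order_trans[OF this le] have "\<bar>cot_regular s - cot_regular s'\<bar> \<le> ?C" by (simp only: mult_1_left)
  then show ?thesis by (simp add: mult_ac)
qed

lemma cot_regular_bound:
  assumes "\<bar>s\<bar> \<le> r" "r < 2"
  shows "\<bar>cot_regular s\<bar> \<le> (2 / (2 - r)\<^sup>2 * (pi\<^sup>2 / 6)) * r"
proof -
  have "\<bar>cot_regular s - cot_regular 0\<bar> \<le> (2 / (2 - r)\<^sup>2 * (pi\<^sup>2 / 6)) * \<bar>s - 0\<bar>"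
    using assms by (intro cot_regular_lipschitz) auto
  also have "\<dots> \<le> (2 / (2 - r)\<^sup>2 * (pi\<^sup>2 / 6)) * r" using assms by (intro mult_left_mono) auto
  finally show ?thesis by (simp add: cot_regular_def)
qed

subsection \<open>Periodization of a real test function\<close>

lemma Pi2_fun_eq_pi2:
  assumes "\<And>x. 1 \<le> \<bar>x\<bar> \<Longrightarrow> \<phi> x = 0"
  shows "Pi2_fun \<phi> x = \<phi> (pi2 x)"
proof -
  obtain m where m: "x = pi2 x + 2 * of_int m" using pi2_decomp by blast
  have "\<phi> (x + 2 * of_int j) = (if j = - m then \<phi> (pi2 x) else 0)" for j
  proof (cases "j = - m")
    case False
    then have "1 \<le> \<bar>real_of_int (m + j)\<bar>" by linarith
    moreover have "x + 2 * of_int j = pi2 x + 2 * real_of_int (m + j)" using m by simp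
    moreover have "1 \<le> \<bar>p + 2 * R\<bar>" if "1 \<le> \<bar>R\<bar>" "-1 \<le> p" "p < 1" for p R :: real
      using that by linarith
    ultimately have "1 \<le> \<bar>x + 2 * of_int j\<bar>" using pi2_bounds[of x] by metis
    then show ?thesis using assms False by simp
  next
    case True
    then have "x + 2 * of_int j = pi2 x" using m by simp
    then show ?thesis using True by simp
  qed
  then have "Pi2_fun \<phi> x = (\<Sum>\<^sub>\<infinity>j\<in>UNIV. if j = - m then \<phi> (pi2 x) else 0)"
    unfolding Pi2_fun_def by (simp cong: if_cong)
  also have "\<dots> = \<phi> (pi2 x)"
    by (subst infsum_cong_neutral[where T = "{- m}" and g = "\<lambda>j. if j = - m then \<phi> (pi2 x) else 0"]) auto
  finally show ?thesis .
qed

lemma pi2_plus_2: "pi2 (x + 2) = pi2 x"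
proof -
  obtain m where m: "x = pi2 x + 2 * of_int m" using pi2_decomp by blast
  have "x + 2 = pi2 x + 2 * of_int (m + 1)" using m by simp
  then show ?thesis using pi2_unique[of "pi2 x" "m + 1"] pi2_bounds[of x] by metis
qed

text \<open>\<open>pi2\<close> jumps at the odd integers. As the support stays within distance b < 1
  of 0, the composition vanishes on a neighbourhood of each odd integer; elsewhere
  \<open>pi2\<close> is locally a translation.\<close>

lemma periodization_has_derivative:
  assumes s: "smooth \<phi>" and b: "b < 1" and supp: "\<And>x. b \<le> \<bar>x\<bar> \<Longrightarrow> \<phi> x = 0"
  shows "((\<lambda>x. \<phi> (pi2 x)) has_vector_derivative vderiv \<phi> (pi2 x)) (at x)"
proof -
  obtain m where m: "x = pi2 x + 2 * of_int m" using pi2_decomp by blast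
  show ?thesis
  proof (cases "pi2 x = -1")
    case False
    let ?U = "{2 * real_of_int m - 1<..<2 * of_int m + 1}"
    have 1: "((\<lambda>x. x - 2 * real_of_int m) has_vector_derivative 1) (at x)"
      by (auto intro!: derivative_eq_intros simp flip: has_real_derivative_iff_has_vector_derivative)
    note D = vector_diff_chain_at[OF 1 smooth_has_vderiv[OF s]]
    have "((\<lambda>x. \<phi> (x - 2 * of_int m)) has_vector_derivative vderiv \<phi> (pi2 x)) (at x)"
    proof -
      have "x - 2 * of_int m = pi2 x" using m by linarith
      then show ?thesis using D by (simp add: o_def)
    qed
    moreover have "open ?U" "x \<in> ?U" using m False pi2_bounds[of x] by auto
    moreover have "\<phi> (y - 2 * of_int m) = \<phi> (pi2 y)" if "y \<in> ?U" for y
      using that pi2_unique[of "y - 2 * of_int m" m] by simp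
    ultimately show ?thesis by (rule has_vector_derivative_transform_within_open)
  next
    case True
    let ?U = "ball x (1 - b)"
    have "((\<lambda>x. 0) has_vector_derivative vderiv \<phi> (pi2 x)) (at x)"
    proof -
      have "vderiv \<phi> (pi2 x) = 0" using vderiv_support[of \<phi> b "pi2 x"] s supp True b by simp
      then show ?thesis by simp
    qed
    moreover have "open ?U" "x \<in> ?U" using b by auto
    moreover have "0 = \<phi> (pi2 y)" if "y \<in> ?U" for y
    proof -
      obtain k where k: "y = pi2 y + 2 * of_int k" using pi2_decomp by blast
      have "\<bar>x - y\<bar> < 1 - b" using that by (simp add: dist_real_def)
      have "b \<le> \<bar>pi2 y\<bar>"
      proof (rule ccontr)
        assume n: "\<not> b \<le> \<bar>pi2 y\<bar>"
        have "1 \<le> \<bar>2 * (m - k) - 1\<bar>" by arith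
        then have "real_of_int 1 \<le> real_of_int \<bar>2 * (m - k) - 1\<bar>" unfolding of_int_le_iff .
        then have odd: "1 \<le> \<bar>2 * real_of_int (m - k) - 1\<bar>" by simp
        have "x - y = (2 * real_of_int (m - k) - 1) - pi2 y" using m k True by simp
        then have "1 - \<bar>pi2 y\<bar> \<le> \<bar>x - y\<bar>" using odd by linarith
        then show False using \<open>\<bar>x - y\<bar> < 1 - b\<close> n by linarith
      qed
      then show ?thesis using supp by simp
    qed
    ultimately show ?thesis by (rule has_vector_derivative_transform_within_open)
  qed
qed

lemma periodization_smooth:
  assumes s: "smooth \<phi>" and b: "b < 1" and supp: "\<And>x. b \<le> \<bar>x\<bar> \<Longrightarrow> \<phi> x = 0"
  shows "smooth (\<lambda>x. \<phi> (pi2 x))"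
proof -
  let ?S = "{\<lambda>x. \<phi> (pi2 x) |\<phi>. smooth \<phi> \<and> (\<exists>b<1. \<forall>x. b \<le> \<bar>x\<bar> \<longrightarrow> \<phi> x = 0)}"
  show ?thesis
  proof (rule smooth_coinduct[of _ ?S])
    show "(\<lambda>x. \<phi> (pi2 x)) \<in> ?S" using assms by blast
    fix f assume "f \<in> ?S"
    then obtain \<phi> b where f: "f = (\<lambda>x. \<phi> (pi2 x))" and \<phi>: "smooth \<phi>" and b: "b < 1" and supp: "\<And>x. b \<le> \<bar>x\<bar> \<Longrightarrow> \<phi> x = 0" by blast
    have "(b + 1) / 2 < 1" "\<And>x. (b + 1) / 2 \<le> \<bar>x\<bar> \<Longrightarrow> vderiv \<phi> x = 0"
    proof -
      show "(b + 1) / 2 < 1" using b by simp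
      fix x :: real assume "(b + 1) / 2 \<le> \<bar>x\<bar>"
      then have "b < \<bar>x\<bar>" using b by simp
      then show "vderiv \<phi> x = 0" using vderiv_support[of \<phi> b x] \<phi> supp by blast
    qed
    then have mem: "(\<lambda>x. vderiv \<phi> (pi2 x)) \<in> ?S" using smooth_vderiv[OF \<phi>] by blast
    show "\<exists>f'\<in>?S. \<forall>x. (f has_vector_derivative f' x) (at x)"
      by (rule bexI[rotated, OF mem], rule allI) (simp add: f periodization_has_derivative[OF \<phi> b supp])
  qed
qed

text \<open>Real values let \<phi> and its Hilbert transform be read off as real and imaginary part
  of one Hardy function. The number b < 1 keeps the support at a positive distance from the end
  points, which bounds the regular kernels.\<close>

locale real_test =
  fixes \<phi> :: "real \<Rightarrow> complex" and b :: real
  assumes test: "\<phi> \<in> test_functions I1" and real: "\<And>x. Im (\<phi> x) = 0"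
    and b: "0 < b" "b < 1" and supp: "\<And>x. b \<le> \<bar>x\<bar> \<Longrightarrow> \<phi> x = 0"
begin

lemma test_UNIV: "\<phi> \<in> test_functions UNIV"
  using test test_functions_mono[of I1 UNIV] by auto

lemma \<phi>_smooth: "smooth \<phi>"
  using test by (rule test_functions_smooth)

lemma supp1: "1 \<le> \<bar>x\<bar> \<Longrightarrow> \<phi> x = 0"
  using supp[of x] b by simp

definition P :: "real \<Rightarrow> complex" where "P = Pi2_fun \<phi>"

lemma P_eq: "P x = \<phi> (pi2 x)"
  unfolding P_def by (rule Pi2_fun_eq_pi2) (rule supp1)

lemma P_smooth: "smooth P"
  using periodization_smooth[OF \<phi>_smooth b(2) supp] P_eq by presburger

lemma P_periodic: "P (x + 2) = P x"
  by (simp add: P_eq pi2_plus_2)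

lemma P_test: "P \<in> periodic_test_functions"
  unfolding periodic_test_functions_def using P_smooth P_periodic by blast

definition H\<phi> :: "real \<Rightarrow> complex" where "H\<phi> = hilbert \<phi>"

definition HP :: "real \<Rightarrow> complex" where "HP = hilbert2 P"

lemma HP_test: "HP \<in> periodic_test_functions"
  unfolding HP_def by (rule hilbert2_periodic_test_function(2)[OF P_test])

lemma HP_smooth: "smooth HP" and HP_periodic: "HP (x + 2) = HP x"
  using HP_test by (auto simp: periodic_test_functions_def)

lemma HP_real: "Im (HP x) = 0"
proof -
  have "P y = of_real (Re (P y))" for y using real by (simp add: P_eq complex_eq_iff)
  then have "(P (x - s) - P (x + s)) * of_real (cot_cut s) = of_real ((Re (P (x - s)) - Re (P (x + s))) * cot_cut s)" for s
    by (metis of_real_diff of_real_mult)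
  then have "hilbert2_int P x = of_real ((LINT s|lborel. (Re (P (x - s)) - Re (P (x + s))) * cot_cut s) / 4)"
    unfolding hilbert2_int_def by (simp only: integral_complex_of_real) simp
  then show ?thesis unfolding HP_def hilbert2_periodic_test_function(1)[OF P_test] by (simp only: Im_complex_of_real)
qed

lemma H\<phi>_real: "Im (H\<phi> x) = 0"
  unfolding H\<phi>_def by (rule hilbert_real[OF test_UNIV, of "\<lambda>t. Re (\<phi> t)"]) (simp add: complex_eq_iff real)

lemma measurables [measurable]: "\<phi> \<in> borel_measurable borel" "P \<in> borel_measurable borel"
  "H\<phi> \<in> borel_measurable borel" "HP \<in> borel_measurable borel"
  using \<phi>_smooth P_smooth HP_smooth hilbert_measurable[OF test_UNIV] by (auto intro: smooth_measurable simp: H\<phi>_def)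

lemma compact_lipschitz_data: obtains L where "compact_lipschitz \<phi> b L"
  using smooth_compact_lipschitz[OF \<phi>_smooth b(1) supp] by blast

lemma \<phi>_integrable: "integrable lborel \<phi>"
  using compact_lipschitz_data compact_lipschitz.integrable by blast

lemma H\<phi>_off_support:
  assumes "b < \<bar>x\<bar>"
  shows "H\<phi> x = of_real (1 / pi) * (LINT t|lborel. \<phi> t / of_real (x - t))"
proof -
  obtain L where 1: "compact_lipschitz \<phi> b L" using compact_lipschitz_data by blast
  show ?thesis unfolding H\<phi>_def compact_lipschitz.hilbert_eq[OF 1]
  proof (rule compact_lipschitz.hilbert_off_support[OF 1, of "\<bar>x\<bar> - b"])
    fix t assume "\<phi> t \<noteq> 0"
    then have "\<not> b \<le> \<bar>t\<bar>" using supp by blast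
    then show "\<bar>x\<bar> - b \<le> \<bar>x - t\<bar>" by linarith
  qed (use assms in simp)
qed

lemma integrable_times:
  assumes [measurable]: "k \<in> borel_measurable borel" and B: "\<And>t. \<bar>t\<bar> < b \<Longrightarrow> norm (k t) \<le> B"
  shows "integrable lborel (\<lambda>t. \<phi> t * k t)" "norm (\<phi> t * k t) \<le> \<bar>B\<bar> * norm (\<phi> t)"
proof -
  have *: "norm (\<phi> t * k t) \<le> \<bar>B\<bar> * norm (\<phi> t)" for t
  proof (cases "\<bar>t\<bar> < b")
    case True
    have "norm (\<phi> t) * norm (k t) \<le> norm (\<phi> t) * \<bar>B\<bar>"
      using B[OF True] by (intro mult_left_mono) auto
    then show ?thesis by (simp add: norm_mult mult.commute)
  qed (simp add: supp)
  show "norm (\<phi> t * k t) \<le> \<bar>B\<bar> * norm (\<phi> t)" by (rule *)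
  show "integrable lborel (\<lambda>t. \<phi> t * k t)"
    by (rule Bochner_Integration.integrable_bound[of _ "\<lambda>t. \<bar>B\<bar> * norm (\<phi> t)"])
       (use \<phi>_integrable * in \<open>auto intro!: AE_I2\<close>)
qed

definition R :: "real \<Rightarrow> complex" where
  "R x = (LINT t|lborel. \<phi> t * of_real (cot_regular (x - t)))"

text \<open>Half the cotangent is 1 / (pi s) plus \<open>cot_regular\<close>, so the principal
  values differ by the absolutely convergent R. For \<epsilon> < 2 - |x| - b the removed
  neighbourhoods of x + 2 k with k \<noteq> 0 miss the support, and the truncations on the circle
  and on the line coincide.\<close>

lemma HP_eq:
  assumes x: "\<bar>x\<bar> < 1"
  shows "HP x = H\<phi> x + R x"
proof -
  obtain L where 1: "compact_lipschitz \<phi> b L" using compact_lipschitz_data by blast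
  define r where "r = \<bar>x\<bar> + b"
  have r: "r < 2" "0 < r" using x b by (auto simp: r_def)
  define C where "C = (2 / (2 - r)\<^sup>2 * (pi\<^sup>2 / 6)) * r"
  have kB: "norm (complex_of_real (cot_regular (x - t))) \<le> C" if "\<bar>t\<bar> < b" for t
    unfolding C_def norm_of_real using that r by (intro cot_regular_bound) (auto simp: r_def)
  have C0: "0 \<le> C" using r by (simp add: C_def)
  have iR: "integrable lborel (\<lambda>t. \<phi> t * of_real (cot_regular (x - t)))" by (rule integrable_times(1)[OF _ kB]) measurable
  let ?A = "\<lambda>\<epsilon>. {t. \<epsilon> < \<bar>x - t\<bar>}"
  have l1: "((\<lambda>\<epsilon>. LINT t:?A \<epsilon>|lborel. \<phi> t / of_real (x - t)) \<longlongrightarrow> (LINT s|lborel. compact_lipschitz.diff_quot \<phi> x s) / 2) (at_right 0)"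
    using compact_lipschitz.truncated_tendsto[OF 1, of x] .
  have l2: "((\<lambda>\<epsilon>. LINT t|lborel. indicat_real (?A \<epsilon>) t *\<^sub>R (\<phi> t * of_real (cot_regular (x - t)))) \<longlongrightarrow> R x) (at_right 0)"
    unfolding R_def
  proof (rule integral_dominated_convergence_within)
    show "integrable lborel (\<lambda>t. norm (\<phi> t * of_real (cot_regular (x - t))))" using iR by simp
    show "AE t in lborel. norm (indicat_real (?A \<epsilon>) t *\<^sub>R (\<phi> t * of_real (cot_regular (x - t)))) \<le> norm (\<phi> t * of_real (cot_regular (x - t)))" for \<epsilon>
      by (rule AE_I2) (simp add: indicator_def)
    show "AE t in lborel. ((\<lambda>\<epsilon>. indicat_real (?A \<epsilon>) t *\<^sub>R (\<phi> t * of_real (cot_regular (x - t)))) \<longlongrightarrow> \<phi> t * of_real (cot_regular (x - t))) (at_right 0)"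
    proof (rule AE_I2)
      fix t
      show "((\<lambda>\<epsilon>. indicat_real (?A \<epsilon>) t *\<^sub>R (\<phi> t * of_real (cot_regular (x - t)))) \<longlongrightarrow> \<phi> t * of_real (cot_regular (x - t))) (at_right 0)"
      proof (cases "x - t = 0")
        case False
        then have "eventually (\<lambda>\<epsilon>. \<epsilon> \<in> {0<..<\<bar>x - t\<bar>}) (at_right 0)" by (intro eventually_at_right_real) auto
        then have "eventually (\<lambda>\<epsilon>. indicat_real (?A \<epsilon>) t *\<^sub>R (\<phi> t * of_real (cot_regular (x - t))) = \<phi> t * of_real (cot_regular (x - t))) (at_right 0)"
          by eventually_elim (auto simp: indicator_def)
        then show ?thesis by (rule tendsto_eventually)
      qed (simp add: cot_regular_def)
    qed
  qed measurable
  let ?T = "\<lambda>\<epsilon>. LINT t:{t \<in> {-1..1}. \<forall>k::int. \<bar>x - t - 2 * of_int k\<bar> > \<epsilon>}|lborel. P t * complex_of_real (cot (pi * (x - t) / 2))"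
  have "((\<lambda>\<epsilon>. of_real (2 / pi) * (LINT t:?A \<epsilon>|lborel. \<phi> t / of_real (x - t)) + 2 * (LINT t|lborel. indicat_real (?A \<epsilon>) t *\<^sub>R (\<phi> t * of_real (cot_regular (x - t)))))
     \<longlongrightarrow> of_real (2 / pi) * ((LINT s|lborel. compact_lipschitz.diff_quot \<phi> x s) / 2) + 2 * R x) (at_right 0)"
    by (intro tendsto_intros l1 l2)
  moreover have "eventually (\<lambda>\<epsilon>. of_real (2 / pi) * (LINT t:?A \<epsilon>|lborel. \<phi> t / of_real (x - t)) + 2 * (LINT t|lborel. indicat_real (?A \<epsilon>) t *\<^sub>R (\<phi> t * of_real (cot_regular (x - t)))) = ?T \<epsilon>) (at_right 0)"
  proof -
    have "eventually (\<lambda>\<epsilon>. \<epsilon> \<in> {0<..<2 - r}) (at_right 0)" using r by (intro eventually_at_right_real) auto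
    then show ?thesis
    proof eventually_elim
      case (elim \<epsilon>)
      have e: "0 < \<epsilon>" "\<epsilon> < 2 - r" using elim by auto
      have i1: "integrable lborel (\<lambda>t. indicat_real (?A \<epsilon>) t *\<^sub>R (\<phi> t / of_real (x - t)))"
      proof -
        have "integrable lborel (\<lambda>t. \<phi> t * (indicat_real (?A \<epsilon>) t *\<^sub>R (1 / of_real (x - t))))"
          by (rule integrable_times(1)[of _ "1 / \<epsilon>"])
             (use e in \<open>auto simp: indicator_def norm_divide intro!: frac_le simp flip: of_real_diff\<close>)
        then show ?thesis by (simp add: mult.commute divide_inverse)
      qed
      have i2: "integrable lborel (\<lambda>t. indicat_real (?A \<epsilon>) t *\<^sub>R (\<phi> t * of_real (cot_regular (x - t))))"
        by (intro integrable_mult_indicator iR) measurable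
      have pt: "indicat_real {t \<in> {-1..1}. \<forall>k::int. \<bar>x - t - 2 * of_int k\<bar> > \<epsilon>} t *\<^sub>R (P t * complex_of_real (cot (pi * (x - t) / 2)))
        = of_real (2 / pi) * (indicat_real (?A \<epsilon>) t *\<^sub>R (\<phi> t / of_real (x - t))) + 2 * (indicat_real (?A \<epsilon>) t *\<^sub>R (\<phi> t * of_real (cot_regular (x - t))))" for t
      proof (cases "\<bar>t\<bar> < b")
        case t: True
        have "(\<forall>k::int. \<bar>x - t - 2 * of_int k\<bar> > \<epsilon>) \<longleftrightarrow> \<epsilon> < \<bar>x - t\<bar>"
        proof
          assume a: "\<epsilon> < \<bar>x - t\<bar>"
          show "\<forall>k::int. \<bar>x - t - 2 * of_int k\<bar> > \<epsilon>"
          proof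
            fix k :: int
            show "\<bar>x - t - 2 * of_int k\<bar> > \<epsilon>"
            proof (cases "k = 0")
              case False
              then have "1 \<le> \<bar>real_of_int k\<bar>" by linarith
              moreover have "\<bar>x - t\<bar> \<le> r" using t by (simp add: r_def)
              ultimately show ?thesis using e by linarith
            qed (use a in simp)
          qed
        qed (auto dest: spec[of _ 0])
        moreover have "t \<in> {-1..1}" using t b by auto
        ultimately have ind: "indicat_real {t \<in> {-1..1}. \<forall>k::int. \<bar>x - t - 2 * of_int k\<bar> > \<epsilon>} t = indicat_real (?A \<epsilon>) t"
          unfolding indicator_def by simp
        have "P t = \<phi> t" using t b by (simp add: P_eq pi2_ident)
        moreover have "complex_of_real (cot (pi * (x - t) / 2)) = of_real (2 / pi) * (1 / of_real (x - t)) + 2 * of_real (cot_regular (x - t))"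
        proof -
          have "cot (pi * (x - t) / 2) = 2 / pi * (1 / (x - t)) + 2 * cot_regular (x - t)" by (simp add: cot_regular_def)
          then show ?thesis by (metis (mono_tags, lifting) of_real_1 of_real_add of_real_divide of_real_mult of_real_numeral)
        qed
        ultimately show ?thesis unfolding ind by (simp add: algebra_simps scaleR_conv_of_real)
      next
        case False
        have "\<phi> t = 0" using False supp by simp
        moreover have "P t = 0 \<or> t \<notin> {-1..1}"
        proof (cases "t \<in> {-1..<1}")
          case True
          then show ?thesis using \<open>\<phi> t = 0\<close> by (simp add: P_eq pi2_ident)
        next
          case t: False
          \<comment> \<open>The closed period contains t = 1, where P takes the value of \<phi> at
            -1, which is 0 as well.\<close>
          have "pi2 1 = -1" using pi2_unique[of "-1" 1] by simp
          then show ?thesis using t supp1[of "-1"] by (cases "t = 1") (auto simp: P_eq)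
        qed
        ultimately show ?thesis by (auto simp: indicator_def)
      qed
      show ?case unfolding set_lebesgue_integral_def pt
        using Bochner_Integration.integral_add[OF integrable_mult_right[OF i1, of "of_real (2 / pi)"] integrable_mult_right[OF i2, of 2]]
        by (simp only: integral_mult_right_zero)
    qed
  qed
  ultimately have "(?T \<longlongrightarrow> of_real (2 / pi) * ((LINT s|lborel. compact_lipschitz.diff_quot \<phi> x s) / 2) + 2 * R x) (at_right 0)"
    by (rule Lim_transform_eventually)
  from tendsto_Lim[OF _ this]
  have "Lim (at_right 0) ?T = of_real (2 / pi) * ((LINT s|lborel. compact_lipschitz.diff_quot \<phi> x s) / 2) + 2 * R x" by simp
  then show ?thesis
    unfolding HP_def hilbert2_def H\<phi>_def compact_lipschitz.hilbert_eq[OF 1] compact_lipschitz.hilbert_int_def[OF 1]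
    by (simp only:) (simp add: algebra_simps)
qed

end

lemma hilbert_plus_decay:
  assumes "\<phi> \<in> test_functions UNIV"
  obtains A where "0 \<le> A" "\<And>x. norm (\<phi> x + \<i> * hilbert \<phi> x) \<le> A / (1 + \<bar>x\<bar>)"
proof -
  obtain M L where 1: "compact_lipschitz \<phi> M L" using test_function_compact_lipschitz assms(1) by blast
  obtain C where C: "0 \<le> C" "\<And>x. norm (hilbert \<phi> x) \<le> C / (1 + \<bar>x\<bar>)" using hilbert_decay[OF assms] by metis
  define B where "B = compact_lipschitz.B M L"
  have B: "0 \<le> B" "\<And>x. norm (\<phi> x) \<le> B" unfolding B_def using compact_lipschitz.B[OF 1] by auto
  have M: "0 < M" using 1 by (simp add: compact_lipschitz_def)
  have "norm (\<phi> x) \<le> (B * (1 + M)) / (1 + \<bar>x\<bar>)" for x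
  proof (cases "\<bar>x\<bar> < M")
    case True
    have "norm (\<phi> x) * (1 + \<bar>x\<bar>) \<le> B * (1 + M)" using B True by (intro mult_mono) auto
    then show ?thesis by (simp add: pos_le_divide_eq add_pos_nonneg)
  next
    case False
    then have "\<phi> x = 0" using compact_lipschitz.supp[OF 1, of x] by simp
    then show ?thesis using B M by simp
  qed
  then have "norm (\<phi> x + \<i> * hilbert \<phi> x) \<le> (B * (1 + M) + C) / (1 + \<bar>x\<bar>)" for x
    unfolding add_divide_distrib using C(2)[of x] by (intro norm_triangle_mono) (auto simp: norm_mult)
  moreover have "0 \<le> B * (1 + M) + C" using B C M by simp
  ultimately show thesis using that by blast
qed

text \<open>Counts the translates that may come close to the support; this is where the linear
  growth in \<open>hardy_psum_bound\<close> originates.\<close>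

lemma count_Suc_less:
  assumes "0 \<le> a" shows "(\<Sum>n<N. if real (Suc n) < a then 1 else 0) \<le> (a::real)"
proof -
  have "(\<Sum>n<N. if real (Suc n) < a then 1 else 0) = real (card {n\<in>{..<N}. real (Suc n) < a})"
    by (simp add: sum.If_cases Int_def)
  also have "card {n\<in>{..<N}. real (Suc n) < a} \<le> card {..<nat \<lfloor>a\<rfloor>}"
    by (intro card_mono) (auto, linarith)
  also have "real (card {..<nat \<lfloor>a\<rfloor>}) \<le> a" using assms by simp
  finally show ?thesis by simp
qed

section \<open>The periodized Hardy function as a limit of symmetric sums of translates\<close>

context real_test
begin

definition Fh :: "real \<Rightarrow> complex" where "Fh x = \<phi> x + \<i> * H\<phi> x"

lemma Fh_hardy: "hardy Fh"
proof -
  obtain L where 1: "compact_lipschitz \<phi> b L" using compact_lipschitz_data by blast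
  show ?thesis
    using compact_lipschitz.hardy_hilbert[OF 1] unfolding Fh_def[abs_def] H\<phi>_def compact_lipschitz.hilbert_eq[OF 1] .
qed

lemma Fh_decay: obtains A where "0 \<le> A" "\<And>x. norm (Fh x) \<le> A / (1 + \<bar>x\<bar>)" "\<And>x. norm (Fh x) \<le> A"
proof -
  obtain A where A: "0 \<le> A" "\<And>x. norm (Fh x) \<le> A / (1 + \<bar>x\<bar>)"
    using hilbert_plus_decay[OF test_UNIV] unfolding Fh_def H\<phi>_def by metis
  have "norm (Fh x) \<le> A" for x
  proof -
    have "A * 1 \<le> A * (1 + \<bar>x\<bar>)" using A by (intro mult_left_mono) auto
    then have "A / (1 + \<bar>x\<bar>) \<le> A" by (simp add: pos_divide_le_eq add_pos_nonneg)
    then show ?thesis using A(2)[of x] by linarith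
  qed
  then show thesis using that A by blast
qed

text \<open>Both translates are written as sums so that \<open>hardy_shift\<close> matches
  them.\<close>

definition pair :: "nat \<Rightarrow> real \<Rightarrow> complex" where
  "pair n x = Fh (x + - (2 * real (Suc n))) + Fh (x + 2 * real (Suc n))"

text \<open>Summation over symmetric ranges of translates turns the line kernel into the cotangent.\<close>

definition hardy_psum :: "nat \<Rightarrow> real \<Rightarrow> complex" where
  "hardy_psum N x = Fh x + (\<Sum>n<N. pair n x)"

lemma hardy_psum_hardy: "hardy (hardy_psum N)"
  unfolding hardy_psum_def[abs_def] pair_def by (intro hardy_add hardy_sum hardy_shift Fh_hardy)

text \<open>Off the support the values of \<phi> vanish and those of its transform are ordinary
  integrals; the two kernels add up to \<open>cot_term\<close>.\<close>

lemma pair_far: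
  assumes far: "\<bar>x\<bar> + b < 2 * real (Suc n)"
    and bound: "\<And>t. \<bar>t\<bar> < b \<Longrightarrow> \<bar>cot_term (x - t) n\<bar> \<le> K"
    and far1: "\<bar>x\<bar> + 1 \<le> 2 * real (Suc n)"
  shows "pair n x = \<i> * (of_real (1 / pi) * (LINT t|lborel. \<phi> t * of_real (cot_term (x - t) n)))"
proof -
  define m where "m = 2 * real (Suc n)"
  have m: "\<bar>x\<bar> + b < m" "\<bar>x\<bar> + 1 \<le> m" using far far1 by (auto simp: m_def)
  have z: "\<phi> (x + - m) = 0" "\<phi> (x + m) = 0" using m by (auto intro!: supp1)
  have kint: "integrable lborel (\<lambda>t. \<phi> t / of_real (x + c - t))" if "\<bar>c\<bar> = m" for c
  proof -
    have "integrable lborel (\<lambda>t. \<phi> t * (1 / of_real (x + c - t)))"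
    proof (rule integrable_times(1))
      fix t assume t: "\<bar>t\<bar> < b"
      have "m - \<bar>x\<bar> - b \<le> \<bar>x + c - t\<bar>" using that t by linarith
      then have "1 / \<bar>x + c - t\<bar> \<le> 1 / (m - \<bar>x\<bar> - b)" using m by (intro frac_le) auto
      then show "norm (1 / complex_of_real (x + c - t)) \<le> 1 / (m - \<bar>x\<bar> - b)" by (simp add: norm_divide del: of_real_add of_real_diff)
    qed measurable
    then show ?thesis by simp
  qed
  have "pair n x = \<i> * (H\<phi> (x + - m) + H\<phi> (x + m))"
    unfolding pair_def m_def[symmetric] Fh_def z by (simp add: distrib_left)
  also have "H\<phi> (x + - m) = of_real (1 / pi) * (LINT t|lborel. \<phi> t / of_real (x + - m - t))"
    by (rule H\<phi>_off_support) (use m in linarith)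
  also have "H\<phi> (x + m) = of_real (1 / pi) * (LINT t|lborel. \<phi> t / of_real (x + m - t))"
    by (rule H\<phi>_off_support) (use m in linarith)
  also have "of_real (1 / pi) * (LINT t|lborel. \<phi> t / of_real (x + - m - t)) + of_real (1 / pi) * (LINT t|lborel. \<phi> t / of_real (x + m - t))
    = complex_of_real (1 / pi) * (LINT t|lborel. \<phi> t / of_real (x + - m - t) + \<phi> t / of_real (x + m - t))"
    using kint[of "- m"] kint[of m] m b by (subst Bochner_Integration.integral_add) (auto simp: distrib_left)
  also have "(\<lambda>t. \<phi> t / of_real (x + - m - t) + \<phi> t / of_real (x + m - t)) = (\<lambda>t. \<phi> t * of_real (cot_term (x - t) n))"
  proof
    fix t
    have e: "x + - m - t = x - t - m" "x + m - t = x - t + m" by simp_all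
    show "\<phi> t / of_real (x + - m - t) + \<phi> t / of_real (x + m - t) = \<phi> t * of_real (cot_term (x - t) n)"
      unfolding e cot_term_def m_def[symmetric] of_real_add[of "1 / _"] of_real_divide of_real_1
      by (simp only: distrib_left times_divide_eq_right mult_1_right)
  qed
  finally show ?thesis .
qed

lemma cot_term_measurable [measurable]: "(\<lambda>t. cot_term t n) \<in> borel_measurable borel"
  unfolding cot_term_def by measurable

lemma weighted_bound:
  assumes [measurable]: "k \<in> borel_measurable borel" and K: "\<And>t. \<bar>t\<bar> < b \<Longrightarrow> \<bar>k t\<bar> \<le> K"
  shows "norm (LINT t|lborel. \<phi> t * of_real (k t)) \<le> \<bar>K\<bar> * (LINT t|lborel. norm (\<phi> t))"
proof -
  have "norm (LINT t|lborel. \<phi> t * of_real (k t)) \<le> (LINT t|lborel. \<bar>K\<bar> * norm (\<phi> t))"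
  proof (rule norm_integral_le)
    show "norm (\<phi> t * of_real (k t)) \<le> \<bar>K\<bar> * norm (\<phi> t)" for t
      by (rule integrable_times(2)) (use K in auto)
  qed (use \<phi>_integrable in auto)
  then show ?thesis by simp
qed

text \<open>At most |x| + 2 pairs have n + 1 < |x| + 2, and each of these is bounded by 2 A. In the
  others the two kernels combine to 2 s / ((s - 2 m) (s + 2 m)), which is of order (1 + |x|) / m^2
  and therefore summable.\<close>

lemma hardy_psum_bound: obtains C where "\<And>N x. norm (hardy_psum N x) \<le> C * (1 + \<bar>x\<bar>)"
proof -
  obtain A where A: "0 \<le> A" "\<And>x. norm (Fh x) \<le> A" using Fh_decay by metis
  define I where "I = (LINT t|lborel. norm (\<phi> t))"
  have I0: "0 \<le> I" by (simp add: I_def)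
  have pb: "norm (pair n x) \<le> 2 * A * (if real (Suc n) < \<bar>x\<bar> + 2 then 1 else 0) + 2 * I * (1 + \<bar>x\<bar>) * (1 / (real n + 1)\<^sup>2)" for n x
  proof (cases "real (Suc n) < \<bar>x\<bar> + 2")
    case True
    have "norm (pair n x) \<le> A + A" unfolding pair_def by (intro norm_triangle_mono A)
    moreover have "0 \<le> 2 * I * (1 + \<bar>x\<bar>) * (1 / (real n + 1)\<^sup>2)" using I0 by simp
    ultimately show ?thesis using True by simp
  next
    case False
    define m where "m = real (Suc n)"
    have m: "\<bar>x\<bar> + 2 \<le> m" "1 \<le> m" using False by (auto simp: m_def)
    have kb: "\<bar>cot_term (x - t) n\<bar> \<le> 2 * (1 + \<bar>x\<bar>) / m\<^sup>2" if t: "\<bar>t\<bar> < b" for t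
    proof -
      define s where "s = x - t"
      have s: "\<bar>s\<bar> \<le> 1 + \<bar>x\<bar>" using t b by (simp add: s_def)
      have ab: "m \<le> \<bar>s - 2 * m\<bar>" "m \<le> \<bar>s + 2 * m\<bar>" using s m by linarith+
      then have nz: "s - 2 * m \<noteq> 0" "s + 2 * m \<noteq> 0" using m by auto
      have "cot_term s n = 2 * s / ((s - 2 * m) * (s + 2 * m))"
        unfolding cot_term_def m_def[symmetric] using nz by (simp add: field_simps)
      then have "\<bar>cot_term s n\<bar> = 2 * \<bar>s\<bar> / (\<bar>s - 2 * m\<bar> * \<bar>s + 2 * m\<bar>)" by (simp add: abs_mult)
      also have "\<dots> \<le> 2 * (1 + \<bar>x\<bar>) / (m * m)"
        using s ab m by (intro frac_le mult_mono) auto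
      finally show ?thesis by (simp add: s_def power2_eq_square)
    qed
    have "norm (pair n x) = (1 / pi) * norm (LINT t|lborel. \<phi> t * of_real (cot_term (x - t) n))"
      by (subst pair_far[OF _ kb]) (use m b m_def in \<open>auto simp: norm_mult norm_divide\<close>)
    also have "\<dots> \<le> 1 * (\<bar>2 * (1 + \<bar>x\<bar>) / m\<^sup>2\<bar> * I)"
      unfolding I_def using pi_gt3 by (intro mult_mono weighted_bound kb) auto
    also have "\<dots> = 2 * I * (1 + \<bar>x\<bar>) * (1 / (real n + 1)\<^sup>2)" by (simp add: m_def add.commute)
    finally show ?thesis using False by simp
  qed
  have "norm (hardy_psum N x) \<le> (A + 4 * A + 2 * I * (pi\<^sup>2 / 6)) * (1 + \<bar>x\<bar>)" for N x
  proof -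
    have sq: "(\<Sum>n<N. 1 / (real n + 1)\<^sup>2) \<le> pi\<^sup>2 / 6"
      using sum_le_suminf[OF sums_summable[OF inverse_squares_sums], of "{..<N}"] sums_unique[OF inverse_squares_sums]
      by (simp add: add.commute)
    have "norm (hardy_psum N x) \<le> A + (\<Sum>n<N. norm (pair n x))"
      unfolding hardy_psum_def by (intro norm_triangle_mono A norm_sum)
    also have "(\<Sum>n<N. norm (pair n x)) \<le> (\<Sum>n<N. 2 * A * (if real (Suc n) < \<bar>x\<bar> + 2 then 1 else 0) + 2 * I * (1 + \<bar>x\<bar>) * (1 / (real n + 1)\<^sup>2))"
      by (intro sum_mono pb)
    also have "\<dots> = 2 * A * (\<Sum>n<N. if real (Suc n) < \<bar>x\<bar> + 2 then 1 else 0) + 2 * I * (1 + \<bar>x\<bar>) * (\<Sum>n<N. 1 / (real n + 1)\<^sup>2)"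
      unfolding sum.distrib sum_distrib_left ..
    also have "\<dots> \<le> 2 * A * (\<bar>x\<bar> + 2) + 2 * I * (1 + \<bar>x\<bar>) * (pi\<^sup>2 / 6)"
      using A I0 sq by (intro add_mono mult_left_mono count_Suc_less) auto
    also have "2 * A * (\<bar>x\<bar> + 2) \<le> 4 * A * (1 + \<bar>x\<bar>)"
    proof -
      have "2 * A * (\<bar>x\<bar> + 2) = 4 * A + 2 * (A * \<bar>x\<bar>)" "4 * A * (1 + \<bar>x\<bar>) = 4 * A + 4 * (A * \<bar>x\<bar>)"
        by (simp_all add: algebra_simps)
      then show ?thesis using A(1) by simp
    qed
    also have "A + (4 * A * (1 + \<bar>x\<bar>) + 2 * I * (1 + \<bar>x\<bar>) * (pi\<^sup>2 / 6)) \<le> A * (1 + \<bar>x\<bar>) + (4 * A * (1 + \<bar>x\<bar>) + 2 * I * (1 + \<bar>x\<bar>) * (pi\<^sup>2 / 6))"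
      using A(1) by (simp add: algebra_simps)
    also have "\<dots> = (A + 4 * A + 2 * I * (pi\<^sup>2 / 6)) * (1 + \<bar>x\<bar>)" by (simp add: algebra_simps)
    finally show ?thesis by simp
  qed
  then show thesis by (rule that)
qed

definition Fper :: "real \<Rightarrow> complex" where "Fper x = P x + \<i> * HP x"

lemma Fper_periodic: "Fper (x + 2) = Fper x"
  by (simp add: Fper_def P_periodic HP_periodic)

text \<open>For |x| < 1 every translate is off the support, so all pairs are integrals of
  \<open>cot_term\<close> and the cotangent series applies. Its partial sums are dominated uniformly
  in N by comparison with s = 0, where they vanish.\<close>

lemma hardy_psum_tendsto_base:
  assumes x: "\<bar>x\<bar> < 1"
  shows "(\<lambda>N. hardy_psum N x) \<longlonglongrightarrow> Fper x"
proof -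
  define r where "r = \<bar>x\<bar> + b"
  have r: "r < 2" "0 < r" using x b by (auto simp: r_def)
  define C where "C = (2 / (2 - r)\<^sup>2 * r) * (pi\<^sup>2 / 6)"
  have sumB: "\<bar>\<Sum>n<N. cot_term (x - t) n\<bar> \<le> C" if "\<bar>t\<bar> < b" for N t
  proof -
    have z: "cot_term 0 n = 0" for n using cot_term_odd[of 0 n] by simp
    have "\<bar>x - t\<bar> \<le> r" using that by (simp add: r_def)
    then have "\<bar>(\<Sum>n<N. cot_term (x - t) n) - (\<Sum>n<N. cot_term 0 n)\<bar> \<le> (2 / (2 - r)\<^sup>2 * \<bar>x - t - 0\<bar>) * (pi\<^sup>2 / 6)"
      using r by (intro cot_sum_lipschitz) auto
    also have "\<dots> \<le> C" unfolding C_def using \<open>\<bar>x - t\<bar> \<le> r\<close> by (intro mult_right_mono mult_left_mono) auto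
    finally show ?thesis by (simp add: z)
  qed
  have termB: "\<bar>cot_term (x - t) n\<bar> \<le> 2 * C" if "\<bar>t\<bar> < b" for n t
    using sumB[OF that, of "Suc n"] sumB[OF that, of n] by simp
  have C0: "0 \<le> C" using r by (simp add: C_def)
  have pair: "pair n x = \<i> * (of_real (1 / pi) * (LINT t|lborel. \<phi> t * of_real (cot_term (x - t) n)))" for n
    by (rule pair_far[OF _ termB]) (use x b in auto)
  have int: "integrable lborel (\<lambda>t. \<phi> t * of_real (cot_term (x - t) n))" for n
    by (rule integrable_times(1)[of _ "2 * C"]) (use termB in auto)
  have sum: "(\<Sum>n<N. pair n x) = \<i> * (of_real (1 / pi) * (LINT t|lborel. \<phi> t * of_real (\<Sum>n<N. cot_term (x - t) n)))" for N
  proof -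
    have "(\<Sum>n<N. pair n x) = \<i> * (of_real (1 / pi) * (\<Sum>n<N. LINT t|lborel. \<phi> t * of_real (cot_term (x - t) n)))"
      unfolding pair sum_distrib_left ..
    also have "(\<Sum>n<N. LINT t|lborel. \<phi> t * of_real (cot_term (x - t) n)) = (LINT t|lborel. (\<Sum>n<N. \<phi> t * of_real (cot_term (x - t) n)))"
      using int by (intro Bochner_Integration.integral_sum[symmetric])
    finally show ?thesis unfolding of_real_sum sum_distrib_left .
  qed
  have "(\<lambda>N. LINT t|lborel. \<phi> t * of_real (\<Sum>n<N. cot_term (x - t) n)) \<longlonglongrightarrow> (LINT t|lborel. \<phi> t * of_real (pi * cot_regular (x - t)))"
  proof (rule integral_dominated_convergence[where w="\<lambda>t. \<bar>C\<bar> * norm (\<phi> t)"])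
    show "integrable lborel (\<lambda>t. \<bar>C\<bar> * norm (\<phi> t))" using \<phi>_integrable by simp
    show "AE t in lborel. norm (\<phi> t * of_real (\<Sum>n<N. cot_term (x - t) n)) \<le> \<bar>C\<bar> * norm (\<phi> t)" for N
    proof (intro AE_I2 integrable_times(2))
      fix t assume "\<bar>t\<bar> < b"
      then show "norm (complex_of_real (\<Sum>n<N. cot_term (x - t) n)) \<le> C" unfolding norm_of_real by (rule sumB)
    qed measurable
    show "AE t in lborel. (\<lambda>N. \<phi> t * of_real (\<Sum>n<N. cot_term (x - t) n)) \<longlonglongrightarrow> \<phi> t * of_real (pi * cot_regular (x - t))"
    proof (rule AE_I2)
      fix t
      show "(\<lambda>N. \<phi> t * of_real (\<Sum>n<N. cot_term (x - t) n)) \<longlonglongrightarrow> \<phi> t * of_real (pi * cot_regular (x - t))"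
      proof (cases "\<bar>t\<bar> < b")
        case True
        then show ?thesis using x b by (intro tendsto_mult tendsto_const tendsto_of_real cot_regular_sums) auto
      qed (simp add: supp)
    qed
  qed measurable
  then have "(\<lambda>N. hardy_psum N x) \<longlonglongrightarrow> Fh x + \<i> * (of_real (1 / pi) * (LINT t|lborel. \<phi> t * of_real (pi * cot_regular (x - t))))"
    unfolding hardy_psum_def sum by (intro tendsto_intros)
  also have "(LINT t|lborel. \<phi> t * of_real (pi * cot_regular (x - t))) = of_real pi * R x"
  proof -
    have "(LINT t|lborel. \<phi> t * of_real (pi * cot_regular (x - t))) = (LINT t|lborel. of_real pi * (\<phi> t * of_real (cot_regular (x - t))))"
      by (intro Bochner_Integration.integral_cong) simp_all
    then show ?thesis unfolding R_def integral_mult_right_zero .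
  qed
  also have "Fh x + \<i> * (of_real (1 / pi) * (of_real pi * R x)) = Fper x"
  proof -
    have "P x = \<phi> x" using x by (simp add: P_eq pi2_ident)
    then show ?thesis by (simp add: Fper_def Fh_def HP_eq[OF x] distrib_left)
  qed
  finally show ?thesis .
qed

text \<open>A shift by one period changes a symmetric sum only at its two ends. The end terms tend
  to 0 by the decay of \<open>Fh\<close>, which makes the limit periodic.\<close>

lemma hardy_psum_shift: "hardy_psum N (x + 2) = hardy_psum N x + Fh (x + 2 + 2 * real N) - Fh (x - 2 * real N)"
proof (induction N)
  case 0
  then show ?case by (simp add: hardy_psum_def)
next
  case (Suc N)
  have "hardy_psum (Suc N) (x + 2) = hardy_psum N (x + 2) + pair N (x + 2)" by (simp add: hardy_psum_def)
  moreover have "hardy_psum (Suc N) x = hardy_psum N x + pair N x" by (simp add: hardy_psum_def)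
  ultimately show ?case using Suc unfolding pair_def by (simp add: algebra_simps)
qed

lemma Fh_tendsto_0:
  assumes "filterlim X at_infinity sequentially"
  shows "(\<lambda>n. Fh (X n)) \<longlonglongrightarrow> 0"
proof -
  obtain A where A: "0 \<le> A" "\<And>x. norm (Fh x) \<le> A / (1 + \<bar>x\<bar>)" using Fh_decay by metis
  have a: "filterlim (\<lambda>n. \<bar>X n\<bar>) at_top sequentially"
    using assms unfolding filterlim_at_infinity_conv_norm_at_top by simp
  have "filterlim (\<lambda>n. 1 + \<bar>X n\<bar>) at_top sequentially"
    by (rule filterlim_tendsto_add_at_top[OF tendsto_const a])
  then have "(\<lambda>n. A / (1 + \<bar>X n\<bar>)) \<longlonglongrightarrow> 0"
    by (intro tendsto_divide_0[OF tendsto_const] filterlim_at_top_imp_at_infinity)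
  then show ?thesis by (rule Lim_null_comparison[rotated]) (use A(2) in auto)
qed

lemma hardy_psum_tendsto_shift:
  "(\<lambda>N. hardy_psum N (x + 2)) \<longlonglongrightarrow> l \<longleftrightarrow> (\<lambda>N. hardy_psum N x) \<longlonglongrightarrow> l"
proof -
  have "filterlim (\<lambda>N. x + 2 + 2 * real N) at_top sequentially" by real_asymp
  then have 1: "(\<lambda>N. Fh (x + 2 + 2 * real N)) \<longlonglongrightarrow> 0" by (intro Fh_tendsto_0 filterlim_at_top_imp_at_infinity)
  have "filterlim (\<lambda>N. x - 2 * real N) at_bot sequentially" by real_asymp
  then have 2: "(\<lambda>N. Fh (x - 2 * real N)) \<longlonglongrightarrow> 0" by (intro Fh_tendsto_0 filterlim_at_bot_imp_at_infinity)
  have d: "(\<lambda>N. Fh (x + 2 + 2 * real N) - Fh (x - 2 * real N)) \<longlonglongrightarrow> 0" using tendsto_diff[OF 1 2] by simp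
  show ?thesis
  proof
    assume "(\<lambda>N. hardy_psum N (x + 2)) \<longlonglongrightarrow> l"
    from tendsto_diff[OF this d] show "(\<lambda>N. hardy_psum N x) \<longlonglongrightarrow> l" by (simp add: hardy_psum_shift)
  next
    assume "(\<lambda>N. hardy_psum N x) \<longlonglongrightarrow> l"
    from tendsto_add[OF this d] show "(\<lambda>N. hardy_psum N (x + 2)) \<longlonglongrightarrow> l" by (simp add: hardy_psum_shift add_diff_eq)
  qed
qed

text \<open>Convergence to a fixed limit is a 2-periodic property of x, so it is enough to know it
  on the base interval; the exceptional odd integers form a null set.\<close>

lemma hardy_psum_tendsto:
  assumes "pi2 x \<noteq> -1"
  shows "(\<lambda>N. hardy_psum N x) \<longlonglongrightarrow> Fper x"
proof -
  have "((\<lambda>N. hardy_psum N x) \<longlonglongrightarrow> Fper (pi2 x)) = ((\<lambda>N. hardy_psum N (pi2 x)) \<longlonglongrightarrow> Fper (pi2 x))"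
    using periodic_pi2[of "\<lambda>y. (\<lambda>N. hardy_psum N y) \<longlonglongrightarrow> Fper (pi2 x)" x] hardy_psum_tendsto_shift by blast
  moreover have "(\<lambda>N. hardy_psum N (pi2 x)) \<longlonglongrightarrow> Fper (pi2 x)"
    using assms pi2_bounds[of x] by (intro hardy_psum_tendsto_base) auto
  moreover have "Fper (pi2 x) = Fper x" using periodic_pi2[of Fper] Fper_periodic by blast
  ultimately show ?thesis by simp
qed

lemma AE_pi2_neq: "AE x in lborel. pi2 x \<noteq> -1"
proof -
  have "{x. pi2 x = -1} \<subseteq> range (\<lambda>m::int. -1 + 2 * real_of_int m)"
  proof
    fix x assume "x \<in> {x. pi2 x = -1}"
    moreover obtain m where "x = pi2 x + 2 * of_int m" using pi2_decomp by blast
    ultimately have "x = -1 + 2 * of_int m" by (metis mem_Collect_eq)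
    then show "x \<in> range (\<lambda>m::int. -1 + 2 * real_of_int m)" by blast
  qed
  then have "countable {x. pi2 x = -1}" by (rule countable_subset) auto
  then have "{x. pi2 x = -1} \<in> null_sets lborel" by (rule countable_imp_null_set_lborel)
  then show ?thesis using AE_not_in by force
qed

lemma Fper_bounded: obtains B where "\<And>x. norm (Fper x) \<le> B"
proof -
  obtain B1 where B1: "\<And>x. norm (P x) \<le> B1" using periodic_smooth_bounded[OF P_smooth P_periodic] by metis
  obtain B2 where B2: "\<And>x. norm (HP x) \<le> B2" using periodic_smooth_bounded[OF HP_smooth HP_periodic] by metis
  show thesis
    by (rule that[of "B1 + B2"]) (use B1 B2 in \<open>auto simp: Fper_def norm_mult intro!: norm_triangle_mono\<close>)
qed

lemma Fper_measurable [measurable]: "Fper \<in> borel_measurable borel"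
  unfolding Fper_def by measurable

lemma Fper_hardy: "hardy Fper"
proof -
  obtain C where C: "\<And>N x. norm (hardy_psum N x) \<le> C * (1 + \<bar>x\<bar>)" using hardy_psum_bound by blast
  obtain B where B: "\<And>x. norm (Fper x) \<le> B" using Fper_bounded by blast
  have "AE x in lborel. (\<lambda>N. hardy_psum N x) \<longlonglongrightarrow> Fper x"
    using AE_pi2_neq by eventually_elim (rule hardy_psum_tendsto)
  then show ?thesis by (rule hardy_limit[OF hardy_psum_hardy Fper_measurable B C])
qed

lemma Fper_continuous: "isCont Fper x"
  unfolding Fper_def using smooth_has_vderiv[OF P_smooth] smooth_has_vderiv[OF HP_smooth]
  by (intro continuous_intros) (auto intro: has_vector_derivative_continuous)

lemma Re_Fper: "of_real (Re (Fper x)) = P x" and Im_Fper: "of_real (Im (Fper x)) = HP x"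
  using real[of "pi2 x"] HP_real[of x] by (auto simp: Fper_def P_eq complex_eq_iff)

text \<open>A relation that holds for all test functions extends to the pair P, HP, which makes the
  periodization of a distribution independent of its decomposition. As \<open>Fper\<close> does not
  decay, it is multiplied by two cut factors: one gives the decay and both together the
  integrability that \<open>hardy_annihilates\<close> asks for.\<close>

lemma periodization_annihilates:
  assumes f: "integrable lborel f" and g: "integrable lborel g"
    and ann: "\<And>\<rho>. \<rho> \<in> test_functions UNIV \<Longrightarrow> (\<And>t. Im (\<rho> t) = 0) \<Longrightarrow> (LINT t|lborel. \<rho> t * f t) = (LINT t|lborel. hilbert \<rho> t * g t)"
  shows "(LINT x|lborel. P x * f x) = (LINT x|lborel. HP x * g x)"
proof -
  note [measurable] = borel_measurable_integrable[OF f] borel_measurable_integrable[OF g]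
  obtain B where B: "\<And>x. norm (Fper x) \<le> B" using Fper_bounded by blast
  have B0: "0 \<le> B" using order_trans[OF norm_ge_zero B] .
  define F where "F N x = Fper x * cut N x * cut N x" for N x
  have hF: "hardy (F N)" for N unfolding F_def by (intro hardy_times_cut Fper_hardy)
  note [measurable] = hardyD(1)[OF hF]
  have FB: "norm (F N x) \<le> B" for N x
  proof -
    have "norm (F N x) \<le> norm (Fper x) * 1 * 1"
      unfolding F_def norm_mult by (intro mult_mono norm_cut_le_1) auto
    then show ?thesis using B[of x] by simp
  qed
  have key: "(LINT x|lborel. of_real (Re (F N x)) * f x) = (LINT x|lborel. of_real (Im (F N x)) * g x)" for N
  proof -
    obtain C where C: "0 < C" "\<And>x::real. norm (1 / (of_real x - (- \<i> * of_nat (Suc N)))) \<le> C / (1 + \<bar>x\<bar>)"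
      using cauchy_kernel_bound'[of "- \<i> * of_nat (Suc N)"] by (auto simp del: of_nat_Suc)
    define D where "D = norm (\<i> * of_nat (Suc N)) * C"
    have cb: "norm (cut N x) \<le> D / (1 + \<bar>x\<bar>)" for x
      unfolding cut_eq norm_mult[of "\<i> * of_nat (Suc N)"] D_def times_divide_eq_right[symmetric]
      using C(2)[of x] by (intro mult_left_mono) auto
    have D0: "0 \<le> D" using C by (simp add: D_def)
    have d2: "norm (F N x) \<le> (B * D * D) / (1 + \<bar>x\<bar>)\<^sup>2" for x
    proof -
      have "norm (F N x) \<le> B * (D / (1 + \<bar>x\<bar>)) * (D / (1 + \<bar>x\<bar>))"
        unfolding F_def norm_mult using B cb B0 D0 by (intro mult_mono) auto
      then show ?thesis by (simp add: power2_eq_square mult_ac)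
    qed
    have d1: "norm (F N x) \<le> (B * D) / (1 + \<bar>x\<bar>)" for x
    proof -
      have "norm (F N x) \<le> B * (D / (1 + \<bar>x\<bar>)) * 1"
        unfolding F_def norm_mult using B cb B0 D0 norm_cut_le_1 by (intro mult_mono) auto
      then show ?thesis by simp
    qed
    show ?thesis
    proof (rule hardy_annihilates[OF hF d1 _ _ zero_less_one _ f g ann])
      show "isCont (F N) x" if "x \<noteq> 0" for x
        unfolding F_def cut_def using cut_denominator_nonzero[of x N]
        by (intro continuous_intros Fper_continuous) auto
      have "integrable lborel (F N)" by (rule integrable_bound_inverse_square[OF _ d2]) measurable
      then show "integrable lborel (\<lambda>x. Re (F N x))" by simp
    qed auto
  qed
  have lim: "(\<lambda>N. F N x) \<longlonglongrightarrow> Fper x" for x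
    unfolding F_def using tendsto_mult[OF tendsto_mult[OF tendsto_const cut_tendsto_1] cut_tendsto_1] by simp
  have "(\<lambda>N. LINT x|lborel. of_real (Re (F N x)) * f x) \<longlonglongrightarrow> (LINT x|lborel. of_real (Re (Fper x)) * f x)"
  proof (rule integral_dominated_convergence[where w="\<lambda>t. B * norm (f t)"])
    show "AE t in lborel. norm (of_real (Re (F N t)) * f t) \<le> B * norm (f t)" for N
      unfolding norm_mult norm_of_real by (intro AE_I2 mult_right_mono order_trans[OF abs_Re_le_cmod FB]) auto
  qed (use f in \<open>auto intro!: tendsto_intros lim\<close>)
  moreover have "(\<lambda>N. LINT x|lborel. of_real (Im (F N x)) * g x) \<longlonglongrightarrow> (LINT x|lborel. of_real (Im (Fper x)) * g x)"
  proof (rule integral_dominated_convergence[where w="\<lambda>t. B * norm (g t)"])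
    show "AE t in lborel. norm (of_real (Im (F N t)) * g t) \<le> B * norm (g t)" for N
      unfolding norm_mult norm_of_real by (intro AE_I2 mult_right_mono order_trans[OF abs_Im_le_cmod FB]) auto
  qed (use g in \<open>auto intro!: tendsto_intros lim\<close>)
  ultimately show ?thesis unfolding key Re_Fper Im_Fper by (rule LIMSEQ_unique)
qed

end

subsection \<open>The transfer operator on representatives\<close>

text \<open>The composition operator of the map \<open>pi2 (- \<beta> / x)\<close>, with value 0
  where that map is left undefined. The value type is general because it acts on complex multipliers
  and on the real functions \<open>survive\<close>.\<close>

definition pullback :: "real \<Rightarrow> (real \<Rightarrow> 'a::zero) \<Rightarrow> real \<Rightarrow> 'a" where
  "pullback \<beta> b x = (if 1 \<le> \<bar>- \<beta> / x\<bar> then b (pi2 (- \<beta> / x)) else 0)"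

text \<open>The operator T on integrable functions, extended by 0. For |x| < 1 the points x + 2 j
  with |x + 2 j| \<ge> 1 are exactly those with j \<noteq> 0, so the condition on y removes the
  central term of the periodization.\<close>

definition gtransfer :: "real \<Rightarrow> (real \<Rightarrow> complex) \<Rightarrow> real \<Rightarrow> complex" where
  "gtransfer \<beta> f x = (if \<bar>x\<bar> < 1 then Pi2_fun (\<lambda>y. if 1 \<le> \<bar>y\<bar> then J_fun \<beta> f y else 0) x else 0)"

lemma pullback_measurable [measurable]:
  fixes b :: "real \<Rightarrow> 'a::{zero, topological_space}"
  assumes [measurable]: "b \<in> borel_measurable borel"
  shows "pullback \<beta> b \<in> borel_measurable borel"
  unfolding pullback_def[abs_def] by measurable

text \<open>Duality between transfer and composition operator: unfold the periodization, then
  substitute -\<beta> / x. All later estimates are made on the side of the bounded function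
  b.\<close>

lemma gtransfer_pairing:
  fixes b :: "real \<Rightarrow> complex"
  assumes \<beta>: "0 < \<beta>" and f: "integrable lborel f" and b[measurable]: "b \<in> borel_measurable borel" and B: "\<And>x. norm (b x) \<le> B"
  shows "integrable lborel (\<lambda>x. b x * gtransfer \<beta> f x)"
    and "(LINT x|lborel. b x * gtransfer \<beta> f x) = (LINT x|lborel. pullback \<beta> b x * f x)"
proof -
  note [measurable] = borel_measurable_integrable[OF f]
  have B0: "0 \<le> B" using order_trans[OF norm_ge_zero B] .
  define b' where "b' y = (if 1 \<le> \<bar>y\<bar> then b (pi2 y) else 0)" for y
  define F where "F y = (if 1 \<le> \<bar>y\<bar> then J_fun \<beta> f y else 0)" for y
  have [measurable]: "b' \<in> borel_measurable borel" unfolding b'_def by measurable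
  have [measurable]: "J_fun \<beta> f \<in> borel_measurable borel" unfolding J_fun_def by measurable
  have [measurable]: "F \<in> borel_measurable borel" unfolding F_def by measurable
  have F: "integrable lborel F"
    by (rule Bochner_Integration.integrable_bound[OF J_fun_integral(1)[OF \<beta> f]]) (auto simp: F_def)
  have b'B: "norm (b' y) \<le> B" for y using B B0 by (simp add: b'_def)
  have pullback: "pullback \<beta> b x = b' (- \<beta> / x)" for x by (simp add: pullback_def b'_def)
  have cf: "integrable lborel (\<lambda>x. b' (- \<beta> / x) * f x)"
    by (rule Bochner_Integration.integrable_bound[of _ "\<lambda>x. B * norm (f x)"])
       (use f b'B B0 in \<open>auto simp: norm_mult intro!: AE_I2 mult_right_mono order_trans[OF _ abs_ge_self]\<close>)
  have ae: "AE x in lborel. indicat_real {-1..<1} x *\<^sub>R (b x * Pi2_fun F x) = b x * gtransfer \<beta> f x"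
    using AE_lborel_singleton[of "-1::real"]
    by eventually_elim (auto simp: gtransfer_def F_def[abs_def] indicator_def)
  have tm: "gtransfer \<beta> f \<in> borel_measurable borel"
  proof -
    have "gtransfer \<beta> f = (\<lambda>x. if \<bar>x\<bar> < 1 then Pi2_fun F x else 0)" by (rule ext) (simp add: gtransfer_def F_def[abs_def])
    moreover have [measurable]: "F \<in> borel_measurable borel" unfolding F_def by measurable
    ultimately show ?thesis by simp
  qed
  note Pi = Pi2_fun_pairing[OF F b B]
  show "integrable lborel (\<lambda>x. b x * gtransfer \<beta> f x)"
    using Pi(1) by (rule integrable_cong_AE_imp) (use ae tm in auto)
  have "(LINT x|lborel. b x * gtransfer \<beta> f x) = (LINT x|lborel. indicat_real {-1..<1} x *\<^sub>R (b x * Pi2_fun F x))"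
    by (rule integral_cong_AE) (use ae tm Pi(1) in \<open>auto simp: eq_commute\<close>)
  also have "\<dots> = (LINT x|lborel. b (pi2 x) * F x)" by (rule Pi(2))
  also have "\<dots> = (LINT x|lborel. b' x * J_fun \<beta> f x)"
    by (intro Bochner_Integration.integral_cong) (auto simp: F_def b'_def)
  also have "\<dots> = (LINT x|lborel. b' (- \<beta> / x) * f x)" by (rule J_fun_pairing(1)[OF \<beta> cf])
  finally show "(LINT x|lborel. b x * gtransfer \<beta> f x) = (LINT x|lborel. pullback \<beta> b x * f x)"
    unfolding pullback .
qed

lemma gtransfer_integrable: "0 < \<beta> \<Longrightarrow> integrable lborel f \<Longrightarrow> integrable lborel (gtransfer \<beta> f)"
  using gtransfer_pairing(1)[of \<beta> f "\<lambda>_. 1" 1] by simp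

text \<open>
  \<open>Im Q\<close> differs from the pullback of \<open>H \<phi>\<close> by an integral operator applied to \<open>\<phi>\<close>. Its kernel is bounded for
  \<open>\<bar>t\<bar> < \<gamma> < 1\<close>: the singularities at \<open>t = pi2 (- \<beta> / x)\<close> cancel.
\<close>

definition residual_ker :: "real \<Rightarrow> real \<Rightarrow> real \<Rightarrow> real" where
  "residual_ker \<beta> x t = cot_regular (pi2 (- \<beta> / x) - t) - cot_regular (- t)
     - (if 1 \<le> \<bar>- \<beta> / x\<bar> then 1 / (pi * (- \<beta> / x - t)) else 0)"

definition residual :: "real \<Rightarrow> real \<Rightarrow> (real \<Rightarrow> complex) \<Rightarrow> real \<Rightarrow> complex" where
  "residual \<gamma> \<beta> g t = (if \<bar>t\<bar> < \<gamma> then LINT x|lborel. of_real (residual_ker \<beta> x t) * g x else 0)"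

lemma residual_ker_measurable [measurable]: "(\<lambda>(x, t). residual_ker \<beta> x t) \<in> borel_measurable (borel \<Otimes>\<^sub>M borel)"
  unfolding residual_ker_def by measurable

text \<open>Twice the bound of \<open>cot_regular_bound\<close> with r = 1 + \<gamma>, plus a bound
  for 1 / (pi (y - t)) when |y| \<ge> 1 and |t| < \<gamma>.\<close>

definition residual_ker_const :: "real \<Rightarrow> real" where
  "residual_ker_const \<gamma> = 2 * ((2 / (2 - (1 + \<gamma>))\<^sup>2 * (pi\<^sup>2 / 6)) * (1 + \<gamma>)) + 1 / (1 - \<gamma>)"

lemma residual_ker_bound:
  assumes "0 < \<gamma>" "\<gamma> < 1" "\<bar>t\<bar> < \<gamma>"
  shows "\<bar>residual_ker \<beta> x t\<bar> \<le> residual_ker_const \<gamma>"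
proof -
  let ?C = "(2 / (2 - (1 + \<gamma>))\<^sup>2 * (pi\<^sup>2 / 6)) * (1 + \<gamma>)" and ?y = "- \<beta> / x"
  have 1: "\<bar>cot_regular (pi2 ?y - t)\<bar> \<le> ?C"
    using pi2_bounds[of ?y] assms by (intro cot_regular_bound) auto
  have 2: "\<bar>cot_regular (- t)\<bar> \<le> ?C" using assms by (intro cot_regular_bound) auto
  have 3: "\<bar>if 1 \<le> \<bar>?y\<bar> then 1 / (pi * (?y - t)) else 0\<bar> \<le> 1 / (1 - \<gamma>)"
  proof (cases "1 \<le> \<bar>?y\<bar>")
    case True
    then have "1 - \<gamma> \<le> \<bar>?y - t\<bar>" using assms(3) by linarith
    moreover have "1 * \<bar>?y - t\<bar> \<le> pi * \<bar>?y - t\<bar>" using pi_gt3 by (intro mult_right_mono) auto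
    ultimately have "1 - \<gamma> \<le> pi * \<bar>?y - t\<bar>" unfolding mult_1_left by (rule order_trans)
    then have "1 / (pi * \<bar>?y - t\<bar>) \<le> 1 / (1 - \<gamma>)" using assms by (intro frac_le) auto
    then show ?thesis using True by (simp add: abs_mult)
  qed (use assms in simp)
  show ?thesis unfolding residual_ker_def residual_ker_const_def using 1 2 3 by linarith
qed

lemma residual_ker_const_nonneg: "0 < \<gamma> \<Longrightarrow> \<gamma> < 1 \<Longrightarrow> 0 \<le> residual_ker_const \<gamma>"
  using residual_ker_bound[of \<gamma> 0 1 1] by (rule order_trans[OF abs_ge_zero]) auto

text \<open>A pointwise majorant is recorded, since the iteration weighs the residual against the
  functions \<open>survive\<close>, whose mass decays geometrically.\<close>

lemma residual_bound:
  assumes \<gamma>: "0 < \<gamma>" "\<gamma> < 1" and g: "integrable lborel g"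
  shows "norm (residual \<gamma> \<beta> g t) \<le> residual_ker_const \<gamma> * (LINT x|lborel. norm (g x)) * indicat_real {-1<..<1} t"
    and "integrable lborel (residual \<gamma> \<beta> g)"
proof -
  note [measurable] = borel_measurable_integrable[OF g]
  have *: "norm (residual \<gamma> \<beta> g t) \<le> residual_ker_const \<gamma> * (LINT x|lborel. norm (g x)) * indicat_real {-1<..<1} t" for t
  proof (cases "\<bar>t\<bar> < \<gamma>")
    case True
    have "norm (LINT x|lborel. of_real (residual_ker \<beta> x t) * g x) \<le> (LINT x|lborel. residual_ker_const \<gamma> * norm (g x))"
      by (rule norm_integral_le) (use g residual_ker_bound[OF \<gamma> True] in \<open>auto simp: norm_mult intro!: mult_right_mono\<close>)
    moreover have "indicat_real {-1<..<1} t = 1" using True \<gamma> by (auto simp: indicator_def abs_less_iff)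
    ultimately show ?thesis using True by (simp add: residual_def)
  qed (use residual_ker_const_nonneg[OF \<gamma>] in \<open>simp add: residual_def\<close>)
  then show "norm (residual \<gamma> \<beta> g t) \<le> residual_ker_const \<gamma> * (LINT x|lborel. norm (g x)) * indicat_real {-1<..<1} t" .
  have [measurable]: "residual \<gamma> \<beta> g \<in> borel_measurable borel"
  proof -
    have "(\<lambda>t. LINT x|lborel. of_real (residual_ker \<beta> x t) * g x) \<in> borel_measurable borel" by measurable
    then show ?thesis unfolding residual_def[abs_def] by measurable
  qed
  show "integrable lborel (residual \<gamma> \<beta> g)"
    by (rule Bochner_Integration.integrable_bound[OF integrable_indicator_I1[of "residual_ker_const \<gamma> * (LINT x|lborel. norm (g x))"]])
       (use * in \<open>auto intro!: AE_I2 order_trans[OF _ abs_ge_self]\<close>)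
qed

context real_test
begin

lemma cot_regular_times_integrable:
  assumes "\<bar>z\<bar> < 1"
  shows "integrable lborel (\<lambda>t. \<phi> t * of_real (cot_regular (z - t)))"
proof (rule integrable_times(1))
  fix t assume "\<bar>t\<bar> < b"
  then show "norm (complex_of_real (cot_regular (z - t))) \<le> (2 / (2 - (1 + b))\<^sup>2 * (pi\<^sup>2 / 6)) * (1 + b)"
    unfolding norm_of_real using assms b by (intro cot_regular_bound) auto
qed measurable

lemma R_real: "Im (R x) = 0"
proof -
  have "\<phi> t * of_real (cot_regular (x - t)) = of_real (Re (\<phi> t) * cot_regular (x - t))" for t
    using real[of t] by (simp add: complex_eq_iff)
  then have "R x = of_real (LINT t|lborel. Re (\<phi> t) * cot_regular (x - t))"
    unfolding R_def by (simp only: integral_complex_of_real)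
  then show ?thesis by (simp only: Im_complex_of_real)
qed

text \<open>The Hardy function belonging to the sum over the nonzero translates. Its real part P -
  \<phi> vanishes on ]-1, 1[, and there its imaginary part is R.\<close>

definition G0 :: "real \<Rightarrow> complex" where "G0 y = Fper y - Fh y"

lemma G0_near: "\<bar>y\<bar> < 1 \<Longrightarrow> G0 y = \<i> * R y"
  by (simp add: G0_def Fper_def Fh_def HP_eq P_eq pi2_ident distrib_left)

lemma G0_hardy: "hardy G0"
  unfolding G0_def[abs_def] by (intro hardy_diff Fper_hardy Fh_hardy)

lemma H\<phi>_continuous: "isCont H\<phi> x"
proof -
  obtain L where 1: "compact_lipschitz \<phi> b L" using compact_lipschitz_data by blast
  have "continuous_on UNIV (hilbert \<phi>)"
    using compact_lipschitz.hilbert_int_cont[OF 1] compact_lipschitz.hilbert_eq[OF 1] by presburger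
  then show ?thesis unfolding H\<phi>_def by (simp add: continuous_on_eq_continuous_at)
qed

lemma G0_continuous: "isCont G0 x"
  unfolding G0_def Fh_def using smooth_has_vderiv[OF \<phi>_smooth]
  by (intro continuous_intros Fper_continuous H\<phi>_continuous) (auto intro: has_vector_derivative_continuous)

text \<open>As |x| tends to infinity, -\<beta> / x tends to 0; hence this estimate at 0 is the
  source of the decay of Q at infinity.\<close>

lemma R_lipschitz: obtains K where "0 \<le> K" "\<And>y. \<bar>y\<bar> < 1 \<Longrightarrow> norm (R y - R 0) \<le> K * \<bar>y\<bar>"
proof -
  define C where "C = 2 / (2 - (1 + b))\<^sup>2 * (pi\<^sup>2 / 6)"
  define I where "I = (LINT t|lborel. norm (\<phi> t))"
  have "norm (R y - R 0) \<le> (C * I) * \<bar>y\<bar>" if y: "\<bar>y\<bar> < 1" for y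
  proof -
    note int = cot_regular_times_integrable
    have "R y - R 0 = (LINT t|lborel. \<phi> t * of_real (cot_regular (y - t)) - \<phi> t * of_real (cot_regular (0 - t)))"
      unfolding R_def using int[OF y] int[of 0] by simp
    also have "\<dots> = (LINT t|lborel. \<phi> t * of_real (cot_regular (y - t) - cot_regular (0 - t)))"
      by (simp add: right_diff_distrib)
    also have "norm \<dots> \<le> \<bar>C * \<bar>y\<bar>\<bar> * I"
      unfolding I_def
    proof (rule weighted_bound)
      fix t assume t: "\<bar>t\<bar> < b"
      have "\<bar>cot_regular (y - t) - cot_regular (0 - t)\<bar> \<le> C * \<bar>y - t - (0 - t)\<bar>"
        unfolding C_def using t y b by (intro cot_regular_lipschitz) auto
      then show "\<bar>cot_regular (y - t) - cot_regular (0 - t)\<bar> \<le> C * \<bar>y\<bar>" by simp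
    qed measurable
    also have "\<dots> = (C * I) * \<bar>y\<bar>" by (simp add: C_def abs_mult)
    finally show ?thesis .
  qed
  moreover have "0 \<le> C * I" by (simp add: C_def I_def)
  ultimately show thesis using that by blast
qed

text \<open>
  By the definition of the operators, \<open>\<langle>\<phi>, T u\<rangle> = \<integral> Re Q f - \<integral> Im Q g\<close> for every \<open>u = f + H g\<close>. The constant is
  harmless because \<open>\<integral> g = 0\<close>, and it makes \<open>Q\<close> decay.
\<close>

definition Q :: "real \<Rightarrow> real \<Rightarrow> complex" where "Q \<beta> x = G0 (- \<beta> / x) - \<i> * R 0"

lemma Q_hardy: "0 < \<beta> \<Longrightarrow> hardy (Q \<beta>)"
  unfolding Q_def[abs_def] by (rule hardy_diff[OF hardy_inversion[OF _ G0_hardy] hardy_const])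

lemma Q_far: "\<bar>- \<beta> / x\<bar> < 1 \<Longrightarrow> Q \<beta> x = \<i> * (R (- \<beta> / x) - R 0)"
  unfolding Q_def by (simp only: G0_near right_diff_distrib)

lemma Q_decay:
  assumes \<beta>: "0 < \<beta>"
  obtains C where "\<And>x. norm (Q \<beta> x) \<le> C / (1 + \<bar>x\<bar>)"
proof -
  obtain B where B: "0 \<le> B" "\<And>x. norm (Q \<beta> x) \<le> B" using hardy_bounded[OF Q_hardy[OF \<beta>]] by blast
  obtain K where K: "0 \<le> K" "\<And>y. \<bar>y\<bar> < 1 \<Longrightarrow> norm (R y - R 0) \<le> K * \<bar>y\<bar>" using R_lipschitz by blast
  have "norm (Q \<beta> x) \<le> (B * (1 + \<beta>) + K * (1 + \<beta>)) / (1 + \<bar>x\<bar>)" for x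
  proof (cases "\<bar>x\<bar> \<le> \<beta>")
    case True
    have "norm (Q \<beta> x) * (1 + \<bar>x\<bar>) \<le> B * (1 + \<beta>)" using B True \<beta> by (intro mult_mono) auto
    also have "\<dots> \<le> B * (1 + \<beta>) + K * (1 + \<beta>)" using K \<beta> by simp
    finally show ?thesis by (simp add: pos_le_divide_eq add_pos_nonneg)
  next
    case False
    then have x: "\<beta> < \<bar>x\<bar>" "0 < \<bar>x\<bar>" using \<beta> by auto
    have y: "\<bar>- \<beta> / x\<bar> = \<beta> / \<bar>x\<bar>" using \<beta> by simp
    then have y1: "\<bar>- \<beta> / x\<bar> < 1" using x by simp
    have "norm (Q \<beta> x) \<le> K * (\<beta> / \<bar>x\<bar>)"
      unfolding Q_far[OF y1] norm_mult using K(2)[OF y1] unfolding y by (simp only: norm_ii mult_1_left)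
    then have "norm (Q \<beta> x) * (1 + \<bar>x\<bar>) \<le> K * (\<beta> / \<bar>x\<bar>) * (1 + \<bar>x\<bar>)" by (intro mult_right_mono) auto
    also have "\<dots> = K * (\<beta> / \<bar>x\<bar> + \<beta>)" using x by (simp add: field_simps)
    also have "\<dots> \<le> K * (1 + \<beta>)" using x K by (intro mult_left_mono) auto
    also have "\<dots> \<le> B * (1 + \<beta>) + K * (1 + \<beta>)" using B \<beta> by simp
    finally show ?thesis by (simp add: pos_le_divide_eq add_pos_nonneg)
  qed
  then show thesis by (rule that)
qed

text \<open>A nonzero real part requires |\<beta> / x| \<ge> 1 and -\<beta> / x to be within b of an
  even integer, which cannot be 0; so |\<beta> / x| \<ge> 2 - b.\<close>

lemma Re_Q_support:
  assumes \<beta>: "0 < \<beta>" and nz: "Re (Q \<beta> x) \<noteq> 0"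
  shows "\<bar>x\<bar> \<le> \<beta> / (2 - b)"
proof -
  let ?y = "- \<beta> / x"
  have y: "1 \<le> \<bar>?y\<bar>"
  proof (rule ccontr)
    assume "\<not> 1 \<le> \<bar>?y\<bar>"
    then have "Re (Q \<beta> x) = 0" by (subst Q_far) (auto simp: R_real)
    then show False using nz by simp
  qed
  have "Re (Q \<beta> x) = Re (P ?y) - Re (\<phi> ?y)"
    unfolding Q_def G0_def Fper_def Fh_def by (simp add: R_real HP_real H\<phi>_real)
  also have "\<phi> ?y = 0" using supp1[OF y] .
  finally have "\<phi> (pi2 ?y) \<noteq> 0" using nz by (auto simp: P_eq)
  then have p: "\<bar>pi2 ?y\<bar> < b" using supp[of "pi2 ?y"] by linarith
  obtain j where j: "?y = pi2 ?y + 2 * of_int j" using pi2_decomp by blast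
  have "j \<noteq> 0" using j p y b by auto
  then have "1 \<le> \<bar>real_of_int j\<bar>" by linarith
  then have "2 - b \<le> \<bar>?y\<bar>" using j p by linarith
  moreover have "\<bar>?y\<bar> = \<beta> / \<bar>x\<bar>" using \<beta> by simp
  moreover have "x \<noteq> 0" using y by auto
  ultimately have "(2 - b) * \<bar>x\<bar> \<le> \<beta>" by (simp add: pos_le_divide_eq)
  then show ?thesis using b by (simp add: pos_le_divide_eq mult.commute)
qed

text \<open>Re Q lives on [-\<beta>, \<beta>], so mollifiers of radius (\<gamma> - \<beta>) / 2 stay
  inside ]-\<gamma>, \<gamma>[, and Q is continuous away from 0. The relation thus extends from test
  functions on ]-\<gamma>, \<gamma>[ to Q.\<close>

lemma Q_annihilates:
  assumes \<beta>: "0 < \<beta>" "\<beta> < \<gamma>" and f: "integrable lborel f" and g: "integrable lborel g"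
    and ann: "\<And>\<rho>. \<rho> \<in> test_functions {-\<gamma><..<\<gamma>} \<Longrightarrow> (\<And>t. Im (\<rho> t) = 0) \<Longrightarrow>
      (LINT t|lborel. \<rho> t * f t) = (LINT t|lborel. hilbert \<rho> t * g t)"
  shows "(LINT x|lborel. of_real (Re (Q \<beta> x)) * f x) = (LINT x|lborel. of_real (Im (Q \<beta> x)) * g x)"
proof -
  obtain C where C: "\<And>x. norm (Q \<beta> x) \<le> C / (1 + \<bar>x\<bar>)" using Q_decay[OF \<beta>(1)] by blast
  obtain B where B: "0 \<le> B" "\<And>x. norm (Q \<beta> x) \<le> B" using hardy_bounded[OF Q_hardy[OF \<beta>(1)]] by blast
  note [measurable] = hardyD(1)[OF Q_hardy[OF \<beta>(1)]]
  have lt: "\<beta> / (2 - b) \<le> \<beta>" using b \<beta> by (simp add: pos_divide_le_eq)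
  show ?thesis
  proof (rule hardy_annihilates[OF Q_hardy[OF \<beta>(1)] C _ _ _ _ f g ann])
    show "isCont (Q \<beta>) x" if "x \<noteq> 0" for x
      unfolding Q_def using that by (intro continuous_intros isCont_o2[OF _ G0_continuous]) auto
    have "integrable lborel (\<lambda>x. complex_of_real (Re (Q \<beta> x)))"
    proof (rule integrable_bounded_support(1)[where R = "\<beta> / (2 - b)"])
      show "norm (complex_of_real (Re (Q \<beta> x))) \<le> B" for x
        unfolding norm_of_real using abs_Re_le_cmod B(2) by (rule order_trans)
      show "complex_of_real (Re (Q \<beta> x)) = 0" if "\<beta> / (2 - b) < \<bar>x\<bar>" for x
        using Re_Q_support[OF \<beta>(1), of x] that by force
    qed measurable
    then show "integrable lborel (\<lambda>x. Re (Q \<beta> x))" by (simp add: complex_of_real_integrable_eq)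
    show "0 < (\<gamma> - \<beta>) / 2" using \<beta> by simp
    show "cball s ((\<gamma> - \<beta>) / 2) \<subseteq> {-\<gamma><..<\<gamma>}" if "Re (Q \<beta> s) \<noteq> 0" for s
    proof
      fix x assume "x \<in> cball s ((\<gamma> - \<beta>) / 2)"
      then have "\<bar>s - x\<bar> \<le> (\<gamma> - \<beta>) / 2" by (simp add: dist_real_def)
      moreover have "\<bar>s\<bar> \<le> \<beta>" using Re_Q_support[OF \<beta>(1) that] lt by linarith
      moreover have "\<bar>x\<bar> \<le> \<bar>s\<bar> + \<bar>s - x\<bar>" using abs_triangle_ineq4[of s "s - x"] by simp
      ultimately have "\<bar>x\<bar> < \<gamma>" using \<beta> by (simp add: field_simps)
      then show "x \<in> {-\<gamma><..<\<gamma>}" by auto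
    qed
  qed
qed

lemma Q_values:
  assumes p: "pi2 (- \<beta> / x) \<noteq> -1"
  shows "of_real (Re (Q \<beta> x)) = pullback \<beta> \<phi> x"
    and "of_real (Im (Q \<beta> x)) = pullback \<beta> H\<phi> x + (LINT t|lborel. \<phi> t * of_real (residual_ker \<beta> x t))"
proof -
  define y where "y = - \<beta> / x"
  note int = cot_regular_times_integrable
  have py: "\<bar>pi2 y\<bar> < 1" using p pi2_bounds[of y] by (auto simp: y_def abs_less_iff)
  have dR: "(LINT t|lborel. \<phi> t * of_real (cot_regular (pi2 y - t) - cot_regular (- t))) = R (pi2 y) - R 0"
    unfolding R_def using int[OF py] int[of 0] by (simp add: right_diff_distrib)
  have idR: "integrable lborel (\<lambda>t. \<phi> t * of_real (cot_regular (pi2 y - t) - cot_regular (- t)))"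
    using Bochner_Integration.integrable_diff[OF int[OF py] int[of 0]] by (simp add: right_diff_distrib)
  have "of_real (Re (Q \<beta> x)) = pullback \<beta> \<phi> x \<and> of_real (Im (Q \<beta> x)) = pullback \<beta> H\<phi> x + (LINT t|lborel. \<phi> t * of_real (residual_ker \<beta> x t))"
  proof (cases "1 \<le> \<bar>y\<bar>")
    case False
    then have "Q \<beta> x = \<i> * (R y - R 0)" using Q_far[of \<beta> x] by (simp add: y_def)
    moreover have "pi2 y = y" using False by (intro pi2_ident) auto
    moreover have "(LINT t|lborel. \<phi> t * of_real (residual_ker \<beta> x t)) = R (pi2 y) - R 0"
      unfolding dR[symmetric] residual_ker_def using False by (simp add: y_def)
    ultimately show ?thesis unfolding pullback_def y_def[symmetric] using False R_real by (simp add: complex_eq_iff)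
  next
    case True
    have off: "H\<phi> y = of_real (1 / pi) * (LINT t|lborel. \<phi> t / of_real (y - t))"
      using True b by (intro H\<phi>_off_support) auto
    have HPy: "HP y = HP (pi2 y)" using periodic_pi2[of HP y] HP_periodic by simp
    have Qv: "Q \<beta> x = \<phi> (pi2 y) + \<i> * (H\<phi> (pi2 y) + (R (pi2 y) - R 0) - H\<phi> y)"
      unfolding Q_def y_def[symmetric] G0_def Fper_def Fh_def P_eq supp1[OF True] HPy HP_eq[OF py]
      by (simp add: algebra_simps)
    have ik: "integrable lborel (\<lambda>t. \<phi> t * of_real (1 / (pi * (y - t))))"
    proof (rule integrable_times(1))
      fix t assume t: "\<bar>t\<bar> < b"
      have "1 - b \<le> \<bar>y - t\<bar>" using True t by linarith
      moreover have "1 * \<bar>y - t\<bar> \<le> pi * \<bar>y - t\<bar>" using pi_gt3 by (intro mult_right_mono) auto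
      ultimately have "1 - b \<le> pi * \<bar>y - t\<bar>" unfolding mult_1_left by (rule order_trans)
      then have "1 / (pi * \<bar>y - t\<bar>) \<le> 1 / (1 - b)" using b by (intro frac_le) auto
      then show "norm (complex_of_real (1 / (pi * (y - t)))) \<le> 1 / (1 - b)" unfolding norm_of_real by (simp add: abs_mult)
    qed measurable
    have Hy: "(LINT t|lborel. \<phi> t * of_real (1 / (pi * (y - t)))) = H\<phi> y"
    proof -
      have "(LINT t|lborel. \<phi> t * of_real (1 / (pi * (y - t)))) = (LINT t|lborel. of_real (1 / pi) * (\<phi> t / of_real (y - t)))"
        by (intro Bochner_Integration.integral_cong) simp_all
      then show ?thesis unfolding off integral_mult_right_zero .
    qed
    have "(LINT t|lborel. \<phi> t * of_real (residual_ker \<beta> x t))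
      = (LINT t|lborel. \<phi> t * of_real (cot_regular (pi2 y - t) - cot_regular (- t)) - \<phi> t * of_real (1 / (pi * (y - t))))"
      unfolding residual_ker_def y_def[symmetric] using True by (intro Bochner_Integration.integral_cong) (simp_all add: algebra_simps)
    also have "\<dots> = R (pi2 y) - R 0 - H\<phi> y"
      using Bochner_Integration.integral_diff[OF idR ik] unfolding dR Hy .
    finally have k: "(LINT t|lborel. \<phi> t * of_real (residual_ker \<beta> x t)) = R (pi2 y) - R 0 - H\<phi> y" .
    show ?thesis unfolding k pullback_def y_def[symmetric] using True Qv real[of "pi2 y"] R_real H\<phi>_real
      by (simp add: complex_eq_iff)
  qed
  then show "of_real (Re (Q \<beta> x)) = pullback \<beta> \<phi> x"
    "of_real (Im (Q \<beta> x)) = pullback \<beta> H\<phi> x + (LINT t|lborel. \<phi> t * of_real (residual_ker \<beta> x t))" by auto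
qed

lemma AE_pi2_inversion_neq: "AE x in lborel. pi2 (- \<beta> / x) \<noteq> -1"
proof -
  have "{x. pi2 (- \<beta> / x) = -1} \<subseteq> insert 0 (range (\<lambda>m::int. - \<beta> / (-1 + 2 * real_of_int m)))"
  proof
    fix x assume x: "x \<in> {x. pi2 (- \<beta> / x) = -1}"
    show "x \<in> insert 0 (range (\<lambda>m::int. - \<beta> / (-1 + 2 * real_of_int m)))"
    proof (cases "x = 0 \<or> \<beta> = 0")
      case True
      then show ?thesis using x pi2_ident[of 0] by auto
    next
      case False
      obtain m where m: "- \<beta> / x = pi2 (- \<beta> / x) + 2 * of_int m" using pi2_decomp by blast
      then have "- \<beta> / x = -1 + 2 * of_int m" using x by auto
      then have "x = - \<beta> / (-1 + 2 * of_int m)" using False by (metis divide_divide_eq_right divide_self_if mult_1 neg_equal_0_iff_equal nonzero_mult_div_cancel_left)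
      then show ?thesis by blast
    qed
  qed
  then have "countable {x. pi2 (- \<beta> / x) = -1}" by (rule countable_subset) auto
  then have "{x. pi2 (- \<beta> / x) = -1} \<in> null_sets lborel" by (rule countable_imp_null_set_lborel)
  then show ?thesis using AE_not_in by force
qed

lemma H\<phi>_bounded: obtains B where "\<And>x. norm (H\<phi> x) \<le> B"
  using hilbert_decay[OF test_UNIV] unfolding H\<phi>_def by metis

lemma \<phi>_bounded: obtains B where "\<And>x. norm (\<phi> x) \<le> B"
proof -
  obtain L where 1: "compact_lipschitz \<phi> b L" using compact_lipschitz_data by blast
  show thesis by (rule that[OF compact_lipschitz.B(2)[OF 1]])
qed

text \<open>The triangular form of one step: composition with the map is dualized to T in both
  components, and Fubini moves the correction kernel from \<phi> to g, where it becomes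
  \<open>residual\<close>. Because b \<le> \<gamma>, the cut-off in \<open>residual\<close> loses
  nothing on the support of \<phi>.\<close>

lemma Q_pairing:
  assumes \<beta>: "0 < \<beta>" and \<gamma>: "b \<le> \<gamma>" "\<gamma> < 1" and f: "integrable lborel f" and g: "integrable lborel g"
  shows "(LINT x|lborel. of_real (Re (Q \<beta> x)) * f x) - (LINT x|lborel. of_real (Im (Q \<beta> x)) * g x)
    = (LINT x|lborel. \<phi> x * (gtransfer \<beta> f x - residual \<gamma> \<beta> g x)) - (LINT x|lborel. H\<phi> x * gtransfer \<beta> g x)"
proof -
  note [measurable] = borel_measurable_integrable[OF f] borel_measurable_integrable[OF g]
  have \<gamma>0: "0 < \<gamma>" using \<gamma> b by simp
  obtain B where B: "\<And>x. norm (\<phi> x) \<le> B" using \<phi>_bounded by blast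
  obtain B' where B': "\<And>x. norm (H\<phi> x) \<le> B'" using H\<phi>_bounded by blast
  have B0: "0 \<le> B" "0 \<le> B'" using order_trans[OF norm_ge_zero B] order_trans[OF norm_ge_zero B'] .
  note hm[measurable] = hardyD(1)[OF Q_hardy[OF \<beta>]]
  note T1 = gtransfer_pairing[OF \<beta> f measurables(1) B] and T2 = gtransfer_pairing[OF \<beta> g measurables(3) B']
  have m2: "(\<lambda>(x, t). \<phi> t * of_real (residual_ker \<beta> x t) * g x) \<in> borel_measurable (lborel \<Otimes>\<^sub>M lborel)" by measurable
  have le: "norm (\<phi> t * of_real (residual_ker \<beta> x t) * g x) \<le> residual_ker_const \<gamma> * norm (g x) * norm (\<phi> t)" for x t
  proof (cases "\<bar>t\<bar> < b")
    case True
    then have "\<bar>residual_ker \<beta> x t\<bar> \<le> residual_ker_const \<gamma>" using \<gamma> \<gamma>0 by (intro residual_ker_bound) auto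
    then have "norm (\<phi> t) * \<bar>residual_ker \<beta> x t\<bar> * norm (g x) \<le> norm (\<phi> t) * residual_ker_const \<gamma> * norm (g x)"
      by (intro mult_right_mono mult_left_mono) auto
    then show ?thesis by (simp add: norm_mult mult_ac)
  qed (simp add: supp)
  have ig: "integrable lborel (\<lambda>x. residual_ker_const \<gamma> * norm (g x))" "integrable lborel (\<lambda>t. norm (\<phi> t))"
    using g \<phi>_integrable by auto
  have F: "(LINT x|lborel. LINT t|lborel. \<phi> t * of_real (residual_ker \<beta> x t) * g x) = (LINT t|lborel. LINT x|lborel. \<phi> t * of_real (residual_ker \<beta> x t) * g x)"
    by (rule Fubini_product_bound(1)[OF m2 ig le])
  have Fi: "integrable lborel (\<lambda>x. LINT t|lborel. \<phi> t * of_real (residual_ker \<beta> x t) * g x)"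
    by (rule Fubini_product_bound(2)[OF m2 ig le])
  have pt: "(LINT x|lborel. \<phi> t * of_real (residual_ker \<beta> x t) * g x) = \<phi> t * residual \<gamma> \<beta> g t" for t
  proof (cases "\<bar>t\<bar> < \<gamma>")
    case True
    then show ?thesis unfolding mult.assoc integral_mult_right_zero by (simp add: residual_def)
  next
    case False
    then have "\<phi> t = 0" using \<gamma> supp by simp
    then show ?thesis by simp
  qed
  note res = arg_cong[OF ext[OF pt], of "integral\<^sup>L lborel"]
  have ri: "integrable lborel (\<lambda>t. \<phi> t * residual \<gamma> \<beta> g t)"
    using Fubini_product_bound(3)[OF m2 ig le] unfolding pt .
  have re: "(LINT x|lborel. of_real (Re (Q \<beta> x)) * f x) = (LINT x|lborel. \<phi> x * gtransfer \<beta> f x)"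
    unfolding T1(2)
  proof (rule integral_cong_AE)
    show "AE x in lborel. of_real (Re (Q \<beta> x)) * f x = pullback \<beta> \<phi> x * f x"
      using AE_pi2_inversion_neq[of \<beta>] by eventually_elim (simp add: Q_values(1))
  qed measurable
  have ci: "integrable lborel (\<lambda>x. pullback \<beta> H\<phi> x * g x)"
    by (rule Bochner_Integration.integrable_bound[of _ "\<lambda>x. B' * norm (g x)"])
       (use g B' B0 in \<open>auto simp: pullback_def norm_mult intro!: AE_I2 mult_right_mono order_trans[OF _ abs_ge_self]\<close>)
  have im: "(LINT x|lborel. of_real (Im (Q \<beta> x)) * g x) = (LINT x|lborel. H\<phi> x * gtransfer \<beta> g x) + (LINT t|lborel. \<phi> t * residual \<gamma> \<beta> g t)"
  proof -
    have "(LINT x|lborel. of_real (Im (Q \<beta> x)) * g x) = (LINT x|lborel. pullback \<beta> H\<phi> x * g x + (LINT t|lborel. \<phi> t * of_real (residual_ker \<beta> x t) * g x))"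
    proof (rule integral_cong_AE)
      show "AE x in lborel. of_real (Im (Q \<beta> x)) * g x = pullback \<beta> H\<phi> x * g x + (LINT t|lborel. \<phi> t * of_real (residual_ker \<beta> x t) * g x)"
        using AE_pi2_inversion_neq[of \<beta>] by eventually_elim (simp add: Q_values(2) distrib_right)
    qed (use ci Fi in measurable)
    also have "\<dots> = (LINT x|lborel. pullback \<beta> H\<phi> x * g x) + (LINT x|lborel. LINT t|lborel. \<phi> t * of_real (residual_ker \<beta> x t) * g x)"
      by (rule Bochner_Integration.integral_add[OF ci Fi])
    finally show ?thesis unfolding F res T2(2) .
  qed
  have "(LINT x|lborel. \<phi> x * (gtransfer \<beta> f x - residual \<gamma> \<beta> g x)) = (LINT x|lborel. \<phi> x * gtransfer \<beta> f x) - (LINT t|lborel. \<phi> t * residual \<gamma> \<beta> g t)"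
    using Bochner_Integration.integral_diff[OF T1(1) ri] by (simp add: right_diff_distrib)
  then show ?thesis unfolding re im by simp
qed

end

section \<open>Unfolding the operators on distributions\<close>

lemma integrable_bounded_times:
  fixes b f :: "real \<Rightarrow> complex"
  assumes f: "integrable lborel f" and [measurable]: "b \<in> borel_measurable borel" and B: "\<And>x. norm (b x) \<le> B"
  shows "integrable lborel (\<lambda>x. b x * f x)"
proof -
  have B0: "0 \<le> B" using order_trans[OF norm_ge_zero B] .
  show ?thesis
    by (rule Bochner_Integration.integrable_bound[of _ "\<lambda>x. B * norm (f x)"])
       (use f B B0 in \<open>auto simp: norm_mult intro!: AE_I2 mult_right_mono order_trans[OF _ abs_ge_self]\<close>)
qed

lemma integral_periodic_pairing:
  assumes f: "integrable lborel f" and m[measurable]: "b \<in> borel_measurable borel" and B: "\<And>x. norm (b x) \<le> B"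
    and per: "\<And>x. b (x + 2) = b x"
  shows "(LINT x:{-1..1}|lborel. b x * Pi2_fun f x) = (LINT x|lborel. b x * f x)"
proof -
  note Pi = Pi2_fun_pairing[OF f m B]
  note [measurable] = Pi2_fun_measurable[OF borel_measurable_integrable[OF f, simplified]]
  have "(LINT x:{-1..1}|lborel. b x * Pi2_fun f x) = (LINT x|lborel. indicat_real {-1..<1} x *\<^sub>R (b x * Pi2_fun f x))"
    unfolding set_lebesgue_integral_def
  proof (rule integral_cong_AE)
    show "AE x in lborel. indicat_real {-1..1} x *\<^sub>R (b x * Pi2_fun f x) = indicat_real {-1..<1} x *\<^sub>R (b x * Pi2_fun f x)"
      using AE_lborel_singleton[of "1::real"] by eventually_elim (auto simp: indicator_def)
  qed measurable
  then show ?thesis using Pi(2) by (simp add: periodic_pi2[of b, OF per])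
qed

lemma decomp_properties:
  assumes "U \<in> frakL"
  obtains f g where "decomp U = (f, g)" "f \<in> L1" "g \<in> L1_0" "U = L1_plus_HL1 f g"
proof -
  obtain f g where fg: "decomp U = (f, g)" by (cases "decomp U")
  have "\<exists>p. case p of (f, g) \<Rightarrow> f \<in> L1 \<and> g \<in> L1_0 \<and> U = L1_plus_HL1 f g"
    using assms by (auto simp: frakL_def)
  then have "case decomp U of (f, g) \<Rightarrow> f \<in> L1 \<and> g \<in> L1_0 \<and> U = L1_plus_HL1 f g"
    unfolding decomp_def by (rule someI_ex)
  then show thesis using that fg by auto
qed

lemma L1_plus_HL1_test:
  "\<phi> \<in> test_functions UNIV \<Longrightarrow> L1_plus_HL1 f g \<phi> = (LINT x|lborel. \<phi> x * f x) - (LINT x|lborel. hilbert \<phi> x * g x)"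
  by (simp add: L1_plus_HL1_def dist_of_fun_def hilbert_dist_def functional_on_def)

lemma test_function_bounds:
  assumes "\<rho> \<in> test_functions UNIV"
  obtains B where "\<And>x. norm (\<rho> x) \<le> B" "\<And>x. norm (hilbert \<rho> x) \<le> B"
proof -
  obtain M L where 1: "compact_lipschitz \<rho> M L" using test_function_compact_lipschitz assms by blast
  obtain C where C: "\<And>x. norm (hilbert \<rho> x) \<le> C" using hilbert_decay[OF assms] by metis
  show thesis
    by (rule that[of "max (compact_lipschitz.B M L) C"])
       (use compact_lipschitz.B(2)[OF 1] C in \<open>auto intro: order_trans[OF _ max.cobounded1] order_trans[OF _ max.cobounded2]\<close>)
qed

lemma test_pairing_integrable:
  assumes "\<rho> \<in> test_functions UNIV" "integrable lborel f"
  shows "integrable lborel (\<lambda>x. \<rho> x * f x)" "integrable lborel (\<lambda>x. hilbert \<rho> x * f x)"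
proof -
  obtain B where "\<And>x. norm (\<rho> x) \<le> B" "\<And>x. norm (hilbert \<rho> x) \<le> B" using test_function_bounds assms(1) by blast
  then show "integrable lborel (\<lambda>x. \<rho> x * f x)" "integrable lborel (\<lambda>x. hilbert \<rho> x * f x)"
    using assms by (auto intro!: integrable_bounded_times smooth_measurable hilbert_measurable test_functions_smooth)
qed

context real_test
begin

text \<open>After the choice of decomposition has been eliminated, P - \<phi> and HP - H\<phi> are
  paired with the images under J, and the substitution -\<beta> / x turns them into the real and
  imaginary parts of Q.\<close>

lemma Sigma2_value:
  assumes \<beta>: "0 < \<beta>" and f: "f \<in> L1" and g: "g \<in> L1_0"
  shows "Sigma2_op (L1_plus_HL1 (J_fun \<beta> f) (J_fun \<beta> g)) \<phi>
    = (LINT x|lborel. of_real (Re (Q \<beta> x)) * f x) - (LINT x|lborel. of_real (Im (Q \<beta> x)) * g x)"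
proof -
  have fi: "integrable lborel f" "integrable lborel g" and g0: "(LINT x|lborel. g x) = 0"
    using f g by (auto simp: L1_def L1_0_def)
  define f' where "f' = J_fun \<beta> f"
  define g' where "g' = J_fun \<beta> g"
  have J: "integrable lborel f'" "integrable lborel g'" "(LINT x|lborel. g' x) = 0"
    unfolding f'_def g'_def using J_fun_integral[OF \<beta>] fi g0 by auto
  define V where "V = L1_plus_HL1 f' g'"
  have "V \<in> frakL" unfolding frakL_def V_def using J by (auto simp: L1_def L1_0_def)
  \<comment> \<open>\<open>Pi2_op\<close> decomposes V afresh, so the pair it works with may differ
    from the one that defines V; the difference of the two pairs annihilates all test functions, and
    hence P and HP.\<close>
  then obtain f1 g1 where d: "decomp V = (f1, g1)" "f1 \<in> L1" "g1 \<in> L1_0" "V = L1_plus_HL1 f1 g1"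
    by (rule decomp_properties)
  have i1: "integrable lborel f1" "integrable lborel g1" using d by (auto simp: L1_def L1_0_def)
  obtain B1 where B1: "\<And>x. norm (P x) \<le> B1" using periodic_smooth_bounded[OF P_smooth P_periodic] by metis
  obtain B2 where B2: "\<And>x. norm (HP x) \<le> B2" using periodic_smooth_bounded[OF HP_smooth HP_periodic] by metis
  have PI: "integrable lborel (\<lambda>x. P x * h x)" "integrable lborel (\<lambda>x. HP x * h x)" if "integrable lborel h" for h
    using that B1 B2 by (auto intro!: integrable_bounded_times)
  have line: "periodic_to_line (Pi2_op V) \<phi> = (LINT x|lborel. P x * f1 x) - (LINT x|lborel. HP x * g1 x)"
  proof -
    have "periodic_to_line (Pi2_op V) \<phi> = Pi2_op V P"
      by (simp add: periodic_to_line_def functional_on_def test_UNIV P_def)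
    also have "\<dots> = periodic_dist_of_fun (Pi2_fun f1) P - periodic_dist_of_fun (Pi2_fun g1) HP"
      by (simp add: Pi2_op_def d(1) hilbert2_dist_def functional_on_def P_test HP_def[symmetric])
    also have "periodic_dist_of_fun (Pi2_fun f1) P = (LINT x|lborel. P x * f1 x)"
      unfolding periodic_dist_of_fun_def functional_on_def
      using integral_periodic_pairing[where b = P, OF i1(1) measurables(2) B1 P_periodic] P_test by simp
    also have "periodic_dist_of_fun (Pi2_fun g1) HP = (LINT x|lborel. HP x * g1 x)"
      unfolding periodic_dist_of_fun_def functional_on_def
      using integral_periodic_pairing[where b = HP, OF i1(2) measurables(4) B2 HP_periodic] HP_test by simp
    finally show ?thesis .
  qed
  have wd: "(LINT x|lborel. P x * (f1 x - f' x)) = (LINT x|lborel. HP x * (g1 x - g' x))"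
  proof (rule periodization_annihilates)
    show "integrable lborel (\<lambda>x. f1 x - f' x)" "integrable lborel (\<lambda>x. g1 x - g' x)" using i1 J by auto
    fix \<rho> assume \<rho>: "\<rho> \<in> test_functions UNIV"
    have "L1_plus_HL1 f1 g1 \<rho> = L1_plus_HL1 f' g' \<rho>" using d(4) V_def by simp
    then have e: "(LINT x|lborel. \<rho> x * f1 x) - (LINT x|lborel. hilbert \<rho> x * g1 x)
      = (LINT x|lborel. \<rho> x * f' x) - (LINT x|lborel. hilbert \<rho> x * g' x)"
      unfolding L1_plus_HL1_test[OF \<rho>] .
    have d: "(LINT x|lborel. \<rho> x * (f1 x - f' x)) = (LINT x|lborel. \<rho> x * f1 x) - (LINT x|lborel. \<rho> x * f' x)"
      "(LINT x|lborel. hilbert \<rho> x * (g1 x - g' x)) = (LINT x|lborel. hilbert \<rho> x * g1 x) - (LINT x|lborel. hilbert \<rho> x * g' x)"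
      using test_pairing_integrable[OF \<rho>] i1 J by (simp_all add: right_diff_distrib)
    have alg: "p - q = r - s" if "p - r = q - s" for p q r s :: complex
      using that by (simp add: algebra_simps)
    show "(LINT x|lborel. \<rho> x * (f1 x - f' x)) = (LINT x|lborel. hilbert \<rho> x * (g1 x - g' x))"
      unfolding d by (rule alg[OF e])
  qed
  have dd: "(LINT x|lborel. P x * (f1 x - f' x)) = (LINT x|lborel. P x * f1 x) - (LINT x|lborel. P x * f' x)"
    "(LINT x|lborel. HP x * (g1 x - g' x)) = (LINT x|lborel. HP x * g1 x) - (LINT x|lborel. HP x * g' x)"
    using PI i1 J by (simp_all add: right_diff_distrib)
  have "periodic_to_line (Pi2_op V) \<phi> = (LINT x|lborel. P x * f' x) - (LINT x|lborel. HP x * g' x)"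
  proof -
    have alg: "p - r = q - s" if "p - q = r - s" for p q r s :: complex
      using that by (simp add: algebra_simps)
    show ?thesis unfolding line by (rule alg[OF wd[unfolded dd]])
  qed
  moreover have "V \<phi> = (LINT x|lborel. \<phi> x * f' x) - (LINT x|lborel. H\<phi> x * g' x)"
    unfolding V_def L1_plus_HL1_test[OF test_UNIV] H\<phi>_def ..
  ultimately have S: "Sigma2_op V \<phi> = ((LINT x|lborel. P x * f' x) - (LINT x|lborel. \<phi> x * f' x)) - ((LINT x|lborel. HP x * g' x) - (LINT x|lborel. H\<phi> x * g' x))"
    by (simp add: Sigma2_op_def)
  obtain B where B: "\<And>x. norm (\<phi> x) \<le> B" using \<phi>_bounded by blast
  obtain B' where B': "\<And>x. norm (H\<phi> x) \<le> B'" using H\<phi>_bounded by blast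
  have pf: "(LINT x|lborel. P x * f' x) - (LINT x|lborel. \<phi> x * f' x) = (LINT x|lborel. of_real (Re (Q \<beta> x)) * f x)"
  proof -
    have "(LINT x|lborel. P x * f' x) - (LINT x|lborel. \<phi> x * f' x) = (LINT x|lborel. (P x - \<phi> x) * f' x)"
      using PI J test_pairing_integrable[OF test_UNIV] by (simp add: left_diff_distrib)
    also have "\<dots> = (LINT x|lborel. (P (- \<beta> / x) - \<phi> (- \<beta> / x)) * f x)"
      unfolding f'_def
    proof (rule J_fun_pairing(1)[OF \<beta>])
      show "integrable lborel (\<lambda>x. (P (- \<beta> / x) - \<phi> (- \<beta> / x)) * f x)"
        by (rule integrable_bounded_times[of _ _ "B1 + B"])
           (use fi B1 B in \<open>auto intro: order_trans[OF norm_triangle_ineq4] add_mono\<close>)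
    qed
    also have "\<dots> = (LINT x|lborel. of_real (Re (Q \<beta> x)) * f x)"
    proof (intro Bochner_Integration.integral_cong refl)
      fix x
      have "of_real (Re (Q \<beta> x)) = P (- \<beta> / x) - \<phi> (- \<beta> / x)"
        unfolding Q_def G0_def Fper_def Fh_def
        using real[of "pi2 (- \<beta> / x)"] real[of "- \<beta> / x"] by (simp add: complex_eq_iff R_real HP_real H\<phi>_real P_eq)
      then show "(P (- \<beta> / x) - \<phi> (- \<beta> / x)) * f x = of_real (Re (Q \<beta> x)) * f x" by simp
    qed
    finally show ?thesis .
  qed
  have pg: "(LINT x|lborel. HP x * g' x) - (LINT x|lborel. H\<phi> x * g' x) = (LINT x|lborel. of_real (Im (Q \<beta> x)) * g x)"
  proof -
    have i2: "integrable lborel (\<lambda>x. (HP (- \<beta> / x) - H\<phi> (- \<beta> / x)) * g x)"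
      by (rule integrable_bounded_times[of _ _ "B2 + B'"])
         (use fi B2 B' in \<open>auto intro: order_trans[OF norm_triangle_ineq4] add_mono\<close>)
    have "(LINT x|lborel. HP x * g' x) - (LINT x|lborel. H\<phi> x * g' x) = (LINT x|lborel. (HP x - H\<phi> x) * g' x)"
      using PI J test_pairing_integrable[OF test_UNIV] by (simp add: left_diff_distrib H\<phi>_def)
    also have "\<dots> = (LINT x|lborel. (HP (- \<beta> / x) - H\<phi> (- \<beta> / x)) * g x)"
      unfolding g'_def by (rule J_fun_pairing(1)[OF \<beta> i2])
    \<comment> \<open>The subtracted integral is 0 because g has mean zero; it supplies the constant
      that is built into Q.\<close>
    also have "\<dots> = (LINT x|lborel. (HP (- \<beta> / x) - H\<phi> (- \<beta> / x)) * g x) - (LINT x|lborel. of_real (Re (R 0)) * g x)"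
      by (simp add: g0)
    also have "\<dots> = (LINT x|lborel. (HP (- \<beta> / x) - H\<phi> (- \<beta> / x)) * g x - of_real (Re (R 0)) * g x)"
      using i2 fi by (intro Bochner_Integration.integral_diff[symmetric]) auto
    also have "\<dots> = (LINT x|lborel. of_real (Im (Q \<beta> x)) * g x)"
    proof (intro Bochner_Integration.integral_cong refl)
      fix x
      have "of_real (Im (Q \<beta> x)) = HP (- \<beta> / x) - H\<phi> (- \<beta> / x) - of_real (Re (R 0))"
        unfolding Q_def G0_def Fper_def Fh_def
        using real[of "pi2 (- \<beta> / x)"] real[of "- \<beta> / x"] by (simp add: complex_eq_iff R_real HP_real H\<phi>_real P_eq)
      then show "(HP (- \<beta> / x) - H\<phi> (- \<beta> / x)) * g x - of_real (Re (R 0)) * g x = of_real (Im (Q \<beta> x)) * g x"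
        by (simp add: left_diff_distrib)
    qed
    finally show ?thesis .
  qed
  show ?thesis using S[unfolded pf pg] unfolding V_def f'_def g'_def .
qed

end

subsection \<open>Survival estimates\<close>

text \<open>
  The indicator of the points whose first \<open>m\<close> iterates under \<open>x \<mapsto> pi2 (- \<beta> / x)\<close> are defined,
  where a point with \<open>\<bar>\<beta> / x\<bar> < 1\<close> has no image.
\<close>

fun survive :: "real \<Rightarrow> nat \<Rightarrow> real \<Rightarrow> real" where
  "survive \<beta> 0 x = 1"
| "survive \<beta> (Suc m) x = pullback \<beta> (survive \<beta> m) x"

lemma survive_bounds: "0 \<le> survive \<beta> m x" "survive \<beta> m x \<le> 1"
  by (induction m arbitrary: x) (auto simp: pullback_def)

lemma survive_measurable [measurable]: "survive \<beta> m \<in> borel_measurable borel"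
proof (induction m)
  case (Suc m)
  have "survive \<beta> (Suc m) = pullback \<beta> (survive \<beta> m)" by auto
  then show ?case using Suc by simp
qed (simp add: fun_eq_iff cong: measurable_cong)

lemma survive_support:
  assumes "0 < \<beta>" "1 \<le> m" "\<beta> < \<bar>x\<bar>" shows "survive \<beta> m x = 0"
proof -
  obtain k where "m = Suc k" using assms(2) by (cases m) auto
  moreover have "\<not> 1 \<le> \<bar>- \<beta> / x\<bar>" using assms by (simp add: not_le)
  ultimately show ?thesis by (simp add: pullback_def)
qed

text \<open>The density 1 / (1 - x^2) is not integrable up to the end points. It is cut off at
  \<beta> because from the first step on the surviving points lie in [-\<beta>, \<beta>].\<close>

definition inv_weight :: "real \<Rightarrow> real \<Rightarrow> real" where
  "inv_weight \<beta> x = (if \<bar>x\<bar> \<le> \<beta> then 1 / (1 - x\<^sup>2) else 0)"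

lemma square_less_1: "0 < \<beta> \<Longrightarrow> \<beta> < 1 \<Longrightarrow> \<beta>\<^sup>2 < (1::real)"
  using power_strict_mono[of \<beta> 1 2] by simp

lemma inv_weight_bounds:
  assumes \<beta>: "0 < \<beta>" "\<beta> < 1"
  shows "0 \<le> inv_weight \<beta> x" "inv_weight \<beta> x \<le> 1 / (1 - \<beta>\<^sup>2)" "\<bar>x\<bar> \<le> \<beta> \<Longrightarrow> 1 \<le> inv_weight \<beta> x"
proof -
  have b1: "\<beta>\<^sup>2 < 1" using square_less_1[OF \<beta>] .
  have x2: "x\<^sup>2 \<le> \<beta>\<^sup>2" if "\<bar>x\<bar> \<le> \<beta>" using that \<beta> by (simp add: abs_le_square_iff[symmetric])
  show "0 \<le> inv_weight \<beta> x" using x2 b1 by (auto simp: inv_weight_def)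
  show "inv_weight \<beta> x \<le> 1 / (1 - \<beta>\<^sup>2)" using x2 b1 by (auto simp: inv_weight_def intro!: frac_le)
  show "1 \<le> inv_weight \<beta> x" if "\<bar>x\<bar> \<le> \<beta>" using x2[OF that] b1 that by (auto simp: inv_weight_def field_simps)
qed

lemma inv_weight_measurable [measurable]: "inv_weight \<beta> \<in> borel_measurable borel"
  unfolding inv_weight_def by measurable

lemma inv_weight_integrable:
  assumes \<beta>: "0 < \<beta>" "\<beta> < 1" shows "integrable lborel (\<lambda>x. complex_of_real (inv_weight \<beta> x))"
  by (rule integrable_bounded_support(1)[of _ "1 / (1 - \<beta>\<^sup>2)" \<beta>])
     (use inv_weight_bounds[OF \<beta>] in \<open>auto simp: inv_weight_def\<close>)

text \<open>The density \<open>1 / (1 - x\<^sup>2)\<close> is invariant for \<open>\<beta> = 1\<close>; the sum over the inverse branches telescopes.\<close>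

lemma branch_sum_bound:
  fixes x :: real
  assumes "\<bar>x\<bar> < 1"
  shows "(\<Sum>n<N. 1 / ((x + 2 * real (Suc n))\<^sup>2 - 1)) \<le> 1 / (2 * (1 + x))"
proof -
  have "(\<Sum>n<N. 1 / ((x + 2 * real (Suc n))\<^sup>2 - 1)) = 1 / (2 * (1 + x)) - 1 / (2 * (x + 2 * real N + 1))"
  proof (induction N)
    case (Suc N)
    define a where "a = x + 2 * real N + 1"
    have a: "0 < a" using assms by (simp add: a_def abs_less_iff)
    have e1: "(x + 2 * real (Suc N))\<^sup>2 - 1 = a * (a + 2)" by (simp add: a_def power2_eq_square algebra_simps)
    have e2: "x + 2 * real (Suc N) + 1 = a + 2" by (simp add: a_def)
    have "1 / (a * (a + 2)) = 1 / (2 * a) - 1 / (2 * (a + 2))"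
    proof -
      have "a \<noteq> 0" "a + 2 \<noteq> 0" using a by auto
      then show ?thesis by (simp add: divide_simps)
    qed
    then show ?case using Suc e1 e2 by (simp add: a_def[symmetric])
  qed (simp add: add.commute)
  moreover have "0 \<le> 1 / (2 * (x + 2 * real N + 1))" using assms by (simp add: abs_less_iff)
  ultimately show ?thesis by linarith
qed

text \<open>On the branch y = x + 2 j the weight contributes \<beta> / (y^2 - \<beta>^2), at most
  \<beta> / (y^2 - 1). The branches with j > 0 and j < 0 sum to at most 1 / (2 (1 + x)) and 1 / (2
  (1 - x)), which add up to 1 / (1 - x^2); the factor \<beta> in front is the contraction.\<close>

lemma gtransfer_wt_bound:
  assumes \<beta>: "0 < \<beta>" "\<beta> < 1" and x: "\<bar>x\<bar> < 1"
  shows "norm (gtransfer \<beta> (\<lambda>x. of_real (inv_weight \<beta> x)) x) \<le> \<beta> * (1 / (1 - x\<^sup>2))"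
proof -
  define F where "F y = (if 1 \<le> \<bar>y\<bar> then J_fun \<beta> (\<lambda>x. of_real (inv_weight \<beta> x)) y else 0)" for y
  have Fle: "norm (F y) \<le> (if 1 \<le> \<bar>y\<bar> then \<beta> * (1 / (y\<^sup>2 - 1)) else 0)" if "\<bar>y\<bar> \<noteq> 1" for y
  proof (cases "1 \<le> \<bar>y\<bar>")
    case True
    have y1: "1 < y\<^sup>2" using True that power_strict_mono[of 1 "\<bar>y\<bar>" 2] by simp
    have bb: "\<beta>\<^sup>2 < 1" using square_less_1[OF \<beta>] .
    have "\<bar>- \<beta> / y\<bar> = \<beta> / \<bar>y\<bar>" using \<beta> by simp
    also have "\<dots> \<le> \<beta> / 1" using True \<beta> by (intro divide_left_mono) auto
    finally have w: "inv_weight \<beta> (- \<beta> / y) = 1 / (1 - (\<beta> / y)\<^sup>2)" by (simp add: inv_weight_def)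
    have nz: "y \<noteq> 0" "y\<^sup>2 - \<beta>\<^sup>2 > 0" using True y1 bb by auto
    have "1 - (\<beta> / y)\<^sup>2 = (y\<^sup>2 - \<beta>\<^sup>2) / y\<^sup>2" using nz by (simp add: power_divide diff_divide_distrib)
    then have e: "\<beta> / y\<^sup>2 * inv_weight \<beta> (- \<beta> / y) = \<beta> * (1 / (y\<^sup>2 - \<beta>\<^sup>2))" unfolding w using nz by simp
    have "F y = complex_of_real (\<beta> / y\<^sup>2 * inv_weight \<beta> (- \<beta> / y))" using True by (simp add: F_def J_fun_def)
    then have "norm (F y) = \<bar>\<beta> * (1 / (y\<^sup>2 - \<beta>\<^sup>2))\<bar>" unfolding e by (simp only: norm_of_real)
    also have "\<dots> = \<beta> * (1 / (y\<^sup>2 - \<beta>\<^sup>2))" using nz \<beta> by simp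
    also have "\<dots> \<le> \<beta> * (1 / (y\<^sup>2 - 1))" using y1 bb \<beta> by (intro mult_left_mono frac_le) auto
    finally show ?thesis using True by simp
  qed (simp add: F_def)
  have k0: "0 \<le> \<beta> * (1 / (1 - x\<^sup>2))" using x \<beta> power_strict_mono[of "\<bar>x\<bar>" 1 2] by simp
  have fin: "(\<Sum>j\<in>A. norm (F (x + 2 * of_int j))) \<le> \<beta> * (1 / (1 - x\<^sup>2))" if "finite A" for A :: "int set"
  proof -
    define h where "h j = (if j = 0 then 0 else \<beta> * (1 / ((x + 2 * of_int j)\<^sup>2 - 1)))" for j :: int
    have jneq: "1 < \<bar>x + 2 * of_int j\<bar>" if "j \<noteq> 0" for j :: int
    proof -
      have "1 \<le> \<bar>real_of_int j\<bar>" using that by linarith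
      then show ?thesis using x by linarith
    qed
    have Fh: "norm (F (x + 2 * of_int j)) \<le> h j" for j
    proof (cases "j = 0")
      case True
      then show ?thesis using x by (simp add: h_def F_def)
    next
      case False
      then show ?thesis using Fle[of "x + 2 * of_int j"] jneq[OF False] by (simp add: h_def)
    qed
    have h0: "0 \<le> h j" for j using order_trans[OF norm_ge_zero Fh] .
    obtain N :: nat where N: "A \<subseteq> {- int N..int N}"
    proof -
      obtain K where "\<And>j. j \<in> A \<Longrightarrow> \<bar>j\<bar> \<le> K"
        using that finite_imageI[OF \<open>finite A\<close>, of abs] by (metis Max_ge image_eqI)
      then have "A \<subseteq> {- int (nat \<bar>K\<bar>)..int (nat \<bar>K\<bar>)}" by fastforce
      then show ?thesis using that by blast
    qed
    have dec: "(\<Sum>j\<in>{- int N..int N}. h j) = (\<Sum>n<N. h (int (Suc n)) + h (- int (Suc n)))"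
    proof (induction N)
      case (Suc N)
      have "{- int (Suc N)..int (Suc N)} = insert (int (Suc N)) (insert (- int (Suc N)) {- int N..int N})" by auto
      then have "(\<Sum>j\<in>{- int (Suc N)..int (Suc N)}. h j) = h (int (Suc N)) + (h (- int (Suc N)) + (\<Sum>j\<in>{- int N..int N}. h j))"
        by (simp del: of_nat_Suc)
      then show ?case using Suc by (simp del: of_nat_Suc)
    qed (simp add: h_def)
    have hp: "h (int (Suc n)) = \<beta> * (1 / ((x + 2 * real (Suc n))\<^sup>2 - 1))" for n by (simp add: h_def)
    have hn: "h (- int (Suc n)) = \<beta> * (1 / (((- x) + 2 * real (Suc n))\<^sup>2 - 1))" for n
    proof -
      have "(x + 2 * of_int (- int (Suc n)))\<^sup>2 = ((- x) + 2 * real (Suc n))\<^sup>2" by (simp add: power2_eq_square algebra_simps)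
      then show ?thesis by (simp add: h_def)
    qed
    have "(\<Sum>j\<in>A. norm (F (x + 2 * of_int j))) \<le> (\<Sum>j\<in>A. h j)" by (intro sum_mono Fh)
    also have "\<dots> \<le> (\<Sum>j\<in>{- int N..int N}. h j)" using N h0 by (intro sum_mono2) auto
    also have "\<dots> = \<beta> * (\<Sum>n<N. 1 / ((x + 2 * real (Suc n))\<^sup>2 - 1)) + \<beta> * (\<Sum>n<N. 1 / (((- x) + 2 * real (Suc n))\<^sup>2 - 1))"
      unfolding dec hp hn sum.distrib sum_distrib_left ..
    also have "\<dots> \<le> \<beta> * (1 / (2 * (1 + x))) + \<beta> * (1 / (2 * (1 + - x)))"
      using \<beta> x by (intro add_mono mult_left_mono branch_sum_bound) auto
    also have "\<dots> = \<beta> * (1 / (1 - x\<^sup>2))"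
    proof -
      have nz: "1 + x \<noteq> 0" "1 - x \<noteq> 0" using x by auto
      have sq: "1 - x\<^sup>2 = (1 + x) * (1 - x)" by (simp add: power2_eq_square algebra_simps)
      have "1 / (2 * (1 + x)) + 1 / (2 * (1 + - x)) = 1 / (1 - x\<^sup>2)"
        unfolding sq using nz by (simp add: divide_simps) (simp add: algebra_simps)
      then show ?thesis unfolding distrib_left[symmetric] by simp
    qed
    finally show ?thesis .
  qed
  have "norm (Pi2_fun F x) \<le> \<beta> * (1 / (1 - x\<^sup>2))"
  proof (cases "(\<lambda>j::int. norm (F (x + 2 * of_int j))) summable_on UNIV")
    case True
    have "norm (Pi2_fun F x) \<le> infsum (\<lambda>j::int. norm (F (x + 2 * of_int j))) UNIV"
      unfolding Pi2_fun_def by (rule norm_infsum_bound[OF True])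
    also have "\<dots> \<le> \<beta> * (1 / (1 - x\<^sup>2))"
      by (rule infsum_le_finite_sums[OF True]) (use fin in auto)
    finally show ?thesis .
  next
    \<comment> \<open>Without summability the periodization is 0 by convention, and the bound holds
      because its right side is nonnegative.\<close>
    case False
    then have "\<not> (\<lambda>j::int. F (x + 2 * of_int j)) summable_on UNIV"
      using summable_on_iff_abs_summable_on_complex[of "\<lambda>j::int. F (x + 2 * of_int j)" UNIV] by simp
    then show ?thesis using k0 by (simp add: Pi2_fun_def infsum_not_exists)
  qed
  moreover have "gtransfer \<beta> (\<lambda>x. of_real (inv_weight \<beta> x)) x = Pi2_fun F x" using x by (simp add: gtransfer_def F_def[abs_def])
  ultimately show ?thesis by simp
qed

definition survive_mass :: "real \<Rightarrow> nat \<Rightarrow> real" where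
  "survive_mass \<beta> m = (LINT x|lborel. survive \<beta> m x * indicat_real {-1<..<1} x)"

lemma survive_weighted_integrable:
  assumes \<beta>: "0 < \<beta>" "\<beta> < 1" shows "integrable lborel (\<lambda>x. survive \<beta> m x * inv_weight \<beta> x)"
proof -
  have "integrable lborel (\<lambda>x. complex_of_real (survive \<beta> m x) * of_real (inv_weight \<beta> x))"
    by (rule integrable_bounded_times[OF inv_weight_integrable[OF \<beta>], of _ 1]) (use survive_bounds in auto)
  then show ?thesis by (simp flip: of_real_mult add: complex_of_real_integrable_eq)
qed

text \<open>Dualize one step onto the weight and apply \<open>gtransfer_wt_bound\<close>. That bound
  involves the density without cut-off; for m \<ge> 1 the factor \<open>survive \<beta> m\<close>
  restricts to [-\<beta>, \<beta>], where the two agree.\<close>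

lemma survive_weighted_decay:
  assumes \<beta>: "0 < \<beta>" "\<beta> < 1" and m: "1 \<le> m"
  shows "(LINT x|lborel. survive \<beta> (Suc m) x * inv_weight \<beta> x) \<le> \<beta> * (LINT x|lborel. survive \<beta> m x * inv_weight \<beta> x)"
proof -
  have b1: "\<And>x. norm (complex_of_real (survive \<beta> m x)) \<le> 1" using survive_bounds by simp
  have c: "pullback \<beta> (\<lambda>x. complex_of_real (survive \<beta> m x)) x = of_real (survive \<beta> (Suc m) x)" for x
    by (simp add: pullback_def)
  have "complex_of_real (LINT x|lborel. survive \<beta> (Suc m) x * inv_weight \<beta> x)
    = (LINT x|lborel. pullback \<beta> (\<lambda>x. complex_of_real (survive \<beta> m x)) x * of_real (inv_weight \<beta> x))"
    unfolding c by (simp only: integral_complex_of_real[symmetric] of_real_mult)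
  also have "\<dots> = (LINT x|lborel. complex_of_real (survive \<beta> m x) * gtransfer \<beta> (\<lambda>x. of_real (inv_weight \<beta> x)) x)"
    by (rule gtransfer_pairing(2)[OF \<beta>(1) inv_weight_integrable[OF \<beta>] _ b1, symmetric]) measurable
  finally have e: "complex_of_real (LINT x|lborel. survive \<beta> (Suc m) x * inv_weight \<beta> x)
    = (LINT x|lborel. complex_of_real (survive \<beta> m x) * gtransfer \<beta> (\<lambda>x. of_real (inv_weight \<beta> x)) x)" .
  have "norm (LINT x|lborel. complex_of_real (survive \<beta> m x) * gtransfer \<beta> (\<lambda>x. of_real (inv_weight \<beta> x)) x) \<le> (LINT x|lborel. \<beta> * (survive \<beta> m x * inv_weight \<beta> x))"
  proof (rule norm_integral_le)
    show "integrable lborel (\<lambda>x. \<beta> * (survive \<beta> m x * inv_weight \<beta> x))" using survive_weighted_integrable[OF \<beta>] by simp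
    fix x
    show "norm (complex_of_real (survive \<beta> m x) * gtransfer \<beta> (\<lambda>x. of_real (inv_weight \<beta> x)) x) \<le> \<beta> * (survive \<beta> m x * inv_weight \<beta> x)"
    proof (cases "\<bar>x\<bar> \<le> \<beta>")
      case True
      then have "norm (gtransfer \<beta> (\<lambda>x. of_real (inv_weight \<beta> x)) x) \<le> \<beta> * inv_weight \<beta> x"
        using gtransfer_wt_bound[OF \<beta>, of x] \<beta> by (simp add: inv_weight_def)
      then have "survive \<beta> m x * norm (gtransfer \<beta> (\<lambda>x. of_real (inv_weight \<beta> x)) x) \<le> survive \<beta> m x * (\<beta> * inv_weight \<beta> x)"
        using survive_bounds by (intro mult_left_mono) auto
      then show ?thesis using survive_bounds(1)[of \<beta> m x] by (simp add: norm_mult mult_ac)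
    qed (use survive_support[OF \<beta>(1) m] in simp)
  qed
  then show ?thesis unfolding e[symmetric] norm_of_real by simp
qed

lemma survive_mass_integrable: "integrable lborel (\<lambda>x. survive \<beta> m x * indicat_real {-1<..<1} x)"
  by (rule Bochner_Integration.integrable_bound[OF integrable_indicator_I1[of 1]])
     (use survive_bounds[of \<beta> m] in \<open>auto simp: indicator_def\<close>)

lemma survive_mass_bound:
  assumes \<beta>: "0 < \<beta>" "\<beta> < 1"
  obtains C where "0 \<le> C" "\<And>m. survive_mass \<beta> m \<le> C * \<beta> ^ m"
proof -
  define W where "W m = (LINT x|lborel. survive \<beta> m x * inv_weight \<beta> x)" for m
  have W0: "0 \<le> W m" for m unfolding W_def using survive_bounds inv_weight_bounds[OF \<beta>] by simp
  have W: "W (Suc m) \<le> W 1 * \<beta> ^ m" for m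
  proof (induction m)
    case (Suc m)
    have "W (Suc (Suc m)) \<le> \<beta> * W (Suc m)" unfolding W_def by (rule survive_weighted_decay[OF \<beta>]) simp
    also have "\<dots> \<le> \<beta> * (W 1 * \<beta> ^ m)" using Suc \<beta> by (intro mult_left_mono) auto
    finally show ?case by (simp add: mult_ac)
  qed simp
  have le: "survive_mass \<beta> m \<le> W m" if "1 \<le> m" for m
    unfolding survive_mass_def W_def
  proof (rule integral_mono[OF survive_mass_integrable survive_weighted_integrable[OF \<beta>]])
    fix x
    show "survive \<beta> m x * indicat_real {-1<..<1} x \<le> survive \<beta> m x * inv_weight \<beta> x"
    proof (cases "\<bar>x\<bar> \<le> \<beta>")
      case True
      have "indicat_real {-1<..<1} x \<le> 1" by (simp add: indicator_def)
      also have "1 \<le> inv_weight \<beta> x" using inv_weight_bounds(3)[OF \<beta> True] .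
      finally show ?thesis using survive_bounds by (intro mult_left_mono) auto
    qed (use survive_support[OF \<beta>(1) that] in simp)
  qed
  \<comment> \<open>The summand 2 is the mass at m = 0; division by \<beta> accounts for the
    geometric decay starting at m = 1.\<close>
  have "survive_mass \<beta> m \<le> (2 + W 1 / \<beta>) * \<beta> ^ m" for m
  proof (cases m)
    case 0
    then show ?thesis using W0[of 1] \<beta> by (simp add: survive_mass_def)
  next
    case (Suc k)
    have "survive_mass \<beta> m \<le> W 1 * \<beta> ^ k" using le[of m] W[of k] Suc by simp
    also have "\<dots> = W 1 / \<beta> * \<beta> ^ m" using \<beta> Suc by simp
    also have "\<dots> \<le> (2 + W 1 / \<beta>) * \<beta> ^ m" using \<beta> by (intro mult_right_mono) auto
    finally show ?thesis .
  qed
  moreover have "0 \<le> 2 + W 1 / \<beta>" using W0 \<beta> by simp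
  ultimately show thesis using that by blast
qed

text \<open>A Borel-Cantelli argument: the masses are summable, so the indicators are summable at
  almost every point of ]-1, 1[; outside they vanish from the first step on.\<close>

lemma survive_tendsto_0:
  assumes \<beta>: "0 < \<beta>" "\<beta> < 1"
  shows "AE x in lborel. (\<lambda>m. survive \<beta> m x) \<longlonglongrightarrow> 0"
proof -
  obtain C where C: "0 \<le> C" "\<And>m. survive_mass \<beta> m \<le> C * \<beta> ^ m" using survive_mass_bound[OF \<beta>] by blast
  define c where "c m x = complex_of_real (survive \<beta> m x * indicat_real {-1<..<1} x)" for m x
  have ci: "integrable lborel (c m)" for m
    unfolding c_def using survive_mass_integrable by (intro integrable_of_real)
  have cn: "(LINT x|lborel. norm (c m x)) = survive_mass \<beta> m" for m
    unfolding c_def norm_of_real survive_mass_def using survive_bounds by (intro Bochner_Integration.integral_cong) auto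
  have "summable (\<lambda>m. LINT x|lborel. norm (c m x))"
  proof (rule summable_comparison_test')
    show "summable (\<lambda>m. C * \<beta> ^ m)" using \<beta> by (intro summable_mult summable_geometric) simp
    show "norm (LINT x|lborel. norm (c m x)) \<le> C * \<beta> ^ m" for m
      using C(2)[of m] cn[of m] survive_bounds by (simp add: survive_mass_def)
  qed
  from AE_summable_norm[OF ci this] show ?thesis
  proof eventually_elim
    case (elim x)
    show ?case
    proof (cases "\<bar>x\<bar> < 1")
      case True
      then have "norm (c m x) = survive \<beta> m x" for m
        using survive_bounds(1)[of \<beta> m x] by (auto simp: c_def indicator_def abs_less_iff)
      then show ?thesis using summable_LIMSEQ_zero[OF elim] by simp
    next
      case False
      have "\<forall>\<^sub>F m in sequentially. survive \<beta> m x = 0"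
        using eventually_ge_at_top[of "1::nat"] by eventually_elim (use survive_support[OF \<beta>(1)] \<beta> False in auto)
      then show ?thesis by (rule tendsto_eventually)
    qed
  qed
qed

lemma survive_integral_tendsto_0:
  fixes f :: "real \<Rightarrow> complex"
  assumes \<beta>: "0 < \<beta>" "\<beta> < 1" and f: "integrable lborel f"
  shows "(\<lambda>m. LINT x|lborel. survive \<beta> m x * norm (f x)) \<longlonglongrightarrow> 0"
proof -
  note [measurable] = borel_measurable_integrable[OF f]
  have "(\<lambda>m. LINT x|lborel. survive \<beta> m x * norm (f x)) \<longlonglongrightarrow> (LINT x|lborel. 0 * norm (f x))"
  proof (rule integral_dominated_convergence[where w="\<lambda>x. norm (f x)"])
    show "AE x in lborel. (\<lambda>m. survive \<beta> m x * norm (f x)) \<longlonglongrightarrow> 0 * norm (f x)"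
      using survive_tendsto_0[OF \<beta>] by eventually_elim (intro tendsto_intros)
    show "AE x in lborel. norm (survive \<beta> m x * norm (f x)) \<le> norm (f x)" for m
      using survive_bounds by (intro AE_I2) (simp add: abs_mult mult_left_le_one_le)
  qed (use f in auto)
  then show ?thesis by simp
qed

text \<open>The sums satisfy s (n + 1) = r s n + a n, an affine contraction driven by a null
  sequence.\<close>

lemma convolution_tendsto_0:
  fixes a :: "nat \<Rightarrow> real"
  assumes r: "0 < r" "r < 1" and a: "a \<longlonglongrightarrow> 0" and a0: "\<And>n. 0 \<le> a n"
  shows "(\<lambda>n. \<Sum>k<n. a k * r ^ (n - 1 - k)) \<longlonglongrightarrow> 0"
proof -
  define s where "s n = (\<Sum>k<n. a k * r ^ (n - 1 - k))" for n
  have s0: "0 \<le> s n" for n unfolding s_def using a0 r by (intro sum_nonneg) auto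
  have rec: "s (Suc n) = r * s n + a n" for n
  proof -
    have "(\<Sum>k<n. a k * r ^ (n - k)) = (\<Sum>k<n. r * (a k * r ^ (n - 1 - k)))"
    proof (intro sum.cong refl)
      fix k assume "k \<in> {..<n}"
      then have "n - k = Suc (n - 1 - k)" by auto
      then show "a k * r ^ (n - k) = r * (a k * r ^ (n - 1 - k))" by simp
    qed
    then show ?thesis by (simp add: s_def sum_distrib_left)
  qed
  have "s \<longlonglongrightarrow> 0"
  proof (rule LIMSEQ_I)
    fix e :: real assume e: "0 < e"
    have "0 < e * (1 - r) / 2" using e r by simp
    \<comment> \<open>The threshold is chosen so that e / 2 is the fixed point of the map sending s
      to r s + e (1 - r) / 2.\<close>
    then obtain N where N: "\<And>n. N \<le> n \<Longrightarrow> norm (a n - 0) < e * (1 - r) / 2" using LIMSEQ_D[OF a] by blast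
    have ind: "s (N + j) \<le> r ^ j * s N + e / 2" for j
    proof (induction j)
      case (Suc j)
      have "s (N + Suc j) = r * s (N + j) + a (N + j)" using rec[of "N + j"] by simp
      also have "\<dots> \<le> r * (r ^ j * s N + e / 2) + e * (1 - r) / 2"
        using Suc r N[of "N + j"] by (intro add_mono mult_left_mono) auto
      also have "\<dots> = r ^ Suc j * s N + e / 2" by (simp add: field_simps)
      finally show ?case .
    qed (use e in simp)
    have "(\<lambda>j. r ^ j * s N) \<longlonglongrightarrow> 0 * s N" using r by (intro tendsto_mult LIMSEQ_power_zero tendsto_const) auto
    then have "(\<lambda>j. r ^ j * s N) \<longlonglongrightarrow> 0" by simp
    then obtain K where K: "\<And>j. K \<le> j \<Longrightarrow> norm (r ^ j * s N - 0) < e / 2" using LIMSEQ_D[of _ 0 "e / 2"] e by fastforce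
    show "\<exists>no. \<forall>n\<ge>no. norm (s n - 0) < e"
    proof (intro exI allI impI)
      fix n assume n: "N + K \<le> n"
      then obtain j where j: "n = N + j" "K \<le> j" by (metis add_leD1 le_add_diff_inverse add_le_cancel_left)
      have "s n \<le> r ^ j * s N + e / 2" using ind[of j] j by simp
      also have "\<dots> < e / 2 + e / 2" using K[OF j(2)] by simp
      finally show "norm (s n - 0) < e" using s0[of n] by simp
    qed
  qed
  then show ?thesis by (simp add: s_def[abs_def])
qed

subsection \<open>Iteration\<close>

text \<open>
  A representative \<open>(f, g)\<close> of the restriction of \<open>f + H g\<close> is moved by the triangular map
  \<open>(f, g) \<mapsto> (T f - residual g, T g)\<close>.
\<close>

fun iter_G :: "real \<Rightarrow> (real \<Rightarrow> complex) \<Rightarrow> nat \<Rightarrow> real \<Rightarrow> complex" where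
  "iter_G \<beta> g 0 = g"
| "iter_G \<beta> g (Suc n) = gtransfer \<beta> (iter_G \<beta> g n)"

fun iter_F :: "real \<Rightarrow> real \<Rightarrow> (real \<Rightarrow> complex) \<Rightarrow> (real \<Rightarrow> complex) \<Rightarrow> nat \<Rightarrow> real \<Rightarrow> complex" where
  "iter_F \<gamma> \<beta> f g 0 = f"
| "iter_F \<gamma> \<beta> f g (Suc n) = (\<lambda>x. gtransfer \<beta> (iter_F \<gamma> \<beta> f g n) x - residual \<gamma> \<beta> (iter_G \<beta> g n) x)"

lemma pullback_survive_bound:
  fixes b :: "real \<Rightarrow> complex"
  shows "(\<And>x. norm (b x) \<le> c * survive \<beta> m x) \<Longrightarrow> norm (pullback \<beta> b x) \<le> c * survive \<beta> (Suc m) x"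
  by (simp add: pullback_def)

lemma survive_norm_integrable:
  fixes h :: "real \<Rightarrow> complex"
  assumes "integrable lborel h" shows "integrable lborel (\<lambda>x. survive \<beta> m x * norm (h x))"
  by (rule Bochner_Integration.integrable_bound[of _ "\<lambda>x. norm (h x)"])
     (use assms survive_bounds in \<open>auto intro!: AE_I2 mult_left_le_one_le simp: abs_mult\<close>)

lemma survive_pairing:
  fixes b h :: "real \<Rightarrow> complex"
  assumes b: "\<And>x. norm (b x) \<le> c * survive \<beta> m x" and h: "integrable lborel h"
  shows "norm (LINT x|lborel. b x * h x) \<le> c * (LINT x|lborel. survive \<beta> m x * norm (h x))"
proof -
  have "norm (LINT x|lborel. b x * h x) \<le> (LINT x|lborel. c * (survive \<beta> m x * norm (h x)))"
  proof (rule norm_integral_le)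
    show "integrable lborel (\<lambda>x. c * (survive \<beta> m x * norm (h x)))"
      by (rule integrable_mult_right) (rule survive_norm_integrable[OF h])
    show "norm (b x * h x) \<le> c * (survive \<beta> m x * norm (h x))" for x
      using mult_right_mono[OF b norm_ge_zero, of x "h x"] by (simp add: norm_mult mult_ac)
  qed
  then show ?thesis by simp
qed

context
  fixes \<beta> \<gamma> :: real and f g :: "real \<Rightarrow> complex"
  assumes \<beta>: "0 < \<beta>" "\<beta> < 1" and \<gamma>: "0 < \<gamma>" "\<gamma> < 1"
    and f: "integrable lborel f" and g: "integrable lborel g"
begin

lemma iter_G_integrable: "integrable lborel (iter_G \<beta> g n)"
  by (induction n) (use \<beta> g in \<open>auto intro: gtransfer_integrable\<close>)

lemma iter_F_integrable: "integrable lborel (iter_F \<gamma> \<beta> f g n)"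
proof (induction n)
  case (Suc n)
  show ?case unfolding iter_F.simps
    using gtransfer_integrable[OF \<beta>(1) Suc] residual_bound(2)[OF \<gamma> iter_G_integrable]
    by (rule Bochner_Integration.integrable_diff)
qed (use f in simp)

lemma bound_const:
  fixes b :: "real \<Rightarrow> complex"
  assumes "\<And>x. norm (b x) \<le> c * survive \<beta> m x" "0 \<le> c"
  shows "norm (b x) \<le> c"
  using assms(1)[of x] mult_left_le[OF survive_bounds(2)[of \<beta> m x] assms(2)] by simp

text \<open>The statement carries a weight \<open>survive \<beta> m\<close> and all b at once: each
  application of duality replaces b by its pullback, which raises m by one.\<close>

lemma iter_G_pairing:
  assumes "b \<in> borel_measurable borel" "\<And>x. norm (b x) \<le> c * survive \<beta> m x" "0 \<le> c"
  shows "norm (LINT x|lborel. b x * iter_G \<beta> g n x) \<le> c * (LINT x|lborel. survive \<beta> (m + n) x * norm (g x))"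
  using assms(1,2)
proof (induction n arbitrary: b m)
  case 0
  show ?case using survive_pairing[of b c \<beta> m, OF 0(2) g] by simp
next
  case (Suc n)
  have "(LINT x|lborel. b x * iter_G \<beta> g (Suc n) x) = (LINT x|lborel. pullback \<beta> b x * iter_G \<beta> g n x)"
    using gtransfer_pairing(2)[OF \<beta>(1) iter_G_integrable Suc.prems(1) bound_const[OF Suc.prems(2) assms(3)]] by simp
  then show ?case
    using Suc.IH[of "pullback \<beta> b" "Suc m"] pullback_measurable[OF Suc.prems(1)] pullback_survive_bound[of b c \<beta> m, OF Suc.prems(2)]
    by simp
qed

lemma iter_G_norm: "(LINT x|lborel. norm (iter_G \<beta> g n x)) \<le> (LINT x|lborel. survive \<beta> n x * norm (g x))"
proof -
  note [measurable] = borel_measurable_integrable[OF iter_G_integrable[of n]]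
  \<comment> \<open>The multiplier of modulus at most 1 that turns the iterate into its absolute
    value; at zeros of the iterate it is 0 by the convention for division. Thus the duality estimate
    becomes an L^1 estimate.\<close>
  define b where "b x = of_real (norm (iter_G \<beta> g n x)) / iter_G \<beta> g n x" for x
  have m: "b \<in> borel_measurable borel" unfolding b_def by measurable
  have e: "b x * iter_G \<beta> g n x = of_real (norm (iter_G \<beta> g n x))" for x by (simp add: b_def)
  have "norm (LINT x|lborel. b x * iter_G \<beta> g n x) \<le> 1 * (LINT x|lborel. survive \<beta> (0 + n) x * norm (g x))"
    by (rule iter_G_pairing[OF m]) (simp_all add: b_def norm_divide)
  then show ?thesis by (simp add: e)
qed

text \<open>A discrete Duhamel formula: the residual produced at step k is carried through the
  remaining n - 1 - k steps, and its pointwise bound on ]-1, 1[ turns the surviving part into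
  \<open>survive_mass\<close>.\<close>

lemma iter_F_pairing:
  assumes "b \<in> borel_measurable borel" "\<And>x. norm (b x) \<le> c * survive \<beta> m x" "0 \<le> c"
  shows "norm (LINT x|lborel. b x * iter_F \<gamma> \<beta> f g n x) \<le> c * ((LINT x|lborel. survive \<beta> (m + n) x * norm (f x))
    + (\<Sum>k<n. residual_ker_const \<gamma> * (LINT x|lborel. norm (iter_G \<beta> g k x)) * survive_mass \<beta> (m + (n - 1 - k))))"
  using assms(1,2)
proof (induction n arbitrary: b m)
  case 0
  show ?case using survive_pairing[of b c \<beta> m, OF 0(2) f] by simp
next
  case (Suc n)
  let ?a = "\<lambda>k. residual_ker_const \<gamma> * (LINT x|lborel. norm (iter_G \<beta> g k x))"
  note bc = bound_const[OF Suc.prems(2) assms(3)]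
  note pair = gtransfer_pairing[OF \<beta>(1) iter_F_integrable Suc.prems(1) bc]
  note res = residual_bound[OF \<gamma> iter_G_integrable[of n]]
  have "(LINT x|lborel. b x * iter_F \<gamma> \<beta> f g (Suc n) x)
    = (LINT x|lborel. pullback \<beta> b x * iter_F \<gamma> \<beta> f g n x) - (LINT x|lborel. b x * residual \<gamma> \<beta> (iter_G \<beta> g n) x)"
    using pair integrable_bounded_times[OF res(2) Suc.prems(1) bc] by (simp add: right_diff_distrib)
  then have "norm (LINT x|lborel. b x * iter_F \<gamma> \<beta> f g (Suc n) x)
    \<le> norm (LINT x|lborel. pullback \<beta> b x * iter_F \<gamma> \<beta> f g n x) + norm (LINT x|lborel. b x * residual \<gamma> \<beta> (iter_G \<beta> g n) x)"
    by (simp add: norm_triangle_ineq4)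
  also have "\<dots> \<le> c * ((LINT x|lborel. survive \<beta> (Suc m + n) x * norm (f x)) + (\<Sum>k<n. ?a k * survive_mass \<beta> (Suc m + (n - 1 - k))))
      + c * (?a n * survive_mass \<beta> m)"
  proof (rule add_mono)
    show "norm (LINT x|lborel. pullback \<beta> b x * iter_F \<gamma> \<beta> f g n x)
      \<le> c * ((LINT x|lborel. survive \<beta> (Suc m + n) x * norm (f x)) + (\<Sum>k<n. ?a k * survive_mass \<beta> (Suc m + (n - 1 - k))))"
      by (rule Suc.IH[OF pullback_measurable[OF Suc.prems(1)] pullback_survive_bound[of b c \<beta> m, OF Suc.prems(2)]])
    have "norm (LINT x|lborel. b x * residual \<gamma> \<beta> (iter_G \<beta> g n) x)
      \<le> (LINT x|lborel. (c * ?a n) * (survive \<beta> m x * indicat_real {-1<..<1} x))"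
    proof (rule norm_integral_le)
      show "integrable lborel (\<lambda>x. (c * ?a n) * (survive \<beta> m x * indicat_real {-1<..<1} x))"
        using survive_mass_integrable by simp
      fix x
      have "norm (b x) * norm (residual \<gamma> \<beta> (iter_G \<beta> g n) x) \<le> (c * survive \<beta> m x) * (?a n * indicat_real {-1<..<1} x)"
        using Suc.prems(2) res(1) survive_bounds assms(3) by (intro mult_mono) auto
      then show "norm (b x * residual \<gamma> \<beta> (iter_G \<beta> g n) x) \<le> (c * ?a n) * (survive \<beta> m x * indicat_real {-1<..<1} x)"
        by (simp add: norm_mult mult_ac)
    qed
    also have "\<dots> = c * (?a n * survive_mass \<beta> m)" unfolding survive_mass_def by simp
    finally show "norm (LINT x|lborel. b x * residual \<gamma> \<beta> (iter_G \<beta> g n) x) \<le> c * (?a n * survive_mass \<beta> m)" .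
  qed
  also have "(\<Sum>k<n. ?a k * survive_mass \<beta> (Suc m + (n - 1 - k))) = (\<Sum>k<n. ?a k * survive_mass \<beta> (m + (Suc n - 1 - k)))"
  proof (intro sum.cong refl)
    fix k assume "k \<in> {..<n}"
    then have "Suc m + (n - 1 - k) = m + (Suc n - 1 - k)" by auto
    then show "?a k * survive_mass \<beta> (Suc m + (n - 1 - k)) = ?a k * survive_mass \<beta> (m + (Suc n - 1 - k))" by (simp only:)
  qed
  finally show ?case by (simp add: distrib_left add.assoc)
qed

lemma iter_G_pairing_tendsto_0:
  assumes "b \<in> borel_measurable borel" "\<And>x. norm (b x) \<le> c"
  shows "(\<lambda>n. LINT x|lborel. b x * iter_G \<beta> g n x) \<longlonglongrightarrow> 0"
proof (rule Lim_null_comparison)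
  have c: "0 \<le> c" using order_trans[OF norm_ge_zero assms(2)] .
  show "\<forall>\<^sub>F n in sequentially. norm (LINT x|lborel. b x * iter_G \<beta> g n x) \<le> c * (LINT x|lborel. survive \<beta> n x * norm (g x))"
    using iter_G_pairing[OF assms(1), of c 0] assms(2) c by (intro always_eventually) simp
  show "(\<lambda>n. c * (LINT x|lborel. survive \<beta> n x * norm (g x))) \<longlonglongrightarrow> 0"
    using tendsto_mult_left[OF survive_integral_tendsto_0[OF \<beta> g], of c] by simp
qed

lemma iter_F_pairing_tendsto_0:
  assumes "b \<in> borel_measurable borel" "\<And>x. norm (b x) \<le> c"
  shows "(\<lambda>n. LINT x|lborel. b x * iter_F \<gamma> \<beta> f g n x) \<longlonglongrightarrow> 0"
proof -
  obtain C where C: "0 \<le> C" "\<And>m. survive_mass \<beta> m \<le> C * \<beta> ^ m" using survive_mass_bound[OF \<beta>] by blast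
  define N where "N k = (LINT x|lborel. norm (iter_G \<beta> g k x))" for k
  have c: "0 \<le> c" using order_trans[OF norm_ge_zero assms(2)] .
  have N0: "0 \<le> N k" for k unfolding N_def by simp
  have N: "N \<longlonglongrightarrow> 0"
    by (rule Lim_null_comparison[OF _ survive_integral_tendsto_0[OF \<beta> g]])
       (use iter_G_norm N0 in \<open>auto simp: N_def intro!: always_eventually\<close>)
  let ?r = "\<lambda>n. c * ((LINT x|lborel. survive \<beta> n x * norm (f x)) + residual_ker_const \<gamma> * C * (\<Sum>k<n. N k * \<beta> ^ (n - 1 - k)))"
  show ?thesis
  proof (rule Lim_null_comparison)
    have "norm (LINT x|lborel. b x * iter_F \<gamma> \<beta> f g n x) \<le> ?r n" for n
    proof -
      have "norm (LINT x|lborel. b x * iter_F \<gamma> \<beta> f g n x)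
        \<le> c * ((LINT x|lborel. survive \<beta> n x * norm (f x)) + (\<Sum>k<n. residual_ker_const \<gamma> * N k * survive_mass \<beta> (n - 1 - k)))"
        using iter_F_pairing[OF assms(1), of c 0 n] assms(2) c by (simp add: N_def)
      also have "(\<Sum>k<n. residual_ker_const \<gamma> * N k * survive_mass \<beta> (n - 1 - k)) \<le> (\<Sum>k<n. residual_ker_const \<gamma> * N k * (C * \<beta> ^ (n - 1 - k)))"
        using C(2) N0 residual_ker_const_nonneg[OF \<gamma>] by (intro sum_mono mult_left_mono) auto
      also have "\<dots> = residual_ker_const \<gamma> * C * (\<Sum>k<n. N k * \<beta> ^ (n - 1 - k))" by (simp add: sum_distrib_left mult_ac)
      finally show ?thesis using c by (simp add: mult_left_mono)
    qed
    then show "\<forall>\<^sub>F n in sequentially. norm (LINT x|lborel. b x * iter_F \<gamma> \<beta> f g n x) \<le> ?r n" by simp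
    have "?r \<longlonglongrightarrow> c * (0 + residual_ker_const \<gamma> * C * 0)"
      by (intro tendsto_intros survive_integral_tendsto_0[OF \<beta> f] convolution_tendsto_0[OF \<beta> N N0])
    then show "?r \<longlonglongrightarrow> 0" by simp
  qed
qed

end

section \<open>Consequences of the eigenvalue equation\<close>

context
  fixes \<beta> :: real and \<mu> :: complex and f g :: "real \<Rightarrow> complex"
  assumes \<beta>: "0 < \<beta>" "\<beta> < 1" and \<mu>: "1 \<le> norm \<mu>" and f: "f \<in> L1" and g: "g \<in> L1_0"
    and eigen: "\<And>\<phi>. \<phi> \<in> test_functions I1 \<Longrightarrow> Sigma2_op (L1_plus_HL1 (J_fun \<beta> f) (J_fun \<beta> g)) \<phi>
      = \<mu> * ((LINT x|lborel. \<phi> x * f x) - (LINT x|lborel. hilbert \<phi> x * g x))"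
begin

lemma f_g_integrable: "integrable lborel f" "integrable lborel g"
  using f g by (auto simp: L1_def L1_0_def)

text \<open>By the induction hypothesis, for all real test functions on ]-\<gamma>, \<gamma>[, the
  pair F_n - \<mu>^n f, G_n - \<mu>^n g is annihilated, so \<open>Q_annihilates\<close> permits
  replacing F_n, G_n by multiples of f, g in the pairing with Q. There the eigenvalue equation gives
  one more factor \<mu>, while \<open>Q_pairing\<close> rewrites the original pairing in terms of
  F_(n+1), G_(n+1).\<close>

lemma iterated_pairing:
  assumes \<gamma>: "\<beta> < \<gamma>" "\<gamma> < 1" and \<phi>: "\<phi> \<in> test_functions {-\<gamma><..<\<gamma>}" "\<And>x. Im (\<phi> x) = 0"
  shows "(LINT x|lborel. \<phi> x * iter_F \<gamma> \<beta> f g n x) - (LINT x|lborel. hilbert \<phi> x * iter_G \<beta> g n x)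
    = \<mu> ^ n * ((LINT x|lborel. \<phi> x * f x) - (LINT x|lborel. hilbert \<phi> x * g x))"
  using \<phi>
proof (induction n arbitrary: \<phi>)
  case (Suc n)
  have \<gamma>0: "0 < \<gamma>" using \<beta> \<gamma> by simp
  note int = iter_F_integrable[OF \<beta> \<gamma>0 \<gamma>(2) f_g_integrable, of n] iter_G_integrable[OF \<beta> \<gamma>0 \<gamma>(2) f_g_integrable, of n]
  obtain b where supp_b: "0 < b" "b < \<gamma>" "\<And>x. b \<le> \<bar>x\<bar> \<Longrightarrow> \<phi> x = 0"
    using test_function_support[OF Suc.prems(1) \<gamma>0] by blast
  have \<phi>I1: "\<phi> \<in> test_functions I1"
    using Suc.prems(1) test_functions_mono[of "{-\<gamma><..<\<gamma>}" I1] \<gamma> by (simp add: subset_iff)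
  interpret real_test \<phi> b
    by unfold_locales (use \<phi>I1 Suc.prems(2) supp_b \<gamma> in auto)
  obtain B where B: "\<And>x. norm (Q \<beta> x) \<le> B" using hardy_bounded[OF Q_hardy[OF \<beta>(1)]] by blast
  note [measurable] = hardyD(1)[OF Q_hardy[OF \<beta>(1)]]
  have Qi: "integrable lborel (\<lambda>x. of_real (Re (Q \<beta> x)) * h x)" "integrable lborel (\<lambda>x. of_real (Im (Q \<beta> x)) * h x)"
    if "integrable lborel h" for h :: "real \<Rightarrow> complex"
    using that order_trans[OF abs_Re_le_cmod B] order_trans[OF abs_Im_le_cmod B]
    by (auto intro!: integrable_bounded_times[of _ _ B])
  have lin: "(LINT x|lborel. c x * (h x - \<mu> ^ n * k x)) = (LINT x|lborel. c x * h x) - \<mu> ^ n * (LINT x|lborel. c x * k x)"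
    if "integrable lborel (\<lambda>x. c x * h x)" "integrable lborel (\<lambda>x. c x * k x)" for c h k :: "real \<Rightarrow> complex"
  proof -
    have "(LINT x|lborel. c x * (h x - \<mu> ^ n * k x)) = (LINT x|lborel. c x * h x - \<mu> ^ n * (c x * k x))"
      by (intro Bochner_Integration.integral_cong) (simp_all add: algebra_simps)
    then show ?thesis using that by simp
  qed
  have alg: "(p - q = m * (r - s)) \<longleftrightarrow> (p - m * r = q - m * s)" for p q r s m :: complex
    by (auto simp: algebra_simps)
  have "(LINT x|lborel. of_real (Re (Q \<beta> x)) * (iter_F \<gamma> \<beta> f g n x - \<mu> ^ n * f x))
    = (LINT x|lborel. of_real (Im (Q \<beta> x)) * (iter_G \<beta> g n x - \<mu> ^ n * g x))"
  proof (rule Q_annihilates[OF \<beta>(1) \<gamma>(1)])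
    fix \<rho> assume \<rho>: "\<rho> \<in> test_functions {-\<gamma><..<\<gamma>}" "\<And>t. Im (\<rho> t) = 0"
    have \<rho>U: "\<rho> \<in> test_functions UNIV" using \<rho>(1) test_functions_mono[of "{-\<gamma><..<\<gamma>}" UNIV] by auto
    show "(LINT t|lborel. \<rho> t * (iter_F \<gamma> \<beta> f g n t - \<mu> ^ n * f t)) = (LINT t|lborel. hilbert \<rho> t * (iter_G \<beta> g n t - \<mu> ^ n * g t))"
      using Suc.IH[OF \<rho>] test_pairing_integrable[OF \<rho>U] int f_g_integrable by (simp add: lin alg)
  qed (use int f_g_integrable in auto)
  then have "(LINT x|lborel. of_real (Re (Q \<beta> x)) * iter_F \<gamma> \<beta> f g n x) - (LINT x|lborel. of_real (Im (Q \<beta> x)) * iter_G \<beta> g n x)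
    = \<mu> ^ n * ((LINT x|lborel. of_real (Re (Q \<beta> x)) * f x) - (LINT x|lborel. of_real (Im (Q \<beta> x)) * g x))"
    using Qi int f_g_integrable by (simp add: lin alg)
  also have "(LINT x|lborel. of_real (Re (Q \<beta> x)) * f x) - (LINT x|lborel. of_real (Im (Q \<beta> x)) * g x)
    = \<mu> * ((LINT x|lborel. \<phi> x * f x) - (LINT x|lborel. hilbert \<phi> x * g x))"
    using Sigma2_value[OF \<beta>(1) f g] eigen[OF \<phi>I1] by simp
  finally have e: "(LINT x|lborel. of_real (Re (Q \<beta> x)) * iter_F \<gamma> \<beta> f g n x) - (LINT x|lborel. of_real (Im (Q \<beta> x)) * iter_G \<beta> g n x)
    = \<mu> ^ Suc n * ((LINT x|lborel. \<phi> x * f x) - (LINT x|lborel. hilbert \<phi> x * g x))" by simp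
  have b\<gamma>: "b \<le> \<gamma>" using supp_b by simp
  show ?case using e Q_pairing[OF \<beta>(1) b\<gamma> \<gamma>(2) int] by (simp add: H\<phi>_def)
qed simp

lemma real_pairing_eq_0:
  assumes \<phi>: "\<phi> \<in> test_functions I1" "\<And>x. Im (\<phi> x) = 0"
  shows "(LINT x|lborel. \<phi> x * f x) - (LINT x|lborel. hilbert \<phi> x * g x) = 0" (is "?v = 0")
proof -
  obtain b where b: "0 < b" "b < 1" "\<And>x. b \<le> \<bar>x\<bar> \<Longrightarrow> \<phi> x = 0"
    using test_function_support[OF \<phi>(1)] by auto
  \<comment> \<open>\<gamma> has to exceed both \<beta>, for the mollification, and b, for the
    support of \<phi>, while staying below 1.\<close>
  define \<gamma> where "\<gamma> = (max \<beta> b + 1) / 2"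
  have \<gamma>: "\<beta> < \<gamma>" "b < \<gamma>" "0 < \<gamma>" "\<gamma> < 1" using \<beta> b by (auto simp: \<gamma>_def)
  have \<phi>\<gamma>: "\<phi> \<in> test_functions {-\<gamma><..<\<gamma>}"
    by (rule test_functionsI[where K="{-b..b}"]) (use \<gamma> b \<phi> in \<open>auto intro: test_functions_smooth\<close>)
  have \<phi>U: "\<phi> \<in> test_functions UNIV" using \<phi>(1) test_functions_mono[of I1 UNIV] by auto
  obtain B where B: "\<And>x. norm (\<phi> x) \<le> B" "\<And>x. norm (hilbert \<phi> x) \<le> B" using test_function_bounds[OF \<phi>U] by blast
  have "(\<lambda>n. (LINT x|lborel. \<phi> x * iter_F \<gamma> \<beta> f g n x) - (LINT x|lborel. hilbert \<phi> x * iter_G \<beta> g n x)) \<longlonglongrightarrow> 0 - 0"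
    by (intro tendsto_diff iter_F_pairing_tendsto_0[OF \<beta> \<gamma>(3,4) f_g_integrable _ B(1)]
        iter_G_pairing_tendsto_0[OF \<beta> \<gamma>(3,4) f_g_integrable _ B(2)] smooth_measurable hilbert_measurable[OF \<phi>U]
        test_functions_smooth[OF \<phi>U])
  then have "(\<lambda>n. \<mu> ^ n * ?v) \<longlonglongrightarrow> 0"
    unfolding iterated_pairing[OF \<gamma>(1,4) \<phi>\<gamma> \<phi>(2)] by simp
  then have "(\<lambda>n. norm (\<mu> ^ n * ?v)) \<longlonglongrightarrow> 0" by (rule tendsto_norm_zero)
  moreover have "norm ?v \<le> norm (\<mu> ^ n * ?v)" for n
    using mult_right_mono[OF one_le_power[OF \<mu>] norm_ge_zero, of ?v n] by (simp add: norm_mult norm_power)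
  ultimately have "norm ?v \<le> 0" by (intro LIMSEQ_le_const) auto
  then show ?thesis by simp
qed

text \<open>Both pairings are complex linear in \<phi>, so real and imaginary parts can be treated
  separately; linearity of the Hilbert transform is read off from its difference-quotient
  form.\<close>

lemma pairing_eq_0_I1:
  assumes \<phi>: "\<phi> \<in> test_functions I1"
  shows "(LINT x|lborel. \<phi> x * f x) - (LINT x|lborel. hilbert \<phi> x * g x) = 0"
proof -
  obtain b where b: "0 < b" "b < 1" "\<And>x. b \<le> \<bar>x\<bar> \<Longrightarrow> \<phi> x = 0"
    using test_function_support[OF \<phi>] by auto
  define p q where "p x = complex_of_real (Re (\<phi> x))" and "q x = complex_of_real (Im (\<phi> x))" for x
  have eq: "\<phi> x = p x + \<i> * q x" for x by (simp add: p_def q_def complex_eq_iff)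
  have "bounded_linear (\<lambda>z. complex_of_real (Re z))" "bounded_linear (\<lambda>z. complex_of_real (Im z))"
    by (rule bounded_linear_compose[OF bounded_linear_of_real bounded_linear_Re],
        rule bounded_linear_compose[OF bounded_linear_of_real bounded_linear_Im])
  then have "smooth p" "smooth q"
    unfolding p_def q_def by (auto intro: smooth_linear_image[OF _ test_functions_smooth[OF \<phi>]])
  then have t: "p \<in> test_functions I1" "q \<in> test_functions I1"
    using b by (auto intro!: test_functionsI[where K="{-b..b}"] simp: p_def q_def)
  have U: "\<phi> \<in> test_functions UNIV" "p \<in> test_functions UNIV" "q \<in> test_functions UNIV"
    using \<phi> t test_functions_mono[of I1 UNIV] by auto
  have "hilbert \<phi> x = hilbert p x + \<i> * hilbert q x" for x
  proof -
    obtain M L where 0: "compact_lipschitz \<phi> M L" using test_function_compact_lipschitz[OF U(1)] .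
    obtain M1 L1 where 1: "compact_lipschitz p M1 L1" using test_function_compact_lipschitz[OF U(2)] .
    obtain M2 L2 where 2: "compact_lipschitz q M2 L2" using test_function_compact_lipschitz[OF U(3)] .
    have "compact_lipschitz.diff_quot \<phi> x s = compact_lipschitz.diff_quot p x s + \<i> * compact_lipschitz.diff_quot q x s" for s
      unfolding compact_lipschitz.diff_quot_def[OF 0] compact_lipschitz.diff_quot_def[OF 1] compact_lipschitz.diff_quot_def[OF 2] eq
      by (simp add: add_divide_distrib diff_divide_distrib algebra_simps)
    then have "(LINT s|lborel. compact_lipschitz.diff_quot \<phi> x s)
      = (LINT s|lborel. compact_lipschitz.diff_quot p x s) + \<i> * (LINT s|lborel. compact_lipschitz.diff_quot q x s)"
      using compact_lipschitz.diff_quot_integrable[OF 1] compact_lipschitz.diff_quot_integrable[OF 2] by simp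
    then show ?thesis
      unfolding compact_lipschitz.hilbert_eq[OF 0] compact_lipschitz.hilbert_eq[OF 1] compact_lipschitz.hilbert_eq[OF 2]
        compact_lipschitz.hilbert_int_def[OF 0] compact_lipschitz.hilbert_int_def[OF 1] compact_lipschitz.hilbert_int_def[OF 2]
      by (simp add: distrib_left)
  qed
  then have e: "\<phi> x * f x = p x * f x + \<i> * (q x * f x)" "hilbert \<phi> x * g x = hilbert p x * g x + \<i> * (hilbert q x * g x)" for x
    using eq[of x] by (simp_all add: algebra_simps)
  have "(LINT x|lborel. \<phi> x * f x) - (LINT x|lborel. hilbert \<phi> x * g x)
    = ((LINT x|lborel. p x * f x) - (LINT x|lborel. hilbert p x * g x)) + \<i> * ((LINT x|lborel. q x * f x) - (LINT x|lborel. hilbert q x * g x))"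
    unfolding e using test_pairing_integrable[OF U(2)] test_pairing_integrable[OF U(3)] f_g_integrable
    by (simp add: right_diff_distrib)
  also have "\<dots> = 0"
    using real_pairing_eq_0[OF t(1)] real_pairing_eq_0[OF t(2)] by (simp add: p_def q_def)
  finally show ?thesis .
qed

end

theorem corollary1p2p3:
  fixes \<beta> :: real and \<mu> :: complex and u :: functional
  assumes "0 < \<beta>" and "\<beta> < 1"
    and "u \<in> frakL_on I1"
    and "T_op \<beta> u = (\<lambda>\<phi>. \<mu> * u \<phi>)"
    and "norm \<mu> \<ge> 1"
  shows "u = (\<lambda>\<phi>. 0)"
proof -
  \<comment> \<open>This is the very extension chosen in \<open>T_op\<close>, and (f, g) below is
    the decomposition chosen in \<open>J_op\<close>, so both definitions unfold literally.\<close>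
  define U where "U = (SOME U. U \<in> frakL \<and> dist_restrict I1 U = u)"
  have "\<exists>U. U \<in> frakL \<and> dist_restrict I1 U = u" using assms(3) by (auto simp: frakL_on_def)
  then have U: "U \<in> frakL" "dist_restrict I1 U = u" unfolding U_def by (metis (mono_tags, lifting) someI_ex)+
  obtain f g where fg: "decomp U = (f, g)" "f \<in> L1" "g \<in> L1_0" "U = L1_plus_HL1 f g"
    using decomp_properties[OF U(1)] .
  have val: "u \<phi> = (LINT x|lborel. \<phi> x * f x) - (LINT x|lborel. hilbert \<phi> x * g x)" if "\<phi> \<in> test_functions I1" for \<phi>
  proof -
    have "\<phi> \<in> test_functions UNIV" using that test_functions_mono[of I1 UNIV] by auto
    then show ?thesis
      unfolding U(2)[symmetric] using that by (simp add: dist_restrict_def functional_on_def fg(4) L1_plus_HL1_test)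
  qed
  have "Sigma2_op (L1_plus_HL1 (J_fun \<beta> f) (J_fun \<beta> g)) \<phi>
      = \<mu> * ((LINT x|lborel. \<phi> x * f x) - (LINT x|lborel. hilbert \<phi> x * g x))" if "\<phi> \<in> test_functions I1" for \<phi>
  proof -
    have "T_op \<beta> u \<phi> = Sigma2_op (L1_plus_HL1 (J_fun \<beta> f) (J_fun \<beta> g)) \<phi>"
      unfolding T_op_def U_def[symmetric] using that by (simp add: dist_restrict_def functional_on_def J_op_def fg(1))
    then show ?thesis using assms(4) val[OF that] by simp
  qed
  note zero = pairing_eq_0_I1[OF assms(1,2,5) fg(2,3) this]
  show ?thesis
  proof
    fix \<phi>
    show "u \<phi> = 0"
    proof (cases "\<phi> \<in> test_functions I1")
      case True
      then show ?thesis using val zero by simp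
    next
      case False
      then show ?thesis unfolding U(2)[symmetric] by (simp add: dist_restrict_def functional_on_def)
    qed
  qed
qed

end
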